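(* Let $f\in C_A^2(H)$ and set $u(t,x)=P_tf(x)$ for $t\ge0$, $x\in H$, where $(P_t)$ is the Ornstein--Uhlenbeck semigroup on $H$. Then $u$ is the unique bounded classical solution to the Cauchy problem $$\begin{cases}\partial_tu(t,x)=\mathcal{L}_0u(t,x),& t\ge0,\ x\in H,\\ u(0,x)=f(x),& x\in H,\end{cases}$$ where $\mathcal{L}_0u(t,x)=(\mathcal{L}_0u(t,\cdot))(x)$.
   Context: Let $H$ be a real separable Hilbert space with inner product $\langle\cdot,\cdot\rangle$ and norm $|\cdot|$, and $L_2(H)$ the Hilbert space of Hilbert--Schmidt operators on $H$. Let $Q:H\to H$ be a non-negative symmetric trace-class operator, $a\in H$, and $\nu$ a $\sigma$-finite Borel measure on $H$ with $\nu(\{0\})=0$ and $\int_H(1\wedge|y|^2)\,\nu(dy)<\infty$. Let $Z=(Z_t)_{t\ge0}$ be an $H$-valued Lévy process with $\mathbb{E}[e^{i\langle Z_t,h\rangle}]=e^{-t\psi(h)}$, where $$\psi(h)=\tfrac12\langle Qh,h\rangle-i\langle a,h\rangle-\int_H\big(e^{i\langle h,y\rangle}-1-i\langle h,y\rangle\mathbf{1}_{\{|y|\le1\}}\big)\,\nu(dy),\quad h\in H.$$ Let $A:D(A)\subset H\to H$ generate a $C_0$-semigroup $(e^{tA})$ on $H$, with adjoint $A^*:D(A^* )\subset H\to H$, which generates $(e^{tA^*})$. Put $X_t^x=e^{tA}x+Y_t$, $Y_t=\int_0^te^{(t-s)A}\,dZ_s$. The law $\mu_t$ of $Y_t$ is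 the Borel probability measure on $H$ with characteristic function $\hat\mu_t(h)=\exp\big(-\int_0^t\psi(e^{sA^*}h)\,ds\big)$, $h\in H$. The Ornstein--Uhlenbeck semigroup is, for $f:H\to\mathbb{R}$ bounded and Borel, $$P_tf(x)=\mathbb{E}[f(X_t^x)]=\int_Hf(e^{tA}x+y)\,\mu_t(dy),\quad t\ge0,\ x\in H.$$ $C_b^2(H)$ is the space of bounded continuous $f:H\to\mathbb{R}$, twice Fréchet differentiable on $H$, with $Df:H\to H$ bounded and continuous, $D^2f(x)\in L_2(H)$ for all $x\in H$, and $D^2f:H\to L_2(H)$ bounded and continuous. Further, $$C_A^2(H)=\{f\in C_b^2(H):\ Df(x)\in D(A^* )\ \text{for all }x\in H,\ \text{and } A^*Df:H\to H\text{ is bounded and continuous}\}.$$ For $f\in C_A^2(H)$ and $x\in H$, $$\mathcal{L}_0f(x)=\langle x,A^*Df(x)\rangle+\int_H\big(f(x+y)-f(x)-\mathbf{1}_{\{|y|\le1\}}\langle y,Df(x)\rangle\big)\,\nu(dy)+\tfrac12\mathrm{Tr}(QD^2f(x))+\langle a,Df(x)\rangle.$$ A bounded classical solution to the Cauchy problem is a bounded and continuous function $u:E\to\mathbb{R}$, $E=[0,+\infty)\times H$, such that: (i) $u(t,\cdot)\in C_A^2(H)$ for every $t\ge0$, and $D_xu:E\to H$, $A^*D_xu:E\to H$, $D_x^2u:E\to L_2(H)$ are bounded and continuous functions on $E$; (ii) for every $x\in H$, $u(\cdot,x)$ is a $C^1$-function on $[0,+\infty)$, and $u$ solves the Cauchy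 problem.
   Formalization: For general e^{tA} the bounds on D_xu, A*D_xu, D_x²u are asked on [0,r]×H for every r, not on all of E (false for H=R, A=1, Z=0, f=sin: D_xu(t,0)=e^t); the literal claim with bounds on E is proved when sup_t|e^{tA}| is finite. *)

theory Defs
  imports "HOL-Probability.Probability"
begin

text \<open>
  Throughout, the Hilbert space is a type of sort
  \<open>{real_inner, banach, second_countable_topology}\<close>: a real separable Hilbert space of
  arbitrary (finite or infinite) dimension.
\<close>

section \<open>Hilbert--Schmidt operators, trace class operators, trace\<close>

definition is_hilbert_basis :: "'a::real_inner set \<Rightarrow> bool" where
  "is_hilbert_basis B \<longleftrightarrow>
     (\<forall>e\<in>B. norm e = 1) \<and> pairwise orthogonal B \<and> (\<forall>x. (\<forall>e\<in>B. x \<bullet> e = 0) \<longrightarrow> x = 0)"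

text \<open>
  A fixed choice of orthonormal basis. The Hilbert--Schmidt norm, and the trace of a trace class
  operator, do not depend on this choice.
\<close>

definition hilbert_basis :: "'a::real_inner set" where
  "hilbert_basis = (SOME B. is_hilbert_basis B)"

lemma is_hilbert_basis_hilbert_basis: "is_hilbert_basis (hilbert_basis :: 'a::real_inner set)"
proof -
  define \<A> :: "'a set set"
    where "\<A> = {B. (\<forall>e\<in>B. norm e = 1) \<and> pairwise orthogonal B}"
  have "\<exists>B\<in>\<A>. \<forall>X\<in>\<A>. B \<subseteq> X \<longrightarrow> X = B"
  proof (rule subset_Zorn)
    fix C assume C: "subset.chain \<A> C"
    have "pairwise orthogonal (\<Union>C)"
      unfolding pairwise_def
    proof (intro ballI impI)
      fix x y assume "x \<in> \<Union>C" "y \<in> \<Union>C" and ne: "x \<noteq> y"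
      then obtain X Y where XY: "X \<in> C" "x \<in> X" "Y \<in> C" "y \<in> Y" by blast
      with C have "X \<subseteq> Y \<or> Y \<subseteq> X" unfolding subset_chain_def by blast
      moreover have "X \<in> \<A>" "Y \<in> \<A>" using C XY unfolding subset_chain_def by auto
      ultimately show "orthogonal x y"
        using XY ne unfolding \<A>_def pairwise_def by blast
    qed
    moreover have "\<forall>e\<in>\<Union>C. norm e = 1"
      using C unfolding subset_chain_def \<A>_def by blast
    ultimately have "\<Union>C \<in> \<A>" unfolding \<A>_def by blast
    then show "\<exists>U\<in>\<A>. \<forall>X\<in>C. X \<subseteq> U" by blast
  qed
  then obtain B where B: "B \<in> \<A>" and max: "\<And>X. X \<in> \<A> \<Longrightarrow> B \<subseteq> X \<Longrightarrow> X = B" by blast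
  have "x = 0" if x: "\<forall>e\<in>B. x \<bullet> e = 0" for x :: 'a
  proof (rule ccontr)
    assume nz: "x \<noteq> 0"
    define u where "u = x /\<^sub>R norm x"
    have u: "norm u = 1" "\<forall>e\<in>B. u \<bullet> e = 0"
      using nz x by (auto simp: u_def)
    have "insert u B \<in> \<A>"
      using B u unfolding \<A>_def
      by (auto simp: pairwise_insert orthogonal_def inner_commute)
    then have "u \<in> B" using max by blast
    with u show False by (metis inner_eq_zero_iff norm_zero zero_neq_one)
  qed
  then have "is_hilbert_basis B"
    using B unfolding is_hilbert_basis_def \<A>_def by blast
  then show ?thesis
    unfolding hilbert_basis_def by (rule someI)
qed

definition hilbert_schmidt :: "('a::real_inner \<Rightarrow> 'a) \<Rightarrow> bool" where
  "hilbert_schmidt L \<longleftrightarrow>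
     bounded_linear L \<and> (\<lambda>e. (norm (L e))\<^sup>2) summable_on hilbert_basis"

definition hs_norm :: "('a::real_inner \<Rightarrow> 'a) \<Rightarrow> real" where
  "hs_norm L = sqrt (\<Sum>\<^sub>\<infinity>e\<in>hilbert_basis. (norm (L e))\<^sup>2)"

definition hs_continuous_on ::
    "'b::topological_space set \<Rightarrow> ('b \<Rightarrow> 'a::real_inner \<Rightarrow> 'a) \<Rightarrow> bool" where
  "hs_continuous_on E F \<longleftrightarrow>
     (\<forall>p\<in>E. ((\<lambda>q. hs_norm (\<lambda>h. F q h - F p h)) \<longlongrightarrow> 0) (at p within E))"

text \<open>Trace class operators in the sense of nuclear operators.\<close>

definition trace_class :: "('a::real_inner \<Rightarrow> 'a) \<Rightarrow> bool" where
  "trace_class L \<longleftrightarrow> bounded_linear L \<and>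
     (\<exists>b c :: nat \<Rightarrow> 'a. summable (\<lambda>k. norm (b k) * norm (c k)) \<and>
        (\<forall>x. (\<lambda>k. (b k \<bullet> x) *\<^sub>R c k) sums L x))"

definition op_trace :: "('a::real_inner \<Rightarrow> 'a) \<Rightarrow> real" where
  "op_trace L = (\<Sum>\<^sub>\<infinity>e\<in>hilbert_basis. L e \<bullet> e)"

section \<open>Semigroups, generators, adjoints\<close>

text \<open>An unbounded operator is a map together with its domain; values off the domain are ignored.\<close>

definition C0_semigroup :: "(real \<Rightarrow> 'a::real_normed_vector \<Rightarrow> 'a) \<Rightarrow> bool" where
  "C0_semigroup T \<longleftrightarrow>
     (\<forall>t\<ge>0. bounded_linear (T t)) \<and>
     (\<forall>x. T 0 x = x) \<and>
     (\<forall>s\<ge>0. \<forall>t\<ge>0. \<forall>x. T (s + t) x = T s (T t x)) \<and>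
     (\<forall>x. ((\<lambda>t. T t x) \<longlongrightarrow> x) (at_right 0))"

definition generates ::
    "'a::real_normed_vector set \<Rightarrow> ('a \<Rightarrow> 'a) \<Rightarrow> (real \<Rightarrow> 'a \<Rightarrow> 'a) \<Rightarrow> bool" where
  "generates D A T \<longleftrightarrow>
     C0_semigroup T \<and>
     D = {x. \<exists>y. ((\<lambda>t. (T t x - x) /\<^sub>R t) \<longlongrightarrow> y) (at_right 0)} \<and>
     (\<forall>x\<in>D. ((\<lambda>t. (T t x - x) /\<^sub>R t) \<longlongrightarrow> A x) (at_right 0))"

definition adj_dom :: "'a::real_inner set \<Rightarrow> ('a \<Rightarrow> 'a) \<Rightarrow> 'a set" where
  "adj_dom D A = {y. \<exists>z. \<forall>x\<in>D. A x \<bullet> y = x \<bullet> z}"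

text \<open>The vector below is unique when \<open>D\<close> is dense, as the domain of a generator is.\<close>

definition adj_op :: "'a::real_inner set \<Rightarrow> ('a \<Rightarrow> 'a) \<Rightarrow> 'a \<Rightarrow> 'a" where
  "adj_op D A y = (THE z. \<forall>x\<in>D. A x \<bullet> y = x \<bullet> z)"

section \<open>Levy processes, stochastic convolution, Ornstein--Uhlenbeck semigroup\<close>

definition levy_exponent ::
    "('a \<Rightarrow> 'a) \<Rightarrow> 'a \<Rightarrow> 'a measure \<Rightarrow> 'a::{real_inner, second_countable_topology} \<Rightarrow> complex" where
  "levy_exponent Q a \<nu> h =
     complex_of_real (Q h \<bullet> h) / 2 - \<i> * complex_of_real (a \<bullet> h)
     - (\<integral>y. (exp (\<i> * complex_of_real (h \<bullet> y)) - 1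
             - \<i> * complex_of_real ((h \<bullet> y) * indicator (cball 0 1) y)) \<partial>\<nu>)"

definition levy_process ::
    "'w measure \<Rightarrow> (real \<Rightarrow> 'w \<Rightarrow> 'a::{real_inner, second_countable_topology}) \<Rightarrow> bool" where
  "levy_process M Z \<longleftrightarrow>
     prob_space M \<and>
     (\<forall>t\<ge>0. Z t \<in> borel_measurable M) \<and>
     (AE \<omega> in M. Z 0 \<omega> = 0) \<and>
     (\<forall>n p. 0 \<le> p 0 \<and> (\<forall>i<n. p i < p (Suc i)) \<longrightarrow>
        prob_space.indep_vars M (\<lambda>_. borel) (\<lambda>i \<omega>. Z (p (Suc i)) \<omega> - Z (p i) \<omega>) {..<n::nat}) \<and>
     (\<forall>s\<ge>0. \<forall>t\<ge>s. distr M borel (\<lambda>\<omega>. Z t \<omega> - Z s \<omega>) = distr M borel (Z (t - s))) \<and>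
     (\<forall>t\<ge>0. \<forall>\<epsilon>>0.
        ((\<lambda>s. measure M {\<omega>\<in>space M. norm (Z s \<omega> - Z t \<omega>) > \<epsilon>}) \<longlongrightarrow> 0) (at t within {0..}))"

text \<open>
  \<open>W\<close> is the stochastic integral of the deterministic integrand \<open>T (t - s)\<close> with respect to
  \<open>dZ s\<close> over \<open>[0, t]\<close>, i.e. the limit in probability of the left-point Riemann sums as the mesh
  of the partition \<open>0 = p 0 \<le> \<dots> \<le> p n = t\<close> tends to 0. This determines \<open>W\<close> almost surely.
\<close>

definition is_stochastic_convolution ::
    "'w measure \<Rightarrow> (real \<Rightarrow> 'a \<Rightarrow> 'a) \<Rightarrow> (real \<Rightarrow> 'w \<Rightarrow> 'a) \<Rightarrow> real
      \<Rightarrow> ('w \<Rightarrow> 'a::{real_inner, second_countable_topology}) \<Rightarrow> bool" where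
  "is_stochastic_convolution M T Z t W \<longleftrightarrow>
     W \<in> borel_measurable M \<and>
     (\<forall>\<epsilon>>0. \<exists>\<delta>>0. \<forall>n p.
        p 0 = 0 \<and> p n = t \<and> (\<forall>i<n. p i \<le> p (Suc i) \<and> p (Suc i) - p i < \<delta>) \<longrightarrow>
        measure M {\<omega>\<in>space M.
          norm ((\<Sum>i<n. T (t - p i) (Z (p (Suc i)) \<omega> - Z (p i) \<omega>)) - W \<omega>) > \<epsilon>} < \<epsilon>)"

definition OU_semigroup ::
    "'w measure \<Rightarrow> (real \<Rightarrow> 'a \<Rightarrow> 'a) \<Rightarrow> (real \<Rightarrow> 'w \<Rightarrow> 'a::real_inner)
      \<Rightarrow> real \<Rightarrow> ('a \<Rightarrow> real) \<Rightarrow> 'a \<Rightarrow> real" where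
  "OU_semigroup M T Y t f x = (\<integral>\<omega>. f (T t x + Y t \<omega>) \<partial>M)"

section \<open>Function spaces\<close>

text \<open>The derivative \<open>Df\<close> as an element of \<open>H\<close>, via the Riesz isomorphism.\<close>

definition grad :: "('a::real_inner \<Rightarrow> real) \<Rightarrow> 'a \<Rightarrow> 'a" where
  "grad f x = (THE g. GDERIV f x :> g)"

definition hess :: "('a::real_inner \<Rightarrow> real) \<Rightarrow> 'a \<Rightarrow> 'a \<Rightarrow> 'a" where
  "hess f x = frechet_derivative (grad f) (at x)"

definition Cb2 :: "('a::real_inner \<Rightarrow> real) set" where
  "Cb2 = {f. bounded (range f) \<and> continuous_on UNIV f \<and>
     (\<forall>x. \<exists>g. GDERIV f x :> g) \<and>
     bounded (range (grad f)) \<and> continuous_on UNIV (grad f) \<and>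
     (\<forall>x. grad f differentiable (at x)) \<and>
     (\<forall>x. hilbert_schmidt (hess f x)) \<and>
     bounded (range (\<lambda>x. hs_norm (hess f x))) \<and> hs_continuous_on UNIV (hess f)}"

definition CA2 :: "'a::real_inner set \<Rightarrow> ('a \<Rightarrow> 'a) \<Rightarrow> ('a \<Rightarrow> real) set" where
  "CA2 D A = {f \<in> Cb2.
     (\<forall>x. grad f x \<in> adj_dom D A) \<and>
     bounded (range (\<lambda>x. adj_op D A (grad f x))) \<and>
     continuous_on UNIV (\<lambda>x. adj_op D A (grad f x))}"

section \<open>The operator and the Cauchy problem\<close>

definition L0 ::
    "'a::{real_inner, second_countable_topology} set \<Rightarrow> ('a \<Rightarrow> 'a) \<Rightarrow> ('a \<Rightarrow> 'a) \<Rightarrow> 'a \<Rightarrow> 'a measure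
      \<Rightarrow> ('a \<Rightarrow> real) \<Rightarrow> 'a \<Rightarrow> real" where
  "L0 D A Q a \<nu> f x =
     x \<bullet> adj_op D A (grad f x)
     + (\<integral>y. (f (x + y) - f x - indicator (cball 0 1) y * (y \<bullet> grad f x)) \<partial>\<nu>)
     + op_trace (\<lambda>h. Q (hess f x h)) / 2
     + a \<bullet> grad f x"

text \<open>
  Only the values \<open>u t x\<close> with \<open>t \<ge> 0\<close> matter; time derivatives at 0 are one-sided.
  The boundedness of the spatial derivatives is kept apart, see below.
\<close>

definition classical_solution ::
    "'a::{real_inner, second_countable_topology} set \<Rightarrow> ('a \<Rightarrow> 'a) \<Rightarrow> ('a \<Rightarrow> 'a) \<Rightarrow> 'a \<Rightarrow> 'a measure
      \<Rightarrow> ('a \<Rightarrow> real) \<Rightarrow> (real \<Rightarrow> 'a \<Rightarrow> real) \<Rightarrow> bool" where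
  "classical_solution D A Q a \<nu> f u \<longleftrightarrow>
     (let E = {0..} \<times> (UNIV :: 'a set) in
       bounded ((\<lambda>(t, x). u t x) ` E) \<and> continuous_on E (\<lambda>(t, x). u t x) \<and>
       (\<forall>t\<ge>0. u t \<in> CA2 D A) \<and>
       continuous_on E (\<lambda>(t, x). grad (u t) x) \<and>
       continuous_on E (\<lambda>(t, x). adj_op D A (grad (u t) x)) \<and>
       hs_continuous_on E (\<lambda>(t, x). hess (u t) x)) \<and>
     (\<forall>x. \<exists>u'. continuous_on {0..} u' \<and>
        (\<forall>t\<ge>0. ((\<lambda>s. u s x) has_real_derivative u' t) (at t within {0..}) \<and>
               u' t = L0 D A Q a \<nu> (u t) x)) \<and>
     (\<forall>x. u 0 x = f x)"

definition derivs_bounded ::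
    "'a::real_inner set \<Rightarrow> ('a \<Rightarrow> 'a) \<Rightarrow> real set \<Rightarrow> (real \<Rightarrow> 'a \<Rightarrow> real) \<Rightarrow> bool" where
  "derivs_bounded D A J u \<longleftrightarrow>
     bounded ((\<lambda>(t, x). grad (u t) x) ` (J \<times> UNIV)) \<and>
     bounded ((\<lambda>(t, x). adj_op D A (grad (u t) x)) ` (J \<times> UNIV)) \<and>
     bounded ((\<lambda>(t, x). hs_norm (hess (u t) x)) ` (J \<times> UNIV))"

definition bounded_classical_solution ::
    "'a::{real_inner, second_countable_topology} set \<Rightarrow> ('a \<Rightarrow> 'a) \<Rightarrow> ('a \<Rightarrow> 'a) \<Rightarrow> 'a \<Rightarrow> 'a measure
      \<Rightarrow> ('a \<Rightarrow> real) \<Rightarrow> (real \<Rightarrow> 'a \<Rightarrow> real) \<Rightarrow> bool" where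
  "bounded_classical_solution D A Q a \<nu> f u \<longleftrightarrow>
     classical_solution D A Q a \<nu> f u \<and> derivs_bounded D A {0..} u"

text \<open>
  The variant in which the spatial derivatives are bounded on \<open>[0, r] \<times> H\<close> for every \<open>r\<close>, while
  \<open>u\<close> itself is still bounded on \<open>[0, \<infinity>) \<times> H\<close>. When the semigroup generated by \<open>A\<close> is unbounded,
  the derivatives of the Ornstein--Uhlenbeck semigroup need not be bounded uniformly in time:
  for \<open>H = \<real>\<close>, \<open>A x = x\<close>, \<open>Q = 0\<close>, \<open>a = 0\<close>, \<open>\<nu> = 0\<close> and \<open>f = sin\<close> one gets
  \<open>u t x = sin (exp t * x)\<close>, whose derivative at \<open>x = 0\<close> is \<open>exp t\<close>.
\<close>

definition loc_bounded_classical_solution ::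
    "'a::{real_inner, second_countable_topology} set \<Rightarrow> ('a \<Rightarrow> 'a) \<Rightarrow> ('a \<Rightarrow> 'a) \<Rightarrow> 'a \<Rightarrow> 'a measure
      \<Rightarrow> ('a \<Rightarrow> real) \<Rightarrow> (real \<Rightarrow> 'a \<Rightarrow> real) \<Rightarrow> bool" where
  "loc_bounded_classical_solution D A Q a \<nu> f u \<longleftrightarrow>
     classical_solution D A Q a \<nu> f u \<and> (\<forall>r\<ge>0. derivs_bounded D A {0..r} u)"

lemma bounded_imp_loc_bounded_classical_solution:
  fixes D :: "'a::{real_inner, second_countable_topology} set"
  assumes "bounded_classical_solution D A Q a \<nu> f u"
  shows "loc_bounded_classical_solution D A Q a \<nu> f u"
proof -
  have sub: "{0..r} \<times> (UNIV :: 'a set) \<subseteq> {0..} \<times> UNIV" for r :: real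
    by auto
  have "derivs_bounded D A {0..r} u" for r
    unfolding derivs_bounded_def
  proof (intro conjI)
    note b = assms[unfolded bounded_classical_solution_def derivs_bounded_def,
        THEN conjunct2]
    show "bounded ((\<lambda>(t, x). grad (u t) x) ` ({0..r} \<times> UNIV))"
      by (rule bounded_subset[OF b[THEN conjunct1] image_mono[OF sub]])
    show "bounded ((\<lambda>(t, x). adj_op D A (grad (u t) x)) ` ({0..r} \<times> UNIV))"
      by (rule bounded_subset[OF b[THEN conjunct2, THEN conjunct1] image_mono[OF sub]])
    show "bounded ((\<lambda>(t, x). hs_norm (hess (u t) x)) ` ({0..r} \<times> UNIV))"
      by (rule bounded_subset[OF b[THEN conjunct2, THEN conjunct2] image_mono[OF sub]])
  qed
  then show ?thesis
    using assms by (simp add: bounded_classical_solution_def loc_bounded_classical_solution_def)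
qed

definition unique_solution ::
    "((real \<Rightarrow> 'a \<Rightarrow> real) \<Rightarrow> bool) \<Rightarrow> (real \<Rightarrow> 'a \<Rightarrow> real) \<Rightarrow> bool" where
  "unique_solution S u \<longleftrightarrow> S u \<and> (\<forall>v. S v \<longrightarrow> (\<forall>t\<ge>0. \<forall>x. v t x = u t x))"

end

theory Submission
  imports Defs
begin

text \<open>
  Everything rests on Dynkin's formula for the law of \<open>Y\<close>: for \<open>g\<close> with bounded derivatives up to order
  two, \<open>E g (z + Y h) - g z\<close> is the integral over \<open>s \<in> {0..h}\<close> of \<open>E (G s g) (z + Y s)\<close>, where \<open>G s\<close> is the
  drift-free part of the operator with jumps, diffusion and shift transported by \<open>T s\<close>. For
  \<open>g = cos (k \<bullet> x + c)\<close> this is the characteristic function of \<open>Y h\<close>, and trigonometric polynomials are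
  dense among all \<open>g\<close> for bounded pointwise convergence with two directional derivatives, so neither an
  Ito formula nor uniqueness theorems for characteristic functions are needed. Applied to
  \<open>|y|\<^sup>2 / (1 + |y|\<^sup>2)\<close> the formula also gives continuity of \<open>Y\<close> in probability.

  Differentiating under the expectation puts \<open>P t f\<close> into \<open>CA2\<close>; the adjoint semigroup acts on the
  gradient. Dynkin's formula together with the chain rule along \<open>r \<mapsto> T r x\<close> shows that \<open>P t f x\<close> has the
  right derivative \<open>L0 (P t f) x\<close>, which is continuous in \<open>t\<close>, hence a derivative. For uniqueness, if \<open>v\<close>
  solves the problem, then \<open>s \<mapsto> E v (t - s) (T s x + Y s)\<close> is continuous on \<open>{0..t}\<close> with right derivative
  zero, by the Markov property; its values at \<open>0\<close> and \<open>t\<close> are \<open>v t x\<close> and \<open>P t f x\<close>. No moment of \<open>Y\<close> enters: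
  along the flow of \<open>T\<close> the equation cancels the unbounded term \<open>x \<bullet> A\<^sup>* D v\<close>.
\<close>


subsection \<open>Expansions in a Hilbert basis\<close>

text \<open>The generator is tested only on values, directional derivatives and pure second
  derivatives along lines: once the nuclear representation of \<open>Q\<close> is polarized, no
  mixed derivative and no estimate uniform over directions is left. Hence bounded pointwise
  convergence of the triple (function, first, second line derivative) is the right approximation;
  jump integral, trace series and expectation all pass to such limits by domination, whereas uniform
  C2 approximation is out of reach.

  The obstacle is the drift: an orbit \<open>T r x\<close> is differentiable only for
  \<open>x\<close> in \<open>D\<close>, and \<open>x \<bullet> adj_op D A (grad f x)\<close> may be
  unbounded. The chain rule is therefore proved on \<open>D\<close>, integrated in time and extended
  by density.

  The integrand of Dynkin's formula is known to be measurable in time, not continuous, so its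
  average over a short interval is compared with its value at one time, chosen so that the value is
  at least half as far from the limit as the average. All limits run along sequences because
  convergence in probability gives pathwise convergence only along subsequences.\<close>

lemma hilbert_basis_norm: "(e :: 'a::real_inner) \<in> hilbert_basis \<Longrightarrow> norm e = 1"
  and hilbert_basis_orthogonal: "(e :: 'a) \<in> hilbert_basis \<Longrightarrow> f \<in> hilbert_basis \<Longrightarrow> e \<noteq> f \<Longrightarrow> e \<bullet> f = 0"
  and hilbert_basis_maximal: "(\<And>e :: 'a. e \<in> hilbert_basis \<Longrightarrow> x \<bullet> e = 0) \<Longrightarrow> x = 0"
proof -
  note b = is_hilbert_basis_hilbert_basis[where 'a='a, unfolded is_hilbert_basis_def]
  show "e \<in> hilbert_basis \<Longrightarrow> norm e = 1" using b by blast
  show "e \<in> hilbert_basis \<Longrightarrow> f \<in> hilbert_basis \<Longrightarrow> e \<noteq> f \<Longrightarrow> e \<bullet> f = 0"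
    using b unfolding pairwise_def orthogonal_def by simp
  show "(\<And>e. e \<in> hilbert_basis \<Longrightarrow> x \<bullet> e = 0) \<Longrightarrow> x = 0" using b by blast
qed

lemma hilbert_basis_inner:
  "e \<in> hilbert_basis \<Longrightarrow> f \<in> hilbert_basis \<Longrightarrow> e \<bullet> f = (if e = f then 1 else 0)"
  using hilbert_basis_orthogonal hilbert_basis_norm by (auto simp: norm_eq_1)

lemma norm_sum_hilbert_basis:
  assumes "finite F" "F \<subseteq> hilbert_basis"
  shows "(norm (\<Sum>e\<in>F. c e *\<^sub>R e))\<^sup>2 = (\<Sum>e\<in>F. (c e)\<^sup>2)"
proof -
  have "(\<Sum>e\<in>F. c e *\<^sub>R e) \<bullet> (\<Sum>e\<in>F. c e *\<^sub>R e) = (\<Sum>e\<in>F. \<Sum>f\<in>F. c e * (c f * (e \<bullet> f)))"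
    by (subst inner_sum_left, intro sum.cong refl, subst inner_sum_right) (simp add: sum_distrib_left mult_ac)
  also have "\<dots> = (\<Sum>e\<in>F. \<Sum>f\<in>F. if e = f then c e * c f else 0)"
    using assms(2) by (intro sum.cong refl) (auto simp: hilbert_basis_inner subset_iff)
  finally show ?thesis
    using assms(1) unfolding power2_norm_eq_inner by (simp add: power2_eq_square)
qed

lemma bessel:
  assumes F: "finite F" "F \<subseteq> hilbert_basis"
  shows "(\<Sum>e\<in>F. (x \<bullet> e)\<^sup>2) \<le> (norm x)\<^sup>2"
proof -
  let ?p = "\<Sum>e\<in>F. (x \<bullet> e) *\<^sub>R e"
  have "x \<bullet> ?p = (\<Sum>e\<in>F. (x \<bullet> e)\<^sup>2)"
    by (simp add: inner_sum_right power2_eq_square)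
  moreover have "?p \<bullet> ?p = (\<Sum>e\<in>F. (x \<bullet> e)\<^sup>2)"
    using norm_sum_hilbert_basis[OF F] by (simp add: power2_norm_eq_inner)
  moreover have "0 \<le> (x - ?p) \<bullet> (x - ?p)" by simp
  ultimately show ?thesis
    by (simp add: inner_diff_left inner_diff_right inner_commute power2_norm_eq_inner)
qed

lemma summable_on_inner_hilbert_basis: "(\<lambda>e. (x \<bullet> e)\<^sup>2) summable_on hilbert_basis"
  by (rule nonneg_bdd_above_summable_on) (auto intro!: bdd_aboveI2 bessel)

text \<open>Completeness through the Cauchy criterion: a finite sum containing \<open>F0\<close>
  differs from the sum over \<open>F0\<close> by orthogonal vectors, whose squared norm is a
  difference of partial sums of the squared coefficients.\<close>

lemma summable_on_hilbert_basis:
  fixes c :: "'a::{real_inner, banach} \<Rightarrow> real"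
  assumes "(\<lambda>e. (c e)\<^sup>2) summable_on hilbert_basis"
  shows "(\<lambda>e. c e *\<^sub>R e) summable_on hilbert_basis"
proof -
  let ?B = "hilbert_basis :: 'a set"
  have ev: "\<exists>P. eventually P (finite_subsets_at_top ?B) \<and>
      (\<forall>F F'. P F \<and> P F' \<longrightarrow> dist (\<Sum>e\<in>F. c e *\<^sub>R e) (\<Sum>e\<in>F'. c e *\<^sub>R e) < \<epsilon>)" if "\<epsilon> > 0" for \<epsilon>
  proof -
    define s where "s = (\<Sum>\<^sub>\<infinity>e\<in>?B. (c e)\<^sup>2)"
    have "(sum (\<lambda>e. (c e)\<^sup>2) \<longlongrightarrow> s) (finite_subsets_at_top ?B)"
      using has_sum_infsum[OF assms] by (simp add: has_sum_def s_def)
    \<comment> \<open>Two partial sums within eps^2/8 of \<open>s\<close> differ by less than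
      eps^2/4; its root eps/2 allows \<open>F\<close> and \<open>F'\<close> to be compared through
      \<open>F0\<close>.\<close>
    then have "\<forall>\<^sub>F F in finite_subsets_at_top ?B. dist (\<Sum>e\<in>F. (c e)\<^sup>2) s < \<epsilon>\<^sup>2 / 8"
      using \<open>\<epsilon> > 0\<close> by (intro tendstoD) auto
    then obtain F0 where F0: "finite F0" "F0 \<subseteq> ?B"
      and F0': "\<And>F. finite F \<Longrightarrow> F0 \<subseteq> F \<Longrightarrow> F \<subseteq> ?B \<Longrightarrow> dist (\<Sum>e\<in>F. (c e)\<^sup>2) s < \<epsilon>\<^sup>2 / 8"
      unfolding eventually_finite_subsets_at_top by metis
    have close: "dist (\<Sum>e\<in>F. c e *\<^sub>R e) (\<Sum>e\<in>F0. c e *\<^sub>R e) < \<epsilon> / 2"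
      if F: "finite F" "F0 \<subseteq> F" "F \<subseteq> ?B" for F
    proof -
      have "(norm (\<Sum>e\<in>F-F0. c e *\<^sub>R e))\<^sup>2 = (\<Sum>e\<in>F-F0. (c e)\<^sup>2)"
        using F by (intro norm_sum_hilbert_basis) auto
      also have "\<dots> = (\<Sum>e\<in>F. (c e)\<^sup>2) - (\<Sum>e\<in>F0. (c e)\<^sup>2)"
        using F F0 by (simp add: sum_diff)
      also have "\<dots> < \<epsilon>\<^sup>2 / 4"
        using F0'[OF F] F0'[OF F0(1) order_refl F0(2)] unfolding dist_real_def by arith
      also have "\<dots> = (\<epsilon> / 2)\<^sup>2" by (simp add: power_divide)
      finally have "norm (\<Sum>e\<in>F-F0. c e *\<^sub>R e) < \<epsilon> / 2"
        using \<open>\<epsilon> > 0\<close> by (metis less_eq_real_def half_gt_zero power_less_imp_less_base)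
      then show ?thesis using F F0 by (simp add: dist_norm sum_diff)
    qed
    show ?thesis
    proof (intro exI conjI allI impI)
      show "\<forall>\<^sub>F F in finite_subsets_at_top ?B. finite F \<and> F0 \<subseteq> F \<and> F \<subseteq> ?B"
        unfolding eventually_finite_subsets_at_top using F0 by blast
      fix F F' assume "(finite F \<and> F0 \<subseteq> F \<and> F \<subseteq> ?B) \<and> finite F' \<and> F0 \<subseteq> F' \<and> F' \<subseteq> ?B"
      then show "dist (\<Sum>e\<in>F. c e *\<^sub>R e) (\<Sum>e\<in>F'. c e *\<^sub>R e) < \<epsilon>"
        using close[of F] close[of F'] dist_triangle_half_l by blast
    qed
  qed
  have "cauchy_filter (filtermap (\<lambda>F. \<Sum>e\<in>F. c e *\<^sub>R e) (finite_subsets_at_top ?B))"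
    unfolding cauchy_filter_metric_filtermap using ev by blast
  moreover have "Topological_Spaces.complete (UNIV::'a set)"
    by (meson Cauchy_convergent UNIV_I metric_space_class.complete_def convergent_def)
  ultimately obtain l where "((\<lambda>F. \<Sum>e\<in>F. c e *\<^sub>R e) \<longlongrightarrow> l) (finite_subsets_at_top ?B)"
    using complete_uniform[where S="UNIV :: 'a set"] by (force simp: filterlim_def)
  then show ?thesis
    unfolding summable_on_def has_sum_def by blast
qed

text \<open>Bessel's inequality provides a sum \<open>z\<close>; \<open>x - z\<close> has zero
  coefficient against every basis vector, and maximality of the basis forces it to vanish.\<close>

lemma has_sum_hilbert_basis:
  fixes x :: "'a::{real_inner, banach}"
  shows "((\<lambda>e. (x \<bullet> e) *\<^sub>R e) has_sum x) hilbert_basis"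
proof -
  obtain z where z: "((\<lambda>e. (x \<bullet> e) *\<^sub>R e) has_sum z) hilbert_basis"
    using summable_on_hilbert_basis[OF summable_on_inner_hilbert_basis] summable_on_def by blast
  have "x - z = 0"
  proof (rule hilbert_basis_maximal)
    fix f :: 'a assume f: "f \<in> hilbert_basis"
    have "((\<lambda>e. (\<lambda>y. y \<bullet> f) ((x \<bullet> e) *\<^sub>R e)) has_sum (z \<bullet> f)) hilbert_basis"
      by (rule has_sum_bounded_linear[OF bounded_linear_inner_left z])
    moreover have "((\<lambda>e. (\<lambda>y. y \<bullet> f) ((x \<bullet> e) *\<^sub>R e)) has_sum (x \<bullet> f)) {f}"
      using f has_sum_finite[of "{f}" "\<lambda>e. (\<lambda>y. y \<bullet> f) ((x \<bullet> e) *\<^sub>R e)"] by (simp add: hilbert_basis_inner)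
    then have "((\<lambda>e. (\<lambda>y. y \<bullet> f) ((x \<bullet> e) *\<^sub>R e)) has_sum (x \<bullet> f)) hilbert_basis"
      by (rule has_sum_cong_neutral[THEN iffD1, rotated -1]) (use f in \<open>auto simp: hilbert_basis_inner\<close>)
    ultimately show "(x - z) \<bullet> f = 0"
      using has_sum_unique by (fastforce simp: inner_diff_left)
  qed
  then show ?thesis using z by simp
qed

lemma parseval:
  fixes x y :: "'a::{real_inner, banach}"
  shows "((\<lambda>e. (x \<bullet> e) * (y \<bullet> e)) has_sum x \<bullet> y) hilbert_basis"
proof -
  have "((\<lambda>e. (\<lambda>z. z \<bullet> y) ((x \<bullet> e) *\<^sub>R e)) has_sum (x \<bullet> y)) hilbert_basis"
    by (rule has_sum_bounded_linear[OF bounded_linear_inner_left has_sum_hilbert_basis])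
  then show ?thesis by (simp add: inner_commute)
qed

text \<open>Distinct basis vectors are at distance sqrt 2, so the balls of radius 1/2 around them
  are disjoint; a second countable space has only countably many disjoint nonempty open
  sets.\<close>

lemma countable_hilbert_basis:
  "countable (hilbert_basis :: 'a::{real_inner, second_countable_topology} set)"
proof -
  let ?B = "hilbert_basis :: 'a set"
  have d: "dist e f \<ge> 1" if "e \<in> ?B" "f \<in> ?B" "e \<noteq> f" for e f :: 'a
  proof -
    have "(dist e f)\<^sup>2 = 2"
      using that by (simp add: dist_norm power2_norm_eq_inner inner_diff_left inner_diff_right
          hilbert_basis_inner)
    then show ?thesis
      by (smt (verit, best) power2_eq_1_iff zero_le_dist power_mono one_power2)
  qed
  have "countable ((\<lambda>e. ball e (1/2)) ` ?B)"
  proof (rule countable_disjoint_open_subsets)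
    show "pairwise disjnt ((\<lambda>e. ball e (1/2)) ` ?B)"
    proof (clarsimp simp: pairwise_def)
      fix e f :: 'a assume "e \<in> ?B" "f \<in> ?B" "ball e (1/2) \<noteq> ball f (1/2)"
      then have "dist e f \<ge> 1" using d by blast
      then show "disjnt (ball e (1/2)) (ball f (1/2))"
        by (simp add: disjnt_def disjoint_ballI)
    qed
  qed auto
  moreover have "inj_on (\<lambda>e. ball e (1/2)) ?B"
  proof (rule inj_onI, rule ccontr)
    fix e f :: 'a assume "e \<in> ?B" "f \<in> ?B" "ball e (1/2) = ball f (1/2)" "e \<noteq> f"
    then have "e \<in> ball f (1/2)" "1 \<le> dist f e"
      using d[of f e] centre_in_ball[of e "1/2"] by auto
    then show False by simp
  qed
  ultimately show ?thesis
    using countable_image_inj_on by blast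
qed

text \<open>Replaces the net of finite subsets by a sequence, as dominated convergence needs;
  initial pieces of an enumeration eventually contain every finite subset of the basis.\<close>

lemma hilbert_basis_approx:
  obtains F :: "nat \<Rightarrow> 'a::{real_inner, banach, second_countable_topology} set"
  where "\<And>n. finite (F n)" "\<And>n. F n \<subseteq> hilbert_basis"
    "\<And>x. (\<lambda>n. \<Sum>e\<in>F n. (x \<bullet> e) *\<^sub>R e) \<longlonglongrightarrow> x"
proof -
  let ?B = "hilbert_basis :: 'a set"
  define F where "F n = {e\<in>?B. to_nat_on ?B e < n}" for n
  have inj: "inj_on (to_nat_on ?B) ?B"
    by (rule inj_on_to_nat_on[OF countable_hilbert_basis])
  have fin: "finite (F n)" for n
  proof -
    have "finite (to_nat_on ?B ` F n)"
      by (rule finite_subset[of _ "{..<n}"]) (auto simp: F_def)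
    then show ?thesis
      using finite_imageD[OF _ inj_on_subset[OF inj]] by (auto simp: F_def)
  qed
  have "filterlim F (finite_subsets_at_top ?B) sequentially"
    unfolding filterlim_finite_subsets_at_top
  proof (intro allI impI)
    fix X :: "'a set" assume X: "finite X \<and> X \<subseteq> ?B"
    define m where "m = Suc (Max (insert 0 (to_nat_on ?B ` X)))"
    have "X \<subseteq> F n" if "n \<ge> m" for n
    proof
      fix e assume "e \<in> X"
      then have "to_nat_on ?B e < m" using X by (simp add: m_def less_Suc_eq_le)
      then show "e \<in> F n" using \<open>e \<in> X\<close> X that by (auto simp: F_def)
    qed
    then show "\<forall>\<^sub>F n in sequentially. finite (F n) \<and> X \<subseteq> F n \<and> F n \<subseteq> ?B"
      using fin by (auto simp: eventually_sequentially F_def)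
  qed
  then have "(\<lambda>n. \<Sum>e\<in>F n. (x \<bullet> e) *\<^sub>R e) \<longlonglongrightarrow> x" for x
    using has_sum_hilbert_basis[of x] unfolding has_sum_def by (rule filterlim_compose[rotated])
  then show thesis using that[of F] fin by (auto simp: F_def)
qed

subsection \<open>Bernstein polynomials by de Casteljau recursion\<close>

text \<open>The value is the Bernstein polynomial with coefficients \<open>f 0\<close> to
  \<open>f n\<close> at \<open>p\<close>, that is, the mean of \<open>f\<close> under the binomial
  law. The recursion turns monotonicity, the variance and differentiation into inductions without
  binomial coefficients.\<close>

fun bern :: "nat \<Rightarrow> (nat \<Rightarrow> real) \<Rightarrow> real \<Rightarrow> real" where
  "bern 0 f p = f 0"
| "bern (Suc n) f p = (1 - p) * bern n f p + p * bern n (\<lambda>k. f (Suc k)) p"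

lemma bern_add: "bern n (\<lambda>k. f k + g k) p = bern n f p + bern n g p"
  by (induction n arbitrary: f g) (auto simp: algebra_simps)

lemma bern_cmult: "bern n (\<lambda>k. c * f k) p = c * bern n f p"
  by (induction n arbitrary: f) (auto simp: algebra_simps)

lemma bern_diff: "bern n (\<lambda>k. f k - g k) p = bern n f p - bern n g p"
  using bern_add[of n f "\<lambda>k. - 1 * g k" p] bern_cmult[of n "- 1" g p] by simp

lemma bern_const: "bern n (\<lambda>k. c) p = c"
  by (induction n) (auto simp: algebra_simps)

lemma bern_mono:
  assumes "0 \<le> p" "p \<le> 1" "\<And>k. k \<le> n \<Longrightarrow> f k \<le> g k"
  shows "bern n f p \<le> bern n g p"
  using assms(3)
proof (induction n arbitrary: f g)
  case (Suc n)
  have "(1 - p) * bern n f p \<le> (1 - p) * bern n g p"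
    using assms(1,2) Suc by (intro mult_left_mono Suc.IH) auto
  moreover have "p * bern n (\<lambda>k. f (Suc k)) p \<le> p * bern n (\<lambda>k. g (Suc k)) p"
    using assms(1,2) Suc by (intro mult_left_mono Suc.IH) auto
  ultimately show ?case by simp
qed simp

lemma bern_abs_le:
  assumes "0 \<le> p" "p \<le> 1" "\<And>k. k \<le> n \<Longrightarrow> \<bar>f k\<bar> \<le> c"
  shows "\<bar>bern n f p\<bar> \<le> c"
proof -
  have "bern n f p \<le> c"
    using bern_mono[of p n f "\<lambda>_. c"] assms by (auto simp: bern_const abs_le_iff)
  moreover have "- c \<le> bern n f p"
    using bern_mono[of p n "\<lambda>_. - c" f] assms by (fastforce simp: bern_const abs_le_iff)
  ultimately show ?thesis by simp
qed

text \<open>Squared bias plus binomial variance. The centre \<open>c\<close> is left free because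
  shifting the index by one in the recursion replaces \<open>c\<close> by
  \<open>c - 1\<close>.\<close>

lemma bern_variance: "bern n (\<lambda>k. (real k - c)\<^sup>2) p = (real n * p - c)\<^sup>2 + real n * p * (1 - p)"
proof (induction n arbitrary: c)
  case (Suc n)
  have "bern n (\<lambda>k. (real (Suc k) - c)\<^sup>2) p = bern n (\<lambda>k. (real k - (c - 1))\<^sup>2) p"
    by (simp add: algebra_simps)
  then show ?case
    using Suc[of c] Suc[of "c - 1"] by (simp add: power2_eq_square) (simp add: algebra_simps)
qed simp

text \<open>Bernstein's argument through the variance. The coefficients may deviate from samples of
  \<open>\<phi>\<close> by a uniformly small error, so that scaled difference quotients, the
  coefficients of differentiated Bernstein polynomials, are covered as well.\<close>

lemma bern_tendsto:
  assumes p: "0 \<le> p" "p \<le> 1" and \<phi>: "continuous_on {0..1} \<phi>"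
    and a: "\<And>\<epsilon>. \<epsilon> > 0 \<Longrightarrow> \<forall>\<^sub>F n in sequentially. \<forall>k\<le>n. \<bar>a n k - \<phi> (real k / real n)\<bar> \<le> \<epsilon>"
  shows "(\<lambda>n. bern n (a n) p) \<longlonglongrightarrow> \<phi> p"
proof (rule LIMSEQ_I)
  fix r :: real assume r: "r > 0"
  define \<epsilon> where "\<epsilon> = r / 4"
  have \<epsilon>: "\<epsilon> > 0" using r by (simp add: \<epsilon>_def)
  have "uniformly_continuous_on {0..1} \<phi>"
    by (rule compact_uniformly_continuous[OF \<phi>]) simp
  then obtain \<delta> where \<delta>: "\<delta> > 0"
    and unif: "\<And>s t. s \<in> {0..1} \<Longrightarrow> t \<in> {0..1} \<Longrightarrow> \<bar>s - t\<bar> < \<delta> \<Longrightarrow> \<bar>\<phi> s - \<phi> t\<bar> < \<epsilon>"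
    unfolding uniformly_continuous_on_def dist_real_def using \<epsilon> by metis
  have "bounded (\<phi> ` {0..1})"
    by (intro compact_imp_bounded compact_continuous_image \<phi>) simp
  then obtain M where M: "M > 0" "\<And>s. s \<in> {0..1} \<Longrightarrow> \<bar>\<phi> s\<bar> \<le> M"
    unfolding bounded_pos by auto
  \<comment> \<open>Uniform continuity for \<open>s\<close> near \<open>p\<close>; for
    \<open>s\<close> farther away than \<open>\<delta>\<close>, the crude bound 2 M is paid for by
    the quadratic term, whose Bernstein mean is the variance.\<close>
  have lip: "\<bar>\<phi> s - \<phi> p\<bar> \<le> \<epsilon> + 2 * M / \<delta>\<^sup>2 * (s - p)\<^sup>2" if s: "s \<in> {0..1}" for s
  proof (cases "\<bar>s - p\<bar> < \<delta>")
    case True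
    moreover have "0 \<le> 2 * M / \<delta>\<^sup>2 * (s - p)\<^sup>2" using M by simp
    ultimately show ?thesis using unif[OF s, of p] p by auto
  next
    case False
    then have "\<delta>\<^sup>2 \<le> (s - p)\<^sup>2"
      using \<delta> by (metis abs_le_square_iff abs_of_pos not_less)
    then have "2 * M * 1 \<le> 2 * M * ((s - p)\<^sup>2 / \<delta>\<^sup>2)"
      using M \<delta> by (intro mult_left_mono) (auto simp: field_simps)
    moreover have "\<bar>\<phi> s - \<phi> p\<bar> \<le> 2 * M"
      using M(2)[OF s] M(2)[of p] p by auto
    ultimately show ?thesis using \<epsilon> by simp
  qed
  obtain n1 where n1: "\<And>n k. n \<ge> n1 \<Longrightarrow> k \<le> n \<Longrightarrow> \<bar>a n k - \<phi> (real k / real n)\<bar> \<le> \<epsilon>"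
    using a[OF \<epsilon>] unfolding eventually_sequentially by blast
  \<comment> \<open>Beyond \<open>n2\<close> the variance term 2 M / (\<open>\<delta>\<close>^2 n)
    is below \<open>\<epsilon>\<close>; with the two other \<open>\<epsilon>\<close> the error stays
    below 3 r / 4.\<close>
  obtain n2 :: nat where n2: "2 * M / \<delta>\<^sup>2 / \<epsilon> < real n2"
    using reals_Archimedean2 by blast
  have "norm (bern n (a n) p - \<phi> p) < r" if n: "n \<ge> max (Suc n1) (Suc n2)" for n
  proof -
    have n0: "n > 0" "n \<ge> n1" "n \<ge> n2" using n by auto
    let ?b = "\<lambda>k. \<bar>a n k - \<phi> p\<bar>"
    have 1: "?b k \<le> 2 * \<epsilon> + 2 * M / \<delta>\<^sup>2 / (real n)\<^sup>2 * (real k - real n * p)\<^sup>2" if "k \<le> n" for k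
    proof -
      have kn: "real k / real n \<in> {0..1}" using that n0 by auto
      have "real k / real n - p = (real k - real n * p) / real n" using n0 by (simp add: field_simps)
      then have "\<bar>\<phi> (real k / real n) - \<phi> p\<bar> \<le> \<epsilon> + 2 * M / \<delta>\<^sup>2 * ((real k - real n * p) / real n)\<^sup>2"
        using lip[OF kn] by simp
      then show ?thesis using n1[OF n0(2) that] by (simp add: power_divide)
    qed
    have "\<bar>bern n (a n) p - \<phi> p\<bar> = \<bar>bern n (\<lambda>k. a n k - \<phi> p) p\<bar>"
      by (simp add: bern_diff bern_const)
    also have "\<dots> \<le> bern n ?b p"
    proof -
      have "bern n (\<lambda>k. a n k - \<phi> p) p \<le> bern n ?b p" using p by (intro bern_mono) auto
      moreover have "bern n (\<lambda>k. - 1 * (a n k - \<phi> p)) p \<le> bern n ?b p" using p by (intro bern_mono) auto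
      ultimately show ?thesis unfolding bern_cmult by simp
    qed
    also have "\<dots> \<le> bern n (\<lambda>k. 2 * \<epsilon> + 2 * M / \<delta>\<^sup>2 / (real n)\<^sup>2 * (real k - real n * p)\<^sup>2) p"
      using p 1 by (intro bern_mono) auto
    also have "\<dots> = 2 * \<epsilon> + 2 * M / \<delta>\<^sup>2 / real n * (p * (1 - p))"
      using n0 by (simp only: bern_add bern_const bern_cmult bern_variance) (simp add: power2_eq_square)
    also have "\<dots> \<le> 2 * \<epsilon> + 2 * M / \<delta>\<^sup>2 / real n * 1"
      using p M by (intro add_left_mono mult_left_mono mult_le_one) auto
    also have "\<dots> < 2 * \<epsilon> + \<epsilon>"
    proof -
      have "2 * M / \<delta>\<^sup>2 / \<epsilon> < real n" using n2 n0 by linarith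
      then show ?thesis using \<epsilon> n0 \<delta> by (simp add: field_simps)
    qed
    finally show ?thesis using r by (simp add: \<epsilon>_def)
  qed
  then show "\<exists>no. \<forall>n\<ge>no. norm (bern n (a n) p - \<phi> p) < r" by blast
qed

subsection \<open>Test functions with bounded second derivatives\<close>

text \<open>One constant bounds value, gradient and Hessian. The Hessian is a bounded operator,
  continuous only in each direction separately; this much survives expectations and composition with
  bounded operators, also on the product space where pairs of values of \<open>Y\<close>
  live.\<close>

definition C2b :: "real \<Rightarrow> ('a::real_inner \<Rightarrow> real) \<Rightarrow> ('a \<Rightarrow> 'a) \<Rightarrow> ('a \<Rightarrow> 'a \<Rightarrow> 'a) \<Rightarrow> bool" where
  "C2b C g g' g'' \<longleftrightarrow>
     (\<forall>x. \<bar>g x\<bar> \<le> C \<and> norm (g' x) \<le> C \<and> (\<forall>h. norm (g'' x h) \<le> C * norm h) \<and>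
        (g has_derivative (\<lambda>h. g' x \<bullet> h)) (at x) \<and> (g' has_derivative g'' x) (at x) \<and>
        (\<forall>h k. g'' x h \<bullet> k = g'' x k \<bullet> h)) \<and>
     (\<forall>h. continuous_on UNIV (\<lambda>x. g'' x h))"

text \<open>
  A weaker notion that only looks along lines: \<open>d x h\<close> and \<open>q x h\<close> are the first and the pure second
  derivative of \<open>g\<close> at \<open>x\<close> in direction \<open>h\<close>.
\<close>

definition line_C2 ::
    "real \<Rightarrow> ('a::real_inner \<Rightarrow> real) \<Rightarrow> ('a \<Rightarrow> 'a \<Rightarrow> real) \<Rightarrow> ('a \<Rightarrow> 'a \<Rightarrow> real) \<Rightarrow> bool" where
  "line_C2 C g d q \<longleftrightarrow>
     (\<forall>x. \<bar>g x\<bar> \<le> C) \<and> (\<forall>x h. \<bar>d x h\<bar> \<le> C * norm h) \<and> (\<forall>x h. \<bar>q x h\<bar> \<le> C * (norm h)\<^sup>2) \<and>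
     (\<forall>x h. ((\<lambda>t. g (x + t *\<^sub>R h)) has_real_derivative d x h) (at 0)) \<and>
     (\<forall>x h. ((\<lambda>t. d (x + t *\<^sub>R h) h) has_real_derivative q x h) (at 0)) \<and>
     continuous_on UNIV g \<and> (\<forall>h. continuous_on UNIV (\<lambda>x. d x h)) \<and>
     (\<forall>h. continuous_on UNIV (\<lambda>x. q x h))"

lemma C2bD:
  assumes "C2b C g g' g''"
  shows "\<bar>g x\<bar> \<le> C" "norm (g' x) \<le> C" "norm (g'' x h) \<le> C * norm h"
    "(g has_derivative (\<lambda>h. g' x \<bullet> h)) (at x)" "(g' has_derivative g'' x) (at x)"
    "g'' x h \<bullet> k = g'' x k \<bullet> h" "continuous_on UNIV (\<lambda>x. g'' x h)"
    "0 \<le> C" "bounded_linear (g'' x)"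
    "continuous_on UNIV g" "continuous_on UNIV g'"
proof -
  show d: "\<bar>g x\<bar> \<le> C" "norm (g' x) \<le> C" "norm (g'' x h) \<le> C * norm h"
    "(g has_derivative (\<lambda>h. g' x \<bullet> h)) (at x)" "(g' has_derivative g'' x) (at x)"
    "g'' x h \<bullet> k = g'' x k \<bullet> h" "continuous_on UNIV (\<lambda>x. g'' x h)" for x h k
    using assms by (auto simp: C2b_def)
  show "0 \<le> C" using d(1)[of 0] by linarith
  show "bounded_linear (g'' x)" using d(5) has_derivative_bounded_linear by blast
  show "continuous_on UNIV g" "continuous_on UNIV g'"
    by (auto intro!: continuous_at_imp_continuous_on has_derivative_continuous[OF d(4)] has_derivative_continuous[OF d(5)])
qed

lemma line_C2D:
  assumes "line_C2 C g d q"
  shows "\<bar>g x\<bar> \<le> C" "\<bar>d x h\<bar> \<le> C * norm h" "\<bar>q x h\<bar> \<le> C * (norm h)\<^sup>2"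
    "((\<lambda>t. g (x + t *\<^sub>R h)) has_real_derivative d (x + s *\<^sub>R h) h) (at s)"
    "((\<lambda>t. d (x + t *\<^sub>R h) h) has_real_derivative q (x + s *\<^sub>R h) h) (at s)"
    "continuous_on UNIV g" "continuous_on UNIV (\<lambda>x. d x h)" "continuous_on UNIV (\<lambda>x. q x h)"
    "0 \<le> C"
proof -
  have d: "\<bar>g x\<bar> \<le> C" "\<bar>d x h\<bar> \<le> C * norm h" "\<bar>q x h\<bar> \<le> C * (norm h)\<^sup>2"
    "((\<lambda>t. g (x + t *\<^sub>R h)) has_real_derivative d x h) (at 0)"
    "((\<lambda>t. d (x + t *\<^sub>R h) h) has_real_derivative q x h) (at 0)"
    "continuous_on UNIV g" "continuous_on UNIV (\<lambda>x. d x h)" "continuous_on UNIV (\<lambda>x. q x h)"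
    for x h
    using assms by (auto simp: line_C2_def)
  show "\<bar>g x\<bar> \<le> C" "\<bar>d x h\<bar> \<le> C * norm h" "\<bar>q x h\<bar> \<le> C * (norm h)\<^sup>2"
    "continuous_on UNIV g" "continuous_on UNIV (\<lambda>x. d x h)" "continuous_on UNIV (\<lambda>x. q x h)"
    using d by auto
  show "0 \<le> C" using d(1)[of 0] by linarith
  show "((\<lambda>t. g (x + t *\<^sub>R h)) has_real_derivative d (x + s *\<^sub>R h) h) (at s)"
    using d(4)[of "x + s *\<^sub>R h" h]
    by (simp add: DERIV_shift[of _ _ 0 s, simplified] algebra_simps)
  show "((\<lambda>t. d (x + t *\<^sub>R h) h) has_real_derivative q (x + s *\<^sub>R h) h) (at s)"
    using d(5)[of "x + s *\<^sub>R h" h]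
    by (simp add: DERIV_shift[of _ _ 0 s, simplified] algebra_simps)
qed

lemma line_C2_mono:
  assumes "line_C2 C g d q" "C \<le> C'"
  shows "line_C2 C' g d q"
proof -
  have "C * norm h \<le> C' * norm h" "C * (norm h)\<^sup>2 \<le> C' * (norm h)\<^sup>2" for h :: 'a
    using assms(2) by (auto intro!: mult_right_mono)
  then show ?thesis using assms unfolding line_C2_def by (meson order_trans)
qed

text \<open>Mean value theorem along the segment, then once more for the directional derivative
  between 0 and \<open>\<xi>\<close>; since \<open>\<xi>\<close> is below 1, the remainder keeps the
  constant \<open>C\<close>.\<close>

lemma line_C2_taylor:
  assumes "line_C2 C g d q"
  shows "\<bar>g (x + h) - g x\<bar> \<le> C * norm h"
    "\<bar>g (x + h) - g x - d x h\<bar> \<le> C * (norm h)\<^sup>2"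
proof -
  note D = line_C2D[OF assms]
  obtain \<xi> where \<xi>: "0 < \<xi>" "\<xi> < 1" "g (x + 1 *\<^sub>R h) - g (x + 0 *\<^sub>R h) = (1 - 0) * d (x + \<xi> *\<^sub>R h) h"
    using MVT2[of 0 1 "\<lambda>t. g (x + t *\<^sub>R h)" "\<lambda>t. d (x + t *\<^sub>R h) h"] D(4) by auto
  then show "\<bar>g (x + h) - g x\<bar> \<le> C * norm h" using D(2) by simp
  obtain \<eta> where \<eta>: "0 < \<eta>" "\<eta> < \<xi>" "d (x + \<xi> *\<^sub>R h) h - d (x + 0 *\<^sub>R h) h = (\<xi> - 0) * q (x + \<eta> *\<^sub>R h) h"
    using MVT2[of 0 \<xi> "\<lambda>t. d (x + t *\<^sub>R h) h" "\<lambda>t. q (x + t *\<^sub>R h) h"] D(5) \<xi> by auto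
  have "g (x + h) - g x - d x h = \<xi> * q (x + \<eta> *\<^sub>R h) h" using \<xi> \<eta> by simp
  moreover have "\<bar>\<xi> * q (x + \<eta> *\<^sub>R h) h\<bar> \<le> 1 * (C * (norm h)\<^sup>2)"
    unfolding abs_mult using \<xi> D(3) by (intro mult_mono) auto
  ultimately show "\<bar>g (x + h) - g x - d x h\<bar> \<le> C * (norm h)\<^sup>2" by simp
qed

lemma line_C2_add:
  assumes "line_C2 C g d q" "line_C2 C' g2 d2 q2"
  shows "line_C2 (C + C') (\<lambda>x. g x + g2 x) (\<lambda>x h. d x h + d2 x h) (\<lambda>x h. q x h + q2 x h)"
  using assms unfolding line_C2_def
  by (auto intro!: DERIV_add continuous_on_add order_trans[OF abs_triangle_ineq] add_mono simp: distrib_right)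

lemma line_C2_cmult:
  assumes "line_C2 C g d q"
  shows "line_C2 (\<bar>c\<bar> * C) (\<lambda>x. c * g x) (\<lambda>x h. c * d x h) (\<lambda>x h. c * q x h)"
  using assms unfolding line_C2_def
  by (auto intro!: DERIV_cmult continuous_on_mult_left mult_left_mono simp: abs_mult mult.assoc)

text \<open>Leibniz rule; the factor 4 counts the contributions 1 + 2 + 1 to the second
  derivative.\<close>

lemma line_C2_mult:
  assumes 1: "line_C2 C g d q" and 2: "line_C2 C' g2 d2 q2"
  shows "line_C2 (4 * C * C') (\<lambda>x. g x * g2 x) (\<lambda>x h. d x h * g2 x + g x * d2 x h)
     (\<lambda>x h. q x h * g2 x + 2 * d x h * d2 x h + g x * q2 x h)"
  unfolding line_C2_def
proof (intro conjI allI)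
  note D = line_C2D[OF 1] and D2 = line_C2D[OF 2]
  have nn: "0 \<le> C * C'" using D(9) D2(9) by simp
  fix x h :: 'a
  show "\<bar>g x * g2 x\<bar> \<le> 4 * C * C'"
  proof -
    have "\<bar>g x\<bar> * \<bar>g2 x\<bar> \<le> C * C'" by (intro mult_mono D(1) D2(1)) (use D(9) in auto)
    then show ?thesis using nn by (simp add: abs_mult)
  qed
  have a1: "\<bar>d x h\<bar> * \<bar>g2 x\<bar> \<le> (C * norm h) * C'" "\<bar>g x\<bar> * \<bar>d2 x h\<bar> \<le> C * (C' * norm h)"
    by (intro mult_mono D D2; use D(9) in auto)+
  have a2: "\<bar>q x h\<bar> * \<bar>g2 x\<bar> \<le> (C * (norm h)\<^sup>2) * C'"
      "\<bar>d x h\<bar> * \<bar>d2 x h\<bar> \<le> (C * norm h) * (C' * norm h)"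
      "\<bar>g x\<bar> * \<bar>q2 x h\<bar> \<le> C * (C' * (norm h)\<^sup>2)"
    by (intro mult_mono D D2; use D(9) in auto)+
  have "0 \<le> C * C' * norm h" using nn by simp
  then show "\<bar>d x h * g2 x + g x * d2 x h\<bar> \<le> 4 * C * C' * norm h"
    using a1 abs_triangle_ineq[of "d x h * g2 x" "g x * d2 x h"]
    by (simp add: abs_mult mult_ac)
  have "\<bar>q x h * g2 x + 2 * d x h * d2 x h + g x * q2 x h\<bar>
      \<le> \<bar>q x h\<bar> * \<bar>g2 x\<bar> + 2 * (\<bar>d x h\<bar> * \<bar>d2 x h\<bar>) + \<bar>g x\<bar> * \<bar>q2 x h\<bar>"
    by (intro order_trans[OF abs_triangle_ineq] add_mono) (simp_all add: abs_mult)
  then show "\<bar>q x h * g2 x + 2 * d x h * d2 x h + g x * q2 x h\<bar> \<le> 4 * C * C' * (norm h)\<^sup>2"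
    using a2 by (simp add: mult_ac power2_eq_square)
  show "((\<lambda>t. g (x + t *\<^sub>R h) * g2 (x + t *\<^sub>R h)) has_real_derivative d x h * g2 x + g x * d2 x h) (at 0)"
    by (auto intro!: derivative_eq_intros D(4)[of x h 0, simplified] D2(4)[of x h 0, simplified])
  show "((\<lambda>t. d (x + t *\<^sub>R h) h * g2 (x + t *\<^sub>R h) + g (x + t *\<^sub>R h) * d2 (x + t *\<^sub>R h) h)
      has_real_derivative q x h * g2 x + 2 * d x h * d2 x h + g x * q2 x h) (at 0)"
    by (auto intro!: derivative_eq_intros D(4,5)[of x h 0, simplified] D2(4,5)[of x h 0, simplified])
  show "continuous_on UNIV (\<lambda>x. g x * g2 x)"
    "continuous_on UNIV (\<lambda>x. d x h * g2 x + g x * d2 x h)"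
    "continuous_on UNIV (\<lambda>x. q x h * g2 x + 2 * d x h * d2 x h + g x * q2 x h)"
    by (intro continuous_intros D D2)+
qed

lemma line_C2_cos:
  "line_C2 (1 + norm k + (norm k)\<^sup>2) (\<lambda>x. cos (k \<bullet> x + c)) (\<lambda>x h. - sin (k \<bullet> x + c) * (k \<bullet> h))
     (\<lambda>x h. - cos (k \<bullet> x + c) * (k \<bullet> h)\<^sup>2)"
  unfolding line_C2_def
proof (intro conjI allI)
  fix x h :: 'a
  have kh: "\<bar>k \<bullet> h\<bar> \<le> norm k * norm h" by (rule Cauchy_Schwarz_ineq2)
  show "\<bar>cos (k \<bullet> x + c)\<bar> \<le> 1 + norm k + (norm k)\<^sup>2"
    using abs_cos_le_one[of "k \<bullet> x + c"] norm_ge_zero[of k] zero_le_power2[of "norm k"] by linarith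
  have "\<bar>sin (k \<bullet> x + c)\<bar> * \<bar>k \<bullet> h\<bar> \<le> 1 * (norm k * norm h)"
    by (intro mult_mono kh) auto
  also have "\<dots> \<le> (1 + norm k + (norm k)\<^sup>2) * norm h"
    unfolding mult_1 by (intro mult_right_mono) auto
  finally show "\<bar>- sin (k \<bullet> x + c) * (k \<bullet> h)\<bar> \<le> (1 + norm k + (norm k)\<^sup>2) * norm h"
    by (simp add: abs_mult)
  have "\<bar>k \<bullet> h\<bar>\<^sup>2 \<le> (norm k * norm h)\<^sup>2" by (intro power_mono kh) auto
  then have "\<bar>cos (k \<bullet> x + c)\<bar> * (k \<bullet> h)\<^sup>2 \<le> 1 * ((norm k)\<^sup>2 * (norm h)\<^sup>2)"
    by (intro mult_mono) (auto simp: power_mult_distrib)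
  also have "\<dots> \<le> (1 + norm k + (norm k)\<^sup>2) * (norm h)\<^sup>2"
    unfolding mult_1 by (intro mult_right_mono) auto
  finally show "\<bar>- cos (k \<bullet> x + c) * (k \<bullet> h)\<^sup>2\<bar> \<le> (1 + norm k + (norm k)\<^sup>2) * (norm h)\<^sup>2"
    by (simp add: abs_mult)
  show "((\<lambda>t. cos (k \<bullet> (x + t *\<^sub>R h) + c)) has_real_derivative - sin (k \<bullet> x + c) * (k \<bullet> h)) (at 0)"
    by (auto intro!: derivative_eq_intros simp: inner_add_right)
  show "((\<lambda>t. - sin (k \<bullet> (x + t *\<^sub>R h) + c) * (k \<bullet> h)) has_real_derivative - cos (k \<bullet> x + c) * (k \<bullet> h)\<^sup>2) (at 0)"
    by (auto intro!: derivative_eq_intros simp: inner_add_right power2_eq_square)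
qed (intro continuous_intros)+

text \<open>Chain rule for an inner map differentiable only along lines, such as replacing
  coordinates by sines. The second derivative has two summands, each at most \<open>C\<close> times
  the squared norm, hence 2 C.\<close>

lemma line_C2_compose:
  fixes S :: "'b::real_inner \<Rightarrow> 'a::real_inner"
  assumes g: "C2b C g g' g''"
    and S1: "\<And>x h. ((\<lambda>t. S (x + t *\<^sub>R h)) has_vector_derivative S1 x h) (at 0)"
    and S2: "\<And>x h. ((\<lambda>t. S1 (x + t *\<^sub>R h) h) has_vector_derivative S2 x h) (at 0)"
    and n1: "\<And>x h. norm (S1 x h) \<le> norm h" and n2: "\<And>x h. norm (S2 x h) \<le> (norm h)\<^sup>2"
    and S: "continuous_on UNIV S" and cS1: "\<And>h. continuous_on UNIV (\<lambda>x. S1 x h)"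
    and cS2: "\<And>h. continuous_on UNIV (\<lambda>x. S2 x h)"
  shows "line_C2 (2 * C) (\<lambda>x. g (S x)) (\<lambda>x h. g' (S x) \<bullet> S1 x h)
     (\<lambda>x h. g'' (S x) (S1 x h) \<bullet> S1 x h + g' (S x) \<bullet> S2 x h)"
  unfolding line_C2_def
proof (intro conjI allI)
  note D = C2bD[OF g]
  fix x h :: 'b
  show "\<bar>g (S x)\<bar> \<le> 2 * C" using D(1)[of "S x"] D(8) by linarith
  have "\<bar>g' (S x) \<bullet> S1 x h\<bar> \<le> norm (g' (S x)) * norm (S1 x h)" by (rule Cauchy_Schwarz_ineq2)
  also have "\<dots> \<le> C * norm h" by (intro mult_mono D n1) (use D in auto)
  also have "\<dots> \<le> 2 * C * norm h" using D(8) by simp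
  finally show "\<bar>g' (S x) \<bullet> S1 x h\<bar> \<le> 2 * C * norm h" .
  have "\<bar>g'' (S x) (S1 x h) \<bullet> S1 x h\<bar> \<le> norm (g'' (S x) (S1 x h)) * norm (S1 x h)"
    by (rule Cauchy_Schwarz_ineq2)
  also have "\<dots> \<le> (C * norm (S1 x h)) * norm (S1 x h)" by (intro mult_right_mono D) auto
  also have "\<dots> \<le> (C * norm h) * norm h" by (intro mult_mono n1) (use D(8) in auto)
  finally have a: "\<bar>g'' (S x) (S1 x h) \<bullet> S1 x h\<bar> \<le> C * (norm h)\<^sup>2" by (simp add: power2_eq_square)
  have "\<bar>g' (S x) \<bullet> S2 x h\<bar> \<le> norm (g' (S x)) * norm (S2 x h)" by (rule Cauchy_Schwarz_ineq2)
  also have "\<dots> \<le> C * (norm h)\<^sup>2" by (intro mult_mono D n2) (use D in auto)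
  finally show "\<bar>g'' (S x) (S1 x h) \<bullet> S1 x h + g' (S x) \<bullet> S2 x h\<bar> \<le> 2 * C * (norm h)\<^sup>2"
    using a by linarith
  have S1': "((\<lambda>t. S (x + t *\<^sub>R h)) has_derivative (\<lambda>t. t *\<^sub>R S1 x h)) (at 0)"
    using S1 by (simp add: has_vector_derivative_def)
  have S2': "((\<lambda>t. S1 (x + t *\<^sub>R h) h) has_derivative (\<lambda>t. t *\<^sub>R S2 x h)) (at 0)"
    using S2 by (simp add: has_vector_derivative_def)
  have 1: "((\<lambda>t. g (S (x + t *\<^sub>R h))) has_derivative (\<lambda>t. g' (S x) \<bullet> (t *\<^sub>R S1 x h))) (at 0)"
    by (rule has_derivative_compose[OF S1', of g "\<lambda>k. g' (S x) \<bullet> k"]) (simp add: D(4))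
  then show "((\<lambda>t. g (S (x + t *\<^sub>R h))) has_real_derivative g' (S x) \<bullet> S1 x h) (at 0)"
    unfolding has_field_derivative_def
    by (rule has_derivative_eq_rhs) (auto simp: mult.commute)
  have 2: "((\<lambda>t. g' (S (x + t *\<^sub>R h))) has_derivative (\<lambda>t. g'' (S x) (t *\<^sub>R S1 x h))) (at 0)"
    by (rule has_derivative_compose[OF S1', of g' "g'' (S x)"]) (simp add: D(5))
  have "((\<lambda>t. g' (S (x + t *\<^sub>R h)) \<bullet> S1 (x + t *\<^sub>R h) h) has_derivative
     (\<lambda>t. g' (S x) \<bullet> (t *\<^sub>R S2 x h) + g'' (S x) (t *\<^sub>R S1 x h) \<bullet> S1 x h)) (at 0)"
    using has_derivative_inner[OF 2 S2'] by simp
  then show "((\<lambda>t. g' (S (x + t *\<^sub>R h)) \<bullet> S1 (x + t *\<^sub>R h) h) has_real_derivative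
      g'' (S x) (S1 x h) \<bullet> S1 x h + g' (S x) \<bullet> S2 x h) (at 0)"
    unfolding has_field_derivative_def
    by (rule has_derivative_eq_rhs)
      (auto simp: algebra_simps linear_scale[OF bounded_linear.linear[OF D(9)]])
  have cg: "continuous_on UNIV (\<lambda>x. g (S x))" "continuous_on UNIV (\<lambda>x. g' (S x))"
    using continuous_on_compose2[OF D(10) S] continuous_on_compose2[OF D(11) S] by auto
  show "continuous_on UNIV (\<lambda>x. g (S x))" by (rule cg)
  show "continuous_on UNIV (\<lambda>x. g' (S x) \<bullet> S1 x h)" by (intro continuous_intros cg cS1)
  have "continuous_on UNIV (\<lambda>x. g'' (S x) (S1 x h))"
    unfolding continuous_on_sequentially
  proof (intro allI ballI impI, unfold o_def)
    fix w and x0 :: 'b assume w: "(\<forall>n. w n \<in> UNIV) \<and> w \<longlonglongrightarrow> x0"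
    have i: "(\<lambda>n. g'' (S (w n)) k) \<longlonglongrightarrow> g'' (S x0) k" for k
      using continuous_on_compose2[OF D(7)[of k] S] w
      by (auto simp: continuous_on_sequentially o_def)
    have ii: "(\<lambda>n. S1 (w n) h) \<longlonglongrightarrow> S1 x0 h"
      using cS1[of h] w by (auto simp: continuous_on_sequentially o_def)
    \<comment> \<open>The Hessian converges only in fixed directions. The moving direction is
      compared with its limit, and the uniform bound \<open>C\<close> controls the
      difference.\<close>
    have "(\<lambda>n. g'' (S (w n)) (S1 (w n) h - S1 x0 h)) \<longlonglongrightarrow> 0"
    proof (rule Lim_null_comparison)
      show "\<forall>\<^sub>F n in sequentially. norm (g'' (S (w n)) (S1 (w n) h - S1 x0 h)) \<le> C * norm (S1 (w n) h - S1 x0 h)"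
        by (simp add: D(3))
      show "(\<lambda>n. C * norm (S1 (w n) h - S1 x0 h)) \<longlonglongrightarrow> 0"
        using tendsto_mult_right_zero[OF tendsto_norm_zero[OF LIM_zero[OF ii]]] .
    qed
    from tendsto_add[OF this i[of "S1 x0 h"]]
    show "(\<lambda>n. g'' (S (w n)) (S1 (w n) h)) \<longlonglongrightarrow> g'' (S x0) (S1 x0 h)"
      by (simp add: linear_diff[OF bounded_linear.linear[OF D(9)]])
  qed
  then show "continuous_on UNIV (\<lambda>x. g'' (S x) (S1 x h) \<bullet> S1 x h + g' (S x) \<bullet> S2 x h)"
    by (intro continuous_intros cg cS1 cS2)
qed

lemma C2b_imp_line_C2:
  assumes "C2b C g g' g''"
  shows "line_C2 (2 * C) g (\<lambda>x h. g' x \<bullet> h) (\<lambda>x h. g'' x h \<bullet> h)"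
proof -
  have "((\<lambda>t. x + t *\<^sub>R h) has_vector_derivative h) (at 0)" for x h :: 'a
    unfolding has_vector_derivative_def by (auto intro!: derivative_eq_intros)
  then show ?thesis
    using line_C2_compose[OF assms, of "\<lambda>x. x" "\<lambda>x h. h" "\<lambda>x h. 0"]
    by (auto intro!: continuous_intros)
qed

text \<open>Gradient and Hessian are pulled back by the adjoint \<open>B'\<close>. Having
  \<open>K\<close> at least 1 lets the single constant K^2 C dominate C, K C and K^2 C.\<close>

lemma C2b_affine:
  fixes B :: "'b::real_inner \<Rightarrow> 'a::real_inner"
  assumes g: "C2b C g g' g''" and B: "bounded_linear B" "bounded_linear B'"
    and adj: "\<And>x y. B x \<bullet> y = x \<bullet> B' y" and n: "\<And>x. norm (B x) \<le> K * norm x" "\<And>y. norm (B' y) \<le> K * norm y" "K \<ge> 1"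
  shows "C2b (K\<^sup>2 * C) (\<lambda>x. g (w + B x)) (\<lambda>x. B' (g' (w + B x))) (\<lambda>x h. B' (g'' (w + B x) (B h)))"
  unfolding C2b_def
proof (intro conjI allI)
  note D = C2bD[OF g]
  have K: "1 \<le> K\<^sup>2" "K \<le> K\<^sup>2" using n(3) by (simp_all add: self_le_power)
  have CK: "C \<le> K\<^sup>2 * C" "K * C \<le> K\<^sup>2 * C"
    using mult_right_mono[OF K(1) D(8)] mult_right_mono[OF K(2) D(8)] by auto
  fix x h k :: 'b
  show "\<bar>g (w + B x)\<bar> \<le> K\<^sup>2 * C" using D(1)[of "w + B x"] CK by linarith
  have "norm (B' (g' (w + B x))) \<le> K * C"
    using n(2)[of "g' (w + B x)"] mult_left_mono[OF D(2)[of "w + B x"], of K] n(3) by linarith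
  then show "norm (B' (g' (w + B x))) \<le> K\<^sup>2 * C" using CK by linarith
  have "norm (B' (g'' (w + B x) (B h))) \<le> K * (C * (K * norm h))"
    by (intro order_trans[OF n(2)] mult_left_mono order_trans[OF D(3)] n(1)) (use n(3) D(8) in auto)
  then show "norm (B' (g'' (w + B x) (B h))) \<le> K\<^sup>2 * C * norm h"
    by (simp add: power2_eq_square mult_ac)
  have dB: "((\<lambda>x. w + B x) has_derivative B) (at x)"
    using bounded_linear_imp_has_derivative[OF B(1)] by (auto intro!: derivative_eq_intros)
  show "((\<lambda>x. g (w + B x)) has_derivative (\<lambda>h. B' (g' (w + B x)) \<bullet> h)) (at x)"
    using has_derivative_compose[OF dB D(4)] by (simp add: adj inner_commute)
  show "((\<lambda>x. B' (g' (w + B x))) has_derivative (\<lambda>h. B' (g'' (w + B x) (B h)))) (at x)"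
    by (rule has_derivative_compose[OF has_derivative_compose[OF dB D(5)] bounded_linear_imp_has_derivative[OF B(2)]])
  show "B' (g'' (w + B x) (B h)) \<bullet> k = B' (g'' (w + B x) (B k)) \<bullet> h"
    using D(6)[of "w + B x" "B h" "B k"] by (metis adj inner_commute)
  have "continuous_on UNIV (\<lambda>x. w + B x)"
    by (intro continuous_intros bounded_linear.continuous_on[OF B(1)])
  from continuous_on_compose2[OF D(7) this]
  show "continuous_on UNIV (\<lambda>x. B' (g'' (w + B x) (B h)))"
    by (intro bounded_linear.continuous_on[OF B(2)]) auto
qed

subsection \<open>Convergence of Bernstein polynomials with two derivatives\<close>

text \<open>A scaled difference of order \<open>j\<close> of samples at mesh 1/(n + j) is a value of
  the derivative of order \<open>j\<close>, here called \<open>\<phi>\<close>, at a mean value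
  point. Both that point and k/n lie between k/(n + j) and (k + j)/(n + j), so uniform continuity
  makes the coefficients asymptotically samples of \<open>\<phi>\<close>.\<close>

lemma bern_tendsto_mean_value:
  assumes p: "0 \<le> p" "p \<le> 1" and \<phi>: "continuous_on {0..1} \<phi>"
    and a: "\<And>n k. k \<le> n \<Longrightarrow> \<exists>\<zeta>. real k / real (n + j) \<le> \<zeta> \<and> \<zeta> \<le> real (k + j) / real (n + j) \<and> a n k = \<phi> \<zeta>"
  shows "(\<lambda>n. bern n (a n) p) \<longlonglongrightarrow> \<phi> p"
proof (rule bern_tendsto[OF p \<phi>])
  fix \<epsilon> :: real assume \<epsilon>: "\<epsilon> > 0"
  have "uniformly_continuous_on {0..1} \<phi>"
    by (rule compact_uniformly_continuous[OF \<phi>]) simp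
  then obtain \<delta> where \<delta>: "\<delta> > 0"
    and unif: "\<And>s t. s \<in> {0..1} \<Longrightarrow> t \<in> {0..1} \<Longrightarrow> \<bar>s - t\<bar> < \<delta> \<Longrightarrow> \<bar>\<phi> s - \<phi> t\<bar> < \<epsilon>"
    unfolding uniformly_continuous_on_def dist_real_def using \<epsilon> by metis
  obtain n0 :: nat where n0: "real j / \<delta> < real n0"
    using reals_Archimedean2 by blast
  show "\<forall>\<^sub>F n in sequentially. \<forall>k\<le>n. \<bar>a n k - \<phi> (real k / real n)\<bar> \<le> \<epsilon>"
    unfolding eventually_sequentially
  proof (intro exI allI impI)
    fix n k assume n: "Suc n0 \<le> n" and k: "k \<le> n"
    obtain \<zeta> where \<zeta>: "real k / real (n + j) \<le> \<zeta>" "\<zeta> \<le> real (k + j) / real (n + j)" "a n k = \<phi> \<zeta>"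
      using a[OF k] by blast
    have np: "0 < real n" "0 < real (n + j)" using n by auto
    have kj: "real k * real j \<le> real n * real j" using k by (intro mult_right_mono) auto
    have b: "real k / real (n + j) \<le> real k / real n" "real k / real n \<le> real (k + j) / real (n + j)"
      using np kj by (auto simp: divide_le_eq le_divide_eq field_simps)
    have w: "real (k + j) / real (n + j) - real k / real (n + j) = real j / real (n + j)"
      by (simp add: diff_divide_distrib[symmetric])
    have "real j < \<delta> * real n"
      using n0 n \<delta> by (smt (verit) divide_less_eq mult.commute of_nat_mono mult_less_cancel_left_pos Suc_leD)
    also have "\<dots> \<le> \<delta> * real (n + j)" using \<delta> by (intro mult_left_mono) auto
    finally have "real j / real (n + j) < \<delta>" using np by (simp add: divide_less_eq)
    then have "\<bar>\<zeta> - real k / real n\<bar> < \<delta>" using \<zeta>(1,2) b w by linarith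
    moreover have "0 \<le> real k / real (n + j)" "real (k + j) / real (n + j) \<le> 1"
      using k np by (auto simp: divide_le_eq)
    then have "\<zeta> \<in> {0..1}" "real k / real n \<in> {0..1}"
      unfolding atLeastAtMost_iff using \<zeta>(1,2) b by linarith+
    ultimately show "\<bar>a n k - \<phi> (real k / real n)\<bar> \<le> \<epsilon>"
      using unif \<zeta>(3) by fastforce
  qed
qed

lemma mean_value_first_difference:
  fixes \<phi> :: "real \<Rightarrow> real"
  assumes d: "\<And>u. (\<phi> has_real_derivative \<phi>' u) (at u)"
  shows "\<exists>\<zeta>. real k / real (n + 1) \<le> \<zeta> \<and> \<zeta> \<le> real (k + 1) / real (n + 1) \<and>
     real (n + 1) * (\<phi> (real (k + 1) / real (n + 1)) - \<phi> (real k / real (n + 1))) = \<phi>' \<zeta>"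
proof -
  have "real k / real (n + 1) < real (k + 1) / real (n + 1)" by (simp add: divide_strict_right_mono)
  from MVT2[OF this, of \<phi> \<phi>'] d obtain \<zeta> where
    \<zeta>: "real k / real (n + 1) < \<zeta>" "\<zeta> < real (k + 1) / real (n + 1)"
      "\<phi> (real (k + 1) / real (n + 1)) - \<phi> (real k / real (n + 1)) =
        (real (k + 1) / real (n + 1) - real k / real (n + 1)) * \<phi>' \<zeta>" by blast
  have "real (k + 1) / real (n + 1) - real k / real (n + 1) = 1 / real (n + 1)"
    by (simp add: diff_divide_distrib[symmetric])
  then show ?thesis using \<zeta> by (intro exI[of _ \<zeta>]) simp
qed

text \<open>The second difference is the first difference, over the step \<open>\<eta>\<close>, of
  the function sending \<open>u\<close> to \<open>\<phi> (u + \<eta>) - \<phi> u\<close>.\<close>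

lemma mean_value_second_difference:
  fixes \<phi> :: "real \<Rightarrow> real"
  assumes d: "\<And>u. (\<phi> has_real_derivative \<phi>' u) (at u)" and d2: "\<And>u. (\<phi>' has_real_derivative \<phi>'' u) (at u)"
  shows "\<exists>\<zeta>. real k / real (n + 2) \<le> \<zeta> \<and> \<zeta> \<le> real (k + 2) / real (n + 2) \<and>
     (real (n + 2))\<^sup>2 * (\<phi> (real (k + 2) / real (n + 2)) - 2 * \<phi> (real (k + 1) / real (n + 2))
       + \<phi> (real k / real (n + 2))) = \<phi>'' \<zeta>"
proof -
  define \<eta> where "\<eta> = 1 / real (n + 2)"
  define s where "s = real k / real (n + 2)"
  have \<eta>: "\<eta> > 0" and sh: "real (k + 1) / real (n + 2) = s + \<eta>" "real (k + 2) / real (n + 2) = s + \<eta> + \<eta>"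
    by (simp_all add: \<eta>_def s_def add_divide_distrib)
  have "((\<lambda>u. \<phi> (u + \<eta>) - \<phi> u) has_real_derivative \<phi>' (u + \<eta>) - \<phi>' u) (at u)" for u
    using d[of "u + \<eta>"] d[of u] by (auto intro!: DERIV_diff simp: DERIV_shift)
  then obtain \<xi> where \<xi>: "s < \<xi>" "\<xi> < s + \<eta>"
    "(\<phi> (s + \<eta> + \<eta>) - \<phi> (s + \<eta>)) - (\<phi> (s + \<eta>) - \<phi> s) = (s + \<eta> - s) * (\<phi>' (\<xi> + \<eta>) - \<phi>' \<xi>)"
    using MVT2[of s "s + \<eta>" "\<lambda>u. \<phi> (u + \<eta>) - \<phi> u" "\<lambda>u. \<phi>' (u + \<eta>) - \<phi>' u"] \<eta> by auto
  obtain \<zeta> where \<zeta>: "\<xi> < \<zeta>" "\<zeta> < \<xi> + \<eta>" "\<phi>' (\<xi> + \<eta>) - \<phi>' \<xi> = (\<xi> + \<eta> - \<xi>) * \<phi>'' \<zeta>"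
    using MVT2[of \<xi> "\<xi> + \<eta>" \<phi>' \<phi>''] \<eta> d2 by auto
  have "\<phi> (s + \<eta> + \<eta>) - 2 * \<phi> (s + \<eta>) + \<phi> s = \<eta> * (\<eta> * \<phi>'' \<zeta>)"
    using \<xi>(3) \<zeta>(3) by simp
  then have "(real (n + 2))\<^sup>2 * (\<phi> (s + \<eta> + \<eta>) - 2 * \<phi> (s + \<eta>) + \<phi> s) = \<phi>'' \<zeta>"
    by (simp add: \<eta>_def power2_eq_square)
  then show ?thesis unfolding sh s_def[symmetric] using \<xi> \<zeta> by (intro exI[of _ \<zeta>]) auto
qed

lemma bern_tendsto_derivatives:
  fixes \<phi> :: "real \<Rightarrow> real"
  assumes p: "0 \<le> p" "p \<le> 1"
    and d: "\<And>u. (\<phi> has_real_derivative \<phi>' u) (at u)" and c: "continuous_on UNIV \<phi>'"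
  shows "(\<lambda>n. bern n (\<lambda>k. \<phi> (real k / real n)) p) \<longlonglongrightarrow> \<phi> p"
    "(\<lambda>n. real (n + 1) * bern n (\<lambda>k. \<phi> (real (k + 1) / real (n + 1)) - \<phi> (real k / real (n + 1))) p) \<longlonglongrightarrow> \<phi>' p"
proof -
  have "continuous_on UNIV \<phi>" using d DERIV_continuous_on by (metis DERIV_isCont continuous_at_imp_continuous_on)
  then show "(\<lambda>n. bern n (\<lambda>k. \<phi> (real k / real n)) p) \<longlonglongrightarrow> \<phi> p"
    using continuous_on_subset by (intro bern_tendsto_mean_value[OF p, of _ 0]) auto
  have "(\<lambda>n. bern n (\<lambda>k. real (n + 1) * (\<phi> (real (k + 1) / real (n + 1)) - \<phi> (real k / real (n + 1)))) p) \<longlonglongrightarrow> \<phi>' p"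
    by (rule bern_tendsto_mean_value[OF p continuous_on_subset[OF c], of 1])
      (use mean_value_first_difference[OF d] in auto)
  then show "(\<lambda>n. real (n + 1) * bern n (\<lambda>k. \<phi> (real (k + 1) / real (n + 1)) - \<phi> (real k / real (n + 1))) p) \<longlonglongrightarrow> \<phi>' p"
    unfolding bern_cmult .
qed

lemma bern_tendsto_second_derivative:
  fixes \<phi> :: "real \<Rightarrow> real"
  assumes p: "0 \<le> p" "p \<le> 1"
    and d: "\<And>u. (\<phi> has_real_derivative \<phi>' u) (at u)" "\<And>u. (\<phi>' has_real_derivative \<phi>'' u) (at u)"
    and c: "continuous_on UNIV \<phi>''"
  shows "(\<lambda>n. real (n + 2) * real (n + 1) * bern n (\<lambda>k. \<phi> (real (k + 2) / real (n + 2))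
       - 2 * \<phi> (real (k + 1) / real (n + 2)) + \<phi> (real k / real (n + 2))) p) \<longlonglongrightarrow> \<phi>'' p"
    (is "(\<lambda>n. _ * _ * ?b n) \<longlonglongrightarrow> _")
proof -
  have "(\<lambda>n. bern n (\<lambda>k. (real (n + 2))\<^sup>2 * (\<phi> (real (k + 2) / real (n + 2))
       - 2 * \<phi> (real (k + 1) / real (n + 2)) + \<phi> (real k / real (n + 2)))) p) \<longlonglongrightarrow> \<phi>'' p"
    by (rule bern_tendsto_mean_value[OF p continuous_on_subset[OF c], of 2])
      (use mean_value_second_difference[OF d] in auto)
  then have 1: "(\<lambda>n. (real (n + 2))\<^sup>2 * ?b n) \<longlonglongrightarrow> \<phi>'' p"
    unfolding bern_cmult .
  \<comment> \<open>Differentiating a polynomial of degree n + 2 twice yields the factor (n + 2)(n +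
    1), the mean value theorem yields (n + 2)^2; their quotient tends to 1.\<close>
  have "(\<lambda>n. real (n + 1) / real (n + 2)) \<longlonglongrightarrow> 1" by real_asymp
  from tendsto_mult[OF this 1]
  have "(\<lambda>n. real (n + 1) / real (n + 2) * ((real (n + 2))\<^sup>2 * ?b n)) \<longlonglongrightarrow> \<phi>'' p" by simp
  moreover have "real (n + 1) / real (n + 2) * ((real (n + 2))\<^sup>2 * y) = real (n + 2) * real (n + 1) * y" for n y
    by (simp add: power2_eq_square)
  ultimately show ?thesis by simp
qed

subsection \<open>Trigonometric polynomials are dense in \<open>C2b\<close> for bounded pointwise convergence\<close>

text \<open>Exchanges a constant that is only known to exist for explicit bounds, so that a sequence
  of approximants gets one common constant.\<close>

lemma line_C2_bounds:
  assumes "line_C2 C0 g d q" "\<And>x. \<bar>g x\<bar> \<le> C" "\<And>x h. \<bar>d x h\<bar> \<le> C * norm h"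
    "\<And>x h. \<bar>q x h\<bar> \<le> C * (norm h)\<^sup>2"
  shows "line_C2 C g d q"
  using assms unfolding line_C2_def by blast

text \<open>\<open>P g d q\<close> is a property of a function together with its first and second
  derivatives along lines, linear in the triple and stable under bounded pointwise limits. It is
  instantiated by equality of two expectations and by Dynkin's formula; the \<open>line_C2\<close>
  premises carry the bounds that make the integrals there converge.\<close>

locale bp_class =
  fixes P :: "('a::{real_inner, banach, second_countable_topology} \<Rightarrow> real) \<Rightarrow> ('a \<Rightarrow> 'a \<Rightarrow> real)
     \<Rightarrow> ('a \<Rightarrow> 'a \<Rightarrow> real) \<Rightarrow> bool"
  assumes P_cos: "P (\<lambda>x. cos (k \<bullet> x + c)) (\<lambda>x h. - sin (k \<bullet> x + c) * (k \<bullet> h))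
     (\<lambda>x h. - cos (k \<bullet> x + c) * (k \<bullet> h)\<^sup>2)"
    and P_add: "line_C2 C g d q \<Longrightarrow> P g d q \<Longrightarrow> line_C2 C' g2 d2 q2 \<Longrightarrow> P g2 d2 q2 \<Longrightarrow>
     P (\<lambda>x. g x + g2 x) (\<lambda>x h. d x h + d2 x h) (\<lambda>x h. q x h + q2 x h)"
    and P_cmult: "line_C2 C g d q \<Longrightarrow> P g d q \<Longrightarrow> P (\<lambda>x. b * g x) (\<lambda>x h. b * d x h) (\<lambda>x h. b * q x h)"
    and P_lim: "(\<And>n. line_C2 C (gs n) (ds n) (qs n)) \<Longrightarrow> (\<And>n. P (gs n) (ds n) (qs n)) \<Longrightarrow>
     line_C2 C g d q \<Longrightarrow> (\<And>x. (\<lambda>n. gs n x) \<longlonglongrightarrow> g x) \<Longrightarrow> (\<And>x h. (\<lambda>n. ds n x h) \<longlonglongrightarrow> d x h) \<Longrightarrow>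
     (\<And>x h. (\<lambda>n. qs n x h) \<longlonglongrightarrow> q x h) \<Longrightarrow> P g d q"
begin

text \<open>
  Membership in \<open>V\<close> survives multiplication by sines and cosines, hence by trigonometric polynomials,
  whereas \<open>P\<close> itself is not assumed to be closed under products.
\<close>

definition V :: "('a \<Rightarrow> real) \<Rightarrow> ('a \<Rightarrow> 'a \<Rightarrow> real) \<Rightarrow> ('a \<Rightarrow> 'a \<Rightarrow> real) \<Rightarrow> bool" where
  "V g d q \<longleftrightarrow> (\<exists>C. line_C2 C g d q) \<and> (\<forall>k c. P (\<lambda>x. g x * cos (k \<bullet> x + c))
     (\<lambda>x h. d x h * cos (k \<bullet> x + c) + g x * (- sin (k \<bullet> x + c) * (k \<bullet> h)))
     (\<lambda>x h. q x h * cos (k \<bullet> x + c) + 2 * d x h * (- sin (k \<bullet> x + c) * (k \<bullet> h))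
        + g x * (- cos (k \<bullet> x + c) * (k \<bullet> h)\<^sup>2)))"

lemma V_const: "V (\<lambda>x. b) (\<lambda>x h. 0) (\<lambda>x h. 0)"
  unfolding V_def
proof (intro conjI allI)
  show "\<exists>C. line_C2 C (\<lambda>x :: 'a. b) (\<lambda>x h. 0) (\<lambda>x h. 0)"
    by (rule exI[of _ "\<bar>b\<bar>"]) (auto simp: line_C2_def)
  fix k :: 'a and c
  show "P (\<lambda>x. b * cos (k \<bullet> x + c)) (\<lambda>x h. 0 * cos (k \<bullet> x + c) + b * (- sin (k \<bullet> x + c) * (k \<bullet> h)))
     (\<lambda>x h. 0 * cos (k \<bullet> x + c) + 2 * 0 * (- sin (k \<bullet> x + c) * (k \<bullet> h)) + b * (- cos (k \<bullet> x + c) * (k \<bullet> h)\<^sup>2))"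
    using P_cmult[OF line_C2_cos P_cos, of b k c] by simp
qed

lemma V_add:
  assumes "V g d q" "V g2 d2 q2"
  shows "V (\<lambda>x. g x + g2 x) (\<lambda>x h. d x h + d2 x h) (\<lambda>x h. q x h + q2 x h)"
proof -
  obtain C C' where C: "line_C2 C g d q" "line_C2 C' g2 d2 q2" using assms by (auto simp: V_def)
  show ?thesis
    unfolding V_def
  proof (intro conjI allI)
    show "\<exists>C. line_C2 C (\<lambda>x. g x + g2 x) (\<lambda>x h. d x h + d2 x h) (\<lambda>x h. q x h + q2 x h)"
      using line_C2_add[OF C] by blast
    fix k c
    show "P (\<lambda>x. (g x + g2 x) * cos (k \<bullet> x + c))
     (\<lambda>x h. (d x h + d2 x h) * cos (k \<bullet> x + c) + (g x + g2 x) * (- sin (k \<bullet> x + c) * (k \<bullet> h)))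
     (\<lambda>x h. (q x h + q2 x h) * cos (k \<bullet> x + c) + 2 * (d x h + d2 x h) * (- sin (k \<bullet> x + c) * (k \<bullet> h))
        + (g x + g2 x) * (- cos (k \<bullet> x + c) * (k \<bullet> h)\<^sup>2))"
      using P_add[OF line_C2_mult[OF C(1) line_C2_cos[of k c]] _ line_C2_mult[OF C(2) line_C2_cos[of k c]]]
        assms unfolding V_def by (simp add: algebra_simps)
  qed
qed

lemma V_cmult:
  assumes "V g d q"
  shows "V (\<lambda>x. b * g x) (\<lambda>x h. b * d x h) (\<lambda>x h. b * q x h)"
proof -
  obtain C where C: "line_C2 C g d q" using assms by (auto simp: V_def)
  show ?thesis
    unfolding V_def
  proof (intro conjI allI)
    show "\<exists>C. line_C2 C (\<lambda>x. b * g x) (\<lambda>x h. b * d x h) (\<lambda>x h. b * q x h)"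
      using line_C2_cmult[OF C] by blast
    fix k c
    show "P (\<lambda>x. b * g x * cos (k \<bullet> x + c))
     (\<lambda>x h. b * d x h * cos (k \<bullet> x + c) + b * g x * (- sin (k \<bullet> x + c) * (k \<bullet> h)))
     (\<lambda>x h. b * q x h * cos (k \<bullet> x + c) + 2 * (b * d x h) * (- sin (k \<bullet> x + c) * (k \<bullet> h))
        + b * g x * (- cos (k \<bullet> x + c) * (k \<bullet> h)\<^sup>2))"
      using P_cmult[OF line_C2_mult[OF C line_C2_cos[of k c]], of b] assms
      unfolding V_def by (simp add: algebra_simps)
  qed
qed

lemma V_lim:
  assumes "\<And>n. line_C2 C (gs n) (ds n) (qs n)" "\<And>n. V (gs n) (ds n) (qs n)" "line_C2 C g d q"
    "\<And>x. (\<lambda>n. gs n x) \<longlonglongrightarrow> g x" "\<And>x h. (\<lambda>n. ds n x h) \<longlonglongrightarrow> d x h" "\<And>x h. (\<lambda>n. qs n x h) \<longlonglongrightarrow> q x h"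
  shows "V g d q"
  unfolding V_def
proof (intro conjI allI)
  show "\<exists>C. line_C2 C g d q" using assms(3) by blast
  fix k c
  show "P (\<lambda>x. g x * cos (k \<bullet> x + c))
     (\<lambda>x h. d x h * cos (k \<bullet> x + c) + g x * (- sin (k \<bullet> x + c) * (k \<bullet> h)))
     (\<lambda>x h. q x h * cos (k \<bullet> x + c) + 2 * d x h * (- sin (k \<bullet> x + c) * (k \<bullet> h))
        + g x * (- cos (k \<bullet> x + c) * (k \<bullet> h)\<^sup>2))"
    by (rule P_lim[OF line_C2_mult[OF assms(1) line_C2_cos[of k c]] _ line_C2_mult[OF assms(3) line_C2_cos[of k c]]])
      (use assms(2) in \<open>auto simp: V_def intro!: tendsto_intros assms\<close>)
qed

text \<open>Product-to-sum formula: cos a sin b = (sin (a + b) - sin (a - b)) / 2, where each sine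
  is a cosine with phase lowered by pi / 2. Multiplication by a sine becomes a combination of the
  frequencies k + l and k - l, both covered by the quantification over \<open>k\<close> in
  \<open>V\<close>.\<close>

lemma V_mult_sin:
  assumes "V g d q"
  shows "V (\<lambda>x. g x * sin (l \<bullet> x)) (\<lambda>x h. d x h * sin (l \<bullet> x) + g x * (cos (l \<bullet> x) * (l \<bullet> h)))
    (\<lambda>x h. q x h * sin (l \<bullet> x) + 2 * d x h * (cos (l \<bullet> x) * (l \<bullet> h)) + g x * (- sin (l \<bullet> x) * (l \<bullet> h)\<^sup>2))"
proof -
  obtain C where C: "line_C2 C g d q" using assms by (auto simp: V_def)
  have sh: "cos (t - pi / 2) = sin t" "sin (t - pi / 2) = - cos t" for t :: real
    by (simp_all add: cos_diff sin_diff)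
  show ?thesis
    unfolding V_def
  proof (intro conjI allI)
    show "\<exists>C. line_C2 C (\<lambda>x. g x * sin (l \<bullet> x)) (\<lambda>x h. d x h * sin (l \<bullet> x) + g x * (cos (l \<bullet> x) * (l \<bullet> h)))
      (\<lambda>x h. q x h * sin (l \<bullet> x) + 2 * d x h * (cos (l \<bullet> x) * (l \<bullet> h)) + g x * (- sin (l \<bullet> x) * (l \<bullet> h)\<^sup>2))"
      using line_C2_mult[OF C line_C2_cos[of l "- pi / 2"]] sh by auto
    fix k c
    define c' where "c' = c - pi / 2"
    have e: "cos ((k + l) \<bullet> x + c') = sin (k \<bullet> x + c) * cos (l \<bullet> x) + cos (k \<bullet> x + c) * sin (l \<bullet> x)"
      "sin ((k + l) \<bullet> x + c') = sin (k \<bullet> x + c) * sin (l \<bullet> x) - cos (k \<bullet> x + c) * cos (l \<bullet> x)"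
      "cos ((k - l) \<bullet> x + c') = sin (k \<bullet> x + c) * cos (l \<bullet> x) - cos (k \<bullet> x + c) * sin (l \<bullet> x)"
      "sin ((k - l) \<bullet> x + c') = - (cos (k \<bullet> x + c) * cos (l \<bullet> x)) - sin (k \<bullet> x + c) * sin (l \<bullet> x)" for x
      using sh[of "k \<bullet> x + c + l \<bullet> x"] sh[of "k \<bullet> x + c - l \<bullet> x"]
        sin_add[of "k \<bullet> x + c" "l \<bullet> x"] cos_add[of "k \<bullet> x + c" "l \<bullet> x"]
        sin_diff[of "k \<bullet> x + c" "l \<bullet> x"] cos_diff[of "k \<bullet> x + c" "l \<bullet> x"]
      by (simp_all add: c'_def inner_add_left inner_diff_left algebra_simps)
    have PV: "P (\<lambda>x. g x * cos (k \<bullet> x + c))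
     (\<lambda>x h. d x h * cos (k \<bullet> x + c) + g x * (- sin (k \<bullet> x + c) * (k \<bullet> h)))
     (\<lambda>x h. q x h * cos (k \<bullet> x + c) + 2 * d x h * (- sin (k \<bullet> x + c) * (k \<bullet> h))
        + g x * (- cos (k \<bullet> x + c) * (k \<bullet> h)\<^sup>2))" for k c
      using assms by (simp add: V_def)
    note L = line_C2_mult[OF C line_C2_cos]
    note A = P_add[OF line_C2_cmult[OF L] P_cmult[OF L PV] line_C2_cmult[OF L] P_cmult[OF L PV],
        of "1 / 2" "k + l" c' "- 1 / 2" "k - l" c', unfolded e]
    show "P (\<lambda>x. g x * sin (l \<bullet> x) * cos (k \<bullet> x + c))
     (\<lambda>x h. (d x h * sin (l \<bullet> x) + g x * (cos (l \<bullet> x) * (l \<bullet> h))) * cos (k \<bullet> x + c)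
        + g x * sin (l \<bullet> x) * (- sin (k \<bullet> x + c) * (k \<bullet> h)))
     (\<lambda>x h. (q x h * sin (l \<bullet> x) + 2 * d x h * (cos (l \<bullet> x) * (l \<bullet> h)) + g x * (- sin (l \<bullet> x) * (l \<bullet> h)\<^sup>2)) * cos (k \<bullet> x + c)
        + 2 * (d x h * sin (l \<bullet> x) + g x * (cos (l \<bullet> x) * (l \<bullet> h))) * (- sin (k \<bullet> x + c) * (k \<bullet> h))
        + g x * sin (l \<bullet> x) * (- cos (k \<bullet> x + c) * (k \<bullet> h)\<^sup>2))"
      by (rule iffD1[OF arg_cong3[where f=P] A]; (rule ext)+)
        (simp_all add: inner_add_left inner_diff_left power2_eq_square field_simps)
  qed
qed

end

text \<open>
  \<open>curv R F x\<close> replaces the coordinates \<open>x \<bullet> e\<close>, \<open>e \<in> F\<close>, by \<open>R sin (x \<bullet> e / R)\<close> and drops the others. A function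
  of \<open>curv R F x\<close> is a function of finitely many variables in \<open>[-1, 1]\<close>, each a sine, so replacing it by
  Bernstein polynomials in one variable after the other yields trigonometric polynomials.
\<close>

definition curv :: "real \<Rightarrow> 'a::real_inner set \<Rightarrow> 'a \<Rightarrow> 'a" where
  "curv R F x = (\<Sum>e\<in>F. (R * sin (e \<bullet> x / R)) *\<^sub>R e)"

definition curv1 :: "real \<Rightarrow> 'a::real_inner set \<Rightarrow> 'a \<Rightarrow> 'a \<Rightarrow> 'a" where
  "curv1 R F x h = (\<Sum>e\<in>F. (cos (e \<bullet> x / R) * (e \<bullet> h)) *\<^sub>R e)"

definition curv2 :: "real \<Rightarrow> 'a::real_inner set \<Rightarrow> 'a \<Rightarrow> 'a \<Rightarrow> 'a" where
  "curv2 R F x h = (\<Sum>e\<in>F. (- sin (e \<bullet> x / R) * (e \<bullet> h)\<^sup>2 / R) *\<^sub>R e)"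

text \<open>Orthonormality and Bessel's inequality make the bounds independent of the number of
  coordinates in \<open>F\<close>: \<open>curv1\<close> contracts, and \<open>curv2\<close> is
  quadratic in \<open>h\<close> with an extra factor 1/R.\<close>

lemma curv_props:
  fixes F :: "'a::real_inner set"
  assumes F: "finite F" "F \<subseteq> hilbert_basis" and R: "R \<ge> 1"
  shows "((\<lambda>t. curv R F (x + t *\<^sub>R h)) has_vector_derivative curv1 R F x h) (at 0)"
    and "((\<lambda>t. curv1 R F (x + t *\<^sub>R h) h) has_vector_derivative curv2 R F x h) (at 0)"
    and "norm (curv1 R F x h) \<le> norm h"
    and "norm (curv2 R F x h) \<le> (norm h)\<^sup>2 / R"
    and "norm (curv2 R F x h) \<le> (norm h)\<^sup>2"
    and "continuous_on UNIV (curv R F)" and "continuous_on UNIV (\<lambda>x. curv1 R F x h)"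
    and "continuous_on UNIV (\<lambda>x. curv2 R F x h)"
proof -
  show "((\<lambda>t. curv R F (x + t *\<^sub>R h)) has_vector_derivative curv1 R F x h) (at 0)"
    unfolding curv_def curv1_def
  proof (rule has_vector_derivative_sum)
    fix e :: 'a
    have "((\<lambda>t. R * sin (e \<bullet> (x + t *\<^sub>R h) / R)) has_real_derivative cos (e \<bullet> x / R) * (e \<bullet> h)) (at 0)"
      using R by (auto intro!: derivative_eq_intros simp: inner_add_right)
    from has_vector_derivative_scaleR[OF this has_vector_derivative_const[of e]]
    show "((\<lambda>t. (R * sin (e \<bullet> (x + t *\<^sub>R h) / R)) *\<^sub>R e) has_vector_derivative
        (cos (e \<bullet> x / R) * (e \<bullet> h)) *\<^sub>R e) (at 0)" by simp
  qed
  show "((\<lambda>t. curv1 R F (x + t *\<^sub>R h) h) has_vector_derivative curv2 R F x h) (at 0)"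
    unfolding curv2_def curv1_def
  proof (rule has_vector_derivative_sum)
    fix e :: 'a
    have "((\<lambda>t. cos (e \<bullet> (x + t *\<^sub>R h) / R) * (e \<bullet> h)) has_real_derivative
        - sin (e \<bullet> x / R) * (e \<bullet> h)\<^sup>2 / R) (at 0)"
      using R by (auto intro!: derivative_eq_intros simp: inner_add_right power2_eq_square)
    from has_vector_derivative_scaleR[OF this has_vector_derivative_const[of e]]
    show "((\<lambda>t. (cos (e \<bullet> (x + t *\<^sub>R h) / R) * (e \<bullet> h)) *\<^sub>R e) has_vector_derivative
        (- sin (e \<bullet> x / R) * (e \<bullet> h)\<^sup>2 / R) *\<^sub>R e) (at 0)" by simp
  qed
  have "(norm (curv1 R F x h))\<^sup>2 = (\<Sum>e\<in>F. (cos (e \<bullet> x / R) * (e \<bullet> h))\<^sup>2)"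
    unfolding curv1_def by (rule norm_sum_hilbert_basis[OF F])
  also have "\<dots> \<le> (\<Sum>e\<in>F. (h \<bullet> e)\<^sup>2)"
  proof (rule sum_mono)
    fix e :: 'a
    have "(cos (e \<bullet> x / R))\<^sup>2 * (e \<bullet> h)\<^sup>2 \<le> 1 * (e \<bullet> h)\<^sup>2"
      by (intro mult_right_mono) (auto simp: abs_square_le_1)
    then show "(cos (e \<bullet> x / R) * (e \<bullet> h))\<^sup>2 \<le> (h \<bullet> e)\<^sup>2"
      by (simp add: power_mult_distrib inner_commute)
  qed
  also have "\<dots> \<le> (norm h)\<^sup>2" by (rule bessel[OF F])
  finally show "norm (curv1 R F x h) \<le> norm h" by (rule power2_le_imp_le) simp
  have "norm (curv2 R F x h) \<le> (\<Sum>e\<in>F. (h \<bullet> e)\<^sup>2 / R)"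
    unfolding curv2_def
  proof (rule sum_norm_le)
    fix e assume "e \<in> F"
    then have e: "norm e = 1" using F hilbert_basis_norm by blast
    have "\<bar>sin (e \<bullet> x / R)\<bar> * ((e \<bullet> h)\<^sup>2 / R) \<le> 1 * ((e \<bullet> h)\<^sup>2 / R)"
      using R by (intro mult_right_mono) auto
    then show "norm ((- sin (e \<bullet> x / R) * (e \<bullet> h)\<^sup>2 / R) *\<^sub>R e) \<le> (h \<bullet> e)\<^sup>2 / R"
      using R e by (simp add: abs_mult inner_commute)
  qed
  also have "\<dots> \<le> (norm h)\<^sup>2 / R"
    unfolding sum_divide_distrib[symmetric] using bessel[OF F] R by (intro divide_right_mono) auto
  finally show 2: "norm (curv2 R F x h) \<le> (norm h)\<^sup>2 / R" .
  also have "\<dots> \<le> (norm h)\<^sup>2 / 1" using R by (intro divide_left_mono) auto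
  finally show "norm (curv2 R F x h) \<le> (norm h)\<^sup>2" by simp
  show "continuous_on UNIV (curv R F)" "continuous_on UNIV (\<lambda>x. curv1 R F x h)"
    "continuous_on UNIV (\<lambda>x. curv2 R F x h)"
    unfolding curv_def curv1_def curv2_def using R by (auto intro!: continuous_intros)
qed

section \<open>Convergence of the sine coordinates to the identity\<close>

lemma abs_sin_minus_le: "\<bar>sin v - v\<bar> \<le> v\<^sup>2" and abs_cos_minus_le: "\<bar>cos v - 1\<bar> \<le> \<bar>v\<bar>" for v :: real
proof -
  have c: "\<bar>cos s - 1\<bar> \<le> \<bar>s\<bar>" for s :: real
  proof -
    have "\<bar>sin (s / 2)\<bar> * \<bar>sin (s / 2)\<bar> \<le> (\<bar>s\<bar> / 2) * 1"
      using abs_sin_x_le_abs_x[of "s / 2"] by (intro mult_mono) auto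
    then show ?thesis using cos_double_sin[of "s / 2"] by (simp add: power2_eq_square abs_mult)
  qed
  show "\<bar>cos v - 1\<bar> \<le> \<bar>v\<bar>" by (rule c)
  obtain \<xi> where \<xi>: "\<bar>\<xi>\<bar> \<le> \<bar>v\<bar>" "sin v - v = v * (cos \<xi> - 1)"
  proof (cases "v = 0")
    case False
    have d: "((\<lambda>s. sin s - s) has_real_derivative cos s - 1) (at s)" for s :: real
      by (auto intro!: derivative_eq_intros)
    consider "v > 0" | "v < 0" using False by linarith
    then show ?thesis
    proof cases
      case 1
      from MVT2[OF this, of "\<lambda>s. sin s - s" "\<lambda>s. cos s - 1"] d that show ?thesis by force
    next
      case 2
      from MVT2[OF this, of "\<lambda>s. sin s - s" "\<lambda>s. cos s - 1"] d obtain z where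
        "v < z" "z < 0" "sin 0 - 0 - (sin v - v) = (0 - v) * (cos z - 1)" by auto
      then show ?thesis by (intro that[of z]) auto
    qed
  qed (use that[of 0] in auto)
  have "\<bar>v\<bar> * \<bar>cos \<xi> - 1\<bar> \<le> \<bar>v\<bar> * \<bar>v\<bar>" using c[of \<xi>] \<xi>(1) by (intro mult_left_mono) auto
  then show "\<bar>sin v - v\<bar> \<le> v\<^sup>2" unfolding \<xi>(2) by (simp add: abs_mult power2_eq_square)
qed

lemma sqrt_bound_tendsto_zero:
  assumes "\<And>n. (norm (y n - z n))\<^sup>2 \<le> (K / real (Suc n))\<^sup>2" "z \<longlonglongrightarrow> l" "K \<ge> 0"
  shows "y \<longlonglongrightarrow> l"
proof -
  have e: "norm (y n - z n) \<le> K / real (Suc n)" for n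
    using assms(1)[of n] assms(3) by (intro power2_le_imp_le[of "norm (y n - z n)"]) auto
  have "(\<lambda>n. K / real (Suc n)) \<longlonglongrightarrow> 0" by real_asymp
  from Lim_null_comparison[OF always_eventually[OF allI[OF e]] this]
  have "(\<lambda>n. y n - z n) \<longlonglongrightarrow> 0" .
  from tendsto_add[OF this assms(2)] show ?thesis by simp
qed

text \<open>With v = x.e / R the error in coordinate \<open>e\<close> is R |sin v - v| \<le> R v^2
  \<le> (|x| / R) |x.e|. Bessel's inequality sums the squares uniformly in \<open>F n\<close>, so
  \<open>R\<close> may tend to infinity at any rate; n + 1 is chosen.\<close>

lemma curv_tendsto:
  fixes F :: "nat \<Rightarrow> 'a::{real_inner, banach} set"
  assumes F: "\<And>n. finite (F n)" "\<And>n. F n \<subseteq> hilbert_basis"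
    and lim: "\<And>x. (\<lambda>n. \<Sum>e\<in>F n. (x \<bullet> e) *\<^sub>R e) \<longlonglongrightarrow> x"
  shows "(\<lambda>n. curv (real (Suc n)) (F n) x) \<longlonglongrightarrow> x"
    and "(\<lambda>n. curv1 (real (Suc n)) (F n) x h) \<longlonglongrightarrow> h"
    and "(\<lambda>n. curv2 (real (Suc n)) (F n) x h) \<longlonglongrightarrow> 0"
proof -
  have xe: "\<bar>e \<bullet> x\<bar> \<le> norm x" if "e \<in> F n" for e n
    using Cauchy_Schwarz_ineq2[of e x] hilbert_basis_norm that F(2)[of n] by fastforce
  show "(\<lambda>n. curv (real (Suc n)) (F n) x) \<longlonglongrightarrow> x"
  proof (rule sqrt_bound_tendsto_zero[OF _ lim])
    fix n
    define R where "R = real (Suc n)"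
    have R: "R > 0" by (simp add: R_def)
    have "curv R (F n) x - (\<Sum>e\<in>F n. (x \<bullet> e) *\<^sub>R e) = (\<Sum>e\<in>F n. (R * sin (e \<bullet> x / R) - x \<bullet> e) *\<^sub>R e)"
      by (simp add: curv_def sum_subtractf scaleR_diff_left)
    then have "(norm (curv R (F n) x - (\<Sum>e\<in>F n. (x \<bullet> e) *\<^sub>R e)))\<^sup>2
        = (\<Sum>e\<in>F n. (R * sin (e \<bullet> x / R) - x \<bullet> e)\<^sup>2)"
      by (simp add: norm_sum_hilbert_basis[OF F])
    also have "\<dots> \<le> (\<Sum>e\<in>F n. (norm x / R)\<^sup>2 * (x \<bullet> e)\<^sup>2)"
    proof (rule sum_mono)
      fix e assume e: "e \<in> F n"
      define v where "v = e \<bullet> x / R"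
      have ev: "x \<bullet> e = R * v" using R by (simp add: v_def inner_commute)
      have v: "\<bar>v\<bar> \<le> norm x / R" using xe[OF e] R by (simp add: v_def divide_right_mono)
      have "\<bar>R * sin v - x \<bullet> e\<bar> = R * \<bar>sin v - v\<bar>"
        using R unfolding ev by (simp add: right_diff_distrib[symmetric] abs_mult)
      also have "\<dots> \<le> R * (\<bar>v\<bar> * \<bar>v\<bar>)"
        using abs_sin_minus_le[of v] R by (intro mult_left_mono) (auto simp: power2_eq_square)
      also have "\<dots> \<le> R * ((norm x / R) * \<bar>v\<bar>)"
        using v R by (intro mult_left_mono mult_right_mono) auto
      also have "\<dots> = \<bar>(norm x / R) * (x \<bullet> e)\<bar>" using R by (simp add: ev abs_mult)
      finally show "(R * sin (e \<bullet> x / R) - x \<bullet> e)\<^sup>2 \<le> (norm x / R)\<^sup>2 * (x \<bullet> e)\<^sup>2"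
        unfolding power_mult_distrib[symmetric] v_def[symmetric] by (simp only: abs_le_square_iff)
    qed
    also have "\<dots> \<le> (norm x / R)\<^sup>2 * (norm x)\<^sup>2"
      unfolding sum_distrib_left[symmetric] by (intro mult_left_mono bessel F) auto
    finally show "(norm (curv (real (Suc n)) (F n) x - (\<Sum>e\<in>F n. (x \<bullet> e) *\<^sub>R e)))\<^sup>2
        \<le> (norm x * norm x / real (Suc n))\<^sup>2"
      by (simp add: R_def power_divide power_mult_distrib)
  qed simp
  show "(\<lambda>n. curv1 (real (Suc n)) (F n) x h) \<longlonglongrightarrow> h"
  proof (rule sqrt_bound_tendsto_zero[OF _ lim])
    fix n
    define R where "R = real (Suc n)"
    have R: "R > 0" by (simp add: R_def)
    have "curv1 R (F n) x h - (\<Sum>e\<in>F n. (h \<bullet> e) *\<^sub>R e) = (\<Sum>e\<in>F n. (cos (e \<bullet> x / R) * (e \<bullet> h) - h \<bullet> e) *\<^sub>R e)"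
      by (simp add: curv1_def sum_subtractf scaleR_diff_left)
    then have "(norm (curv1 R (F n) x h - (\<Sum>e\<in>F n. (h \<bullet> e) *\<^sub>R e)))\<^sup>2
        = (\<Sum>e\<in>F n. (cos (e \<bullet> x / R) * (e \<bullet> h) - h \<bullet> e)\<^sup>2)"
      by (simp add: norm_sum_hilbert_basis[OF F])
    also have "\<dots> \<le> (\<Sum>e\<in>F n. (norm x / R)\<^sup>2 * (h \<bullet> e)\<^sup>2)"
    proof (rule sum_mono)
      fix e assume e: "e \<in> F n"
      define v where "v = e \<bullet> x / R"
      have v: "\<bar>v\<bar> \<le> norm x / R" using xe[OF e] R by (simp add: v_def divide_right_mono)
      have "cos v * (e \<bullet> h) - h \<bullet> e = (cos v - 1) * (h \<bullet> e)"
        by (simp add: inner_commute algebra_simps)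
      moreover have "\<bar>cos v - 1\<bar> * \<bar>h \<bullet> e\<bar> \<le> (norm x / R) * \<bar>h \<bullet> e\<bar>"
        using abs_cos_minus_le[of v] v by (intro mult_right_mono) auto
      ultimately have "\<bar>cos v * (e \<bullet> h) - h \<bullet> e\<bar> \<le> \<bar>(norm x / R) * (h \<bullet> e)\<bar>"
        using R by (simp add: abs_mult)
      then show "(cos (e \<bullet> x / R) * (e \<bullet> h) - h \<bullet> e)\<^sup>2 \<le> (norm x / R)\<^sup>2 * (h \<bullet> e)\<^sup>2"
        unfolding power_mult_distrib[symmetric] v_def[symmetric] by (simp only: abs_le_square_iff)
    qed
    also have "\<dots> \<le> (norm x / R)\<^sup>2 * (norm h)\<^sup>2"
      unfolding sum_distrib_left[symmetric] by (intro mult_left_mono bessel F) auto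
    finally show "(norm (curv1 (real (Suc n)) (F n) x h - (\<Sum>e\<in>F n. (h \<bullet> e) *\<^sub>R e)))\<^sup>2
        \<le> (norm x * norm h / real (Suc n))\<^sup>2"
      by (simp add: R_def power_divide power_mult_distrib)
  qed simp
  show "(\<lambda>n. curv2 (real (Suc n)) (F n) x h) \<longlonglongrightarrow> 0"
  proof (rule Lim_null_comparison[where g = "\<lambda>n. (norm h)\<^sup>2 / real (Suc n)"])
    show "(\<lambda>n. (norm h)\<^sup>2 / real (Suc n)) \<longlonglongrightarrow> 0" by real_asymp
    show "\<forall>\<^sub>F n in sequentially. norm (curv2 (real (Suc n)) (F n) x h) \<le> (norm h)\<^sup>2 / real (Suc n)"
      by (intro always_eventually allI curv_props(4)[OF F]) simp
  qed
qed

text \<open>Sine moved from [-1, 1] to the parameter interval [0, 1] of Bernstein polynomials;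
  \<open>node1\<close> and \<open>node2\<close> are its first and second derivatives in direction
  \<open>h\<close>.\<close>

definition node :: "'a::real_inner \<Rightarrow> 'a \<Rightarrow> real" where "node l x = (1 + sin (l \<bullet> x)) / 2"

definition node1 :: "'a::real_inner \<Rightarrow> 'a \<Rightarrow> 'a \<Rightarrow> real" where "node1 l x h = cos (l \<bullet> x) * (l \<bullet> h) / 2"

definition node2 :: "'a::real_inner \<Rightarrow> 'a \<Rightarrow> 'a \<Rightarrow> real" where
  "node2 l x h = - sin (l \<bullet> x) * (l \<bullet> h)\<^sup>2 / 2"

context bp_class
begin

lemma V_mult_half_sin:
  assumes "V g d q"
  shows "V (\<lambda>x. node l x * g x) (\<lambda>x h. node l x * d x h + node1 l x h * g x)
    (\<lambda>x h. node l x * q x h + 2 * node1 l x h * d x h + node2 l x h * g x)"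
  by (rule iffD1[OF arg_cong3[where f=V]
        V_add[OF V_cmult[OF assms(1), of "1/2"] V_cmult[OF V_mult_sin[OF assms(1), of l], of "1/2"]]]; (rule ext)+)
    (simp_all add: node_def node1_def node2_def field_simps)

text \<open>Leibniz rule for a Bernstein polynomial in \<open>node l x\<close> whose coefficients
  depend on \<open>x\<close> too: its derivative in the node is n times the polynomial of degree n -
  1 of first differences, and the second one n (n - 1) times that of second differences. The
  truncated \<open>n - 1\<close> and \<open>n - 2\<close> occur with a factor that vanishes whenever
  they are cut off.\<close>

lemma V_bern:
  assumes "\<And>k. V (G k) (D k) (Q k)"
  shows "V (\<lambda>x. bern n (\<lambda>k. G k x) (node l x))
     (\<lambda>x h. bern n (\<lambda>k. D k x h) (node l x) + node1 l x h * (real n * bern (n - 1) (\<lambda>k. G (Suc k) x - G k x) (node l x)))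
     (\<lambda>x h. bern n (\<lambda>k. Q k x h) (node l x) + 2 * node1 l x h * (real n * bern (n - 1) (\<lambda>k. D (Suc k) x h - D k x h) (node l x))
        + node2 l x h * (real n * bern (n - 1) (\<lambda>k. G (Suc k) x - G k x) (node l x))
        + (node1 l x h)\<^sup>2 * (real n * real (n - 1) * bern (n - 2) (\<lambda>k. G (Suc (Suc k)) x - 2 * G (Suc k) x + G k x) (node l x)))"
  using assms(1)
proof (induction n arbitrary: G D Q)
  case 0
  then show ?case by simp
next
  case (Suc n)
  note A = Suc.IH[of G D Q, OF Suc.prems]
  note B = Suc.IH[of "\<lambda>k. G (Suc k)" "\<lambda>k. D (Suc k)" "\<lambda>k. Q (Suc k)", OF Suc.prems]
  note AB = V_add[OF B V_cmult[OF A, of "- 1"]]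
  \<comment> \<open>De Casteljau step in the form A + node (B - A), where \<open>B\<close> has the
    shifted coefficients; \<open>V\<close> admits multiplication by \<open>node l\<close>, a
    combination of 1 and a sine.\<close>
  note S = V_add[OF A V_mult_half_sin[OF AB, of l]]
  have 1: "bern n D p + p1 * (real n * bern (n - 1) DD p) + (p * (bern n D' p + p1 * (real n * bern (n - 1) DD' p)
        + - 1 * (bern n D p + p1 * (real n * bern (n - 1) DD p))) + p1 * (bern n G' p + - 1 * bern n G p))
      = ((1 - p) * bern n D p + p * bern n D' p) +
        p1 * (real n * ((1 - p) * bern (n - 1) DD p + p * bern (n - 1) DD' p) + (bern n G' p - bern n G p))"
    for D D' DD DD' G G' and p p1 :: real
    by (simp add: algebra_simps)
  have n1: "real n * ((1 - p) * bern (n - 1) f p + p * bern (n - 1) (\<lambda>k. f (Suc k)) p) = real n * bern n f p" for f p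
    by (cases n) auto
  have n2: "real n * real (n - 1) * ((1 - p) * bern (n - 2) f p + p * bern (n - 2) (\<lambda>k. f (Suc k)) p)
      = real n * real (n - 1) * bern (n - 1) f p" for f p
  proof (cases "n \<le> 1")
    case False
    then have "n = Suc (Suc (n - 2))" by simp
    then obtain m where "n = Suc (Suc m)" by blast
    then show ?thesis by simp
  qed auto
  have ds: "bern n (\<lambda>k. f (Suc k)) p - bern n f p = bern n (\<lambda>k. f (Suc k) - f k) p" for f p
    by (rule bern_diff[symmetric])
  have dd: "real n * (bern (n - 1) (\<lambda>k. G (Suc (Suc k)) x - G (Suc k) x) p - bern (n - 1) (\<lambda>k. G (Suc k) x - G k x) p)
      = real n * bern (n - 1) (\<lambda>k. G (Suc (Suc k)) x - 2 * G (Suc k) x + G k x) p" for x p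
    unfolding bern_diff[symmetric] by (simp add: algebra_simps)
  show ?case
  proof (rule iffD1[OF arg_cong3[where f=V] S]; (rule ext)+)
    fix x
    show "bern n (\<lambda>k. G k x) (node l x) + node l x * (bern n (\<lambda>k. G (Suc k) x) (node l x) + - 1 * bern n (\<lambda>k. G k x) (node l x))
        = bern (Suc n) (\<lambda>k. G k x) (node l x)"
      by (simp add: algebra_simps)
  next
    fix x h
    let ?b = "bern n (\<lambda>k. G k x) (node l x)" and ?b' = "bern n (\<lambda>k. G (Suc k) x) (node l x)"
    let ?B1 = "bern (n - 1) (\<lambda>k. G (Suc k) x - G k x) (node l x)"
    let ?B1' = "bern (n - 1) (\<lambda>k. G (Suc (Suc k)) x - G (Suc k) x) (node l x)"
    let ?D = "bern n (\<lambda>k. D k x h) (node l x)" and ?D' = "bern n (\<lambda>k. D (Suc k) x h) (node l x)"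
    let ?D1 = "bern (n - 1) (\<lambda>k. D (Suc k) x h - D k x h) (node l x)"
    let ?D1' = "bern (n - 1) (\<lambda>k. D (Suc (Suc k)) x h - D (Suc k) x h) (node l x)"
    let ?Q = "bern n (\<lambda>k. Q k x h) (node l x)" and ?Q' = "bern n (\<lambda>k. Q (Suc k) x h) (node l x)"
    let ?B2 = "bern (n - 2) (\<lambda>k. G (Suc (Suc k)) x - 2 * G (Suc k) x + G k x) (node l x)"
    let ?B2' = "bern (n - 2) (\<lambda>k. G (Suc (Suc (Suc k))) x - 2 * G (Suc (Suc k)) x + G (Suc k) x) (node l x)"
    have S1: "bern (Suc n) (\<lambda>k. D k x h) (node l x) = (1 - node l x) * ?D + node l x * ?D'"
      "bern (Suc n) (\<lambda>k. Q k x h) (node l x) = (1 - node l x) * ?Q + node l x * ?Q'" by simp_all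
    have E1: "real (Suc n) * bern (Suc n - 1) (\<lambda>k. G (Suc k) x - G k x) (node l x)
        = real n * ((1 - node l x) * ?B1 + node l x * ?B1') + (?b' - ?b)"
      using n1[of "node l x" "\<lambda>k. G (Suc k) x - G k x"] ds[of "\<lambda>k. G k x" "node l x"] by (simp add: algebra_simps)
    have E2: "real (Suc n) * bern (Suc n - 1) (\<lambda>k. D (Suc k) x h - D k x h) (node l x)
        = real n * ((1 - node l x) * ?D1 + node l x * ?D1') + (?D' - ?D)"
      using n1[of "node l x" "\<lambda>k. D (Suc k) x h - D k x h"] ds[of "\<lambda>k. D k x h" "node l x"] by (simp add: algebra_simps)
    have E3: "real (Suc n) * real (Suc n - 1) * bern (Suc n - 2) (\<lambda>k. G (Suc (Suc k)) x - 2 * G (Suc k) x + G k x) (node l x)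
        = real n * real (n - 1) * ((1 - node l x) * ?B2 + node l x * ?B2') + 2 * (real n * (?B1' - ?B1))"
    proof -
      let ?r = "bern (n - 1) (\<lambda>k. G (Suc (Suc k)) x - 2 * G (Suc k) x + G k x) (node l x)"
      have "real n * real (n - 1) * ((1 - node l x) * ?B2 + node l x * ?B2') + 2 * (real n * (?B1' - ?B1))
         = real n * real (n - 1) * ?r + 2 * (real n * ?r)"
        using n2[of "node l x" "\<lambda>k. G (Suc (Suc k)) x - 2 * G (Suc k) x + G k x"] dd[of x "node l x"] by linarith
      also have "\<dots> = real (Suc n) * real n * ?r" by (cases n) (auto simp: algebra_simps)
      finally show ?thesis by (simp add: numeral_2_eq_2)
    qed
    show "?D + node1 l x h * (real n * ?B1) + (node l x * (?D' + node1 l x h * (real n * ?B1') + - 1 * (?D + node1 l x h * (real n * ?B1)))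
          + node1 l x h * (?b' + - 1 * ?b))
        = bern (Suc n) (\<lambda>k. D k x h) (node l x) + node1 l x h * (real (Suc n) * bern (Suc n - 1) (\<lambda>k. G (Suc k) x - G k x) (node l x))"
      unfolding S1 E1 by (simp add: algebra_simps)
    show "?Q + 2 * node1 l x h * (real n * ?D1) + node2 l x h * (real n * ?B1) + (node1 l x h)\<^sup>2 * (real n * real (n - 1) * ?B2)
        + (node l x * (?Q' + 2 * node1 l x h * (real n * ?D1') + node2 l x h * (real n * ?B1') + (node1 l x h)\<^sup>2 * (real n * real (n - 1) * ?B2')
            + - 1 * (?Q + 2 * node1 l x h * (real n * ?D1) + node2 l x h * (real n * ?B1) + (node1 l x h)\<^sup>2 * (real n * real (n - 1) * ?B2)))
          + 2 * node1 l x h * (?D' + node1 l x h * (real n * ?B1') + - 1 * (?D + node1 l x h * (real n * ?B1)))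
          + node2 l x h * (?b' + - 1 * ?b))
        = bern (Suc n) (\<lambda>k. Q k x h) (node l x)
          + 2 * node1 l x h * (real (Suc n) * bern (Suc n - 1) (\<lambda>k. D (Suc k) x h - D k x h) (node l x))
          + node2 l x h * (real (Suc n) * bern (Suc n - 1) (\<lambda>k. G (Suc k) x - G k x) (node l x))
          + (node1 l x h)\<^sup>2 * (real (Suc n) * real (Suc n - 1) * bern (Suc n - 2) (\<lambda>k. G (Suc (Suc k)) x - 2 * G (Suc k) x + G k x) (node l x))"
      unfolding S1 E1 E2 E3 by (simp add: algebra_simps power2_eq_square)
  qed
qed

end

text \<open>The degree is written as n + 2 so that first and second differences have the degrees n +
  1 and n. The mean value representation that gives the limits also gives a bound uniform in n, for
  use as a common constant of the approximants.\<close>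

lemma bern_difference_limits:
  fixes \<phi> :: "real \<Rightarrow> real"
  assumes p: "0 \<le> p" "p \<le> 1"
    and d: "\<And>u. (\<phi> has_real_derivative \<phi>' u) (at u)" and c: "continuous_on UNIV \<phi>'"
    and b: "\<And>u. \<bar>\<phi>' u\<bar> \<le> M"
  shows "(\<lambda>n. bern (Suc (Suc n)) (\<lambda>k. \<phi> (real k / real (Suc (Suc n)))) p) \<longlonglongrightarrow> \<phi> p"
    and "(\<lambda>n. real (Suc (Suc n)) * bern (Suc n) (\<lambda>k. \<phi> (real (Suc k) / real (Suc (Suc n)))
          - \<phi> (real k / real (Suc (Suc n)))) p) \<longlonglongrightarrow> \<phi>' p"
    and "\<bar>real (Suc (Suc n)) * bern (Suc n) (\<lambda>k. \<phi> (real (Suc k) / real (Suc (Suc n)))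
          - \<phi> (real k / real (Suc (Suc n)))) p\<bar> \<le> M"
proof -
  note L = bern_tendsto_derivatives[OF p d c]
  show "(\<lambda>n. bern (Suc (Suc n)) (\<lambda>k. \<phi> (real k / real (Suc (Suc n)))) p) \<longlonglongrightarrow> \<phi> p"
    by (rule LIMSEQ_Suc[OF LIMSEQ_Suc[OF L(1)]])
  show "(\<lambda>n. real (Suc (Suc n)) * bern (Suc n) (\<lambda>k. \<phi> (real (Suc k) / real (Suc (Suc n)))
          - \<phi> (real k / real (Suc (Suc n)))) p) \<longlonglongrightarrow> \<phi>' p"
    using LIMSEQ_Suc[OF L(2)] by (simp only: Suc_eq_plus1[symmetric])
  show "\<bar>real (Suc (Suc n)) * bern (Suc n) (\<lambda>k. \<phi> (real (Suc k) / real (Suc (Suc n)))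
          - \<phi> (real k / real (Suc (Suc n)))) p\<bar> \<le> M"
    unfolding bern_cmult[symmetric]
  proof (rule bern_abs_le[OF p])
    fix k
    from mean_value_first_difference[OF d, of k "Suc n"] obtain z where
      "real (Suc n + 1) * (\<phi> (real (k + 1) / real (Suc n + 1)) - \<phi> (real k / real (Suc n + 1))) = \<phi>' z"
      by blast
    then show "\<bar>real (Suc (Suc n)) * (\<phi> (real (Suc k) / real (Suc (Suc n))) - \<phi> (real k / real (Suc (Suc n))))\<bar> \<le> M"
      using b[of z] by (simp only: Suc_eq_plus1[symmetric])
  qed
qed

lemma bern_second_difference_limits:
  fixes \<phi> :: "real \<Rightarrow> real"
  assumes p: "0 \<le> p" "p \<le> 1"
    and d: "\<And>u. (\<phi> has_real_derivative \<phi>' u) (at u)" "\<And>u. (\<phi>' has_real_derivative \<phi>'' u) (at u)"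
    and c: "continuous_on UNIV \<phi>''" and b: "\<And>u. \<bar>\<phi>'' u\<bar> \<le> M"
  shows "(\<lambda>n. real (Suc (Suc n)) * real (Suc n) * bern n (\<lambda>k. \<phi> (real (Suc (Suc k)) / real (Suc (Suc n)))
       - 2 * \<phi> (real (Suc k) / real (Suc (Suc n))) + \<phi> (real k / real (Suc (Suc n)))) p) \<longlonglongrightarrow> \<phi>'' p"
    and "\<bar>real (Suc (Suc n)) * real (Suc n) * bern n (\<lambda>k. \<phi> (real (Suc (Suc k)) / real (Suc (Suc n)))
       - 2 * \<phi> (real (Suc k) / real (Suc (Suc n))) + \<phi> (real k / real (Suc (Suc n)))) p\<bar> \<le> M"
proof -
  show "(\<lambda>n. real (Suc (Suc n)) * real (Suc n) * bern n (\<lambda>k. \<phi> (real (Suc (Suc k)) / real (Suc (Suc n)))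
       - 2 * \<phi> (real (Suc k) / real (Suc (Suc n))) + \<phi> (real k / real (Suc (Suc n)))) p) \<longlonglongrightarrow> \<phi>'' p"
    using bern_tendsto_second_derivative[OF p d c] by (simp only: add_2_eq_Suc' Suc_eq_plus1[symmetric])
  let ?b = "bern n (\<lambda>k. \<phi> (real (Suc (Suc k)) / real (Suc (Suc n)))
       - 2 * \<phi> (real (Suc k) / real (Suc (Suc n))) + \<phi> (real k / real (Suc (Suc n)))) p"
  \<comment> \<open>The factor (n + 2)(n + 1) is enlarged to (n + 2)^2, which is the one in the mean
    value formula.\<close>
  have "\<bar>real (Suc (Suc n)) * real (Suc n) * ?b\<bar> \<le> \<bar>(real (Suc (Suc n)))\<^sup>2 * ?b\<bar>"
    unfolding abs_mult power2_eq_square by (intro mult_right_mono mult_left_mono) auto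
  also have "\<dots> \<le> M"
    unfolding bern_cmult[symmetric]
  proof (rule bern_abs_le[OF p])
    fix k
    from mean_value_second_difference[OF d, of k n] obtain z where
      "(real (n + 2))\<^sup>2 * (\<phi> (real (k + 2) / real (n + 2)) - 2 * \<phi> (real (k + 1) / real (n + 2))
       + \<phi> (real k / real (n + 2))) = \<phi>'' z" by blast
    then show "\<bar>(real (Suc (Suc n)))\<^sup>2 * (\<phi> (real (Suc (Suc k)) / real (Suc (Suc n)))
       - 2 * \<phi> (real (Suc k) / real (Suc (Suc n))) + \<phi> (real k / real (Suc (Suc n))))\<bar> \<le> M"
      using b[of z] by (simp only: add_2_eq_Suc' Suc_eq_plus1[symmetric])
  qed
  finally show "\<bar>real (Suc (Suc n)) * real (Suc n) * ?b\<bar> \<le> M" .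
qed

lemma C2b_shift:
  assumes "C2b C g g' g''"
  shows "C2b C (\<lambda>x. g (w + x)) (\<lambda>x. g' (w + x)) (\<lambda>x h. g'' (w + x) h)"
  using C2b_affine[OF assms bounded_linear_ident bounded_linear_ident, of 1 w] by simp

text \<open>As \<open>u\<close> runs over [0, 1], the point runs over the segment from y - v to y +
  v; for v = R e this is the range of a coordinate R sin.\<close>

lemma C2b_segment:
  assumes g: "C2b C g g' g''"
  shows "((\<lambda>u. g ((2 * u - 1) *\<^sub>R v + y)) has_real_derivative 2 * (g' ((2 * u - 1) *\<^sub>R v + y) \<bullet> v)) (at u)"
    and "((\<lambda>u. g' ((2 * u - 1) *\<^sub>R v + y) \<bullet> z) has_real_derivative 2 * (g'' ((2 * u - 1) *\<^sub>R v + y) v \<bullet> z)) (at u)"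
    and "continuous_on UNIV (\<lambda>u. g' ((2 * u - 1) *\<^sub>R v + y) \<bullet> z)"
    and "continuous_on UNIV (\<lambda>u. g'' ((2 * u - 1) *\<^sub>R v + y) z' \<bullet> z)"
proof -
  note D = C2bD[OF g]
  have w: "((\<lambda>u. (2 * u - 1) *\<^sub>R v + y) has_derivative (\<lambda>t. (2 * t) *\<^sub>R v)) (at u)"
    by (auto intro!: derivative_eq_intros)
  show "((\<lambda>u. g ((2 * u - 1) *\<^sub>R v + y)) has_real_derivative 2 * (g' ((2 * u - 1) *\<^sub>R v + y) \<bullet> v)) (at u)"
    unfolding has_field_derivative_def
    by (rule has_derivative_eq_rhs[OF has_derivative_compose[OF w D(4)]]) auto
  show "((\<lambda>u. g' ((2 * u - 1) *\<^sub>R v + y) \<bullet> z) has_real_derivative 2 * (g'' ((2 * u - 1) *\<^sub>R v + y) v \<bullet> z)) (at u)"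
    unfolding has_field_derivative_def
    by (rule has_derivative_eq_rhs[OF has_derivative_inner_left[OF has_derivative_compose[OF w D(5)]]])
      (auto simp: linear_scale[OF bounded_linear.linear[OF D(9)]])
  have c: "continuous_on UNIV (\<lambda>u. (2 * u - 1) *\<^sub>R v + y)" by (intro continuous_intros)
  show "continuous_on UNIV (\<lambda>u. g' ((2 * u - 1) *\<^sub>R v + y) \<bullet> z)"
    by (intro continuous_on_inner continuous_on_const continuous_on_compose2[OF D(11) c]) auto
  show "continuous_on UNIV (\<lambda>u. g'' ((2 * u - 1) *\<^sub>R v + y) z' \<bullet> z)"
    by (intro continuous_on_inner continuous_on_const continuous_on_compose2[OF D(7) c]) auto
qed

lemma node_bounds: "0 \<le> node l x" "node l x \<le> 1"
  using sin_ge_minus_one[of "l \<bullet> x"] sin_le_one[of "l \<bullet> x"] unfolding node_def by (simp_all, linarith)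

context bp_class
begin

text \<open>Induction on the coordinates. As a function of the new one, \<open>g\<close> is sampled
  at the Bernstein nodes; each sample is a shift of \<open>g\<close> in the old coordinates, hence
  in \<open>V\<close> by the induction hypothesis, and a Bernstein polynomial in a sine stays in
  \<open>V\<close>. Letting the degree grow gives the claim, provided all bounds are uniform in the
  degree.\<close>

lemma V_curv:
  assumes "finite F" "F \<subseteq> hilbert_basis" "R \<ge> 1" "C2b C g g' g''"
  shows "V (\<lambda>x. g (curv R F x)) (\<lambda>x h. g' (curv R F x) \<bullet> curv1 R F x h)
     (\<lambda>x h. g'' (curv R F x) (curv1 R F x h) \<bullet> curv1 R F x h + g' (curv R F x) \<bullet> curv2 R F x h)"
  using assms
proof (induction F arbitrary: g g' g'' rule: finite_induct)
  case empty
  have "g'' 0 0 = 0" using C2bD(3)[OF empty(3), of 0 0] by simp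
  then show ?case using V_const[of "g 0"] by (simp add: curv_def curv1_def curv2_def)
next
  case (insert e F)
  note g = insert.prems(3) and R = insert.prems(2)
  note D = C2bD[OF g]
  have F: "finite F" "F \<subseteq> hilbert_basis" "finite (insert e F)" "insert e F \<subseteq> hilbert_basis" "norm e = 1"
    using insert hilbert_basis_norm by auto
  define l where "l = (1 / R) *\<^sub>R e"
  define v where "v = R *\<^sub>R e"
  have v: "norm v = R" using F(5) R by (simp add: v_def)
  \<comment> \<open>Position of the new coordinate at the node k / (n + 2), running from -R to R
    along \<open>e\<close>.\<close>
  define w where "w n k = (2 * (real k / real (Suc (Suc n))) - 1) *\<^sub>R v" for n k
  let ?y = "curv R F" and ?y1 = "curv1 R F" and ?y2 = "curv2 R F"
  define G where "G n k x = g (w n k + ?y x)" for n k x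
  define Dd where "Dd n k x h = g' (w n k + ?y x) \<bullet> ?y1 x h" for n k x h
  define Q where "Q n k x h = g'' (w n k + ?y x) (?y1 x h) \<bullet> ?y1 x h + g' (w n k + ?y x) \<bullet> ?y2 x h" for n k x h
  have VG: "V (G n k) (Dd n k) (Q n k)" for n k
    using insert.IH[OF F(2) R C2b_shift[OF g, of "w n k"]] unfolding G_def Dd_def Q_def .
  define gs where "gs n x = bern (Suc (Suc n)) (\<lambda>k. G n k x) (node l x)" for n x
  define dG where "dG n x = real (Suc (Suc n)) * bern (Suc n) (\<lambda>k. G n (Suc k) x - G n k x) (node l x)" for n x
  define dD where "dD n x h = real (Suc (Suc n)) * bern (Suc n) (\<lambda>k. Dd n (Suc k) x h - Dd n k x h) (node l x)" for n x h
  define ddG where "ddG n x = real (Suc (Suc n)) * real (Suc n) *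
      bern n (\<lambda>k. G n (Suc (Suc k)) x - 2 * G n (Suc k) x + G n k x) (node l x)" for n x
  define ds where "ds n x h = bern (Suc (Suc n)) (\<lambda>k. Dd n k x h) (node l x) + node1 l x h * dG n x" for n x h
  define qs where "qs n x h = bern (Suc (Suc n)) (\<lambda>k. Q n k x h) (node l x) + 2 * node1 l x h * dD n x h
      + node2 l x h * dG n x + (node1 l x h)\<^sup>2 * ddG n x" for n x h
  have s2: "Suc (Suc n) - 1 = Suc n" "Suc (Suc n) - 2 = n" for n by simp_all
  have VB: "V (gs n) (ds n) (qs n)" for n
    using V_bern[OF VG[of n], where n = "Suc (Suc n)" and l = l, unfolded s2]
    unfolding gs_def[abs_def] ds_def[abs_def] qs_def[abs_def] dG_def dD_def ddG_def by simp

  let ?z = "curv R (insert e F)" and ?z1 = "curv1 R (insert e F)" and ?z2 = "curv2 R (insert e F)"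
  define t where "t x u = (2 * u - 1) *\<^sub>R v + ?y x" for x u
  have wt: "w n k + ?y x = t x (real k / real (Suc (Suc n)))" for n k x
    by (simp only: w_def t_def)
  have lx: "l \<bullet> x = e \<bullet> x / R" for x by (simp add: l_def)
  have tz: "t x (node l x) = ?z x" for x
    using insert.hyps F(1) by (simp add: t_def node_def lx v_def curv_def field_simps)
  have z1: "?z1 x h = ?y1 x h + (2 * node1 l x h) *\<^sub>R v" for x h
    using insert.hyps F(1) R by (simp add: node1_def lx v_def curv1_def)
  have z2: "?z2 x h = ?y2 x h + (2 * node2 l x h) *\<^sub>R v" for x h
    using insert.hyps F(1) R by (simp add: node2_def lx v_def curv2_def power2_eq_square)
  note seg = C2b_segment[OF g, of v "?y x" for x, folded t_def]
  note y1 = curv_props(3)[OF F(1,2) R] and y2 = curv_props(5)[OF F(1,2) R]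
  have ip: "\<bar>g' x \<bullet> k\<bar> \<le> C * norm k" "\<bar>g'' x h \<bullet> k\<bar> \<le> C * norm h * norm k" for x h k
    using Cauchy_Schwarz_ineq2[of "g' x" k] mult_right_mono[OF D(2)[of x], of "norm k"]
      Cauchy_Schwarz_ineq2[of "g'' x h" k] mult_right_mono[OF D(3)[of x h], of "norm k"] by auto
  have b1: "\<bar>2 * (g' (t x u) \<bullet> v)\<bar> \<le> 2 * C * R" for x u
    using ip(1)[of "t x u" v] v by simp
  have b2: "\<bar>2 * (g'' (t x u) v \<bullet> ?y1 x h)\<bar> \<le> 2 * C * R * norm h" for x u h
  proof -
    have "C * norm v * norm (?y1 x h) \<le> C * R * norm h"
      unfolding v using y1[of x h] D(8) R by (intro mult_left_mono) auto
    then show ?thesis using ip(2)[of "t x u" v "?y1 x h"] by simp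
  qed
  have b3: "\<bar>2 * (2 * (g'' (t x u) v \<bullet> v))\<bar> \<le> 4 * C * R\<^sup>2" for x u
    using ip(2)[of "t x u" v v] v by (simp add: power2_eq_square)
  have cnt1: "continuous_on UNIV (\<lambda>u. 2 * (g' (t x u) \<bullet> v))" for x
    by (intro continuous_on_mult_left seg(3))
  have cnt2: "continuous_on UNIV (\<lambda>u. 2 * (g'' (t x u) h \<bullet> z))" for x h z
    by (intro continuous_on_mult_left seg(4))
  have der2: "((\<lambda>u. 2 * (g' (t x u) \<bullet> v)) has_real_derivative 2 * (2 * (g'' (t x u) v \<bullet> v))) (at u)" for x u
    by (intro DERIV_cmult seg(2))
  have lim1: "(\<lambda>n. gs n x) \<longlonglongrightarrow> g (?z x)" "(\<lambda>n. dG n x) \<longlonglongrightarrow> 2 * (g' (?z x) \<bullet> v)"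
    "\<bar>dG n x\<bar> \<le> 2 * C * R" for n x
    using bern_difference_limits[OF node_bounds[of l x] seg(1)[of x] cnt1[of x] b1[of x], folded wt tz]
    unfolding gs_def G_def dG_def tz by blast+
  have lim2: "(\<lambda>n. bern (Suc (Suc n)) (\<lambda>k. Dd n k x h) (node l x)) \<longlonglongrightarrow> g' (?z x) \<bullet> ?y1 x h"
    "(\<lambda>n. dD n x h) \<longlonglongrightarrow> 2 * (g'' (?z x) v \<bullet> ?y1 x h)" "\<bar>dD n x h\<bar> \<le> 2 * C * R * norm h" for n and x h :: 'a
    using bern_difference_limits[OF node_bounds[of l x] seg(2)[of x "?y1 x h"] cnt2[of x v "?y1 x h"] b2[of x _ h], folded wt tz]
    unfolding Dd_def dD_def tz by blast+
  have "continuous_on UNIV (\<lambda>u. 2 * (2 * (g'' (t x u) v \<bullet> v)))" for x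
    by (intro continuous_on_mult_left cnt2)
  from bern_second_difference_limits[OF node_bounds seg(1) der2 this b3, folded wt]
  have lim3': "(\<lambda>n. ddG n x) \<longlonglongrightarrow> 2 * (2 * (g'' (?z x) v \<bullet> v))" "\<bar>ddG n x\<bar> \<le> 4 * C * R\<^sup>2" for n x
    unfolding G_def ddG_def tz[symmetric] by blast+
  have limQ: "(\<lambda>n. bern (Suc (Suc n)) (\<lambda>k. Q n k x h) (node l x)) \<longlonglongrightarrow>
      g'' (?z x) (?y1 x h) \<bullet> ?y1 x h + g' (?z x) \<bullet> ?y2 x h" for x h
  proof -
    have "continuous_on UNIV (\<lambda>u. g'' (t x u) (?y1 x h) \<bullet> ?y1 x h + g' (t x u) \<bullet> ?y2 x h)"
      by (intro continuous_on_add seg(3,4))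
    then have "continuous_on {0..1} (\<lambda>u. g'' (t x u) (?y1 x h) \<bullet> ?y1 x h + g' (t x u) \<bullet> ?y2 x h)"
      by (rule continuous_on_subset) simp
    from bern_tendsto_mean_value[OF node_bounds this, of 0 "\<lambda>n k. g'' (t x (real k / real n)) (?y1 x h) \<bullet> ?y1 x h
        + g' (t x (real k / real n)) \<bullet> ?y2 x h" l x]
    have "(\<lambda>n. bern n (\<lambda>k. g'' (t x (real k / real n)) (?y1 x h) \<bullet> ?y1 x h
        + g' (t x (real k / real n)) \<bullet> ?y2 x h) (node l x)) \<longlonglongrightarrow>
       g'' (t x (node l x)) (?y1 x h) \<bullet> ?y1 x h + g' (t x (node l x)) \<bullet> ?y2 x h" by auto
    from LIMSEQ_Suc[OF LIMSEQ_Suc[OF this]] show ?thesis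
      unfolding Q_def wt tz .
  qed
  have p1: "\<bar>node1 l x h\<bar> \<le> norm h / (2 * R)" for x h
  proof -
    have "\<bar>cos (e \<bullet> x / R)\<bar> * (\<bar>e \<bullet> h\<bar> / R) \<le> 1 * (norm h / R)"
      using Cauchy_Schwarz_ineq2[of e h] F(5) R by (intro mult_mono divide_right_mono) auto
    then show ?thesis using R by (simp add: node1_def lx abs_mult field_simps)
  qed
  have p2: "\<bar>node2 l x h\<bar> \<le> (norm h)\<^sup>2 / (2 * R\<^sup>2)" for x h
  proof -
    have "\<bar>e \<bullet> h\<bar>\<^sup>2 \<le> (norm h)\<^sup>2"
      using Cauchy_Schwarz_ineq2[of e h] F(5) by (intro power_mono) auto
    then have "\<bar>sin (e \<bullet> x / R)\<bar> * ((e \<bullet> h)\<^sup>2 / R\<^sup>2) \<le> 1 * ((norm h)\<^sup>2 / R\<^sup>2)"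
      by (intro mult_mono divide_right_mono) auto
    then show ?thesis using R by (simp add: node2_def lx abs_mult power_divide field_simps)
  qed
  have p1': "(node1 l x h)\<^sup>2 \<le> (norm h)\<^sup>2 / (4 * R\<^sup>2)" for x h
    using power_mono[OF p1[of x h], of 2] by (simp add: power_divide power_mult_distrib)
  have pb: "\<bar>bern n f (node l x)\<bar> \<le> c" if "\<And>k. \<bar>f k\<bar> \<le> c" for n f x c
    using bern_abs_le[OF node_bounds] that by blast
  have R0: "R > 0" using R by simp
  \<comment> \<open>The second derivative has four groups, bounded by 2 C, 2 C, C and C times the
    squared norm; the powers of \<open>R\<close> gained through \<open>v\<close> are offset by those
    lost through \<open>l\<close>.\<close>
  have bnd: "line_C2 (6 * C) (gs n) (ds n) (qs n)" for n
  proof -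
    obtain C0 where C0: "line_C2 C0 (gs n) (ds n) (qs n)" using VB unfolding V_def by blast
    show ?thesis
    proof (rule line_C2_bounds[OF C0])
      fix x h :: 'a
      have "\<bar>gs n x\<bar> \<le> C" unfolding gs_def by (rule pb) (simp add: G_def D)
      then show "\<bar>gs n x\<bar> \<le> 6 * C" using D(8) by linarith
      have Ch: "0 \<le> C * norm h" using D(8) by simp
      have Dk: "\<bar>Dd n k x h\<bar> \<le> C * norm h" for k
        unfolding Dd_def using ip(1)[of "w n k + ?y x" "?y1 x h"] mult_left_mono[OF y1[of x h] D(8)] by linarith
      have "\<bar>node1 l x h * dG n x\<bar> \<le> norm h / (2 * R) * (2 * C * R)"
        unfolding abs_mult by (intro mult_mono p1 lim1) (use R in auto)
      then have a1: "\<bar>node1 l x h * dG n x\<bar> \<le> C * norm h" using R0 by (simp add: mult_ac)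
      have "\<bar>ds n x h\<bar> \<le> C * norm h + C * norm h"
        unfolding ds_def by (intro order_trans[OF abs_triangle_ineq] add_mono a1 pb Dk)
      then show "\<bar>ds n x h\<bar> \<le> 6 * C * norm h" using Ch by linarith
      have hh: "norm h * norm h = (norm h)\<^sup>2" by (simp add: power2_eq_square)
      have Qk: "\<bar>Q n k x h\<bar> \<le> 2 * C * (norm h)\<^sup>2" for k
      proof -
        have "C * norm (?y1 x h) * norm (?y1 x h) \<le> C * norm h * norm h"
          using y1[of x h] D(8) by (intro mult_mono) auto
        moreover have "C * norm (?y2 x h) \<le> C * (norm h)\<^sup>2" using y2[of x h] D(8) by (intro mult_left_mono) auto
        ultimately show ?thesis
          unfolding Q_def using ip(2)[of "w n k + ?y x" "?y1 x h" "?y1 x h"] ip(1)[of "w n k + ?y x" "?y2 x h"] hh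
          by (simp add: mult.assoc)
      qed
      have "\<bar>2 * node1 l x h * dD n x h\<bar> \<le> 2 * (norm h / (2 * R)) * (2 * C * R * norm h)"
        unfolding abs_mult by (intro mult_mono p1 lim2) (use R in auto)
      then have q1: "\<bar>2 * node1 l x h * dD n x h\<bar> \<le> 2 * C * (norm h)\<^sup>2"
        using R0 by (simp add: power2_eq_square mult_ac)
      have "\<bar>node2 l x h * dG n x\<bar> \<le> (norm h)\<^sup>2 / (2 * R\<^sup>2) * (2 * C * R)"
        unfolding abs_mult by (intro mult_mono p2 lim1) (use R in auto)
      also have "\<dots> = C * (norm h)\<^sup>2 / R" using R0 by (simp add: power2_eq_square field_simps)
      also have "\<dots> \<le> C * (norm h)\<^sup>2 / 1" using R D(8) by (intro divide_left_mono) auto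
      finally have q2: "\<bar>node2 l x h * dG n x\<bar> \<le> C * (norm h)\<^sup>2" by simp
      have "\<bar>(node1 l x h)\<^sup>2 * ddG n x\<bar> \<le> (norm h)\<^sup>2 / (4 * R\<^sup>2) * (4 * C * R\<^sup>2)"
        unfolding abs_mult abs_power2 by (intro mult_mono p1' lim3') (use R in auto)
      then have q3: "\<bar>(node1 l x h)\<^sup>2 * ddG n x\<bar> \<le> C * (norm h)\<^sup>2"
        using R0 by (simp add: mult_ac)
      have "\<bar>qs n x h\<bar> \<le> 2 * C * (norm h)\<^sup>2 + 2 * C * (norm h)\<^sup>2 + C * (norm h)\<^sup>2 + C * (norm h)\<^sup>2"
        unfolding qs_def by (intro order_trans[OF abs_triangle_ineq] add_mono q1 q2 q3 pb Qk)
      then show "\<bar>qs n x h\<bar> \<le> 6 * C * (norm h)\<^sup>2" by simp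
    qed
  qed
  have lin: "linear (g'' x)" for x by (rule bounded_linear.linear[OF D(9)])
  show ?case
  proof (rule V_lim[OF bnd VB])
    show "line_C2 (6 * C) (\<lambda>x. g (?z x)) (\<lambda>x h. g' (?z x) \<bullet> ?z1 x h)
        (\<lambda>x h. g'' (?z x) (?z1 x h) \<bullet> ?z1 x h + g' (?z x) \<bullet> ?z2 x h)"
      by (rule line_C2_mono[OF line_C2_compose[OF g]]) (use curv_props[OF F(3,4) R] D(8) in auto)
    fix x h :: 'a
    show "(\<lambda>n. gs n x) \<longlonglongrightarrow> g (?z x)"
      by (rule lim1)
    have "(\<lambda>n. ds n x h) \<longlonglongrightarrow> g' (?z x) \<bullet> ?y1 x h + node1 l x h * (2 * (g' (?z x) \<bullet> v))"
      unfolding ds_def by (intro tendsto_intros lim1 lim2)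
    then show "(\<lambda>n. ds n x h) \<longlonglongrightarrow> g' (?z x) \<bullet> ?z1 x h"
      by (simp add: z1 inner_add_right mult_ac)
    have "(\<lambda>n. qs n x h) \<longlonglongrightarrow> g'' (?z x) (?y1 x h) \<bullet> ?y1 x h + g' (?z x) \<bullet> ?y2 x h
        + 2 * node1 l x h * (2 * (g'' (?z x) v \<bullet> ?y1 x h)) + node2 l x h * (2 * (g' (?z x) \<bullet> v))
        + (node1 l x h)\<^sup>2 * (2 * (2 * (g'' (?z x) v \<bullet> v)))"
      unfolding qs_def by (intro tendsto_intros limQ lim1 lim2 lim3')
    \<comment> \<open>Symmetry merges the two mixed terms of the expanded quadratic form into the
      factor 2 of the Bernstein derivative.\<close>
    moreover have "g'' (?z x) (?y1 x h) \<bullet> v = g'' (?z x) v \<bullet> ?y1 x h" by (rule D(6))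
    ultimately show "(\<lambda>n. qs n x h) \<longlonglongrightarrow> g'' (?z x) (?z1 x h) \<bullet> ?z1 x h + g' (?z x) \<bullet> ?z2 x h"
      by (simp add: z1 z2 inner_add_right inner_add_left linear_add[OF lin] linear_scale[OF lin]
          power2_eq_square algebra_simps)
  qed
qed

text \<open>With growing \<open>R\<close> and \<open>F\<close> the maps \<open>curv\<close> tend to
  the identity together with their derivatives along lines, so \<open>g\<close> inherits membership
  in \<open>V\<close> from \<open>V_curv\<close>.\<close>

theorem C2b_in_class:
  assumes g: "C2b C g g' g''"
  shows "P g (\<lambda>x h. g' x \<bullet> h) (\<lambda>x h. g'' x h \<bullet> h)"
proof -
  note D = C2bD[OF g]
  obtain F :: "nat \<Rightarrow> 'a set" where F: "\<And>n. finite (F n)" "\<And>n. F n \<subseteq> hilbert_basis"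
    and lim: "\<And>x. (\<lambda>n. \<Sum>e\<in>F n. (x \<bullet> e) *\<^sub>R e) \<longlonglongrightarrow> x"
    by (rule hilbert_basis_approx) (rule that)
  define c where "c n = curv (real (Suc n)) (F n)" for n
  define c1 where "c1 n = curv1 (real (Suc n)) (F n)" for n
  define c2 where "c2 n = curv2 (real (Suc n)) (F n)" for n
  have R: "1 \<le> real (Suc n)" for n by simp
  note L = curv_tendsto[OF F lim, folded c_def c1_def c2_def]
  have "V g (\<lambda>x h. g' x \<bullet> h) (\<lambda>x h. g'' x h \<bullet> h)"
  proof (rule V_lim)
    show "V (\<lambda>x. g (c n x)) (\<lambda>x h. g' (c n x) \<bullet> c1 n x h)
       (\<lambda>x h. g'' (c n x) (c1 n x h) \<bullet> c1 n x h + g' (c n x) \<bullet> c2 n x h)" for n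
      unfolding c_def c1_def c2_def by (rule V_curv[OF F R g])
    show "line_C2 (2 * C) (\<lambda>x. g (c n x)) (\<lambda>x h. g' (c n x) \<bullet> c1 n x h)
       (\<lambda>x h. g'' (c n x) (c1 n x h) \<bullet> c1 n x h + g' (c n x) \<bullet> c2 n x h)" for n
      unfolding c_def c1_def c2_def
      by (rule line_C2_compose[OF g]; rule curv_props[OF F R])
    show "line_C2 (2 * C) g (\<lambda>x h. g' x \<bullet> h) (\<lambda>x h. g'' x h \<bullet> h)"
      by (rule C2b_imp_line_C2[OF g])
    fix x h :: 'a
    have g1: "(\<lambda>n. g (c n x)) \<longlonglongrightarrow> g x" "(\<lambda>n. g' (c n x)) \<longlonglongrightarrow> g' x" "(\<lambda>n. g'' (c n x) k) \<longlonglongrightarrow> g'' x k" for k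
      using continuous_on_tendsto_compose[OF D(10) L(1)] continuous_on_tendsto_compose[OF D(11) L(1)]
        continuous_on_tendsto_compose[OF D(7) L(1)] by auto
    then show "(\<lambda>n. g (c n x)) \<longlonglongrightarrow> g x" by simp
    show "(\<lambda>n. g' (c n x) \<bullet> c1 n x h) \<longlonglongrightarrow> g' x \<bullet> h"
      by (intro tendsto_inner g1 L)
    have lin: "linear (g'' x)" for x by (rule bounded_linear.linear[OF D(9)])
    have "(\<lambda>n. g'' (c n x) (c1 n x h - h)) \<longlonglongrightarrow> 0"
    proof (rule Lim_null_comparison)
      show "\<forall>\<^sub>F n in sequentially. norm (g'' (c n x) (c1 n x h - h)) \<le> C * norm (c1 n x h - h)"
        by (simp add: D(3))
      show "(\<lambda>n. C * norm (c1 n x h - h)) \<longlonglongrightarrow> 0"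
        by (intro tendsto_mult_right_zero tendsto_norm_zero LIM_zero L)
    qed
    from tendsto_add[OF this g1(3)[of h]] have "(\<lambda>n. g'' (c n x) (c1 n x h)) \<longlonglongrightarrow> g'' x h"
      by (simp add: linear_diff[OF lin])
    then have "(\<lambda>n. g'' (c n x) (c1 n x h) \<bullet> c1 n x h + g' (c n x) \<bullet> c2 n x h) \<longlonglongrightarrow> g'' x h \<bullet> h + g' x \<bullet> 0"
      by (intro tendsto_intros g1 L)
    then show "(\<lambda>n. g'' (c n x) (c1 n x h) \<bullet> c1 n x h + g' (c n x) \<bullet> c2 n x h) \<longlonglongrightarrow> g'' x h \<bullet> h"
      by simp
  qed
  \<comment> \<open>At frequency and phase 0 the multiplier in \<open>V\<close> is cos 0 = 1, which
    leaves \<open>P\<close> for \<open>g\<close> itself.\<close>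
  then have "P (\<lambda>x. g x * cos (0 \<bullet> x + 0)) (\<lambda>x h. g' x \<bullet> h * cos (0 \<bullet> x + 0) + g x * (- sin (0 \<bullet> x + 0) * (0 \<bullet> h)))
     (\<lambda>x h. g'' x h \<bullet> h * cos (0 \<bullet> x + 0) + 2 * (g' x \<bullet> h) * (- sin (0 \<bullet> x + 0) * (0 \<bullet> h))
        + g x * (- cos (0 \<bullet> x + 0) * (0 \<bullet> h)\<^sup>2))"
    unfolding V_def by blast
  then show ?thesis by simp
qed

end

subsection \<open>Symmetry of the second derivative\<close>

text \<open>Schwarz's theorem: the second difference over a small parallelogram is evaluated by mean
  values in both orders, and both points shrink to \<open>x\<close>. Continuity of the Hessian in
  fixed directions is enough because \<open>h\<close> and \<open>k\<close> stay fixed.\<close>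

lemma second_derivative_symmetric:
  fixes g :: "'a::real_inner \<Rightarrow> real"
  assumes g1: "\<And>x. (g has_derivative (\<lambda>h. g' x \<bullet> h)) (at x)" and g2: "\<And>x. (g' has_derivative g'' x) (at x)"
    and c: "\<And>h. continuous_on UNIV (\<lambda>x. g'' x h)"
  shows "g'' x h \<bullet> k = g'' x k \<bullet> h"
proof -
  have lin: "g'' x (c *\<^sub>R v) = c *\<^sub>R g'' x v" for x c v
    using g2 by (meson bounded_linear.linear has_derivative_bounded_linear linear_scale)
  have line: "((\<lambda>r. y + r *\<^sub>R v) has_derivative (\<lambda>t. t *\<^sub>R v)) (at r)" for y v :: 'a and r :: real
    by (auto intro!: derivative_eq_intros)
  have mvt: "\<exists>a b. 0 < a \<and> a < s \<and> 0 < b \<and> b < s \<and>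
      g (x + s *\<^sub>R u + s *\<^sub>R v) - g (x + s *\<^sub>R u) - g (x + s *\<^sub>R v) + g x = s * (s * (g'' (x + a *\<^sub>R u + b *\<^sub>R v) v \<bullet> u))"
    if s: "s > 0" for s :: real and u v
  proof -
    have d1: "((\<lambda>r. g (y + r *\<^sub>R u)) has_real_derivative g' (y + r *\<^sub>R u) \<bullet> u) (at r)" for y r
      unfolding has_field_derivative_def
      by (rule has_derivative_eq_rhs[OF has_derivative_compose[OF line g1]]) (auto simp: mult.commute)
    have d2: "((\<lambda>r. g' (y + r *\<^sub>R v) \<bullet> u) has_real_derivative g'' (y + r *\<^sub>R v) v \<bullet> u) (at r)" for y r
      unfolding has_field_derivative_def
      by (rule has_derivative_eq_rhs[OF has_derivative_inner_left[OF has_derivative_compose[OF line g2]]])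
        (auto simp: lin)
    have dd: "((\<lambda>r. g ((x + s *\<^sub>R v) + r *\<^sub>R u) - g (x + r *\<^sub>R u)) has_real_derivative
        g' ((x + s *\<^sub>R v) + r *\<^sub>R u) \<bullet> u - g' (x + r *\<^sub>R u) \<bullet> u) (at r)" for r
      by (intro DERIV_diff d1)
    from MVT2[OF s dd] obtain a where
      a: "0 < a" "a < s" "g ((x + s *\<^sub>R v) + s *\<^sub>R u) - g (x + s *\<^sub>R u) - (g ((x + s *\<^sub>R v) + 0 *\<^sub>R u) - g (x + 0 *\<^sub>R u))
         = (s - 0) * (g' ((x + s *\<^sub>R v) + a *\<^sub>R u) \<bullet> u - g' (x + a *\<^sub>R u) \<bullet> u)" by blast
    from MVT2[OF s d2[of "x + a *\<^sub>R u"]] obtain b where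
      b: "0 < b" "b < s" "g' ((x + a *\<^sub>R u) + s *\<^sub>R v) \<bullet> u - g' ((x + a *\<^sub>R u) + 0 *\<^sub>R v) \<bullet> u
         = (s - 0) * (g'' ((x + a *\<^sub>R u) + b *\<^sub>R v) v \<bullet> u)" by blast
    have "g (x + s *\<^sub>R u + s *\<^sub>R v) - g (x + s *\<^sub>R u) - g (x + s *\<^sub>R v) + g x = s * (s * (g'' (x + a *\<^sub>R u + b *\<^sub>R v) v \<bullet> u))"
      using a(3) b(3) by (simp add: algebra_simps)
    then show ?thesis using a b by blast
  qed
  define s where "s n = 1 / real (Suc n)" for n
  have s: "s n > 0" for n by (simp add: s_def)
  have s0: "s \<longlonglongrightarrow> 0" unfolding s_def by real_asymp
  have "\<forall>n. \<exists>a b a' b'. 0 < a \<and> a < s n \<and> 0 < b \<and> b < s n \<and> 0 < a' \<and> a' < s n \<and> 0 < b' \<and> b' < s n \<and>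
     g'' (x + a *\<^sub>R h + b *\<^sub>R k) k \<bullet> h = g'' (x + a' *\<^sub>R k + b' *\<^sub>R h) h \<bullet> k"
  proof
    fix n
    obtain a b where 1: "0 < a" "a < s n" "0 < b" "b < s n"
      "g (x + s n *\<^sub>R h + s n *\<^sub>R k) - g (x + s n *\<^sub>R h) - g (x + s n *\<^sub>R k) + g x = s n * (s n * (g'' (x + a *\<^sub>R h + b *\<^sub>R k) k \<bullet> h))"
      using mvt[OF s, of n h k] by blast
    obtain a' b' where 2: "0 < a'" "a' < s n" "0 < b'" "b' < s n"
      "g (x + s n *\<^sub>R k + s n *\<^sub>R h) - g (x + s n *\<^sub>R k) - g (x + s n *\<^sub>R h) + g x = s n * (s n * (g'' (x + a' *\<^sub>R k + b' *\<^sub>R h) h \<bullet> k))"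
      using mvt[OF s, of n k h] by blast
    have comm: "x + s n *\<^sub>R k + s n *\<^sub>R h = x + s n *\<^sub>R h + s n *\<^sub>R k" by (simp add: add_ac)
    then have "s n * (s n * (g'' (x + a *\<^sub>R h + b *\<^sub>R k) k \<bullet> h)) = s n * (s n * (g'' (x + a' *\<^sub>R k + b' *\<^sub>R h) h \<bullet> k))"
      using 1(5) 2(5)[unfolded comm] by linarith
    then have "g'' (x + a *\<^sub>R h + b *\<^sub>R k) k \<bullet> h = g'' (x + a' *\<^sub>R k + b' *\<^sub>R h) h \<bullet> k"
      using s[of n] by simp
    with 1 2 show "\<exists>a b a' b'. 0 < a \<and> a < s n \<and> 0 < b \<and> b < s n \<and> 0 < a' \<and> a' < s n \<and> 0 < b' \<and> b' < s n \<and>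
     g'' (x + a *\<^sub>R h + b *\<^sub>R k) k \<bullet> h = g'' (x + a' *\<^sub>R k + b' *\<^sub>R h) h \<bullet> k" by blast
  qed
  then obtain a b a' b' where ab: "\<And>n. 0 < a n" "\<And>n. a n < s n" "\<And>n. 0 < b n" "\<And>n. b n < s n"
    "\<And>n. 0 < a' n" "\<And>n. a' n < s n" "\<And>n. 0 < b' n" "\<And>n. b' n < s n"
    and eq: "\<And>n. g'' (x + a n *\<^sub>R h + b n *\<^sub>R k) k \<bullet> h = g'' (x + a' n *\<^sub>R k + b' n *\<^sub>R h) h \<bullet> k"
    by metis
  have z: "f \<longlonglongrightarrow> 0" if "\<And>n. 0 < f n" "\<And>n. f n < s n" for f :: "nat \<Rightarrow> real"
    by (rule tendsto_sandwich[OF _ _ tendsto_const s0]) (use that less_imp_le in \<open>auto intro!: always_eventually\<close>)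
  have l1: "(\<lambda>n. x + a n *\<^sub>R h + b n *\<^sub>R k) \<longlonglongrightarrow> x + 0 *\<^sub>R h + 0 *\<^sub>R k"
    by (intro tendsto_intros z ab)
  have l2: "(\<lambda>n. x + a' n *\<^sub>R k + b' n *\<^sub>R h) \<longlonglongrightarrow> x + 0 *\<^sub>R k + 0 *\<^sub>R h"
    by (intro tendsto_intros z ab)
  have L1: "(\<lambda>n. g'' (x + a n *\<^sub>R h + b n *\<^sub>R k) k \<bullet> h) \<longlonglongrightarrow> g'' x k \<bullet> h"
    using continuous_on_tendsto_compose[OF c l1] by (auto intro!: tendsto_inner)
  have L2: "(\<lambda>n. g'' (x + a' n *\<^sub>R k + b' n *\<^sub>R h) h \<bullet> k) \<longlonglongrightarrow> g'' x h \<bullet> k"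
    using continuous_on_tendsto_compose[OF c l2] by (auto intro!: tendsto_inner)
  show ?thesis using LIMSEQ_unique[OF L1[unfolded eq] L2] by simp
qed

subsection \<open>Hilbert--Schmidt norms\<close>

lemma hilbert_schmidtI:
  assumes L: "bounded_linear L" and c: "0 \<le> c"
    and le: "\<And>F. finite F \<Longrightarrow> F \<subseteq> hilbert_basis \<Longrightarrow> (\<Sum>e\<in>F. (norm (L e))\<^sup>2) \<le> c\<^sup>2"
  shows "hilbert_schmidt L" "hs_norm L \<le> c"
proof -
  have s: "(\<lambda>e. (norm (L e))\<^sup>2) summable_on hilbert_basis"
    by (rule nonneg_bdd_above_summable_on) (auto intro!: bdd_aboveI2 le)
  then show "hilbert_schmidt L" using L by (simp add: hilbert_schmidt_def)
  have "(\<Sum>\<^sub>\<infinity>e\<in>hilbert_basis. (norm (L e))\<^sup>2) \<le> c\<^sup>2"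
    by (rule infsum_le_finite_sums[OF s le])
  then show "hs_norm L \<le> c"
    unfolding hs_norm_def using c real_le_lsqrt by blast
qed

lemma hs_norm_nonneg: "0 \<le> hs_norm L"
  by (simp add: hs_norm_def infsum_nonneg)

lemma hs_norm_finite_sum:
  assumes "hilbert_schmidt L" "finite F" "F \<subseteq> hilbert_basis"
  shows "(\<Sum>e\<in>F. (norm (L e))\<^sup>2) \<le> (hs_norm L)\<^sup>2"
proof -
  have "(\<Sum>e\<in>F. (norm (L e))\<^sup>2) \<le> (\<Sum>\<^sub>\<infinity>e\<in>hilbert_basis. (norm (L e))\<^sup>2)"
    by (rule finite_sum_le_infsum) (use assms in \<open>auto simp: hilbert_schmidt_def\<close>)
  then show ?thesis by (simp add: hs_norm_def infsum_nonneg)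
qed

lemma hs_norm_add:
  assumes L: "hilbert_schmidt L" and K: "hilbert_schmidt K"
  shows "hilbert_schmidt (\<lambda>h. L h + K h)" "hs_norm (\<lambda>h. L h + K h) \<le> hs_norm L + hs_norm K"
proof -
  have le: "(\<Sum>e\<in>F. (norm (L e + K e))\<^sup>2) \<le> (hs_norm L + hs_norm K)\<^sup>2"
    if F: "finite F" "F \<subseteq> hilbert_basis" for F
  proof -
    have "L2_set (\<lambda>e. norm (L e + K e)) F \<le> L2_set (\<lambda>e. norm (L e) + norm (K e)) F"
      by (intro L2_set_mono norm_triangle_ineq) auto
    also have "\<dots> \<le> L2_set (\<lambda>e. norm (L e)) F + L2_set (\<lambda>e. norm (K e)) F"
      by (rule L2_set_triangle_ineq)
    also have "\<dots> \<le> hs_norm L + hs_norm K"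
      unfolding L2_set_def using hs_norm_finite_sum[OF L F] hs_norm_finite_sum[OF K F]
      by (intro add_mono) (auto intro!: real_le_lsqrt hs_norm_nonneg)
    finally show ?thesis
      unfolding L2_set_def using sqrt_le_D by blast
  qed
  have b: "bounded_linear (\<lambda>h. L h + K h)"
    using L K by (auto simp: hilbert_schmidt_def intro!: bounded_linear_add)
  show "hilbert_schmidt (\<lambda>h. L h + K h)" "hs_norm (\<lambda>h. L h + K h) \<le> hs_norm L + hs_norm K"
    using hilbert_schmidtI[OF b _ le] hs_norm_nonneg[of L] hs_norm_nonneg[of K] by simp_all
qed

lemma hs_norm_compose_left:
  assumes L: "hilbert_schmidt L" and S: "bounded_linear S" "\<And>x. norm (S x) \<le> c * norm x" "0 \<le> c"
  shows "hilbert_schmidt (\<lambda>h. S (L h))" "hs_norm (\<lambda>h. S (L h)) \<le> c * hs_norm L"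
proof -
  have le: "(\<Sum>e\<in>F. (norm (S (L e)))\<^sup>2) \<le> (c * hs_norm L)\<^sup>2"
    if F: "finite F" "F \<subseteq> hilbert_basis" for F
  proof -
    have "(\<Sum>e\<in>F. (norm (S (L e)))\<^sup>2) \<le> (\<Sum>e\<in>F. (c * norm (L e))\<^sup>2)"
      by (intro sum_mono power_mono S) auto
    also have "\<dots> = c\<^sup>2 * (\<Sum>e\<in>F. (norm (L e))\<^sup>2)"
      by (simp add: power_mult_distrib sum_distrib_left)
    also have "\<dots> \<le> c\<^sup>2 * (hs_norm L)\<^sup>2"
      by (intro mult_left_mono hs_norm_finite_sum[OF L F]) auto
    finally show ?thesis by (simp add: power_mult_distrib)
  qed
  have "bounded_linear (\<lambda>h. S (L h))"
    using L S(1) bounded_linear_compose by (auto simp: hilbert_schmidt_def)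
  from hilbert_schmidtI[OF this _ le] show "hilbert_schmidt (\<lambda>h. S (L h))" "hs_norm (\<lambda>h. S (L h)) \<le> c * hs_norm L"
    using hs_norm_nonneg[of L] S(3) by simp_all
qed

lemma hs_norm_scale:
  assumes "hilbert_schmidt L"
  shows "hilbert_schmidt (\<lambda>h. c *\<^sub>R L h)" "hs_norm (\<lambda>h. c *\<^sub>R L h) \<le> \<bar>c\<bar> * hs_norm L"
  using hs_norm_compose_left[OF assms, of "\<lambda>x. c *\<^sub>R x" "\<bar>c\<bar>"] by (auto simp: bounded_linear_scaleR_right)

lemma hs_norm_diff:
  assumes L: "hilbert_schmidt L" and K: "hilbert_schmidt K"
  shows "hilbert_schmidt (\<lambda>h. L h - K h)" "hs_norm (\<lambda>h. L h - K h) \<le> hs_norm L + hs_norm K"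
  using hs_norm_add[OF L hs_norm_scale(1)[OF K, of "- 1"]] hs_norm_scale(2)[OF K, of "- 1"] by auto

text \<open>The double sum of (L e . f)^2 is evaluated over \<open>e\<close> by Parseval, for
  finitely many \<open>f\<close>, and bounded over \<open>f\<close> by Bessel.\<close>

lemma hs_norm_adjoint:
  fixes L L' :: "'a::{real_inner, banach} \<Rightarrow> 'a"
  assumes L: "hilbert_schmidt L" and L': "bounded_linear L'" and adj: "\<And>x y. L x \<bullet> y = x \<bullet> L' y"
  shows "hilbert_schmidt L'" "hs_norm L' \<le> hs_norm L"
proof -
  have le: "(\<Sum>f\<in>F. (norm (L' f))\<^sup>2) \<le> (hs_norm L)\<^sup>2"
    if F: "finite F" "F \<subseteq> hilbert_basis" for F
  proof -
    have hs: "((\<lambda>e. (L e \<bullet> f)\<^sup>2) has_sum (norm (L' f))\<^sup>2) hilbert_basis" for f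
    proof -
      have "(L e \<bullet> f)\<^sup>2 = (L' f \<bullet> e) * (L' f \<bullet> e)" for e
        by (simp only: adj inner_commute[of "L' f" e] power2_eq_square)
      then show ?thesis using parseval[of "L' f" "L' f"] by (simp only: power2_norm_eq_inner)
    qed
    have "((\<lambda>e. \<Sum>f\<in>F. (L e \<bullet> f)\<^sup>2) has_sum (\<Sum>f\<in>F. (norm (L' f))\<^sup>2)) hilbert_basis"
      using F(1) by (induction F) (auto intro!: has_sum_add hs)
    then show ?thesis
    proof (rule has_sum_le_finite_sums)
      fix E :: "'a set" assume E: "finite E" "E \<subseteq> hilbert_basis"
      have "(\<Sum>e\<in>E. \<Sum>f\<in>F. (L e \<bullet> f)\<^sup>2) \<le> (\<Sum>e\<in>E. (norm (L e))\<^sup>2)"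
        by (intro sum_mono bessel F)
      also have "\<dots> \<le> (hs_norm L)\<^sup>2" by (rule hs_norm_finite_sum[OF L E])
      finally show "(\<Sum>e\<in>E. \<Sum>f\<in>F. (L e \<bullet> f)\<^sup>2) \<le> (hs_norm L)\<^sup>2" .
    qed
  qed
  from hilbert_schmidtI[OF L' hs_norm_nonneg le]
  show "hilbert_schmidt L'" "hs_norm L' \<le> hs_norm L" by blast+
qed

text \<open>Expand \<open>h\<close> in the basis and apply Cauchy-Schwarz to its coefficients
  against the norms of \<open>L e\<close>.\<close>

lemma norm_le_hs_norm:
  fixes L :: "'a::{real_inner, banach} \<Rightarrow> 'a"
  assumes L: "hilbert_schmidt L"
  shows "norm (L h) \<le> hs_norm L * norm h"
proof -
  have "((\<lambda>e. L ((h \<bullet> e) *\<^sub>R e)) has_sum L h) hilbert_basis"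
    using L has_sum_bounded_linear[OF _ has_sum_hilbert_basis[of h]] by (auto simp: hilbert_schmidt_def)
  then have "((\<lambda>F. \<Sum>e\<in>F. L ((h \<bullet> e) *\<^sub>R e)) \<longlongrightarrow> L h) (finite_subsets_at_top hilbert_basis)"
    by (simp add: has_sum_def)
  from tendsto_norm[OF this] show ?thesis
  proof (rule tendsto_upperbound)
    show "\<forall>\<^sub>F F in finite_subsets_at_top hilbert_basis. norm (\<Sum>e\<in>F. L ((h \<bullet> e) *\<^sub>R e)) \<le> hs_norm L * norm h"
    proof (rule eventually_finite_subsets_at_top_weakI)
      fix F :: "'a set" assume F: "finite F" "F \<subseteq> hilbert_basis"
      have lin: "L ((h \<bullet> e) *\<^sub>R e) = (h \<bullet> e) *\<^sub>R L e" for e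
        using L by (simp add: hilbert_schmidt_def bounded_linear.linear linear_scale)
      have "norm (\<Sum>e\<in>F. L ((h \<bullet> e) *\<^sub>R e)) \<le> (\<Sum>e\<in>F. \<bar>h \<bullet> e\<bar> * \<bar>norm (L e)\<bar>)"
        unfolding lin by (rule order_trans[OF norm_sum]) simp
      also have "\<dots> \<le> L2_set (\<lambda>e. h \<bullet> e) F * L2_set (\<lambda>e. norm (L e)) F" by (rule L2_set_mult_ineq)
      also have "\<dots> \<le> norm h * hs_norm L"
        unfolding L2_set_def using bessel[OF F, of h] hs_norm_finite_sum[OF L F]
        by (intro mult_mono real_le_lsqrt hs_norm_nonneg) (auto simp: sum_nonneg)
      finally show "norm (\<Sum>e\<in>F. L ((h \<bullet> e) *\<^sub>R e)) \<le> hs_norm L * norm h" by (simp add: mult.commute)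
    qed
  qed simp
qed

text \<open>A fixed Hilbert-Schmidt factor upgrades strong convergence to convergence in
  Hilbert-Schmidt norm: finitely many basis vectors carry all but a small part of \<open>L\<close>,
  and on the rest the operators are uniformly bounded.\<close>

lemma hs_norm_strong_limit:
  fixes S :: "nat \<Rightarrow> 'a::{real_inner, banach} \<Rightarrow> 'a"
  assumes L: "hilbert_schmidt L" and S: "\<And>n. bounded_linear (S n)" "\<And>n x. norm (S n x) \<le> c * norm x"
    and lim: "\<And>x. (\<lambda>n. S n x) \<longlonglongrightarrow> 0"
  shows "(\<lambda>n. hs_norm (\<lambda>h. S n (L h))) \<longlonglongrightarrow> 0"
proof (rule LIMSEQ_I)
  fix r :: real assume r: "r > 0"
  \<comment> \<open>The tail of \<open>L\<close> is at most 2 eps, so c^2 times it is at most r^2/8;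
    with the finite part below r^2/8 the total is at most (r/2)^2.\<close>
  define \<epsilon> where "\<epsilon> = r\<^sup>2 / 16 / (c\<^sup>2 + 1)"
  have \<epsilon>: "\<epsilon> > 0" using r by (simp add: \<epsilon>_def add_nonneg_pos)
  let ?B = "hilbert_basis :: 'a set" and ?s = "\<lambda>F. \<Sum>e\<in>F. (norm (L e))\<^sup>2"
  have "(\<lambda>e. (norm (L e))\<^sup>2) summable_on ?B" using L by (simp add: hilbert_schmidt_def)
  from has_sum_infsum[OF this] obtain s where "(?s \<longlongrightarrow> s) (finite_subsets_at_top ?B)"
    by (auto simp: has_sum_def)
  then have "\<forall>\<^sub>F F in finite_subsets_at_top ?B. dist (?s F) s < \<epsilon>"
    using \<epsilon> by (rule tendstoD)
  then obtain F0 where F0: "finite F0" "F0 \<subseteq> ?B"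
    and F0': "\<And>F. finite F \<Longrightarrow> F0 \<subseteq> F \<Longrightarrow> F \<subseteq> ?B \<Longrightarrow> dist (?s F) s < \<epsilon>"
    unfolding eventually_finite_subsets_at_top by metis
  have tail: "?s (F - F0) \<le> 2 * \<epsilon>" if F: "finite F" "F \<subseteq> ?B" for F
  proof -
    have "?s (F \<union> F0) = ?s (F - F0) + ?s F0"
      using F F0 by (metis Diff_disjoint Int_commute Un_Diff_cancel2 finite_Diff sum.union_disjoint)
    then show ?thesis
      using F0'[of "F \<union> F0"] F0'[of F0] F F0 unfolding dist_real_def by auto
  qed
  have "(\<lambda>n. \<Sum>e\<in>F0. (norm (S n (L e)))\<^sup>2) \<longlonglongrightarrow> (\<Sum>e\<in>F0. (norm (0 :: 'a))\<^sup>2)"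
    by (intro tendsto_intros lim)
  then have "\<forall>\<^sub>F n in sequentially. dist (\<Sum>e\<in>F0. (norm (S n (L e)))\<^sup>2) (\<Sum>e\<in>F0. (norm (0 :: 'a))\<^sup>2) < r\<^sup>2 / 8"
    using r by (intro tendstoD) auto
  then have ev: "\<forall>\<^sub>F n in sequentially. (\<Sum>e\<in>F0. (norm (S n (L e)))\<^sup>2) < r\<^sup>2 / 8"
    by eventually_elim (simp add: dist_real_def abs_of_nonneg sum_nonneg)
  have "norm (hs_norm (\<lambda>h. S n (L h)) - 0) < r" if n: "(\<Sum>e\<in>F0. (norm (S n (L e)))\<^sup>2) < r\<^sup>2 / 8" for n
  proof -
    have le: "(\<Sum>e\<in>F. (norm (S n (L e)))\<^sup>2) \<le> (r / 2)\<^sup>2" if F: "finite F" "F \<subseteq> ?B" for F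
    proof -
      have "(\<Sum>e\<in>F. (norm (S n (L e)))\<^sup>2) \<le> (\<Sum>e\<in>F0 \<union> (F - F0). (norm (S n (L e)))\<^sup>2)"
        using F F0 by (intro sum_mono2) auto
      also have "\<dots> = (\<Sum>e\<in>F0. (norm (S n (L e)))\<^sup>2) + (\<Sum>e\<in>F - F0. (norm (S n (L e)))\<^sup>2)"
        using F F0 by (intro sum.union_disjoint) auto
      also have "(\<Sum>e\<in>F - F0. (norm (S n (L e)))\<^sup>2) \<le> (\<Sum>e\<in>F - F0. (c * norm (L e))\<^sup>2)"
        by (intro sum_mono power_mono S) auto
      also have "\<dots> = c\<^sup>2 * ?s (F - F0)" by (simp add: power_mult_distrib sum_distrib_left)
      also have "\<dots> \<le> (c\<^sup>2 + 1) * (2 * \<epsilon>)"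
        using tail[OF F] \<epsilon> by (intro mult_mono) (auto simp: sum_nonneg)
      also have "\<dots> = r\<^sup>2 / 8"
        unfolding \<epsilon>_def using add_nonneg_pos[of "c\<^sup>2" 1] by (simp add: field_simps)
      finally show ?thesis using n by (simp add: power_divide)
    qed
    have "bounded_linear (\<lambda>h. S n (L h))"
      using L S(1) bounded_linear_compose by (auto simp: hilbert_schmidt_def)
    from hilbert_schmidtI(2)[OF this _ le] show ?thesis
      using r hs_norm_nonneg[of "\<lambda>h. S n (L h)"] by simp
  qed
  with ev show "\<exists>no. \<forall>n\<ge>no. norm (hs_norm (\<lambda>h. S n (L h)) - 0) < r"
    unfolding eventually_sequentially by metis
qed

lemma hs_continuous_tendsto:
  fixes F :: "'b::metric_space \<Rightarrow> 'a::real_inner \<Rightarrow> 'a"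
  assumes "hs_continuous_on E F" "p \<in> E" "\<And>n. ps n \<in> E" "ps \<longlonglongrightarrow> p"
  shows "(\<lambda>n. hs_norm (\<lambda>h. F (ps n) h - F p h)) \<longlonglongrightarrow> 0"
proof -
  \<comment> \<open>The filter \<open>at p within E\<close> omits \<open>p\<close>; the value 0
    there makes the function continuous, so sequences that hit \<open>p\<close> are covered
    too.\<close>
  have z: "hs_norm (\<lambda>h. F p h - F p h) = 0" by (simp add: hs_norm_def)
  have "continuous (at p within E) (\<lambda>q. hs_norm (\<lambda>h. F q h - F p h))"
    using assms(1,2) z by (simp add: hs_continuous_on_def continuous_within)
  then show ?thesis
    using assms z unfolding continuous_within_sequentially by (auto simp: o_def)
qed

lemma hs_continuousI:
  fixes F :: "'b::first_countable_topology \<Rightarrow> 'a::real_inner \<Rightarrow> 'a"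
  assumes "\<And>p ps. p \<in> E \<Longrightarrow> (\<And>n. ps n \<in> E) \<Longrightarrow> ps \<longlonglongrightarrow> p \<Longrightarrow> (\<lambda>n. hs_norm (\<lambda>h. F (ps n) h - F p h)) \<longlonglongrightarrow> 0"
  shows "hs_continuous_on E F"
  unfolding hs_continuous_on_def tendsto_at_iff_sequentially o_def
  using assms by blast

lemma hs_continuous_strong:
  fixes F :: "'b::metric_space \<Rightarrow> 'a::{real_inner, banach} \<Rightarrow> 'a"
  assumes c: "hs_continuous_on E F" and hs: "\<And>p. p \<in> E \<Longrightarrow> hilbert_schmidt (F p)"
  shows "continuous_on E (\<lambda>p. F p h)"
  unfolding continuous_on_sequentially o_def
proof (intro allI ballI impI)
  fix ps p assume p: "p \<in> E" "(\<forall>n. ps n \<in> E) \<and> ps \<longlonglongrightarrow> p"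
  have "(\<lambda>n. F (ps n) h - F p h) \<longlonglongrightarrow> 0"
  proof (rule Lim_null_comparison)
    show "\<forall>\<^sub>F n in sequentially. norm (F (ps n) h - F p h) \<le> hs_norm (\<lambda>h. F (ps n) h - F p h) * norm h"
      using p by (intro always_eventually allI norm_le_hs_norm hs_norm_diff hs) auto
    show "(\<lambda>n. hs_norm (\<lambda>h. F (ps n) h - F p h) * norm h) \<longlonglongrightarrow> 0"
      using p by (intro tendsto_mult_left_zero hs_continuous_tendsto[OF c]) auto
  qed
  then show "(\<lambda>n. F (ps n) h) \<longlonglongrightarrow> F p h" by (rule LIM_zero_cancel)
qed

section \<open>Gradients and Hessians of functions in \<open>Cb2\<close>\<close>

lemma grad_eqI:
  assumes "(f has_derivative (\<lambda>h. g \<bullet> h)) (at x)"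
  shows "grad f x = g"
  unfolding grad_def
proof (rule the_equality)
  show "GDERIV f x :> g" using assms by (simp add: gderiv_def inner_commute)
  fix g' assume "GDERIV f x :> g'"
  then have "(\<lambda>h. h \<bullet> g') = (\<lambda>h. g \<bullet> h)"
    using assms has_derivative_unique unfolding gderiv_def by blast
  then have "h \<bullet> (g' - g) = 0" for h
    by (metis inner_commute inner_diff_right right_minus_eq)
  then show "g' = g" by (metis inner_eq_zero_iff right_minus_eq)
qed

lemma Cb2D:
  fixes f :: "'a::{real_inner, banach} \<Rightarrow> real"
  assumes f: "f \<in> Cb2"
  shows "(f has_derivative (\<lambda>h. grad f x \<bullet> h)) (at x)" "(grad f has_derivative hess f x) (at x)"
    "hilbert_schmidt (hess f x)" "hs_continuous_on UNIV (hess f)" "hess f x h \<bullet> k = hess f x k \<bullet> h"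
    "continuous_on UNIV f" "continuous_on UNIV (grad f)" "continuous_on UNIV (\<lambda>x. hess f x h)"
proof -
  have d1: "(f has_derivative (\<lambda>h. grad f x \<bullet> h)) (at x)" for x
  proof -
    obtain g where "GDERIV f x :> g" using f unfolding Cb2_def by blast
    then have "(f has_derivative (\<lambda>h. g \<bullet> h)) (at x)" by (simp add: gderiv_def inner_commute)
    with grad_eqI[OF this] show ?thesis by simp
  qed
  have d2: "(grad f has_derivative hess f x) (at x)" for x
    using f frechet_derivative_works unfolding hess_def Cb2_def by auto
  have hs: "hilbert_schmidt (hess f x)" "hs_continuous_on UNIV (hess f)" for x
    using f by (auto simp: Cb2_def)
  have c: "continuous_on UNIV (\<lambda>x. hess f x h)" for h
    by (rule hs_continuous_strong[OF hs(2)]) (use hs in auto)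
  show "(f has_derivative (\<lambda>h. grad f x \<bullet> h)) (at x)" "(grad f has_derivative hess f x) (at x)"
    "hilbert_schmidt (hess f x)" "hs_continuous_on UNIV (hess f)" "continuous_on UNIV (\<lambda>x. hess f x h)"
    by (fact d1 d2 hs c)+
  show "hess f x h \<bullet> k = hess f x k \<bullet> h"
    by (rule second_derivative_symmetric[OF d1 d2 c])
  show "continuous_on UNIV f" "continuous_on UNIV (grad f)"
    using f by (auto simp: Cb2_def)
qed

lemma Cb2_imp_C2b:
  fixes f :: "'a::{real_inner, banach} \<Rightarrow> real"
  assumes f: "f \<in> Cb2" and b: "\<And>x. \<bar>f x\<bar> \<le> C" "\<And>x. norm (grad f x) \<le> C" "\<And>x. hs_norm (hess f x) \<le> C"
  shows "C2b C f (grad f) (hess f)"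
  unfolding C2b_def
proof (intro conjI allI)
  fix x h
  show "norm (hess f x h) \<le> C * norm h"
    using norm_le_hs_norm[OF Cb2D(3)[OF f], of x h] mult_right_mono[OF b(3)[of x], of "norm h"] by simp
qed (use b Cb2D[OF f] in auto)

lemma Cb2_bound:
  fixes f :: "'a::{real_inner, banach} \<Rightarrow> real"
  assumes f: "f \<in> Cb2"
  obtains C where "\<And>x. \<bar>f x\<bar> \<le> C" "\<And>x. norm (grad f x) \<le> C" "\<And>x. hs_norm (hess f x) \<le> C"
proof -
  obtain a b c where "\<And>x. norm (f x) \<le> a" "\<And>x. norm (grad f x) \<le> b" "\<And>x. norm (hs_norm (hess f x)) \<le> c"
    using f unfolding Cb2_def bounded_iff by (auto simp: image_iff) 
  then have "\<And>x. \<bar>f x\<bar> \<le> max a (max b c)" "\<And>x. norm (grad f x) \<le> max a (max b c)" "\<And>x. hs_norm (hess f x) \<le> max a (max b c)"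
    by (force simp: le_max_iff_disj abs_le_iff)+
  then show thesis by (rule that)
qed

subsection \<open>Strongly continuous semigroups\<close>

text \<open>Banach-Steinhaus for a sequence: by Baire's theorem some sublevel set \<open>S m\<close>
  contains a ball. Subtracting the centre shows that every \<open>L n\<close> is at most 2 m on a
  ball about 0.\<close>

lemma uniform_boundedness:
  fixes L :: "nat \<Rightarrow> 'a::{real_normed_vector, complete_space} \<Rightarrow> 'b::real_normed_vector"
  assumes L: "\<And>n. bounded_linear (L n)" and b: "\<And>x. bounded (range (\<lambda>n. L n x))"
  obtains M where "\<And>n x. norm (L n x) \<le> M * norm x"
proof -
  define S where "S m = {x. \<forall>n. norm (L n x) \<le> real m}" for m :: nat
  have cl: "closed (S m)" for m
  proof -
    have "S m = (\<Inter>n. {x. norm (L n x) \<le> real m})" by (auto simp: S_def)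
    moreover have "closed {x. norm (L n x) \<le> real m}" for n
      by (intro closed_Collect_le continuous_intros bounded_linear.continuous_on[OF L])
    ultimately show ?thesis by (simp add: closed_INT)
  qed
  have un: "\<Union>(range S) = UNIV"
  proof -
    have "\<exists>m. x \<in> S m" for x
    proof -
      obtain c where c: "\<And>n. norm (L n x) \<le> c" using b[of x] by (auto simp: bounded_iff)
      obtain m :: nat where "c \<le> real m" using real_arch_simple by blast
      then have "x \<in> S m" using c order_trans by (fastforce simp: S_def)
      then show ?thesis ..
    qed
    then show ?thesis by auto
  qed
  have "\<exists>m. interior (S m) \<noteq> {}"
  proof (rule ccontr)
    assume "\<not> ?thesis"
    then have "Met_TC.mtopology interior_of \<Union>(range S) = {}"
      using cl complete_UNIV
      by (intro Met_TC.metric_Baire_category_alt) auto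
    then show False using un by simp
  qed
  then obtain m x0 r where r: "r > 0" "cball x0 r \<subseteq> S m"
    by (metis ex_in_conv mem_interior_cball)
  have bound: "norm (L n y) \<le> 2 * real m" if "norm y \<le> r" for n y
  proof -
    have "x0 + y \<in> cball x0 r" "x0 \<in> cball x0 r" using that r by (auto simp: dist_norm)
    then have "x0 + y \<in> S m" "x0 \<in> S m" using r(2) by blast+
    then have "norm (L n (x0 + y)) \<le> real m" "norm (L n x0) \<le> real m" by (auto simp: S_def)
    moreover have "L n y = L n (x0 + y) - L n x0"
      using L by (simp add: bounded_linear.linear linear_add)
    ultimately show ?thesis using norm_triangle_ineq4[of "L n (x0 + y)" "L n x0"] by simp
  qed
  have "norm (L n x) \<le> (2 * real m / r) * norm x" for n x
  proof (cases "x = 0")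
    case False
    define y where "y = (r / norm x) *\<^sub>R x"
    have "norm (L n y) \<le> 2 * real m" using r False by (intro bound) (simp add: y_def)
    moreover have "norm (L n y) = (r / norm x) * norm (L n x)"
      using r L by (simp add: y_def bounded_linear.linear linear_scale)
    ultimately show ?thesis using r False by (simp add: field_simps)
  qed (use L in \<open>simp add: bounded_linear.linear linear_0\<close>)
  then show thesis by (rule that)
qed

lemma has_vector_derivative_quotient:
  assumes "(f has_vector_derivative f') (at x within S)"
  shows "((\<lambda>y. (f y - f x) /\<^sub>R (y - x)) \<longlongrightarrow> f') (at x within S)"
proof -
  have "((\<lambda>y. norm ((1 / norm (y - x)) *\<^sub>R (f y - (f x + (y - x) *\<^sub>R f')))) \<longlongrightarrow> 0) (at x within S)"
    using assms unfolding has_vector_derivative_def has_derivative_within by (intro tendsto_norm_zero) simp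
  then have "((\<lambda>y. norm ((f y - f x) /\<^sub>R (y - x) - f')) \<longlongrightarrow> 0) (at x within S)"
  proof (rule Lim_transform_eventually)
    show "\<forall>\<^sub>F y in at x within S. norm ((1 / norm (y - x)) *\<^sub>R (f y - (f x + (y - x) *\<^sub>R f'))) = norm ((f y - f x) /\<^sub>R (y - x) - f')"
      unfolding eventually_at_filter
    proof (intro always_eventually allI impI)
      fix y assume "y \<noteq> x"
      then have "f y - (f x + (y - x) *\<^sub>R f') = (y - x) *\<^sub>R ((f y - f x) /\<^sub>R (y - x) - f')"
        by (simp add: scaleR_diff_right)
      then show "norm ((1 / norm (y - x)) *\<^sub>R (f y - (f x + (y - x) *\<^sub>R f'))) = norm ((f y - f x) /\<^sub>R (y - x) - f')"
        using \<open>y \<noteq> x\<close> by simp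
    qed
  qed
  then show ?thesis by (rule LIM_zero_cancel[OF tendsto_norm_zero_cancel])
qed

locale c0_semigroup =
  fixes T :: "real \<Rightarrow> 'a::banach \<Rightarrow> 'a"
  assumes C0: "C0_semigroup T"
begin

lemma T_linear: "t \<ge> 0 \<Longrightarrow> bounded_linear (T t)"
  and T_0: "T 0 x = x"
  and T_add: "s \<ge> 0 \<Longrightarrow> t \<ge> 0 \<Longrightarrow> T (s + t) x = T s (T t x)"
  and T_at_0: "((\<lambda>t. T t x) \<longlongrightarrow> x) (at_right 0)"
  using C0 by (auto simp: C0_semigroup_def)

lemma T_lin: "t \<ge> 0 \<Longrightarrow> T t (x + y) = T t x + T t y" "t \<ge> 0 \<Longrightarrow> T t (x - y) = T t x - T t y"
   "t \<ge> 0 \<Longrightarrow> T t (c *\<^sub>R x) = c *\<^sub>R T t x" "t \<ge> 0 \<Longrightarrow> T t 0 = 0"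
  using T_linear[of t] by (simp_all add: bounded_linear.linear linear_add linear_diff linear_scale linear_0)

text \<open>Otherwise there are times tending to 0 at which the bound n + 1 fails; along them the
  operators converge pointwise to the identity, hence are uniformly bounded, a
  contradiction.\<close>

lemma T_bounded_near_0: "\<exists>\<delta>>0. \<exists>M\<ge>1. \<forall>t\<in>{0..\<delta>}. \<forall>x. norm (T t x) \<le> M * norm x"
proof (rule ccontr)
  assume "\<not> ?thesis"
  then have neg: "\<And>\<delta> M. \<delta> > 0 \<Longrightarrow> M \<ge> 1 \<Longrightarrow> \<exists>t\<in>{0..\<delta>}. \<exists>x. \<not> norm (T t x) \<le> M * norm x"
    by metis
  have "\<forall>n. \<exists>t. t \<in> {0..1 / real (Suc n)} \<and> (\<exists>x. \<not> norm (T t x) \<le> real (Suc n) * norm x)"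
  proof
    fix n show "\<exists>t. t \<in> {0..1 / real (Suc n)} \<and> (\<exists>x. \<not> norm (T t x) \<le> real (Suc n) * norm x)"
      using neg[of "1 / real (Suc n)" "real (Suc n)"] by (simp add: Bex_def)
  qed
  then obtain t where t: "\<And>n. t n \<in> {0..1 / real (Suc n)}"
    and big: "\<And>n. \<exists>x. \<not> norm (T (t n) x) \<le> real (Suc n) * norm x" by metis
  have lim: "(\<lambda>n. 1 / real (Suc n)) \<longlonglongrightarrow> 0" by real_asymp
  have t0: "t \<longlonglongrightarrow> 0"
  proof (rule tendsto_sandwich[OF _ _ tendsto_const lim])
    show "\<forall>\<^sub>F n in sequentially. 0 \<le> t n" "\<forall>\<^sub>F n in sequentially. t n \<le> 1 / real (Suc n)"
      using t by (auto intro!: always_eventually simp del: of_nat_Suc)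
  qed
  \<comment> \<open>Time 0 is excluded since the identity satisfies the bound; strict positivity is
    needed to use the limit \<open>at_right 0\<close>.\<close>
  have tpos: "t n > 0" for n
  proof -
    obtain x where "\<not> norm (T (t n) x) \<le> real (Suc n) * norm x" using big by blast
    moreover have "norm x \<le> real (Suc n) * norm x" using mult_right_mono[of 1 "real (Suc n)" "norm x"] by simp
    ultimately have "t n \<noteq> 0" by (auto simp: T_0)
    then show ?thesis using t[of n] by simp
  qed
  have "filterlim t (at_right 0) sequentially"
    using t0 tpos less_imp_neq[OF tpos, symmetric] by (simp add: filterlim_at)
  then have "(\<lambda>n. T (t n) x) \<longlonglongrightarrow> x" for x
    using filterlim_compose[OF T_at_0] by blast
  then have "bounded (range (\<lambda>n. T (t n) x))" for x
    using convergent_imp_bounded by blast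
  then obtain M where M: "\<And>n x. norm (T (t n) x) \<le> M * norm x"
    using uniform_boundedness[of "\<lambda>n. T (t n)"] T_linear t by (metis atLeastAtMost_iff)
  obtain n :: nat where "M \<le> real n" using real_arch_simple by blast
  then have "norm (T (t n) x) \<le> real (Suc n) * norm x" for x
    using M[of n x] mult_right_mono[of M "real (Suc n)" "norm x"] by simp
  then show False using big by blast
qed

text \<open>Each step of length \<open>\<delta>\<close> costs a factor \<open>M\<close>, and
  finitely many steps reach \<open>r\<close>.\<close>

lemma T_bounded:
  obtains M where "M \<ge> 1" "\<And>t x. 0 \<le> t \<Longrightarrow> t \<le> r \<Longrightarrow> norm (T t x) \<le> M * norm x"
proof -
  obtain \<delta> M where \<delta>: "\<delta> > 0" and M: "M \<ge> 1" and b: "\<And>t x. t \<in> {0..\<delta>} \<Longrightarrow> norm (T t x) \<le> M * norm x"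
    using T_bounded_near_0 by blast
  have step: "norm (T t x) \<le> M ^ Suc n * norm x" if "0 \<le> t" "t \<le> real (Suc n) * \<delta>" for n t x
    using that
  proof (induction n arbitrary: t x)
    case 0
    then show ?case using b[of t x] by simp
  next
    case (Suc n)
    show ?case
    proof (cases "t \<le> \<delta>")
      case True
      then have "norm (T t x) \<le> M * norm x" using b Suc.prems by simp
      also have "\<dots> \<le> M ^ Suc (Suc n) * norm x"
        using M by (intro mult_right_mono self_le_power) auto
      finally show ?thesis .
    next
      case False
      then have "T t x = T \<delta> (T (t - \<delta>) x)" using T_add[of \<delta> "t - \<delta>" x] \<delta> by simp
      then have "norm (T t x) \<le> M * norm (T (t - \<delta>) x)" using b[of \<delta>] \<delta> by simp
      also have "\<dots> \<le> M * (M ^ Suc n * norm x)"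
        using M False Suc.prems by (intro mult_left_mono Suc.IH) (auto simp: algebra_simps)
      finally show ?thesis by simp
    qed
  qed
  obtain n :: nat where "r / \<delta> \<le> real n" using real_arch_simple by blast
  then have "r \<le> real n * \<delta>" using \<delta> by (simp add: divide_le_eq)
  also have "\<dots> \<le> real (Suc n) * \<delta>" using \<delta> by (intro mult_right_mono) auto
  finally have rn: "r \<le> real (Suc n) * \<delta>" .
  show thesis
  proof (rule that)
    show "M ^ Suc n \<ge> 1" using M by (rule one_le_power)
    show "\<And>t x. 0 \<le> t \<Longrightarrow> t \<le> r \<Longrightarrow> norm (T t x) \<le> M ^ Suc n * norm x"
      using step rn order_trans by blast
  qed
qed

lemma T_tendsto:
  assumes s: "\<And>n. s n \<ge> 0" "s \<longlonglongrightarrow> t" and x: "xs \<longlonglongrightarrow> x"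
  shows "(\<lambda>n. T (s n) (xs n)) \<longlonglongrightarrow> T t x"
proof -
  have t: "t \<ge> 0" using s by (simp add: LIMSEQ_le_const)
  obtain M where M: "M \<ge> 1" "\<And>s x. 0 \<le> s \<Longrightarrow> s \<le> t + 1 \<Longrightarrow> norm (T s x) \<le> M * norm x"
    using T_bounded[of "t + 1"] by metis
  have ev: "\<forall>\<^sub>F n in sequentially. s n < t + 1"
    using s(2) by (rule order_tendstoD) simp
  have "\<forall>\<^sub>F h in at_right 0. dist (T h x) x < \<epsilon>" if "\<epsilon> > 0" for \<epsilon>
    using T_at_0 that by (rule tendstoD)
  then have small: "\<exists>\<delta>>0. \<forall>h. 0 \<le> h \<and> h < \<delta> \<longrightarrow> dist (T h x) x < \<epsilon>" if "\<epsilon> > 0" for \<epsilon>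
    using that unfolding eventually_at_right_field by (metis T_0 dist_self order_le_less)
  have "(\<lambda>n. T (s n) x - T t x) \<longlonglongrightarrow> 0"
  proof (rule LIMSEQ_I)
    fix r :: real assume r: "r > 0"
    obtain \<delta> where \<delta>: "\<delta> > 0" "\<And>h. 0 \<le> h \<Longrightarrow> h < \<delta> \<Longrightarrow> dist (T h x) x < r / M"
      using small[of "r / M"] r M by auto
    have "\<forall>\<^sub>F n in sequentially. dist (s n) t < \<delta>" using s(2) \<delta>(1) by (rule tendstoD)
    with ev have "\<forall>\<^sub>F n in sequentially. norm (T (s n) x - T t x - 0) < r"
    proof eventually_elim
      case (elim n)
      \<comment> \<open>Writing the two times as \<open>u\<close> and \<open>u + h\<close> treats
        approach from the left and from the right alike: up to sign the difference is
        \<open>T u (T h x - x)\<close>.\<close>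
      define u h where "u = min (s n) t" and "h = \<bar>s n - t\<bar>"
      have uh: "u \<ge> 0" "h \<ge> 0" "u \<le> t + 1" "h < \<delta>"
        using s(1)[of n] t elim by (auto simp: u_def h_def dist_real_def)
      have "norm (T (s n) x - T t x) = norm (T (u + h) x - T u x)"
        by (auto simp: u_def h_def min_def abs_if norm_minus_commute)
      also have "\<dots> = norm (T u (T h x - x))" using uh by (simp add: T_add T_lin)
      also have "\<dots> \<le> M * norm (T h x - x)" using M uh by simp
      also have "\<dots> < r" using \<delta>(2)[OF uh(2,4)] M by (simp add: dist_norm field_simps)
      finally show ?case by simp
    qed
    then show "\<exists>no. \<forall>n\<ge>no. norm (T (s n) x - T t x - 0) < r"
      by (simp add: eventually_sequentially)
  qed
  moreover have "(\<lambda>n. T (s n) (xs n - x)) \<longlonglongrightarrow> 0"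
  proof (rule Lim_null_comparison)
    show "\<forall>\<^sub>F n in sequentially. norm (T (s n) (xs n - x)) \<le> M * norm (xs n - x)"
      using ev by eventually_elim (use s M in auto)
    show "(\<lambda>n. M * norm (xs n - x)) \<longlonglongrightarrow> 0"
      by (intro tendsto_mult_right_zero tendsto_norm_zero LIM_zero x)
  qed
  ultimately have "(\<lambda>n. (T (s n) x - T t x) + T (s n) (xs n - x)) \<longlonglongrightarrow> 0 + 0" by (rule tendsto_add)
  moreover have "(T (s n) x - T t x) + T (s n) (xs n - x) = T (s n) (xs n) - T t x" for n
    using s by (simp add: T_lin)
  ultimately have "(\<lambda>n. T (s n) (xs n) - T t x) \<longlonglongrightarrow> 0" by simp
  then show ?thesis by (rule LIM_zero_cancel)
qed

lemma T_continuous_time: "continuous_on {0..} (\<lambda>t. T t x)"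
  unfolding continuous_on_sequentially o_def
  by (auto intro!: T_tendsto)

end

locale c0_generator = c0_semigroup T for T :: "real \<Rightarrow> 'a::banach \<Rightarrow> 'a" +
  fixes D :: "'a set" and A :: "'a \<Rightarrow> 'a"
  assumes gen: "generates D A T"
begin

lemma in_D_iff: "x \<in> D \<longleftrightarrow> (\<exists>y. ((\<lambda>t. (T t x - x) /\<^sub>R t) \<longlongrightarrow> y) (at_right 0))"
  and A_limit: "x \<in> D \<Longrightarrow> ((\<lambda>t. (T t x - x) /\<^sub>R t) \<longlongrightarrow> A x) (at_right 0)"
  using gen by (auto simp: generates_def)

lemma A_eqI: "((\<lambda>t. (T t x - x) /\<^sub>R t) \<longlongrightarrow> y) (at_right 0) \<Longrightarrow> x \<in> D \<and> A x = y"
  using tendsto_unique[OF trivial_limit_at_right_real A_limit[of x]] in_D_iff[of x] by blast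

lemma T_commute:
  assumes x: "x \<in> D" and t: "t \<ge> 0"
  shows "T t x \<in> D \<and> A (T t x) = T t (A x)"
proof (rule A_eqI)
  have "((\<lambda>h. T t ((T h x - x) /\<^sub>R h)) \<longlongrightarrow> T t (A x)) (at_right 0)"
    by (rule bounded_linear.tendsto[OF T_linear[OF t] A_limit[OF x]])
  moreover have "\<forall>\<^sub>F h in at_right 0. T t ((T h x - x) /\<^sub>R h) = (T h (T t x) - T t x) /\<^sub>R h"
    unfolding eventually_at_right_field
    by (rule exI[of _ 1]) (use t in \<open>auto simp: T_lin T_add[symmetric] add.commute\<close>)
  ultimately show "((\<lambda>h. (T h (T t x) - T t x) /\<^sub>R h) \<longlongrightarrow> T t (A x)) (at_right 0)"
    by (rule Lim_transform_eventually)
qed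

text \<open>The generator only gives a right derivative at 0. With \<open>u n\<close> the smaller of
  the two times, left and right quotients both become \<open>T (u n)\<close> applied to a right
  quotient at 0, and joint continuity yields the limit.\<close>

lemma T_derivative:
  assumes x: "x \<in> D" and t: "t \<ge> 0"
  shows "((\<lambda>t. T t x) has_vector_derivative T t (A x)) (at t within {0..})"
  unfolding has_vector_derivative_def has_derivative_within
proof (intro conjI)
  show "bounded_linear (\<lambda>h. h *\<^sub>R T t (A x))" by (rule bounded_linear_scaleR_left)
  show "((\<lambda>y. (1 / norm (y - t)) *\<^sub>R (T y x - (T t x + (y - t) *\<^sub>R T t (A x)))) \<longlongrightarrow> 0) (at t within {0..})"
    unfolding tendsto_at_iff_sequentially o_def
  proof (intro allI impI)
    fix s assume s: "\<forall>n. s n \<in> {0..} - {t}" "s \<longlonglongrightarrow> t"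
    define h where "h n = \<bar>s n - t\<bar>" for n
    define u where "u n = min (s n) t" for n
    have hu: "h n > 0" "u n \<ge> 0" for n using s t by (auto simp: h_def u_def)
    have "(\<lambda>n. \<bar>s n - t\<bar>) \<longlonglongrightarrow> \<bar>t - t\<bar>" by (intro tendsto_intros s)
    then have h0: "h \<longlonglongrightarrow> 0" by (simp add: h_def[abs_def])
    have "(\<lambda>n. min (s n) t) \<longlonglongrightarrow> min t t" by (intro tendsto_intros s)
    then have u0: "u \<longlonglongrightarrow> t" by (simp add: u_def[abs_def])
    have "filterlim h (at_right 0) sequentially" using h0 hu(1) less_imp_neq[OF hu(1), symmetric] by (simp add: filterlim_at)
    from filterlim_compose[OF A_limit[OF x] this]
    have "(\<lambda>n. (T (h n) x - x) /\<^sub>R h n) \<longlonglongrightarrow> A x" .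
    from T_tendsto[OF hu(2) u0 this] have 1: "(\<lambda>n. T (u n) ((T (h n) x - x) /\<^sub>R h n)) \<longlonglongrightarrow> T t (A x)" .
    have 2: "T (s n) x - T t x = (s n - t) *\<^sub>R T (u n) ((T (h n) x - x) /\<^sub>R h n)" for n
    proof -
      have "T (u n) ((T (h n) x - x) /\<^sub>R h n) = (T (u n + h n) x - T (u n) x) /\<^sub>R h n"
        using hu[of n] by (simp add: T_lin T_add)
      moreover have "(s n - t) * inverse (t - s n) = - 1" if "s n < t"
        using that by (simp add: field_simps)
      ultimately show ?thesis
        using hu(1)[of n] by (cases "s n \<le> t") (auto simp: u_def h_def scaleR_diff_right)
    qed
    have "(\<lambda>n. norm (T (u n) ((T (h n) x - x) /\<^sub>R h n) - T t (A x))) \<longlonglongrightarrow> 0"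
      by (intro tendsto_norm_zero LIM_zero 1)
    moreover have "norm ((1 / norm (s n - t)) *\<^sub>R (T (s n) x - (T t x + (s n - t) *\<^sub>R T t (A x))))
        = norm (T (u n) ((T (h n) x - x) /\<^sub>R h n) - T t (A x))" for n
    proof -
      have "T (s n) x - (T t x + (s n - t) *\<^sub>R T t (A x))
          = (s n - t) *\<^sub>R (T (u n) ((T (h n) x - x) /\<^sub>R h n) - T t (A x))"
        unfolding diff_diff_add[symmetric] 2 by (simp add: scaleR_diff_right)
      then show ?thesis using s(1) by auto
    qed
    ultimately have "(\<lambda>n. norm ((1 / norm (s n - t)) *\<^sub>R (T (s n) x - (T t x + (s n - t) *\<^sub>R T t (A x))))) \<longlonglongrightarrow> 0"
      by simp
    then show "(\<lambda>n. (1 / norm (s n - t)) *\<^sub>R (T (s n) x - (T t x + (s n - t) *\<^sub>R T t (A x)))) \<longlonglongrightarrow> 0"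
      by (rule tendsto_norm_zero_cancel)
  qed
qed

text \<open>Shifting the interval of integration gives T r (J h) - J h = (J (h + r) - J h) - J r;
  after division by r both differences converge because J is a primitive of the orbit.\<close>

lemma integral_in_D:
  assumes h: "h > 0"
  shows "integral {0..h} (\<lambda>s. T s x) \<in> D"
proof -
  have ci: "continuous_on {a..b} (\<lambda>s. T s x)" if "a \<ge> 0" for a b
    by (rule continuous_on_subset[OF T_continuous_time]) (use that in auto)
  have int: "(\<lambda>s. T s x) integrable_on {a..b}" if "a \<ge> 0" for a b
    by (rule integrable_continuous_interval[OF ci[OF that]])
  define J where "J u = integral {0..u} (\<lambda>s. T s x)" for u
  have J_der: "(J has_vector_derivative T u x) (at u within {0..u + 1})" if "u \<ge> 0" for u
    unfolding J_def by (rule integral_has_vector_derivative[OF ci]) (use that in auto)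
  have J_lim: "((\<lambda>r. (J (u + r) - J u) /\<^sub>R r) \<longlongrightarrow> T u x) (at_right 0)" if u: "u \<ge> 0" for u
    unfolding tendsto_at_iff_sequentially o_def
  proof (intro allI impI)
    fix r :: "nat \<Rightarrow> real" assume r: "\<forall>n. r n \<in> {0<..} - {0}" "r \<longlonglongrightarrow> 0"
    have "(\<lambda>n. u + r n) \<longlonglongrightarrow> u + 0" by (intro tendsto_intros r)
    moreover have "\<forall>\<^sub>F n in sequentially. r n < 1" using r(2) by (rule order_tendstoD) simp
    ultimately have fl: "filterlim (\<lambda>n. u + r n) (at u within {0..u + 1}) sequentially"
      unfolding filterlim_at using r(1) u by (auto elim!: eventually_mono simp: less_imp_le less_imp_neq[symmetric])
    have "((\<lambda>y. (J y - J u) /\<^sub>R (y - u)) \<longlongrightarrow> T u x) (at u within {0..u + 1})"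
      using J_der[OF u] by (rule has_vector_derivative_quotient)
    from filterlim_compose[OF this fl] show "(\<lambda>n. (J (u + r n) - J u) /\<^sub>R r n) \<longlonglongrightarrow> T u x" by simp
  qed
  have shift: "T r (J h) - J h = (J (h + r) - J h) - J r" if r: "r > 0" for r
  proof -
    have "T r (J h) = integral {0..h} (\<lambda>s. T r (T s x))"
      unfolding J_def using integral_linear[OF int[of 0 h] T_linear[of r]] r by (simp add: o_def)
    also have "\<dots> = integral {0..h} (\<lambda>s. T (s + r) x)"
      by (intro integral_cong) (use r in \<open>simp add: T_add[symmetric] add.commute\<close>)
    also have "\<dots> = integral {r..h + r} (\<lambda>s. T s x)"
      using integral_shift_Icc_real[of 0 h "\<lambda>s. T s x" r] by (simp add: o_def add.commute)
    also have "\<dots> = J (h + r) - J r"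
      unfolding J_def using Henstock_Kurzweil_Integration.integral_combine[of 0 r "h + r" "\<lambda>s. T s x"] int[of 0] r h
      by (simp add: algebra_simps)
    finally show ?thesis by simp
  qed
  have J0: "J 0 = 0" by (simp add: J_def)
  have "((\<lambda>r. (J (h + r) - J h) /\<^sub>R r - (J (0 + r) - J 0) /\<^sub>R r) \<longlongrightarrow> T h x - T 0 x) (at_right 0)"
    by (intro tendsto_diff J_lim) (use h in auto)
  then have "((\<lambda>r. (T r (J h) - J h) /\<^sub>R r) \<longlongrightarrow> T h x - T 0 x) (at_right 0)"
  proof (rule Lim_transform_eventually)
    show "\<forall>\<^sub>F r in at_right 0. (J (h + r) - J h) /\<^sub>R r - (J (0 + r) - J 0) /\<^sub>R r = (T r (J h) - J h) /\<^sub>R r"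
      unfolding eventually_at_right_field
      by (rule exI[of _ 1]) (auto simp: shift J0 scaleR_diff_right)
  qed
  from A_eqI[OF this] show ?thesis by (simp add: J_def)
qed

text \<open>Averages of the orbit over [0, 1/(n + 1)] lie in \<open>D\<close> and tend to
  \<open>x\<close>.\<close>

lemma D_dense:
  obtains xs where "\<And>n. xs n \<in> D" "xs \<longlonglongrightarrow> x"
proof -
  define J where "J u = integral {0..u} (\<lambda>s. T s x)" for u
  have ci: "continuous_on {0..b} (\<lambda>s. T s x)" for b
    by (rule continuous_on_subset[OF T_continuous_time]) auto
  have "(J has_vector_derivative T 0 x) (at 0 within {0..1})"
    unfolding J_def by (rule integral_has_vector_derivative[OF ci]) auto
  then have J: "((\<lambda>y. (J y - J 0) /\<^sub>R (y - 0)) \<longlongrightarrow> T 0 x) (at 0 within {0..1})"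
    by (rule has_vector_derivative_quotient)
  have "(\<lambda>n. 1 / real (Suc n)) \<longlonglongrightarrow> 0" by real_asymp
  then have "filterlim (\<lambda>n. 1 / real (Suc n)) (at 0 within {0..1}) sequentially"
    unfolding filterlim_at by (auto simp: divide_le_eq)
  from filterlim_compose[OF J this] have lim: "(\<lambda>n. J (1 / real (Suc n)) /\<^sub>R (1 / real (Suc n))) \<longlonglongrightarrow> x"
    by (simp add: J_def T_0)
  have sc: "c *\<^sub>R y \<in> D" if "y \<in> D" for c y
  proof -
    have "((\<lambda>t. c *\<^sub>R ((T t y - y) /\<^sub>R t)) \<longlongrightarrow> c *\<^sub>R A y) (at_right 0)"
      by (intro tendsto_intros A_limit that)
    moreover have "\<forall>\<^sub>F t in at_right 0. c *\<^sub>R ((T t y - y) /\<^sub>R t) = (T t (c *\<^sub>R y) - c *\<^sub>R y) /\<^sub>R t"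
      unfolding eventually_at_right_field by (rule exI[of _ 1]) (auto simp: T_lin scaleR_diff_right mult.commute)
    ultimately have "((\<lambda>t. (T t (c *\<^sub>R y) - c *\<^sub>R y) /\<^sub>R t) \<longlongrightarrow> c *\<^sub>R A y) (at_right 0)"
      by (rule Lim_transform_eventually)
    then show ?thesis using A_eqI by blast
  qed
  show thesis
    by (rule that[OF _ lim]) (auto intro!: sc integral_in_D simp: J_def)
qed

end

text \<open>The nodes are counted down from \<open>t\<close>: the left point i t / n of a
  convolution sum carries the semigroup at time t - i t / n.\<close>

lemma riemann_sum_tendsto:
  fixes g :: "real \<Rightarrow> 'b::banach"
  assumes g: "continuous_on {0..t} g" and t: "t \<ge> 0"
  shows "(\<lambda>n. \<Sum>i<n. (t / real n) *\<^sub>R g (t - real i * (t / real n))) \<longlonglongrightarrow> integral {0..t} g"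
proof (rule LIMSEQ_I)
  fix r :: real assume r: "r > 0"
  \<comment> \<open>Adding 1 to \<open>t\<close> keeps the denominator positive when
    \<open>t\<close> is 0.\<close>
  define \<epsilon> where "\<epsilon> = r / (2 * (t + 1))"
  have \<epsilon>: "\<epsilon> > 0" using r t by (simp add: \<epsilon>_def)
  have "uniformly_continuous_on {0..t} g"
    by (rule compact_uniformly_continuous[OF g]) simp
  then obtain \<delta> where \<delta>: "\<delta> > 0"
    and unif: "\<And>u v. u \<in> {0..t} \<Longrightarrow> v \<in> {0..t} \<Longrightarrow> dist u v < \<delta> \<Longrightarrow> dist (g u) (g v) < \<epsilon>"
    unfolding uniformly_continuous_on_def using \<epsilon> by metis
  obtain n0 :: nat where n0: "t / \<delta> < real n0" using reals_Archimedean2 by blast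
  have "norm ((\<Sum>i<n. (t / real n) *\<^sub>R g (t - real i * (t / real n))) - integral {0..t} g) < r"
    if n: "n \<ge> Suc n0" for n
  proof -
    define h where "h = t / real n"
    have n0': "real n > 0" using n by simp
    have h: "h \<ge> 0" "real n * h = t" using t n0' by (auto simp: h_def)
    have "t < \<delta> * real n0" using n0 \<delta> by (simp add: field_simps)
    also have "\<dots> < \<delta> * real n" using n \<delta> by simp
    finally have h\<delta>: "h < \<delta>" using n0' by (simp add: h_def field_simps)
    define G where "G u = integral {0..u} g" for u
    define b where "b i = t - real i * h" for i :: nat
    have b_bounds: "0 \<le> b (Suc i)" "b (Suc i) \<le> b i" "b i \<le> t" "b i - b (Suc i) = h" if "i < n" for i
    proof -
      have "real (Suc i) * h \<le> real n * h" using that h(1) by (intro mult_right_mono) auto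
      then show "0 \<le> b (Suc i)" using h by (simp add: b_def)
    qed (use h in \<open>auto simp: b_def algebra_simps\<close>)
    have piece: "norm (h *\<^sub>R g (b i) - (G (b i) - G (b (Suc i)))) \<le> h * \<epsilon>" if i: "i < n" for i
    proof -
      note bb = b_bounds[OF i]
      have ig: "g integrable_on {0..b i}" "g integrable_on {b (Suc i)..b i}"
        by (rule integrable_continuous_interval[OF continuous_on_subset[OF g]]; use bb in auto)+
      have e1: "G (b (Suc i)) + integral {b (Suc i)..b i} g = G (b i)"
        unfolding G_def by (rule Henstock_Kurzweil_Integration.integral_combine[OF bb(1,2) ig(1)])
      have "((\<lambda>u. g (b i)) has_integral (b i - b (Suc i)) *\<^sub>R g (b i)) {b (Suc i)..b i}"
        using has_integral_const_real[of "g (b i)" "b (Suc i)" "b i"] bb by simp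
      from has_integral_diff[OF this integrable_integral[OF ig(2)]]
      have "((\<lambda>u. g (b i) - g u) has_integral h *\<^sub>R g (b i) - integral {b (Suc i)..b i} g) {b (Suc i)..b i}"
        unfolding bb(4) .
      then have e2: "h *\<^sub>R g (b i) - integral {b (Suc i)..b i} g = integral {b (Suc i)..b i} (\<lambda>u. g (b i) - g u)"
        by (rule integral_unique[symmetric])
      have e3: "norm (integral {b (Suc i)..b i} (\<lambda>u. g (b i) - g u)) \<le> \<epsilon> * (b i - b (Suc i))"
      proof (rule integral_bound[OF bb(2)])
        show "continuous_on {b (Suc i)..b i} (\<lambda>u. g (b i) - g u)"
          by (intro continuous_intros continuous_on_subset[OF g]) (use bb in auto)
        fix u assume u: "u \<in> {b (Suc i)..b i}"
        have "dist (b i) u < \<delta>" using u bb(4) h\<delta> by (auto simp: dist_real_def)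
        then show "norm (g (b i) - g u) \<le> \<epsilon>"
          using unif[of "b i" u] u bb by (auto simp: dist_norm less_imp_le)
      qed
      have "h *\<^sub>R g (b i) - (G (b i) - G (b (Suc i))) = integral {b (Suc i)..b i} (\<lambda>u. g (b i) - g u)"
        unfolding e1[symmetric] e2[symmetric] by simp
      then show ?thesis using e3 bb(4) by (simp add: mult.commute)
    qed
    have "integral {0..t} g = G (b 0) - G (b n)" using h by (simp add: G_def b_def)
    also have "\<dots> = (\<Sum>i<n. G (b i) - G (b (Suc i)))" by (rule sum_lessThan_telescope'[symmetric])
    finally have "norm ((\<Sum>i<n. h *\<^sub>R g (b i)) - integral {0..t} g)
        = norm (\<Sum>i<n. h *\<^sub>R g (b i) - (G (b i) - G (b (Suc i))))"
      by (simp add: sum_subtractf)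
    also have "\<dots> \<le> (\<Sum>i<n. h * \<epsilon>)" by (rule sum_norm_le) (use piece in auto)
    also have "\<dots> = t * \<epsilon>" using h(2) by simp
    also have "\<dots> \<le> (t + 1) * \<epsilon>" using \<epsilon> by simp
    also have "\<dots> = r / 2" using t unfolding \<epsilon>_def by (simp add: divide_simps)
    also have "\<dots> < r" using r by simp
    finally show ?thesis by (simp add: h_def b_def)
  qed
  then show "\<exists>no. \<forall>n\<ge>no. norm ((\<Sum>i<n. (t / real n) *\<^sub>R g (t - real i * (t / real n))) - integral {0..t} g) < r"
    by blast
qed

lemma norm_iexp_diff_le: "cmod (iexp x - iexp y) \<le> \<bar>x - y\<bar>" and norm_iexp_diff_le_2: "cmod (iexp x - iexp y) \<le> 2"
proof -
  have "iexp x - iexp y = iexp y * (iexp (x - y) - 1)"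
    by (simp add: right_diff_distrib exp_add[symmetric] algebra_simps)
  then have "cmod (iexp x - iexp y) = cmod (iexp (x - y) - 1)" by (simp add: norm_mult)
  also have "\<dots> \<le> \<bar>x - y\<bar>" using iexp_approx1[of "x - y" 0] by simp
  finally show "cmod (iexp x - iexp y) \<le> \<bar>x - y\<bar>" .
  show "cmod (iexp x - iexp y) \<le> 2" using norm_triangle_ineq4[of "iexp x" "iexp y"] by simp
qed

subsection \<open>Convergence in probability\<close>

definition in_prob :: "'w measure \<Rightarrow> (nat \<Rightarrow> 'w \<Rightarrow> 'b::real_normed_vector) \<Rightarrow> ('w \<Rightarrow> 'b) \<Rightarrow> bool" where
  "in_prob M X W \<longleftrightarrow> (\<forall>\<epsilon>>0. (\<lambda>n. measure M {\<omega>\<in>space M. norm (X n \<omega> - W \<omega>) > \<epsilon>}) \<longlonglongrightarrow> 0)"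

lemma in_probD: "in_prob M X W \<Longrightarrow> \<epsilon> > 0 \<Longrightarrow> (\<lambda>n. measure M {\<omega>\<in>space M. norm (X n \<omega> - W \<omega>) > \<epsilon>}) \<longlonglongrightarrow> 0"
  by (simp only: in_prob_def)

context prob_space
begin

lemma in_prob_le:
  fixes X :: "nat \<Rightarrow> 'a \<Rightarrow> 'b::{real_normed_vector, second_countable_topology}"
  assumes X: "in_prob M X W" and c: "c > 0"
    and le: "\<And>n \<omega>. norm (X' n \<omega> - W' \<omega>) \<le> c * norm (X n \<omega> - W \<omega>)"
    and [measurable]: "\<And>n. X n \<in> borel_measurable M" "W \<in> borel_measurable M"
  shows "in_prob M (X' :: nat \<Rightarrow> 'a \<Rightarrow> 'c::{real_normed_vector, second_countable_topology})
     (W' :: 'a \<Rightarrow> 'c)"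
  unfolding in_prob_def
proof (intro allI impI)
  fix \<epsilon> :: real assume \<epsilon>: "\<epsilon> > 0"
  have "(\<lambda>n. prob {\<omega>\<in>space M. norm (X n \<omega> - W \<omega>) > \<epsilon> / c}) \<longlonglongrightarrow> 0"
    by (rule in_probD[OF X]) (use \<epsilon> c in simp)
  then show "(\<lambda>n. prob {\<omega>\<in>space M. norm (X' n \<omega> - W' \<omega>) > \<epsilon>}) \<longlonglongrightarrow> 0"
  proof (rule Lim_null_comparison[rotated])
    have "{\<omega>\<in>space M. norm (X' n \<omega> - W' \<omega>) > \<epsilon>} \<subseteq> {\<omega>\<in>space M. norm (X n \<omega> - W \<omega>) > \<epsilon> / c}" for n
      using le[of n] c by (auto simp: divide_less_eq mult.commute intro: less_le_trans)
    then show "\<forall>\<^sub>F n in sequentially. norm (prob {\<omega>\<in>space M. norm (X' n \<omega> - W' \<omega>) > \<epsilon>})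
        \<le> prob {\<omega>\<in>space M. norm (X n \<omega> - W \<omega>) > \<epsilon> / c}"
      by (auto intro!: always_eventually finite_measure_mono)
  qed
qed

lemma in_prob_add:
  fixes X X' :: "nat \<Rightarrow> 'a \<Rightarrow> 'c::{real_normed_vector, second_countable_topology}"
  assumes "in_prob M X W" "in_prob M X' W'"
    and [measurable]: "\<And>n. X n \<in> borel_measurable M" "W \<in> borel_measurable M"
      "\<And>n. X' n \<in> borel_measurable M" "W' \<in> borel_measurable M"
  shows "in_prob M (\<lambda>n \<omega>. X n \<omega> + X' n \<omega>) (\<lambda>\<omega>. W \<omega> + W' \<omega>)"
  unfolding in_prob_def
proof (intro allI impI)
  fix \<epsilon> :: real assume \<epsilon>: "\<epsilon> > 0"
  let ?A = "\<lambda>n. {\<omega>\<in>space M. norm (X n \<omega> - W \<omega>) > \<epsilon> / 2}"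
  let ?B = "\<lambda>n. {\<omega>\<in>space M. norm (X' n \<omega> - W' \<omega>) > \<epsilon> / 2}"
  have "(\<lambda>n. prob (?A n) + prob (?B n)) \<longlonglongrightarrow> 0 + 0"
    by (intro tendsto_add in_probD assms(1,2)) (use \<epsilon> in simp_all)
  then have "(\<lambda>n. prob (?A n) + prob (?B n)) \<longlonglongrightarrow> 0" by simp
  then show "(\<lambda>n. prob {\<omega>\<in>space M. norm (X n \<omega> + X' n \<omega> - (W \<omega> + W' \<omega>)) > \<epsilon>}) \<longlonglongrightarrow> 0"
  proof (rule Lim_null_comparison[rotated])
    have "prob {\<omega>\<in>space M. norm (X n \<omega> + X' n \<omega> - (W \<omega> + W' \<omega>)) > \<epsilon>} \<le> prob (?A n \<union> ?B n)" for n
    proof (rule finite_measure_mono)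
      show "{\<omega>\<in>space M. norm (X n \<omega> + X' n \<omega> - (W \<omega> + W' \<omega>)) > \<epsilon>} \<subseteq> ?A n \<union> ?B n"
      proof (rule subsetI, rule ccontr)
        fix \<omega> assume "\<omega> \<in> {\<omega>\<in>space M. norm (X n \<omega> + X' n \<omega> - (W \<omega> + W' \<omega>)) > \<epsilon>}" "\<omega> \<notin> ?A n \<union> ?B n"
        then show False
          using norm_diff_triangle_ineq[of "X n \<omega>" "X' n \<omega>" "W \<omega>" "W' \<omega>"] by auto
      qed
    qed measurable
    also have "prob (?A n \<union> ?B n) \<le> prob (?A n) + prob (?B n)" for n
      by (rule measure_Un_le) measurable
    finally show "\<forall>\<^sub>F n in sequentially. norm (prob {\<omega>\<in>space M. norm (X n \<omega> + X' n \<omega> - (W \<omega> + W' \<omega>)) > \<epsilon>})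
        \<le> prob (?A n) + prob (?B n)"
      by (auto intro!: always_eventually)
  qed
qed

text \<open>The integrands differ by at most r/4 off the exceptional set and by at most 2 on it; as
  its probability is below r/4, the total stays under r.\<close>

lemma in_prob_iexp:
  fixes X :: "nat \<Rightarrow> 'a \<Rightarrow> real"
  assumes X: "in_prob M X W"
    and [measurable]: "\<And>n. X n \<in> borel_measurable M" "W \<in> borel_measurable M"
  shows "(\<lambda>n. \<integral>\<omega>. iexp (X n \<omega>) \<partial>M) \<longlonglongrightarrow> (\<integral>\<omega>. iexp (W \<omega>) \<partial>M)"
proof (rule LIMSEQ_I)
  fix r :: real assume r: "r > 0"
  have i: "integrable M (\<lambda>\<omega>. iexp (V \<omega>))" if [measurable]: "V \<in> borel_measurable M" for V :: "'a \<Rightarrow> real"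
    by (rule integrable_const_bound[where B = 1]) auto
  let ?A = "\<lambda>n. {\<omega>\<in>space M. norm (X n \<omega> - W \<omega>) > r / 4}"
  have "(\<lambda>n. prob (?A n)) \<longlonglongrightarrow> 0" by (rule in_probD[OF X]) (use r in simp)
  then have "\<forall>\<^sub>F n in sequentially. prob (?A n) < r / 4" by (rule order_tendstoD) (use r in simp)
  moreover have "norm ((\<integral>\<omega>. iexp (X n \<omega>) \<partial>M) - (\<integral>\<omega>. iexp (W \<omega>) \<partial>M)) < r" if A: "prob (?A n) < r / 4" for n
  proof -
    have int: "integrable M (\<lambda>\<omega>. r / 4 + 2 * indicator (?A n) \<omega>)" by (simp add: emeasure_eq_measure)
    have "norm ((\<integral>\<omega>. iexp (X n \<omega>) \<partial>M) - (\<integral>\<omega>. iexp (W \<omega>) \<partial>M)) = norm (\<integral>\<omega>. iexp (X n \<omega>) - iexp (W \<omega>) \<partial>M)"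
      by (subst Bochner_Integration.integral_diff) (auto intro!: i)
    also have "\<dots> \<le> (\<integral>\<omega>. norm (iexp (X n \<omega>) - iexp (W \<omega>)) \<partial>M)" by (rule integral_norm_bound)
    also have "\<dots> \<le> (\<integral>\<omega>. r / 4 + 2 * indicator (?A n) \<omega> \<partial>M)"
    proof (rule integral_mono[OF _ int])
      show "integrable M (\<lambda>\<omega>. norm (iexp (X n \<omega>) - iexp (W \<omega>)))"
        by (intro integrable_norm Bochner_Integration.integrable_diff i) auto
      fix \<omega> assume "\<omega> \<in> space M"
      then show "norm (iexp (X n \<omega>) - iexp (W \<omega>)) \<le> r / 4 + 2 * indicator (?A n) \<omega>"
        using norm_iexp_diff_le[of "X n \<omega>" "W \<omega>"] norm_iexp_diff_le_2[of "X n \<omega>" "W \<omega>"] r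
        by (auto simp: indicator_def)
    qed
    also have "\<dots> = r / 4 + 2 * prob (?A n)"
      by (subst Bochner_Integration.integral_add) (auto simp: prob_space emeasure_eq_measure)
    also have "\<dots> < r" using A r by simp
    finally show ?thesis .
  qed
  ultimately have "\<forall>\<^sub>F n in sequentially. norm ((\<integral>\<omega>. iexp (X n \<omega>) \<partial>M) - (\<integral>\<omega>. iexp (W \<omega>) \<partial>M)) < r"
    by (auto elim: eventually_mono)
  then show "\<exists>no. \<forall>n\<ge>no. norm ((\<integral>\<omega>. iexp (X n \<omega>) \<partial>M) - (\<integral>\<omega>. iexp (W \<omega>) \<partial>M)) < r"
    by (simp add: eventually_sequentially)
qed

end

lemma stochastic_convolution_in_prob:
  assumes M: "prob_space M" and W: "is_stochastic_convolution M T Z t W"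
    and p: "\<And>n. p n 0 = 0" "\<And>n. p n (N n) = t" "\<And>n i. i < N n \<Longrightarrow> p n i \<le> p n (Suc i)"
    and mesh: "\<And>n i. i < N n \<Longrightarrow> p n (Suc i) - p n i \<le> m n" "m \<longlonglongrightarrow> 0"
    and meas: "\<And>n. (\<lambda>\<omega>. \<Sum>i<N n. T (t - p n i) (Z (p n (Suc i)) \<omega> - Z (p n i) \<omega>)) \<in> borel_measurable M"
  shows "in_prob M (\<lambda>n \<omega>. \<Sum>i<N n. T (t - p n i) (Z (p n (Suc i)) \<omega> - Z (p n i) \<omega>)) W"
  unfolding in_prob_def
proof (intro allI impI)
  interpret prob_space M by fact
  note [measurable] = meas
  have [measurable]: "W \<in> borel_measurable M" using W by (simp add: is_stochastic_convolution_def)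
  fix \<epsilon> :: real assume \<epsilon>: "\<epsilon> > 0"
  let ?S = "\<lambda>n \<omega>. \<Sum>i<N n. T (t - p n i) (Z (p n (Suc i)) \<omega> - Z (p n i) \<omega>)"
  show "(\<lambda>n. prob {\<omega>\<in>space M. norm (?S n \<omega> - W \<omega>) > \<epsilon>}) \<longlonglongrightarrow> 0"
  proof (rule LIMSEQ_I)
    fix r :: real assume r: "r > 0"
    \<comment> \<open>The definition of the convolution uses one number for both the deviation and
      the probability; the minimum serves both tolerances.\<close>
    define \<eta> where "\<eta> = min \<epsilon> r"
    have \<eta>: "\<eta> > 0" "\<eta> \<le> \<epsilon>" "\<eta> \<le> r" using \<epsilon> r by (auto simp: \<eta>_def)
    from W[unfolded is_stochastic_convolution_def, THEN conjunct2, rule_format, OF \<eta>(1)]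
    obtain \<delta> where \<delta>: "\<delta> > 0" and close: "\<forall>n p. p 0 = 0 \<and> p n = t \<and>
        (\<forall>i<n. p i \<le> p (Suc i) \<and> p (Suc i) - p i < \<delta>) \<longrightarrow>
        prob {\<omega>\<in>space M. norm ((\<Sum>i<n. T (t - p i) (Z (p (Suc i)) \<omega> - Z (p i) \<omega>)) - W \<omega>) > \<eta>} < \<eta>"
      by (elim exE conjE) (rule that)
    have "\<forall>\<^sub>F n in sequentially. m n < \<delta>" using mesh(2) \<delta> by (rule order_tendstoD)
    then have "\<forall>\<^sub>F n in sequentially. norm (prob {\<omega>\<in>space M. norm (?S n \<omega> - W \<omega>) > \<epsilon>} - 0) < r"
    proof eventually_elim
      case (elim n)
      have "prob {\<omega>\<in>space M. norm (?S n \<omega> - W \<omega>) > \<epsilon>} \<le> prob {\<omega>\<in>space M. norm (?S n \<omega> - W \<omega>) > \<eta>}"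
        using \<eta> by (intro finite_measure_mono) auto
      also have "\<dots> < \<eta>"
        by (rule close[rule_format]) (use p le_less_trans[OF mesh(1)[of _ n] elim] in auto)
      finally show ?case using \<eta> by simp
    qed
    then show "\<exists>no. \<forall>n\<ge>no. norm (prob {\<omega>\<in>space M. norm (?S n \<omega> - W \<omega>) > \<epsilon>} - 0) < r"
      by (simp add: eventually_sequentially)
  qed
qed

locale ou_setting =
  fixes Q A :: "'a::{real_inner, banach, second_countable_topology} \<Rightarrow> 'a"
    and a :: 'a and \<nu> :: "'a measure" and M :: "'w measure" and Z Y :: "real \<Rightarrow> 'w \<Rightarrow> 'a"
    and D :: "'a set" and T T' :: "real \<Rightarrow> 'a \<Rightarrow> 'a"
  assumes Q_trace_class: "trace_class Q"
    and Q_symmetric: "\<And>x y. Q x \<bullet> y = x \<bullet> Q y"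
    and \<nu>_borel: "sets \<nu> = sets borel"
    and \<nu>_integrable: "(\<integral>\<^sup>+ y. ennreal (min 1 ((norm y)\<^sup>2)) \<partial>\<nu>) < \<infinity>"
    and Z_levy: "levy_process M Z"
    and Z_char: "\<And>t h. t \<ge> 0 \<Longrightarrow>
      (\<integral>\<omega>. exp (\<i> * complex_of_real (Z t \<omega> \<bullet> h)) \<partial>M) = exp (- complex_of_real t * levy_exponent Q a \<nu> h)"
    and A_generates: "generates D A T"
    and A_adjoint_generates: "generates (adj_dom D A) (adj_op D A) T'"
    and Y_conv: "\<And>t. t \<ge> 0 \<Longrightarrow> is_stochastic_convolution M T Z t (Y t)"
begin

sublocale T: c0_generator T D A
  using A_generates by unfold_locales (auto simp: generates_def)

sublocale T': c0_generator T' "adj_dom D A" "adj_op D A"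
  using A_adjoint_generates by unfold_locales (auto simp: generates_def)

sublocale prob_space M
  using Z_levy by (simp add: levy_process_def)

subsection \<open>Adjoint semigroup\<close>

text \<open>Density of \<open>D\<close> makes the vector \<open>z\<close> unique, so the description
  in \<open>adj_op\<close> returns it.\<close>

lemma adj_op_eqI:
  assumes z: "\<And>x. x \<in> D \<Longrightarrow> A x \<bullet> y = x \<bullet> z"
  shows "y \<in> adj_dom D A" "adj_op D A y = z"
proof -
  show "y \<in> adj_dom D A" using z by (auto simp: adj_dom_def)
  show "adj_op D A y = z"
    unfolding adj_op_def
  proof (rule the_equality)
    show "\<forall>x\<in>D. A x \<bullet> y = x \<bullet> z" using z by blast
    fix z' assume z': "\<forall>x\<in>D. A x \<bullet> y = x \<bullet> z'"
    obtain xs where xs: "\<And>n. xs n \<in> D" "xs \<longlonglongrightarrow> z' - z"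
      using T.D_dense[of "z' - z"] by metis
    have "(\<lambda>n. xs n \<bullet> (z' - z)) \<longlonglongrightarrow> (z' - z) \<bullet> (z' - z)"
      by (intro tendsto_intros xs)
    moreover have "xs n \<bullet> (z' - z) = 0" for n
      using z'[rule_format, OF xs(1)] z[OF xs(1)] by (simp add: inner_diff_right)
    ultimately have "(z' - z) \<bullet> (z' - z) = 0" by (simp add: LIMSEQ_const_iff)
    then show "z' = z" by simp
  qed
qed

lemma adj_op_eq:
  assumes "y \<in> adj_dom D A" "x \<in> D"
  shows "A x \<bullet> y = x \<bullet> adj_op D A y"
proof -
  obtain z where "\<And>x. x \<in> D \<Longrightarrow> A x \<bullet> y = x \<bullet> z" using assms(1) by (auto simp: adj_dom_def)
  with adj_op_eqI[of y z] assms(2) show ?thesis by simp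
qed

text \<open>\<open>T'\<close> is given only through its generator, the adjoint of \<open>A\<close>.
  For vectors in the two domains the pairing of \<open>T (t - s) x\<close> with
  \<open>T' s y\<close> has derivative zero in \<open>s\<close>; comparing the ends and using
  density of both domains gives adjointness.\<close>

lemma T_adjoint:
  assumes t: "t \<ge> 0"
  shows "T t x \<bullet> y = x \<bullet> T' t y"
proof -
  have core: "T t x \<bullet> y = x \<bullet> T' t y" if x: "x \<in> D" and y: "y \<in> adj_dom D A" for x y
  proof -
    define \<phi> where "\<phi> s = T (t - s) x \<bullet> T' s y" for s
    have "(\<phi> has_vector_derivative 0) (at s within {0..t})" if s: "s \<in> {0..t}" for s
    proof -
      have s0: "0 \<le> s" "0 \<le> t - s" using s by auto
      have 1: "((\<lambda>s. T' s y) has_vector_derivative T' s (adj_op D A y)) (at s within {0..t})"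
        by (rule has_vector_derivative_within_subset[OF T'.T_derivative[OF y s0(1)]]) auto
      have "((\<lambda>s. t - s) has_vector_derivative - 1) (at s within {0..t})"
        by (auto intro!: derivative_eq_intros)
      moreover have "((\<lambda>t. T t x) has_vector_derivative T (t - s) (A x)) (at (t - s) within (\<lambda>s. t - s) ` {0..t})"
        by (rule has_vector_derivative_within_subset[OF T.T_derivative[OF x s0(2)]]) auto
      ultimately have 2: "((\<lambda>s. T (t - s) x) has_vector_derivative - T (t - s) (A x)) (at s within {0..t})"
        using vector_diff_chain_within[of "\<lambda>s. t - s" "- 1" s "{0..t}" "\<lambda>t. T t x"] by (simp add: o_def)
      have "T (t - s) x \<bullet> T' s (adj_op D A y) = T (t - s) (A x) \<bullet> T' s y"
        using T.T_commute[OF x s0(2)] T'.T_commute[OF y s0(1)] adj_op_eq[of "T' s y" "T (t - s) x"] by simp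
      moreover have "(\<phi> has_vector_derivative T (t - s) x \<bullet> T' s (adj_op D A y) + - T (t - s) (A x) \<bullet> T' s y) (at s within {0..t})"
        using has_derivative_inner[OF 2[unfolded has_vector_derivative_def] 1[unfolded has_vector_derivative_def]]
        unfolding \<phi>_def has_vector_derivative_def
        by (rule has_derivative_eq_rhs) (auto simp: algebra_simps)
      ultimately show ?thesis by simp
    qed
    then obtain c where c: "\<And>s. s \<in> {0..t} \<Longrightarrow> \<phi> s = c"
      using has_vector_derivative_zero_constant[of "{0..t}" \<phi>] by auto
    have "\<phi> 0 = \<phi> t" using c[of 0] c[of t] t by simp
    then show ?thesis by (simp add: \<phi>_def T.T_0 T'.T_0)
  qed
  obtain xs where xs: "\<And>n. xs n \<in> D" "xs \<longlonglongrightarrow> x" using T.D_dense[of x] by metis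
  obtain ys where ys: "\<And>n. ys n \<in> adj_dom D A" "ys \<longlonglongrightarrow> y" using T'.D_dense[of y] by metis
  have "(\<lambda>n. T t (xs n) \<bullet> ys n) \<longlonglongrightarrow> T t x \<bullet> y"
    by (intro tendsto_inner ys bounded_linear.tendsto[OF T.T_linear[OF t]] xs)
  moreover have "(\<lambda>n. xs n \<bullet> T' t (ys n)) \<longlonglongrightarrow> x \<bullet> T' t y"
    by (intro tendsto_inner xs bounded_linear.tendsto[OF T'.T_linear[OF t]] ys)
  ultimately show ?thesis using core[OF xs(1) ys(1)] LIMSEQ_unique by fastforce
qed

text \<open>The squared norm of \<open>T' t y\<close> is the pairing of \<open>T t (T' t y)\<close>
  with \<open>y\<close>; one factor cancels.\<close>

lemma T'_bound:
  assumes "t \<ge> 0" "\<And>x. norm (T t x) \<le> K * norm x"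
  shows "norm (T' t y) \<le> K * norm y"
proof -
  have "(norm (T' t y))\<^sup>2 = T t (T' t y) \<bullet> y"
    using T_adjoint[OF assms(1)] by (simp add: power2_norm_eq_inner)
  also have "\<dots> \<le> norm (T t (T' t y)) * norm y" by (rule norm_cauchy_schwarz)
  also have "\<dots> \<le> (K * norm (T' t y)) * norm y" by (intro mult_right_mono assms) auto
  finally have le: "norm (T' t y) * norm (T' t y) \<le> norm (T' t y) * (K * norm y)"
    by (simp add: power2_eq_square mult_ac)
  show ?thesis
  proof (cases "norm (T' t y) = 0")
    case True
    have "0 \<le> norm (T t y)" by simp
    also have "\<dots> \<le> K * norm y" by (rule assms(2))
    finally show ?thesis using True by simp
  next
    case False
    then have "norm (T' t y) > 0" by simp
    with le show ?thesis by (metis mult_le_cancel_left_pos)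
  qed
qed

lemma bounds_on:
  obtains K where "K \<ge> 1" "\<And>t x. 0 \<le> t \<Longrightarrow> t \<le> r \<Longrightarrow> norm (T t x) \<le> K * norm x"
    "\<And>t x. 0 \<le> t \<Longrightarrow> t \<le> r \<Longrightarrow> norm (T' t x) \<le> K * norm x"
proof -
  obtain K where K: "K \<ge> 1" "\<And>t x. 0 \<le> t \<Longrightarrow> t \<le> r \<Longrightarrow> norm (T t x) \<le> K * norm x"
    using T.T_bounded[of r] by metis
  show thesis by (rule that[OF K(1) K(2) T'_bound]) (use K in auto)
qed

subsection \<open>The characteristic exponent\<close>

abbreviation "\<psi> \<equiv> levy_exponent Q a \<nu>"
abbreviation "m \<equiv> \<lambda>y :: 'a. min 1 ((norm y)\<^sup>2)"

lemma Q_linear: "bounded_linear Q" using Q_trace_class by (simp add: trace_class_def)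

lemma \<nu>_measurable: "f \<in> borel_measurable borel \<Longrightarrow> f \<in> borel_measurable \<nu>"
  using measurable_cong_sets[OF \<nu>_borel refl] by blast

lemma integrable_m: "integrable \<nu> m"
  by (rule integrableI_nonneg) (use \<nu>_integrable in \<open>auto intro!: \<nu>_measurable\<close>)

lemma integrable_dominated_m:
  fixes f :: "'a \<Rightarrow> 'b::{banach, second_countable_topology}"
  assumes "f \<in> borel_measurable borel" "\<And>y. norm (f y) \<le> c * m y"
  shows "integrable \<nu> f"
proof (rule Bochner_Integration.integrable_bound[of _ "\<lambda>y. c * m y"])
  show "integrable \<nu> (\<lambda>y. c * m y)" using integrable_m by simp
  show "f \<in> borel_measurable \<nu>" by (rule \<nu>_measurable[OF assms(1)])
  show "AE y in \<nu>. norm (f y) \<le> norm (c * m y)"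
    using assms(2) by (auto intro!: AE_I2 order_trans[OF assms(2) abs_ge_self])
qed

lemma integral_tendsto_m:
  fixes f :: "nat \<Rightarrow> 'a \<Rightarrow> 'b::{banach, second_countable_topology}"
  assumes "\<And>n. f n \<in> borel_measurable borel" "g \<in> borel_measurable borel" "\<And>n y. norm (f n y) \<le> c * m y"
    "\<And>y. (\<lambda>n. f n y) \<longlonglongrightarrow> g y"
  shows "(\<lambda>n. integral\<^sup>L \<nu> (f n)) \<longlonglongrightarrow> integral\<^sup>L \<nu> g"
  by (rule integral_dominated_convergence[where w = "\<lambda>y. c * m y"])
    (use assms integrable_m in \<open>auto intro!: \<nu>_measurable\<close>)

definition levy_int :: "'a \<Rightarrow> 'a \<Rightarrow> complex" where
  "levy_int h y = exp (\<i> * complex_of_real (h \<bullet> y)) - 1 - \<i> * complex_of_real ((h \<bullet> y) * indicator (cball 0 1) y)"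

text \<open>Second order expansion on the unit ball and the trivial bound 2 outside; 2 + |h|^2
  dominates both.\<close>

lemma levy_int_bound: "cmod (levy_int h y) \<le> (2 + (norm h)\<^sup>2) * m y"
proof (cases "norm y \<le> 1")
  case True
  then have ind: "indicator (cball 0 1) y = (1 :: real)" by simp
  have "cmod (levy_int h y) \<le> \<bar>h \<bullet> y\<bar>\<^sup>2 / 2"
    using iexp_approx1[of "h \<bullet> y" 1] unfolding levy_int_def ind
    by (simp add: numeral_2_eq_2 diff_diff_eq)
  also have "\<dots> \<le> (norm h * norm y)\<^sup>2"
    using power_mono[OF Cauchy_Schwarz_ineq2[of h y] abs_ge_zero, of 2] zero_le_power2[of "norm h * norm y"]
    by linarith
  also have "\<dots> \<le> (2 + (norm h)\<^sup>2) * (norm y)\<^sup>2"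
    by (simp add: power_mult_distrib distrib_right)
  finally have "cmod (levy_int h y) \<le> (2 + (norm h)\<^sup>2) * (norm y)\<^sup>2" .
  moreover have "m y = (norm y)\<^sup>2" using True abs_square_le_1[of "norm y"] by (simp add: min_absorb2)
  ultimately show ?thesis by (simp only:)
next
  case False
  then have "1 \<le> (norm y)\<^sup>2" by (intro one_le_power) simp
  then have "m y = 1" by simp
  moreover have "cmod (levy_int h y) \<le> 2"
    using False norm_iexp_diff_le_2[of "h \<bullet> y" 0] by (simp add: levy_int_def)
  moreover have "0 \<le> (norm h)\<^sup>2" by simp
  ultimately show ?thesis by (simp only: mult_1_right)
qed

lemma levy_int_measurable: "levy_int h \<in> borel_measurable borel"
proof -
  have [measurable]: "indicator (cball 0 1) \<in> borel_measurable (borel :: 'a measure)"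
    by (rule borel_measurable_indicator) simp
  show ?thesis unfolding levy_int_def[abs_def] by measurable
qed

lemma levy_int_integrable: "integrable \<nu> (levy_int h)"
  by (rule integrable_dominated_m[OF levy_int_measurable levy_int_bound])

lemma \<psi>_eq: "\<psi> h = complex_of_real (Q h \<bullet> h) / 2 - \<i> * complex_of_real (a \<bullet> h) - (\<integral>y. levy_int h y \<partial>\<nu>)"
  by (simp add: levy_exponent_def levy_int_def)

lemma \<psi>_0: "\<psi> 0 = 0"
  by (simp add: \<psi>_eq levy_int_def)

lemma \<psi>_tendsto:
  assumes h: "hs \<longlonglongrightarrow> h"
  shows "(\<lambda>n. \<psi> (hs n)) \<longlonglongrightarrow> \<psi> h"
proof -
  have "bounded (range hs)" using h convergent_imp_bounded by blast
  then obtain K where K: "\<And>n. norm (hs n) \<le> K" by (auto simp: bounded_iff)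
  have "(\<lambda>n. \<integral>y. levy_int (hs n) y \<partial>\<nu>) \<longlonglongrightarrow> (\<integral>y. levy_int h y \<partial>\<nu>)"
  proof (rule integral_tendsto_m[OF levy_int_measurable levy_int_measurable])
    fix n y
    have "(2 + (norm (hs n))\<^sup>2) * m y \<le> (2 + K\<^sup>2) * m y"
      using K[of n] by (intro mult_right_mono add_left_mono power_mono) auto
    with levy_int_bound[of "hs n" y] show "cmod (levy_int (hs n) y) \<le> (2 + K\<^sup>2) * m y" by linarith
    show "(\<lambda>n. levy_int (hs n) y) \<longlonglongrightarrow> levy_int h y"
      unfolding levy_int_def by (intro tendsto_intros h)
  qed
  moreover have "(\<lambda>n. Q (hs n)) \<longlonglongrightarrow> Q h" by (rule bounded_linear.tendsto[OF Q_linear h])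
  ultimately show ?thesis unfolding \<psi>_eq by (intro tendsto_intros h) auto
qed

lemma \<psi>_continuous_time: "continuous_on {0..t} (\<lambda>s. \<psi> (T' s k))"
proof (rule continuous_on_subset[of "{0..}"])
  show "continuous_on {0..} (\<lambda>s. \<psi> (T' s k))"
    unfolding continuous_on_sequentially o_def
    by (auto intro!: \<psi>_tendsto T'.T_tendsto)
qed auto

subsection \<open>Laws of the increments\<close>

lemma Z_measurable: "t \<ge> 0 \<Longrightarrow> Z t \<in> borel_measurable M"
  using Z_levy by (simp add: levy_process_def)

lemma Y_measurable [measurable]: "t \<ge> 0 \<Longrightarrow> Y t \<in> borel_measurable M"
  using Y_conv by (simp add: is_stochastic_convolution_def)

lemma increment_char:
  assumes s: "0 \<le> s" "s \<le> t"
  shows "(\<integral>\<omega>. iexp ((Z t \<omega> - Z s \<omega>) \<bullet> h) \<partial>M) = exp (- complex_of_real (t - s) * \<psi> h)"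
proof -
  have [measurable]: "Z t \<in> borel_measurable M" "Z s \<in> borel_measurable M" "Z (t - s) \<in> borel_measurable M"
    using s by (auto intro: Z_measurable)
  have d: "distr M borel (\<lambda>\<omega>. Z t \<omega> - Z s \<omega>) = distr M borel (Z (t - s))"
    using Z_levy s by (simp add: levy_process_def)
  have "(\<integral>\<omega>. iexp ((Z t \<omega> - Z s \<omega>) \<bullet> h) \<partial>M) = (\<integral>y. iexp (y \<bullet> h) \<partial>distr M borel (\<lambda>\<omega>. Z t \<omega> - Z s \<omega>))"
    by (subst integral_distr) auto
  also have "\<dots> = (\<integral>\<omega>. iexp (Z (t - s) \<omega> \<bullet> h) \<partial>M)"
    unfolding d by (subst integral_distr) auto
  also have "\<dots> = exp (- complex_of_real (t - s) * \<psi> h)"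
    using s by (intro Z_char) simp
  finally show ?thesis .
qed

text \<open>Independence turns the integral of a product into a product; strictly increasing times
  are the form in which \<open>levy_process\<close> provides independence.\<close>

lemma increments_char:
  assumes p: "0 \<le> p 0" "\<And>i. i < n \<Longrightarrow> p i < p (Suc i)"
  shows "(\<integral>\<omega>. iexp (\<Sum>i<n. (Z (p (Suc i)) \<omega> - Z (p i) \<omega>) \<bullet> k i) \<partial>M)
      = exp (- (\<Sum>i<n. complex_of_real (p (Suc i) - p i) * \<psi> (k i)))"
proof -
  have pos: "0 \<le> p i" if "i \<le> n" for i
    using that by (induction i) (use p in \<open>auto intro: order_trans less_imp_le simp: Suc_le_eq\<close>)
  have "indep_vars (\<lambda>_. borel) (\<lambda>i \<omega>. Z (p (Suc i)) \<omega> - Z (p i) \<omega>) {..<n}"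
    using Z_levy p by (simp add: levy_process_def)
  then have ind: "indep_vars (\<lambda>_. borel) (\<lambda>i \<omega>. iexp ((Z (p (Suc i)) \<omega> - Z (p i) \<omega>) \<bullet> k i)) {..<n}"
    by (rule indep_vars_compose2) auto
  have meas: "(\<lambda>\<omega>. iexp ((Z (p (Suc i)) \<omega> - Z (p i) \<omega>) \<bullet> k i)) \<in> borel_measurable M" if "i < n" for i
  proof -
    have [measurable]: "Z (p i) \<in> borel_measurable M" "Z (p (Suc i)) \<in> borel_measurable M"
      using Z_measurable[OF pos[of i]] Z_measurable[OF pos[of "Suc i"]] that by auto
    show ?thesis by measurable
  qed
  have "(\<integral>\<omega>. iexp (\<Sum>i<n. (Z (p (Suc i)) \<omega> - Z (p i) \<omega>) \<bullet> k i) \<partial>M)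
      = (\<integral>\<omega>. (\<Prod>i<n. iexp ((Z (p (Suc i)) \<omega> - Z (p i) \<omega>) \<bullet> k i)) \<partial>M)"
    by (simp add: exp_sum sum_distrib_left)
  also have "\<dots> = (\<Prod>i<n. \<integral>\<omega>. iexp ((Z (p (Suc i)) \<omega> - Z (p i) \<omega>) \<bullet> k i) \<partial>M)"
    by (rule indep_vars_lebesgue_integral[OF _ ind])
      (use meas in \<open>auto intro!: integrable_const_bound[where B = 1]\<close>)
  also have "\<dots> = (\<Prod>i<n. exp (- complex_of_real (p (Suc i) - p i) * \<psi> (k i)))"
    by (intro prod.cong refl increment_char pos) (use p(2) in \<open>auto intro: less_imp_le\<close>)
  also have "\<dots> = exp (- (\<Sum>i<n. complex_of_real (p (Suc i) - p i) * \<psi> (k i)))"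
    by (simp only: sum_negf[symmetric] exp_sum[OF finite_lessThan] mult_minus_left)
  finally show ?thesis .
qed

end

lemma sum_lessThan_add_split:
  fixes f :: "nat \<Rightarrow> 'b::comm_monoid_add"
  shows "(\<Sum>i<m + n. f i) = (\<Sum>i<m. f i) + (\<Sum>i<n. f (m + i))"
  by (induction n) (auto simp: add.assoc)

subsection \<open>Characteristic functions determine integrals of \<open>C2b\<close> functions\<close>

text \<open>Equality of expectations is linear and stable under bounded pointwise limits, and for
  cosines it is the real part of the hypothesis times a phase. The type is kept general because the
  lemma is applied on the product space, to pairs.\<close>

lemma C2b_integral_eq_of_char:
  fixes X1 :: "'w1 \<Rightarrow> 'b::{real_inner, banach, second_countable_topology}" and X2 :: "'w2 \<Rightarrow> 'b"
  assumes N: "prob_space N1" "prob_space N2"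
    and X: "X1 \<in> borel_measurable N1" "X2 \<in> borel_measurable N2"
    and char: "\<And>k. (\<integral>\<omega>. iexp (k \<bullet> X1 \<omega>) \<partial>N1) = (\<integral>\<omega>. iexp (k \<bullet> X2 \<omega>) \<partial>N2)"
    and g: "C2b C g g' g''"
  shows "(\<integral>\<omega>. g (X1 \<omega>) \<partial>N1) = (\<integral>\<omega>. g (X2 \<omega>) \<partial>N2)"
proof -
  interpret N1: prob_space N1 by fact
  interpret N2: prob_space N2 by fact
  have meas: "(\<lambda>\<omega>. g (X1 \<omega>)) \<in> borel_measurable N1" "(\<lambda>\<omega>. g (X2 \<omega>)) \<in> borel_measurable N2"
    if "line_C2 C g d q" for C d q and g :: "'b \<Rightarrow> real"
    using measurable_compose[OF X(1) borel_measurable_continuous_onI[OF line_C2D(6)[OF that]]]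
      measurable_compose[OF X(2) borel_measurable_continuous_onI[OF line_C2D(6)[OF that]]] by auto
  have int: "integrable N1 (\<lambda>\<omega>. g (X1 \<omega>))" "integrable N2 (\<lambda>\<omega>. g (X2 \<omega>))"
    if "line_C2 C g d q" for C d q and g :: "'b \<Rightarrow> real"
    using meas[OF that] line_C2D(1)[OF that]
    by (auto intro!: N1.integrable_const_bound[where B = C] N2.integrable_const_bound[where B = C])
  interpret bp_class "\<lambda>g d q. (\<integral>\<omega>. g (X1 \<omega>) \<partial>N1) = (\<integral>\<omega>. g (X2 \<omega>) \<partial>N2)"
  proof
    fix k :: 'b and c
    have cs: "cos (s + c) = Re (iexp s * cis c)" for s
      by (simp add: cis_conv_exp[symmetric] cis_mult)
    have "(\<integral>\<omega>. cos (k \<bullet> X1 \<omega> + c) \<partial>N1) = Re ((\<integral>\<omega>. iexp (k \<bullet> X1 \<omega>) \<partial>N1) * cis c)"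
    proof -
      have i: "integrable N1 (\<lambda>\<omega>. iexp (k \<bullet> X1 \<omega>))"
        using X(1) by (intro N1.integrable_const_bound[where B = 1]) auto
      show ?thesis
        unfolding cs by (subst integral_Re) (auto intro!: i)
    qed
    moreover have "(\<integral>\<omega>. cos (k \<bullet> X2 \<omega> + c) \<partial>N2) = Re ((\<integral>\<omega>. iexp (k \<bullet> X2 \<omega>) \<partial>N2) * cis c)"
    proof -
      have i: "integrable N2 (\<lambda>\<omega>. iexp (k \<bullet> X2 \<omega>))"
        using X(2) by (intro N2.integrable_const_bound[where B = 1]) auto
      show ?thesis
        unfolding cs by (subst integral_Re) (auto intro!: i)
    qed
    ultimately show "(\<integral>\<omega>. cos (k \<bullet> X1 \<omega> + c) \<partial>N1) = (\<integral>\<omega>. cos (k \<bullet> X2 \<omega> + c) \<partial>N2)"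
      by (simp add: char)
  next
    fix C C' g d q g2 d2 q2
    assume "line_C2 C g d q" "(\<integral>\<omega>. g (X1 \<omega>) \<partial>N1) = (\<integral>\<omega>. g (X2 \<omega>) \<partial>N2)"
      "line_C2 C' g2 d2 q2" "(\<integral>\<omega>. g2 (X1 \<omega>) \<partial>N1) = (\<integral>\<omega>. g2 (X2 \<omega>) \<partial>N2)"
    then show "(\<integral>\<omega>. g (X1 \<omega>) + g2 (X1 \<omega>) \<partial>N1) = (\<integral>\<omega>. g (X2 \<omega>) + g2 (X2 \<omega>) \<partial>N2)"
      using int by simp
  next
    fix C g d q and b :: real
    assume "line_C2 C g d q" "(\<integral>\<omega>. g (X1 \<omega>) \<partial>N1) = (\<integral>\<omega>. g (X2 \<omega>) \<partial>N2)"
    then show "(\<integral>\<omega>. b * g (X1 \<omega>) \<partial>N1) = (\<integral>\<omega>. b * g (X2 \<omega>) \<partial>N2)" by simp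
  next
    fix C gs ds qs g d q
    assume L: "\<And>n. line_C2 C (gs n) (ds n) (qs n)" "line_C2 C g d q" and lim: "\<And>x. (\<lambda>n. gs n x) \<longlonglongrightarrow> g x"
      and eq: "\<And>n. (\<integral>\<omega>. gs n (X1 \<omega>) \<partial>N1) = (\<integral>\<omega>. gs n (X2 \<omega>) \<partial>N2)"
    have "(\<lambda>n. \<integral>\<omega>. gs n (X1 \<omega>) \<partial>N1) \<longlonglongrightarrow> (\<integral>\<omega>. g (X1 \<omega>) \<partial>N1)"
      by (rule integral_dominated_convergence[where w = "\<lambda>_. C"])
        (use L lim meas line_C2D(1)[OF L(1)] in auto)
    moreover have "(\<lambda>n. \<integral>\<omega>. gs n (X2 \<omega>) \<partial>N2) \<longlonglongrightarrow> (\<integral>\<omega>. g (X2 \<omega>) \<partial>N2)"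
      by (rule integral_dominated_convergence[where w = "\<lambda>_. C"])
        (use L lim meas line_C2D(1)[OF L(1)] in auto)
    ultimately show "(\<integral>\<omega>. g (X1 \<omega>) \<partial>N1) = (\<integral>\<omega>. g (X2 \<omega>) \<partial>N2)"
      unfolding eq by (rule LIMSEQ_unique)
  qed
  show ?thesis by (rule C2b_in_class[OF g])
qed

section \<open>Joint law of the convolution at two times\<close>

context ou_setting
begin

lemma T_measurable [measurable]: "t \<ge> 0 \<Longrightarrow> T t \<in> borel_measurable borel"
  by (intro borel_measurable_continuous_onI bounded_linear.continuous_on[OF T.T_linear] continuous_on_id)

lemma convolution_sum_measurable:
  assumes "\<And>i. i \<le> n \<Longrightarrow> 0 \<le> p i \<and> p i \<le> t"
  shows "(\<lambda>\<omega>. \<Sum>i<n. T (t - p i) (Z (p (Suc i)) \<omega> - Z (p i) \<omega>)) \<in> borel_measurable M"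
proof (rule borel_measurable_sum)
  fix i assume i: "i \<in> {..<n}"
  have [measurable]: "Z (p i) \<in> borel_measurable M" "Z (p (Suc i)) \<in> borel_measurable M"
    "T (t - p i) \<in> borel_measurable borel"
    using assms[of i] assms[of "Suc i"] i by (auto intro: Z_measurable T_measurable)
  show "(\<lambda>\<omega>. T (t - p i) (Z (p (Suc i)) \<omega> - Z (p i) \<omega>)) \<in> borel_measurable M"
    by measurable
qed

definition char_Y :: "real \<Rightarrow> 'a \<Rightarrow> complex" where
  "char_Y t k = exp (- integral {0..t} (\<lambda>s. \<psi> (T' s k)))"

lemma riemann_char:
  assumes "t \<ge> 0"
  shows "(\<lambda>n. exp (- (\<Sum>i<Suc n. complex_of_real (t / real (Suc n)) * \<psi> (T' (t - real i * (t / real (Suc n))) k)))) \<longlonglongrightarrow> char_Y t k"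
  unfolding char_Y_def scaleR_conv_of_real[symmetric]
  by (intro tendsto_intros LIMSEQ_Suc[OF riemann_sum_tendsto[OF \<psi>_continuous_time assms]])

text \<open>On a partition through \<open>s\<close>, the part over [0, s] of the sum for
  \<open>Y t\<close> is exactly \<open>T (t - s)\<close> applied to the sum for \<open>Y s\<close>.
  Only increments after \<open>s\<close> remain in the difference, which makes it independent of
  \<open>Y s\<close> and distributed like \<open>Y (t - s)\<close>.\<close>

lemma joint_char:
  assumes s: "0 < s" "s < t"
  shows "(\<integral>\<omega>. iexp (k \<bullet> Y s \<omega> + l \<bullet> (Y t \<omega> - T (t - s) (Y s \<omega>))) \<partial>M) = char_Y s k * char_Y (t - s) l"
proof -
  \<comment> \<open>n + 1 equal steps on [0, s], then n + 1 equal steps on [s, t]; both intervals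
    have positive length, so the times increase strictly.\<close>
  define p where "p n i = (if i \<le> Suc n then real i * (s / real (Suc n))
     else s + real (i - Suc n) * ((t - s) / real (Suc n)))" for n i
  have p1: "p n i = real i * (s / real (Suc n))" if "i \<le> Suc n" for n i
    using that by (simp add: p_def)
  have p2: "p n (Suc n + i) = s + real i * ((t - s) / real (Suc n))" for n i
    by (cases "i = 0") (auto simp: p_def)
  have split: "i < Suc n \<or> (\<exists>j < Suc n. i = Suc n + j)" if "i < Suc n + Suc n" for i n
  proof (cases "i < Suc n")
    case False
    then have "i = Suc n + (i - Suc n)" "i - Suc n < Suc n" using that by auto
    then show ?thesis by blast
  qed simp
  have step1: "p n (Suc i) - p n i = s / real (Suc n)" if "i < Suc n" for n i
  proof -
    have "real (Suc i) * d - real i * d = d" for d by (simp add: distrib_right)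
    then show ?thesis by (simp only: p1[OF less_imp_le[OF that]] p1[OF Suc_leI[OF that]])
  qed
  have step2: "p n (Suc (Suc n + i)) - p n (Suc n + i) = (t - s) / real (Suc n)" for n i
  proof -
    have "(s + real (Suc i) * d) - (s + real i * d) = d" for d by (simp add: distrib_right)
    then show ?thesis by (simp only: p2 add_Suc_right[symmetric])
  qed
  have pos: "0 < s / real (Suc n)" "0 < (t - s) / real (Suc n)" for n using s by auto
  have steps: "p n (Suc i) - p n i = s / real (Suc n) \<or> p n (Suc i) - p n i = (t - s) / real (Suc n)"
    if i: "i < Suc n + Suc n" for n i
    using split[OF i]
  proof
    assume "\<exists>j<Suc n. i = Suc n + j"
    then obtain j where "i = Suc n + j" by blast
    then show ?thesis by (simp only: step2) simp
  qed (intro disjI1 step1)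
  have inc: "p n i < p n (Suc i)" if "i < Suc n + Suc n" for n i
    using steps[OF that] pos[of n] by linarith
  have mono: "p n i \<le> p n j" if "i \<le> j" "j \<le> Suc n + Suc n" for i j n
    using that
  proof (induction j rule: dec_induct)
    case (step r)
    have "p n i \<le> p n r" using step by simp
    also have "\<dots> \<le> p n (Suc r)" by (rule less_imp_le[OF inc]) (use step.prems in linarith)
    finally show ?case .
  qed simp
  have p0: "p n 0 = 0" and ps: "p n (Suc n) = s" and pt: "p n (Suc n + Suc n) = t" for n
    using p2[of n 0] p2[of n "Suc n"] by (simp_all add: p_def)
  have mesh: "p n (Suc i) - p n i \<le> t / real (Suc n)" if "i < Suc n + Suc n" for n i
  proof -
    have "s / real (Suc n) \<le> t / real (Suc n)" "(t - s) / real (Suc n) \<le> t / real (Suc n)"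
      using s by (auto intro!: divide_right_mono)
    then show ?thesis using steps[OF that] by linarith
  qed
  have mesh0: "(\<lambda>n. t / real (Suc n)) \<longlonglongrightarrow> 0" by real_asymp
  define Ss where "Ss n \<omega> = (\<Sum>i<Suc n. T (s - p n i) (Z (p n (Suc i)) \<omega> - Z (p n i) \<omega>))" for n \<omega>
  define St where "St n \<omega> = (\<Sum>i<Suc n + Suc n. T (t - p n i) (Z (p n (Suc i)) \<omega> - Z (p n i) \<omega>))" for n \<omega>
  have mSs [measurable]: "Ss n \<in> borel_measurable M" and mSt [measurable]: "St n \<in> borel_measurable M" for n
  proof -
    show "Ss n \<in> borel_measurable M"
      unfolding Ss_def[abs_def]
    proof (rule convolution_sum_measurable)
      fix i assume "i \<le> Suc n"
      then show "0 \<le> p n i \<and> p n i \<le> s" using mono[of 0 i n] mono[of i "Suc n" n] p0[of n] ps[of n] by simp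
    qed
    show "St n \<in> borel_measurable M"
      unfolding St_def[abs_def]
    proof (rule convolution_sum_measurable)
      fix i assume "i \<le> Suc n + Suc n"
      then show "0 \<le> p n i \<and> p n i \<le> t" using mono[of 0 i n] mono[of i "Suc n + Suc n" n] p0[of n] pt[of n] by simp
    qed
  qed
  have [measurable]: "Y s \<in> borel_measurable M" "Y t \<in> borel_measurable M" using s by auto
  have "in_prob M Ss (Y s)"
    unfolding Ss_def[abs_def]
    by (rule stochastic_convolution_in_prob[OF prob_space_axioms Y_conv, where m = "\<lambda>n. t / real (Suc n)"])
      (insert s p0 ps mesh mesh0 less_imp_le[OF inc] mSs, simp_all add: Ss_def[abs_def] del: sum.lessThan_Suc of_nat_Suc)
  moreover have "in_prob M St (Y t)"
    unfolding St_def[abs_def]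
    by (rule stochastic_convolution_in_prob[OF prob_space_axioms Y_conv, where m = "\<lambda>n. t / real (Suc n)"])
      (insert s p0 pt mesh mesh0 less_imp_le[OF inc] mSt, simp_all add: St_def[abs_def] del: sum.lessThan_Suc of_nat_Suc)
  \<comment> \<open>Moving \<open>T (t - s)\<close> to the frequency by the adjoint makes the
    exponent a sum of linear functionals of \<open>Y s\<close> and of \<open>Y t\<close>, whose
    convergence in probability is known separately.\<close>
  define k' where "k' = k - T' (t - s) l"
  have ip: "norm (v \<bullet> x - v \<bullet> y) \<le> (norm v + 1) * norm (x - y)" for v x y :: 'a
    using Cauchy_Schwarz_ineq2[of v "x - y"] by (simp add: inner_diff_right distrib_right add_increasing2)
  have pl: "norm v + 1 > 0" for v :: 'a by (simp add: add_nonneg_pos)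
  have A: "in_prob M (\<lambda>n \<omega>. k' \<bullet> Ss n \<omega>) (\<lambda>\<omega>. k' \<bullet> Y s \<omega>)"
    by (rule in_prob_le[OF \<open>in_prob M Ss (Y s)\<close> pl[of k'] ip]) measurable
  have B: "in_prob M (\<lambda>n \<omega>. l \<bullet> St n \<omega>) (\<lambda>\<omega>. l \<bullet> Y t \<omega>)"
    by (rule in_prob_le[OF \<open>in_prob M St (Y t)\<close> pl[of l] ip]) measurable
  have ts: "0 \<le> t - s" using s by simp
  have kk: "k' \<bullet> x + l \<bullet> y = k \<bullet> x + l \<bullet> (y - T (t - s) x)" for x y
    using T_adjoint[OF ts, of x l] by (simp add: k'_def inner_diff_left inner_diff_right inner_commute)
  have "(\<lambda>n. \<integral>\<omega>. iexp (k' \<bullet> Ss n \<omega> + l \<bullet> St n \<omega>) \<partial>M) \<longlonglongrightarrow> (\<integral>\<omega>. iexp (k' \<bullet> Y s \<omega> + l \<bullet> Y t \<omega>) \<partial>M)"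
    by (rule in_prob_iexp[OF in_prob_add[OF A B]]) measurable
  then have L1: "(\<lambda>n. \<integral>\<omega>. iexp (k \<bullet> Ss n \<omega> + l \<bullet> (St n \<omega> - T (t - s) (Ss n \<omega>))) \<partial>M) \<longlonglongrightarrow>
      (\<integral>\<omega>. iexp (k \<bullet> Y s \<omega> + l \<bullet> (Y t \<omega> - T (t - s) (Y s \<omega>))) \<partial>M)"
    unfolding kk .
  have val: "(\<integral>\<omega>. iexp (k \<bullet> Ss n \<omega> + l \<bullet> (St n \<omega> - T (t - s) (Ss n \<omega>))) \<partial>M)
      = exp (- (\<Sum>i<Suc n. complex_of_real (s / real (Suc n)) * \<psi> (T' (s - real i * (s / real (Suc n))) k)))
      * exp (- (\<Sum>i<Suc n. complex_of_real ((t - s) / real (Suc n)) * \<psi> (T' ((t - s) - real i * ((t - s) / real (Suc n))) l)))" for n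
  proof -
    define \<kappa> where "\<kappa> i = (if i < Suc n then T' (s - p n i) k else T' (t - p n i) l)" for i
    define dZ where "dZ i \<omega> = Z (p n (Suc i)) \<omega> - Z (p n i) \<omega>" for i \<omega>
    have sp: "0 \<le> s - p n i" if "i < Suc n" for i
      using mono[of i "Suc n" n] ps[of n] that by simp
    have tp: "0 \<le> t - p n i" if "i < Suc n + Suc n" for i
      using mono[of i "Suc n + Suc n" n] pt[of n] that by simp
    have "T (t - s) (Ss n \<omega>) = (\<Sum>i<Suc n. T (t - p n i) (dZ i \<omega>))" for \<omega>
    proof -
      have "T (t - s) (Ss n \<omega>) = (\<Sum>i<Suc n. T (t - s) (T (s - p n i) (dZ i \<omega>)))"
        unfolding Ss_def dZ_def by (rule linear_sum[OF bounded_linear.linear[OF T.T_linear[OF ts]]])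
      also have "\<dots> = (\<Sum>i<Suc n. T (t - p n i) (dZ i \<omega>))"
      proof (rule sum.cong[OF refl])
        fix i assume "i \<in> {..<Suc n}"
        then show "T (t - s) (T (s - p n i) (dZ i \<omega>)) = T (t - p n i) (dZ i \<omega>)"
          using T.T_add[OF ts sp[of i], of "dZ i \<omega>"] by simp
      qed
      finally show ?thesis .
    qed
    \<comment> \<open>The first n + 1 terms of \<open>St\<close> cancel against
      \<open>T (t - s) (Ss n \<omega>)\<close>.\<close>
    then have R: "St n \<omega> - T (t - s) (Ss n \<omega>) = (\<Sum>i<Suc n. T (t - p n (Suc n + i)) (dZ (Suc n + i) \<omega>))" for \<omega>
      unfolding St_def dZ_def[symmetric] by (simp only: sum_lessThan_add_split) simp
    have "k \<bullet> Ss n \<omega> + l \<bullet> (St n \<omega> - T (t - s) (Ss n \<omega>)) = (\<Sum>i<Suc n + Suc n. dZ i \<omega> \<bullet> \<kappa> i)" for \<omega>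
    proof -
      have "k \<bullet> Ss n \<omega> = (\<Sum>i<Suc n. dZ i \<omega> \<bullet> \<kappa> i)"
        unfolding Ss_def inner_sum_right dZ_def[symmetric]
        by (rule sum.cong[OF refl]) (use T_adjoint[OF sp] in \<open>auto simp: \<kappa>_def inner_commute[of k]\<close>)
      moreover have "l \<bullet> (St n \<omega> - T (t - s) (Ss n \<omega>)) = (\<Sum>i<Suc n. dZ (Suc n + i) \<omega> \<bullet> \<kappa> (Suc n + i))"
        unfolding R inner_sum_right
      proof (rule sum.cong[OF refl])
        fix i assume "i \<in> {..<Suc n}"
        then have "0 \<le> t - p n (Suc n + i)" by (intro tp) auto
        then show "l \<bullet> T (t - p n (Suc n + i)) (dZ (Suc n + i) \<omega>) = dZ (Suc n + i) \<omega> \<bullet> \<kappa> (Suc n + i)"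
          using T_adjoint by (simp add: \<kappa>_def inner_commute[of l])
      qed
      ultimately show ?thesis by (simp only: sum_lessThan_add_split)
    qed
    then have "(\<integral>\<omega>. iexp (k \<bullet> Ss n \<omega> + l \<bullet> (St n \<omega> - T (t - s) (Ss n \<omega>))) \<partial>M)
        = (\<integral>\<omega>. iexp (\<Sum>i<Suc n + Suc n. (Z (p n (Suc i)) \<omega> - Z (p n i) \<omega>) \<bullet> \<kappa> i) \<partial>M)"
      by (simp only: dZ_def)
    also have "\<dots> = exp (- (\<Sum>i<Suc n + Suc n. complex_of_real (p n (Suc i) - p n i) * \<psi> (\<kappa> i)))"
      by (rule increments_char) (use p0 inc in auto)
    also have "(\<Sum>i<Suc n + Suc n. complex_of_real (p n (Suc i) - p n i) * \<psi> (\<kappa> i))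
       = (\<Sum>i<Suc n. complex_of_real (p n (Suc i) - p n i) * \<psi> (\<kappa> i))
        + (\<Sum>i<Suc n. complex_of_real (p n (Suc (Suc n + i)) - p n (Suc n + i)) * \<psi> (\<kappa> (Suc n + i)))"
      by (rule sum_lessThan_add_split)
    also have "(\<Sum>i<Suc n. complex_of_real (p n (Suc i) - p n i) * \<psi> (\<kappa> i))
        = (\<Sum>i<Suc n. complex_of_real (s / real (Suc n)) * \<psi> (T' (s - real i * (s / real (Suc n))) k))"
    proof (rule sum.cong[OF refl])
      fix i assume "i \<in> {..<Suc n}"
      then have i: "i < Suc n" by simp
      have "\<kappa> i = T' (s - real i * (s / real (Suc n))) k"
        unfolding \<kappa>_def p1[OF less_imp_le[OF i]] using i by (simp only: if_True)
      then show "complex_of_real (p n (Suc i) - p n i) * \<psi> (\<kappa> i)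
          = complex_of_real (s / real (Suc n)) * \<psi> (T' (s - real i * (s / real (Suc n))) k)"
        by (simp only: step1[OF i])
    qed
    also have "(\<Sum>i<Suc n. complex_of_real (p n (Suc (Suc n + i)) - p n (Suc n + i)) * \<psi> (\<kappa> (Suc n + i)))
        = (\<Sum>i<Suc n. complex_of_real ((t - s) / real (Suc n)) * \<psi> (T' ((t - s) - real i * ((t - s) / real (Suc n))) l))"
      unfolding step2 by (rule sum.cong[OF refl]) (simp add: \<kappa>_def p2[unfolded add_Suc] diff_diff_eq del: of_nat_Suc)
    finally show ?thesis by (simp only: minus_add_distrib exp_add)
  qed
  have "(\<lambda>n. \<integral>\<omega>. iexp (k \<bullet> Ss n \<omega> + l \<bullet> (St n \<omega> - T (t - s) (Ss n \<omega>))) \<partial>M) \<longlonglongrightarrow> char_Y s k * char_Y (t - s) l"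
    unfolding val by (intro tendsto_mult riemann_char) (use s in auto)
  from LIMSEQ_unique[OF L1 this] show ?thesis .
qed

text \<open>At time 0 the partition without intervals is admissible for every mesh. Its sum is 0, so
  0 approximates \<open>Y 0\<close> in probability to every tolerance.\<close>

lemma Y_0: "AE \<omega> in M. Y 0 \<omega> = 0"
proof -
  have meas: "Y 0 \<in> borel_measurable M" by simp
  have small: "prob {\<omega>\<in>space M. norm (Y 0 \<omega>) > \<epsilon>} < \<epsilon>" if "\<epsilon> > 0" for \<epsilon>
  proof -
    from Y_conv[of 0, unfolded is_stochastic_convolution_def, THEN conjunct2, rule_format, OF order_refl that]
    obtain \<delta> where "\<forall>n p. p 0 = 0 \<and> p n = 0 \<and>
        (\<forall>i<n. p i \<le> p (Suc i) \<and> p (Suc i) - p i < \<delta>) \<longrightarrow>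
        prob {\<omega>\<in>space M. norm ((\<Sum>i<n. T (0 - p i) (Z (p (Suc i)) \<omega> - Z (p i) \<omega>)) - Y 0 \<omega>) > \<epsilon>} < \<epsilon>"
      by (elim exE conjE) (rule that)
    from this[rule_format, of "\<lambda>_. 0" 0] show ?thesis by simp
  qed
  have "AE \<omega> in M. \<forall>n. norm (Y 0 \<omega>) \<le> 1 / real (Suc n)"
    unfolding AE_all_countable
  proof
    fix n
    have "prob {\<omega>\<in>space M. norm (Y 0 \<omega>) > 1 / real (Suc n)} \<le> 0"
    proof (rule field_le_epsilon)
      fix e :: real assume e: "e > 0"
      define d where "d = min e (1 / real (Suc n))"
      have d: "d > 0" "d \<le> e" "d \<le> 1 / real (Suc n)" using e by (auto simp: d_def)
      have "prob {\<omega>\<in>space M. norm (Y 0 \<omega>) > 1 / real (Suc n)} \<le> prob {\<omega>\<in>space M. norm (Y 0 \<omega>) > d}"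
        using d meas by (intro finite_measure_mono) (auto intro: le_less_trans)
      also have "\<dots> < d" by (rule small[OF d(1)])
      finally show "prob {\<omega>\<in>space M. norm (Y 0 \<omega>) > 1 / real (Suc n)} \<le> 0 + e" using d by simp
    qed
    then have "prob {\<omega>\<in>space M. norm (Y 0 \<omega>) > 1 / real (Suc n)} = 0"
      using measure_nonneg order_antisym by blast
    then have "{\<omega>\<in>space M. norm (Y 0 \<omega>) > 1 / real (Suc n)} \<in> null_sets M"
      using meas by (auto simp: null_sets_def emeasure_eq_measure)
    from AE_not_in[OF this] show "AE \<omega> in M. norm (Y 0 \<omega>) \<le> 1 / real (Suc n)"
      by (rule AE_mp) (auto simp: not_less)
  qed
  then show ?thesis
  proof (rule AE_mp, intro AE_I2 impI)
    fix \<omega> assume *: "\<forall>n. norm (Y 0 \<omega>) \<le> 1 / real (Suc n)"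
    have "(\<lambda>n. 1 / real (Suc n)) \<longlonglongrightarrow> 0" by real_asymp
    from LIMSEQ_le_const[OF this] * have "norm (Y 0 \<omega>) \<le> 0" by blast
    then show "Y 0 \<omega> = 0" by simp
  qed
qed

lemma Y_char:
  assumes t: "t \<ge> 0"
  shows "(\<integral>\<omega>. iexp (k \<bullet> Y t \<omega>) \<partial>M) = char_Y t k"
proof (cases "t = 0")
  case True
  have "(\<integral>\<omega>. iexp (k \<bullet> Y 0 \<omega>) \<partial>M) = (\<integral>\<omega>. iexp 0 \<partial>M)"
  proof (rule integral_cong_AE)
    show "AE \<omega> in M. iexp (k \<bullet> Y 0 \<omega>) = iexp 0" using Y_0 by eventually_elim simp
  qed auto
  then show ?thesis using True by (simp add: char_Y_def prob_space)
next
  case False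
  have "char_Y r 0 = 1" if "r \<ge> 0" for r
  proof -
    have "integral {0..r} (\<lambda>s. \<psi> (T' s 0)) = integral {0..r} (\<lambda>s. 0)"
      by (rule integral_cong) (simp add: T'.T_lin \<psi>_0)
    then show ?thesis by (simp add: char_Y_def)
  qed
  \<comment> \<open>The joint formula with second frequency 0, where \<open>char_Y\<close> is 1; any
    later time serves, here t + 1.\<close>
  then show ?thesis using joint_char[of t "t + 1" k 0] False t by simp
qed

text \<open>For 0 < s < t both pairs have the same characteristic function on the product space. At
  the ends \<open>s = 0\<close> and \<open>s = t\<close> one component is almost surely 0 and the
  identity is checked directly.\<close>

lemma increment_law_pair:
  fixes g :: "'a \<times> 'a \<Rightarrow> real"
  assumes s: "0 \<le> s" "s \<le> t" and g: "C2b C g g' g''"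
  shows "(\<integral>\<omega>. g (Y s \<omega>, Y t \<omega> - T (t - s) (Y s \<omega>)) \<partial>M) = (\<integral>\<omega>. (\<integral>\<omega>'. g (Y s \<omega>, Y (t - s) \<omega>') \<partial>M) \<partial>M)"
proof -
  have [measurable]: "Y s \<in> borel_measurable M" "Y t \<in> borel_measurable M" "Y (t - s) \<in> borel_measurable M"
    "T (t - s) \<in> borel_measurable borel" using s by auto
  have gm [measurable]: "g \<in> borel_measurable borel"
    by (rule borel_measurable_continuous_onI[OF C2bD(10)[OF g]])
  consider "s = 0" | "s = t" | "0 < s" "s < t" using s by linarith
  then show ?thesis
  proof cases
    case 1
    have "(\<integral>\<omega>. g (Y s \<omega>, Y t \<omega> - T (t - s) (Y s \<omega>)) \<partial>M) = (\<integral>\<omega>. g (0, Y t \<omega>) \<partial>M)"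
    proof (rule integral_cong_AE)
      show "AE \<omega> in M. g (Y s \<omega>, Y t \<omega> - T (t - s) (Y s \<omega>)) = g (0, Y t \<omega>)"
        using Y_0 by eventually_elim (use s 1 in \<open>simp add: T.T_lin\<close>)
    qed measurable
    also have "\<dots> = (\<integral>\<omega>. (\<integral>\<omega>'. g (0, Y (t - s) \<omega>') \<partial>M) \<partial>M)" using 1 by (simp add: prob_space)
    also have "\<dots> = (\<integral>\<omega>. (\<integral>\<omega>'. g (Y s \<omega>, Y (t - s) \<omega>') \<partial>M) \<partial>M)"
    proof (rule integral_cong_AE)
      show "AE \<omega> in M. (\<integral>\<omega>'. g (0, Y (t - s) \<omega>') \<partial>M) = (\<integral>\<omega>'. g (Y s \<omega>, Y (t - s) \<omega>') \<partial>M)"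
        using Y_0 by eventually_elim (use 1 in simp)
    qed measurable
    finally show ?thesis .
  next
    case 2
    have "(\<integral>\<omega>. g (Y s \<omega>, Y t \<omega> - T (t - s) (Y s \<omega>)) \<partial>M) = (\<integral>\<omega>. g (Y s \<omega>, 0) \<partial>M)"
      using 2 by (simp add: T.T_0)
    also have "\<dots> = (\<integral>\<omega>. (\<integral>\<omega>'. g (Y s \<omega>, Y (t - s) \<omega>') \<partial>M) \<partial>M)"
    proof (rule Bochner_Integration.integral_cong[OF refl])
      fix \<omega>
      have "(\<integral>\<omega>'. g (Y s \<omega>, Y (t - s) \<omega>') \<partial>M) = (\<integral>\<omega>'. g (Y s \<omega>, 0) \<partial>M)"
      proof (rule integral_cong_AE)
        show "AE \<omega>' in M. g (Y s \<omega>, Y (t - s) \<omega>') = g (Y s \<omega>, 0)"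
          using Y_0 by eventually_elim (use 2 in simp)
      qed measurable
      then show "g (Y s \<omega>, 0) = (\<integral>\<omega>'. g (Y s \<omega>, Y (t - s) \<omega>') \<partial>M)" by (simp add: prob_space)
    qed
    finally show ?thesis .
  next
    case 3
    interpret MM: pair_prob_space M M ..
    have "(\<integral>\<omega>. g (Y s \<omega>, Y t \<omega> - T (t - s) (Y s \<omega>)) \<partial>M)
        = (\<integral>z. g (Y s (fst z), Y (t - s) (snd z)) \<partial>(M \<Otimes>\<^sub>M M))"
    proof (rule C2b_integral_eq_of_char[OF prob_space_axioms MM.prob_space_axioms _ _ _ g])
      fix kl :: "'a \<times> 'a"
      obtain k l where kl: "kl = (k, l)" by (cases kl)
      have "(\<integral>z. iexp (k \<bullet> Y s (fst z)) * iexp (l \<bullet> Y (t - s) (snd z)) \<partial>(M \<Otimes>\<^sub>M M))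
          = (\<integral>\<omega>. (\<integral>\<omega>'. iexp (k \<bullet> Y s \<omega>) * iexp (l \<bullet> Y (t - s) \<omega>') \<partial>M) \<partial>M)"
      proof (subst MM.integral_fst'[symmetric])
        show "integrable (M \<Otimes>\<^sub>M M) (\<lambda>z. iexp (k \<bullet> Y s (fst z)) * iexp (l \<bullet> Y (t - s) (snd z)))"
          by (rule MM.integrable_const_bound[where B = 1]) (auto simp: norm_mult)
      qed simp
      also have "\<dots> = (\<integral>\<omega>. iexp (k \<bullet> Y s \<omega>) * char_Y (t - s) l \<partial>M)"
        using Y_char[of "t - s" l] 3 by simp
      also have "\<dots> = char_Y s k * char_Y (t - s) l"
        using Y_char[of s k] 3 by simp
      finally have "(\<integral>z. iexp (k \<bullet> Y s (fst z) + l \<bullet> Y (t - s) (snd z)) \<partial>(M \<Otimes>\<^sub>M M)) = char_Y s k * char_Y (t - s) l"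
        by (simp add: exp_add[symmetric] distrib_left)
      then show "(\<integral>\<omega>. iexp (kl \<bullet> (Y s \<omega>, Y t \<omega> - T (t - s) (Y s \<omega>))) \<partial>M)
          = (\<integral>z. iexp (kl \<bullet> (Y s (fst z), Y (t - s) (snd z))) \<partial>(M \<Otimes>\<^sub>M M))"
        using joint_char[OF 3] by (simp add: kl)
    qed measurable
    also have "\<dots> = (\<integral>\<omega>. (\<integral>\<omega>'. g (Y s \<omega>, Y (t - s) \<omega>') \<partial>M) \<partial>M)"
    proof (subst MM.integral_fst'[symmetric])
      show "integrable (M \<Otimes>\<^sub>M M) (\<lambda>z. g (Y s (fst z), Y (t - s) (snd z)))"
        by (rule MM.integrable_const_bound[where B = C]) (auto simp: C2bD(1)[OF g])
    qed simp
    finally show ?thesis .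
  qed
qed

end

subsection \<open>Traces\<close>

text \<open>Rescaling \<open>b k\<close> and \<open>c k\<close> against each other leaves the rank
  one operators unchanged and gives both vectors the squared norm |b k| |c k|, which is
  summable.\<close>

lemma trace_class_normalized:
  fixes Q :: "'a::real_inner \<Rightarrow> 'a"
  assumes "trace_class Q"
  shows "\<exists>b c :: nat \<Rightarrow> 'a. summable (\<lambda>k. (norm (b k))\<^sup>2) \<and> summable (\<lambda>k. (norm (c k))\<^sup>2) \<and>
    (\<forall>x. (\<lambda>k. (b k \<bullet> x) *\<^sub>R c k) sums Q x)"
proof -
  obtain b c :: "nat \<Rightarrow> 'a" where s: "summable (\<lambda>k. norm (b k) * norm (c k))"
    and Q: "\<And>x. (\<lambda>k. (b k \<bullet> x) *\<^sub>R c k) sums Q x"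
    using assms by (auto simp: trace_class_def)
  define r where "r k = sqrt (norm (c k) / norm (b k))" for k
  define b' where "b' k = (if norm (b k) * norm (c k) = 0 then 0 else r k *\<^sub>R b k)" for k
  define c' where "c' k = (if norm (b k) * norm (c k) = 0 then 0 else (1 / r k) *\<^sub>R c k)" for k
  have r: "r k > 0" "(r k)\<^sup>2 = norm (c k) / norm (b k)" if "norm (b k) * norm (c k) \<noteq> 0" for k
    using that by (auto simp: r_def)
  have "(norm (b' k))\<^sup>2 = norm (b k) * norm (c k)" "(norm (c' k))\<^sup>2 = norm (b k) * norm (c k)" for k
    using r[of k]
    by (auto simp: b'_def c'_def power_mult_distrib power_divide power2_eq_square[of "norm (b k)"]
        power2_eq_square[of "norm (c k)"])
  moreover have "(b' k \<bullet> x) *\<^sub>R c' k = (b k \<bullet> x) *\<^sub>R c k" for k x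
    using r(1)[of k] by (auto simp: b'_def c'_def)
  ultimately show ?thesis
    using s Q by (intro exI[of _ b'] exI[of _ c']) simp
qed

text \<open>The trace is a double series over the basis and the nuclear index. The inequality 2 |x
  y| \<le> x^2 + y^2 and Bessel bound each row by \<open>w k\<close>, so the summations may be
  exchanged; summing over the basis first is Parseval.\<close>

lemma op_trace_compose:
  fixes b c :: "nat \<Rightarrow> 'a::{real_inner, banach}"
  assumes b: "summable (\<lambda>k. (norm (b k))\<^sup>2)" and c: "summable (\<lambda>k. (norm (c k))\<^sup>2)"
    and Q: "\<And>x. (\<lambda>k. (b k \<bullet> x) *\<^sub>R c k) sums Q x"
    and H: "\<And>x y. H x \<bullet> y = x \<bullet> H y" "\<And>x. norm (H x) \<le> K * norm x"
  shows "op_trace (\<lambda>h. Q (H h)) = (\<Sum>k. H (b k) \<bullet> c k)"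
proof -
  let ?B = "hilbert_basis :: 'a set"
  define f where "f k e = (H (b k) \<bullet> e) * (c k \<bullet> e)" for k e
  define w where "w k = (K\<^sup>2 * (norm (b k))\<^sup>2 + (norm (c k))\<^sup>2) / 2" for k
  have w: "summable w" unfolding w_def by (intro summable_divide summable_add summable_mult b c)
  have w0: "0 \<le> w k" for k by (simp add: w_def)
  have fin: "(\<Sum>e\<in>E. \<bar>f k e\<bar>) \<le> w k" if E: "finite E" "E \<subseteq> ?B" for E k
  proof -
    have "(\<Sum>e\<in>E. \<bar>f k e\<bar>) \<le> (\<Sum>e\<in>E. ((H (b k) \<bullet> e)\<^sup>2 + (c k \<bullet> e)\<^sup>2) / 2)"
    proof (rule sum_mono)
      fix e :: 'a
      have "0 \<le> (\<bar>H (b k) \<bullet> e\<bar> - \<bar>c k \<bullet> e\<bar>)\<^sup>2" by simp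
      then show "\<bar>f k e\<bar> \<le> ((H (b k) \<bullet> e)\<^sup>2 + (c k \<bullet> e)\<^sup>2) / 2"
        by (simp add: f_def power2_diff abs_mult)
    qed
    also have "\<dots> \<le> ((norm (H (b k)))\<^sup>2 + (norm (c k))\<^sup>2) / 2"
      unfolding sum_divide_distrib[symmetric] sum.distrib by (intro divide_right_mono add_mono bessel E) auto
    also have "\<dots> \<le> w k"
      unfolding w_def power_mult_distrib[symmetric]
      by (intro divide_right_mono add_right_mono power_mono H) auto
    finally show ?thesis .
  qed
  have "(\<lambda>(k, e). norm (f k e)) summable_on UNIV \<times> ?B"
  proof (rule nonneg_bdd_above_summable_on)
    show "bdd_above (sum (\<lambda>(k, e). norm (f k e)) ` {F. F \<subseteq> UNIV \<times> ?B \<and> finite F})"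
    proof (rule bdd_aboveI2)
      fix F assume F: "F \<in> {F. F \<subseteq> (UNIV :: nat set) \<times> ?B \<and> finite F}"
      have "sum (\<lambda>(k, e). norm (f k e)) F \<le> sum (\<lambda>(k, e). norm (f k e)) (fst ` F \<times> snd ` F)"
        using F subset_fst_snd[of F] by (intro sum_mono2) auto
      also have "\<dots> = (\<Sum>k\<in>fst ` F. \<Sum>e\<in>snd ` F. \<bar>f k e\<bar>)"
        by (simp add: sum.cartesian_product)
      also have "\<dots> \<le> (\<Sum>k\<in>fst ` F. w k)"
        by (intro sum_mono fin) (use F in auto)
      also have "\<dots> \<le> suminf w"
        by (rule sum_le_suminf[OF w]) (use F w0 in auto)
      finally show "sum (\<lambda>(k, e). norm (f k e)) F \<le> suminf w" .
    qed
  qed auto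
  then have sm: "(\<lambda>(k, e). f k e) summable_on UNIV \<times> ?B"
    by (rule abs_summable_summable[OF summable_on_cong[THEN iffD1, rotated]]) auto
  have row: "infsum (f k) ?B = H (b k) \<bullet> c k" for k
    unfolding f_def by (rule infsumI[OF parseval])
  have abs_e: "summable (\<lambda>k. norm (f k e))" if "e \<in> ?B" for e
  proof (rule summable_comparison_test'[OF w, of 0])
    fix k show "norm (norm (f k e)) \<le> w k" using fin[of "{e}" k] that by simp
  qed
  have col: "infsum (\<lambda>k. f k e) UNIV = Q (H e) \<bullet> e" if e: "e \<in> ?B" for e
  proof -
    have "(\<lambda>k. ((b k \<bullet> H e) *\<^sub>R c k) \<bullet> e) sums (Q (H e) \<bullet> e)"
      by (rule bounded_linear.sums[OF bounded_linear_inner_left Q])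
    then have "(\<lambda>k. f k e) sums (Q (H e) \<bullet> e)" by (simp add: f_def H(1))
    from norm_summable_imp_has_sum[OF abs_e[OF e] this] show ?thesis by (rule infsumI)
  qed
  have abs_k: "summable (\<lambda>k. norm (H (b k) \<bullet> c k))"
  proof (rule summable_comparison_test'[OF w, of 0])
    fix k
    have "\<bar>H (b k) \<bullet> c k\<bar> \<le> norm (H (b k)) * norm (c k)" by (rule Cauchy_Schwarz_ineq2)
    also have "\<dots> \<le> ((norm (H (b k)))\<^sup>2 + (norm (c k))\<^sup>2) / 2"
      using sum_squares_bound[of "norm (H (b k))" "norm (c k)"] by simp
    also have "\<dots> \<le> w k"
      unfolding w_def power_mult_distrib[symmetric]
      by (intro divide_right_mono add_right_mono power_mono H) auto
    finally show "norm (norm (H (b k) \<bullet> c k)) \<le> w k" by simp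
  qed
  have "op_trace (\<lambda>h. Q (H h)) = infsum (\<lambda>e. infsum (\<lambda>k. f k e) UNIV) ?B"
    unfolding op_trace_def by (rule infsum_cong) (simp add: col)
  also have "\<dots> = infsum (\<lambda>k. infsum (f k) ?B) UNIV"
    by (rule infsum_swap_banach[OF sm, symmetric])
  also have "\<dots> = infsum (\<lambda>k. H (b k) \<bullet> c k) UNIV" by (simp add: row)
  also have "\<dots> = (\<Sum>k. H (b k) \<bullet> c k)"
    by (rule infsumI[OF norm_summable_imp_has_sum[OF abs_k summable_sums]]) (rule summable_norm_cancel[OF abs_k])
  finally show ?thesis .
qed

section \<open>\<open>Q\<close> as a signed sum of squares\<close>

context ou_setting
begin

text \<open>Polarized nuclear representation \<open>Q = \<Sum>k (qp k \<otimes> qp k - qm k \<otimes> qm k)\<close> of the symmetric operator \<open>Q\<close>.\<close>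

definition qbc :: "(nat \<Rightarrow> 'a) \<times> (nat \<Rightarrow> 'a)" where
  "qbc = (SOME (b, c). summable (\<lambda>k. (norm (b k))\<^sup>2) \<and> summable (\<lambda>k. (norm (c k))\<^sup>2) \<and>
    (\<forall>x. (\<lambda>k. (b k \<bullet> x) *\<^sub>R c k) sums Q x))"

definition qp :: "nat \<Rightarrow> 'a" where "qp k = (1 / 2) *\<^sub>R (fst qbc k + snd qbc k)"
definition qm :: "nat \<Rightarrow> 'a" where "qm k = (1 / 2) *\<^sub>R (fst qbc k - snd qbc k)"

lemma qbc: "summable (\<lambda>k. (norm (fst qbc k))\<^sup>2)" "summable (\<lambda>k. (norm (snd qbc k))\<^sup>2)"
    "(\<lambda>k. (fst qbc k \<bullet> x) *\<^sub>R snd qbc k) sums Q x"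
proof -
  have "\<exists>bc. case bc of (b, c) \<Rightarrow> summable (\<lambda>k. (norm (b k))\<^sup>2) \<and> summable (\<lambda>k. (norm (c k))\<^sup>2) \<and>
    (\<forall>x. (\<lambda>k. (b k \<bullet> x) *\<^sub>R c k) sums Q x)"
    using trace_class_normalized[OF Q_trace_class] by auto
  from someI_ex[OF this] have "case qbc of (b, c) \<Rightarrow> summable (\<lambda>k. (norm (b k))\<^sup>2) \<and> summable (\<lambda>k. (norm (c k))\<^sup>2) \<and>
    (\<forall>x. (\<lambda>k. (b k \<bullet> x) *\<^sub>R c k) sums Q x)"
    unfolding qbc_def .
  then show "summable (\<lambda>k. (norm (fst qbc k))\<^sup>2)" "summable (\<lambda>k. (norm (snd qbc k))\<^sup>2)"
    "(\<lambda>k. (fst qbc k \<bullet> x) *\<^sub>R snd qbc k) sums Q x"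
    by (auto simp: case_prod_beta)
qed

lemma q_summable: "summable (\<lambda>k. (norm (qp k))\<^sup>2 + (norm (qm k))\<^sup>2)"
proof (rule summable_comparison_test'[of "\<lambda>k. (norm (fst qbc k))\<^sup>2 + (norm (snd qbc k))\<^sup>2" 0])
  show "summable (\<lambda>k. (norm (fst qbc k))\<^sup>2 + (norm (snd qbc k))\<^sup>2)" by (intro summable_add qbc)
  fix k
  have half: "(norm (qp k))\<^sup>2 + (norm (qm k))\<^sup>2 = ((norm (fst qbc k))\<^sup>2 + (norm (snd qbc k))\<^sup>2) / 2"
    unfolding qp_def qm_def power2_norm_eq_inner
    by (simp add: inner_add_left inner_add_right inner_diff_left inner_diff_right inner_commute field_simps)
  have "(norm (qp k))\<^sup>2 + (norm (qm k))\<^sup>2 \<le> (norm (fst qbc k))\<^sup>2 + (norm (snd qbc k))\<^sup>2"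
  proof -
    have "z \<le> u + v" if "z = (u + v) / 2" "0 \<le> u" "0 \<le> v" for z u v :: real using that by simp
    from this[OF half] show ?thesis by simp
  qed
  then show "norm ((norm (qp k))\<^sup>2 + (norm (qm k))\<^sup>2) \<le> (norm (fst qbc k))\<^sup>2 + (norm (snd qbc k))\<^sup>2" by simp
qed

text \<open>Polarization, b c = ((b + c)/2)^2 - ((b - c)/2)^2. It turns the trace into values of the
  quadratic form of \<open>H\<close> alone, so pure second directional derivatives suffice in the
  generator.\<close>

lemma polarize:
  assumes "\<And>x y. H x \<bullet> y = x \<bullet> H y" "linear H"
  shows "H (qp k) \<bullet> qp k - H (qm k) \<bullet> qm k = H (fst qbc k) \<bullet> snd qbc k"
proof -
  have "H (fst qbc k) \<bullet> snd qbc k = H (snd qbc k) \<bullet> fst qbc k"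
    using assms(1) by (metis inner_commute)
  then show ?thesis
    unfolding qp_def qm_def
    by (simp add: linear_add[OF assms(2)] linear_diff[OF assms(2)] linear_scale[OF assms(2)]
        inner_add_left inner_add_right inner_diff_left inner_diff_right field_simps)
qed

lemma Q_quadratic: "(\<lambda>k. (qp k \<bullet> x)\<^sup>2 - (qm k \<bullet> x)\<^sup>2) sums (Q x \<bullet> x)"
proof -
  have "(\<lambda>k. ((fst qbc k \<bullet> x) *\<^sub>R snd qbc k) \<bullet> x) sums (Q x \<bullet> x)"
    by (rule bounded_linear.sums[OF bounded_linear_inner_left qbc(3)])
  moreover have "((fst qbc k \<bullet> x) *\<^sub>R snd qbc k) \<bullet> x = (qp k \<bullet> x)\<^sup>2 - (qm k \<bullet> x)\<^sup>2" for k
    unfolding qp_def qm_def by (simp add: inner_add_left inner_diff_left power2_eq_square field_simps)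
  ultimately show ?thesis by simp
qed

lemma op_trace_Q:
  assumes H: "\<And>x y. H x \<bullet> y = x \<bullet> H y" "linear H" "\<And>x. norm (H x) \<le> K * norm x"
  shows "op_trace (\<lambda>h. Q (H h)) = (\<Sum>k. H (qp k) \<bullet> qp k - H (qm k) \<bullet> qm k)"
  unfolding polarize[OF H(1,2)] by (rule op_trace_compose[OF qbc H(1,3)])

subsection \<open>The time-dependent generator without drift\<close>

text \<open>The cut-off sees the original jump \<open>y\<close>, not \<open>T s y\<close>, as in the
  exponent at \<open>T' s k\<close>.\<close>

definition Gint :: "real \<Rightarrow> ('a \<Rightarrow> real) \<Rightarrow> ('a \<Rightarrow> 'a \<Rightarrow> real) \<Rightarrow> 'a \<Rightarrow> 'a \<Rightarrow> real" where
  "Gint s g d x y = g (x + T s y) - g x - indicator (cball 0 1) y * d x (T s y)"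

definition Gtr :: "real \<Rightarrow> ('a \<Rightarrow> 'a \<Rightarrow> real) \<Rightarrow> 'a \<Rightarrow> nat \<Rightarrow> real" where
  "Gtr s q x k = q x (T s (qp k)) - q x (T s (qm k))"

definition G :: "real \<Rightarrow> ('a \<Rightarrow> real) \<Rightarrow> ('a \<Rightarrow> 'a \<Rightarrow> real) \<Rightarrow> ('a \<Rightarrow> 'a \<Rightarrow> real) \<Rightarrow> 'a \<Rightarrow> real" where
  "G s g d q x = (\<integral>y. Gint s g d x y \<partial>\<nu>) + (\<Sum>k. Gtr s q x k) / 2 + d x (T s a)"

text \<open>Second order Taylor bound for small jumps, 2 C for large ones; since \<open>K\<close> is
  at least 1, the constant 2 C K^2 covers both.\<close>

lemma Gint_bound:
  assumes L: "line_C2 C g d q" and K: "\<And>x. norm (T s x) \<le> K * norm x" "K \<ge> 1"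
  shows "\<bar>Gint s g d x y\<bar> \<le> 2 * C * K\<^sup>2 * m y"
proof -
  note D = line_C2D[OF L]
  have K2: "1 \<le> K\<^sup>2" using K(2) by simp
  show ?thesis
  proof (cases "norm y \<le> 1")
    case True
    then have "\<bar>Gint s g d x y\<bar> \<le> C * (norm (T s y))\<^sup>2"
      using line_C2_taylor(2)[OF L, of x "T s y"] by (simp add: Gint_def)
    also have "\<dots> \<le> C * (K * norm y)\<^sup>2"
      using D(9) K(1)[of y] by (intro mult_left_mono power_mono) auto
    also have "\<dots> = C * K\<^sup>2 * (norm y)\<^sup>2" by (simp add: power_mult_distrib)
    also have "\<dots> \<le> 2 * C * K\<^sup>2 * (norm y)\<^sup>2"
      using D(9) by (intro mult_right_mono) auto
    also have "(norm y)\<^sup>2 = m y" using True abs_square_le_1[of "norm y"] by (simp add: min_absorb2)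
    finally show ?thesis .
  next
    case False
    then have "1 \<le> (norm y)\<^sup>2" by (intro one_le_power) simp
    then have my: "m y = 1" by simp
    have "\<bar>Gint s g d x y\<bar> \<le> C + C"
      using False D(1)[of "x + T s y"] D(1)[of x] by (simp add: Gint_def)
    also have "\<dots> \<le> 2 * C * K\<^sup>2"
      using mult_left_mono[OF K2, of "2 * C"] D(9) by simp
    finally show ?thesis by (simp only: my mult_1_right)
  qed
qed

lemma Gtr_bound:
  assumes L: "line_C2 C g d q" and K: "\<And>x. norm (T s x) \<le> K * norm x" "K \<ge> 1"
  shows "\<bar>Gtr s q x k\<bar> \<le> C * K\<^sup>2 * ((norm (qp k))\<^sup>2 + (norm (qm k))\<^sup>2)"
proof -
  note D = line_C2D[OF L]
  have b: "\<bar>q x (T s v)\<bar> \<le> C * K\<^sup>2 * (norm v)\<^sup>2" for v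
  proof -
    have "\<bar>q x (T s v)\<bar> \<le> C * (norm (T s v))\<^sup>2" by (rule D(3))
    also have "\<dots> \<le> C * (K * norm v)\<^sup>2"
      using D(9) K(1)[of v] by (intro mult_left_mono power_mono) auto
    finally show ?thesis by (simp add: power_mult_distrib)
  qed
  show ?thesis
    using b[of "qp k"] b[of "qm k"] by (simp add: Gtr_def distrib_left)
qed

lemma Gint_measurable:
  assumes L: "line_C2 C g d q" and s: "s \<ge> 0" and d: "(\<lambda>y. d x (T s y)) \<in> borel_measurable borel"
  shows "Gint s g d x \<in> borel_measurable borel"
proof -
  note D = line_C2D[OF L]
  have [measurable]: "indicator (cball 0 1) \<in> borel_measurable (borel :: 'a measure)"
    by (rule borel_measurable_indicator) simp
  have [measurable]: "g \<in> borel_measurable borel" by (rule borel_measurable_continuous_onI[OF D(6)])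
  note [measurable] = T_measurable[OF s] d
  show ?thesis unfolding Gint_def[abs_def] by measurable
qed

text \<open>Nothing in \<open>line_C2\<close> says how \<open>d x h\<close> depends on
  \<open>h\<close> beyond its size; it is measurable as a limit of difference quotients of the
  continuous \<open>g\<close>.\<close>

lemma line_C2_direction_measurable:
  assumes L: "line_C2 C g d q"
  shows "d x \<in> borel_measurable borel"
proof (rule borel_measurable_LIMSEQ_metric)
  note D = line_C2D[OF L]
  have c: "continuous_on UNIV (\<lambda>h. g (x + r *\<^sub>R h))" for r
    by (rule continuous_on_compose2[OF D(6)]) (auto intro!: continuous_intros)
  show "(\<lambda>h. (g (x + (1 / real (Suc n)) *\<^sub>R h) - g x) / (1 / real (Suc n))) \<in> borel_measurable borel" for n
    by (intro borel_measurable_continuous_onI continuous_intros c) simp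
  fix h
  have "((\<lambda>r. (g (x + r *\<^sub>R h) - g (x + 0 *\<^sub>R h)) / (r - 0)) \<longlongrightarrow> d x h) (at 0)"
    using D(4)[of x h 0] by (simp add: has_field_derivative_iff)
  moreover have "filterlim (\<lambda>n. 1 / real (Suc n)) (at 0) sequentially"
    unfolding filterlim_at by (auto intro!: always_eventually) real_asymp
  ultimately have "(\<lambda>n. (g (x + (1 / real (Suc n)) *\<^sub>R h) - g (x + 0 *\<^sub>R h)) / (1 / real (Suc n) - 0)) \<longlonglongrightarrow> d x h"
    by (rule filterlim_compose)
  then show "(\<lambda>n. (g (x + (1 / real (Suc n)) *\<^sub>R h) - g x) / (1 / real (Suc n))) \<longlonglongrightarrow> d x h" by simp
qed

lemma Gint_measurable':
  assumes L: "line_C2 C g d q" and s: "s \<ge> 0"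
  shows "Gint s g d x \<in> borel_measurable borel"
  by (rule Gint_measurable[OF L s]) (rule measurable_compose[OF T_measurable[OF s] line_C2_direction_measurable[OF L]])

lemma Gint_integrable:
  assumes L: "line_C2 C g d q" and s: "s \<ge> 0"
  shows "integrable \<nu> (Gint s g d x)"
proof -
  obtain K where K: "K \<ge> 1" "\<And>t x. 0 \<le> t \<Longrightarrow> t \<le> s \<Longrightarrow> norm (T t x) \<le> K * norm x"
    using T.T_bounded[of s] by metis
  show ?thesis
    by (rule integrable_dominated_m[OF Gint_measurable'[OF L s]])
      (use Gint_bound[OF L _ K(1)] K(2)[OF s order_refl] in auto)
qed

lemma Gtr_summable:
  assumes L: "line_C2 C g d q" and s: "s \<ge> 0"
  shows "summable (Gtr s q x)"
proof -
  obtain K where K: "K \<ge> 1" "\<And>t x. 0 \<le> t \<Longrightarrow> t \<le> s \<Longrightarrow> norm (T t x) \<le> K * norm x"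
    using T.T_bounded[of s] by metis
  show ?thesis
    by (rule summable_comparison_test'[OF summable_mult[OF q_summable, of "C * K\<^sup>2"], of 0])
      (use Gtr_bound[OF L _ K(1)] K(2)[OF s order_refl] in auto)
qed

text \<open>\<open>L\<close> depends only on the time horizon and multiplies \<open>C\<close>; this
  uniformity in the function and the point supplies later dominating constants.\<close>

lemma G_bound:
  assumes r: "r \<ge> 0"
  obtains L where "L \<ge> 0" "\<And>C g d q s x. line_C2 C g d q \<Longrightarrow> 0 \<le> s \<Longrightarrow> s \<le> r \<Longrightarrow> \<bar>G s g d q x\<bar> \<le> C * L"
proof -
  obtain K where K: "K \<ge> 1" "\<And>t x. 0 \<le> t \<Longrightarrow> t \<le> r \<Longrightarrow> norm (T t x) \<le> K * norm x"
    using T.T_bounded[of r] by metis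
  define I where "I = integral\<^sup>L \<nu> m"
  define S where "S = (\<Sum>k. (norm (qp k))\<^sup>2 + (norm (qm k))\<^sup>2)"
  have I: "I \<ge> 0" unfolding I_def by simp
  have S: "S \<ge> 0" unfolding S_def by (rule suminf_nonneg[OF q_summable]) simp
  define L where "L = 2 * K\<^sup>2 * I + K\<^sup>2 * S + K * norm a"
  show thesis
  proof (rule that[of L])
    show "L \<ge> 0" using I S K(1) by (auto simp: L_def intro!: add_nonneg_nonneg mult_nonneg_nonneg)
    fix C and g :: "'a \<Rightarrow> real" and d q :: "'a \<Rightarrow> 'a \<Rightarrow> real" and s x
    assume L: "line_C2 C g d q" and s: "0 \<le> s" "s \<le> r"
    note D = line_C2D[OF L] and Ks = K(2)[OF s]
    have "\<bar>\<integral>y. Gint s g d x y \<partial>\<nu>\<bar> \<le> (\<integral>y. \<bar>Gint s g d x y\<bar> \<partial>\<nu>)" by (rule integral_abs_bound)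
    also have "\<dots> \<le> (\<integral>y. 2 * C * K\<^sup>2 * m y \<partial>\<nu>)"
      by (rule integral_mono) (use Gint_integrable[OF L s(1)] integrable_m Gint_bound[OF L Ks K(1)] in auto)
    also have "\<dots> = C * (2 * K\<^sup>2 * I)" by (simp add: I_def)
    finally have 1: "\<bar>\<integral>y. Gint s g d x y \<partial>\<nu>\<bar> \<le> C * (2 * K\<^sup>2 * I)" .
    have "norm (\<Sum>k. Gtr s q x k) \<le> (\<Sum>k. C * K\<^sup>2 * ((norm (qp k))\<^sup>2 + (norm (qm k))\<^sup>2))"
    proof -
      have gs: "summable (\<lambda>k. norm (Gtr s q x k))"
        by (rule summable_comparison_test'[OF summable_mult[OF q_summable, of "C * K\<^sup>2"], of 0])
          (use Gtr_bound[OF L Ks K(1)] in simp)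
      have "norm (\<Sum>k. Gtr s q x k) \<le> (\<Sum>k. norm (Gtr s q x k))" by (rule summable_norm[OF gs])
      also have "\<dots> \<le> (\<Sum>k. C * K\<^sup>2 * ((norm (qp k))\<^sup>2 + (norm (qm k))\<^sup>2))"
        by (rule suminf_le[OF _ gs summable_mult[OF q_summable]]) (use Gtr_bound[OF L Ks K(1)] in simp)
      finally show ?thesis .
    qed
    also have "\<dots> = C * (K\<^sup>2 * S)" unfolding S_def by (subst suminf_mult[OF q_summable]) simp
    finally have 2: "\<bar>\<Sum>k. Gtr s q x k\<bar> / 2 \<le> C * (K\<^sup>2 * S)" by simp
    have "\<bar>d x (T s a)\<bar> \<le> C * norm (T s a)" by (rule D(2))
    also have "\<dots> \<le> C * (K * norm a)" by (intro mult_left_mono Ks D(9))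
    finally show "\<bar>G s g d q x\<bar> \<le> C * L"
      using 1 2 by (simp add: G_def L_def distrib_left)
  qed
qed

text \<open>Function, time and point may vary together, with convergence needed only along each
  transported vector. Dominated convergence handles the jumps and Tannery's theorem the trace; the
  lemma serves limits of test functions, continuity in \<open>x\<close> and small times.\<close>

lemma G_tendsto:
  assumes L: "\<And>n. line_C2 C (gs n) (ds n) (qs n)" "line_C2 C g d q"
    and s: "\<And>n. 0 \<le> sn n" "\<And>n. sn n \<le> r" "0 \<le> s"
    and g0: "(\<lambda>n. gs n (xs n)) \<longlonglongrightarrow> g x" and g1: "\<And>y. (\<lambda>n. gs n (xs n + T (sn n) y)) \<longlonglongrightarrow> g (x + T s y)"
    and d: "\<And>y. (\<lambda>n. ds n (xs n) (T (sn n) y)) \<longlonglongrightarrow> d x (T s y)"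
    and q: "\<And>y. (\<lambda>n. qs n (xs n) (T (sn n) y)) \<longlonglongrightarrow> q x (T s y)"
  shows "(\<lambda>n. G (sn n) (gs n) (ds n) (qs n) (xs n)) \<longlonglongrightarrow> G s g d q x"
proof -
  obtain K where K: "K \<ge> 1" "\<And>t x. 0 \<le> t \<Longrightarrow> t \<le> r \<Longrightarrow> norm (T t x) \<le> K * norm x"
    using T.T_bounded[of r] by metis
  have "(\<lambda>n. \<integral>y. Gint (sn n) (gs n) (ds n) (xs n) y \<partial>\<nu>) \<longlonglongrightarrow> (\<integral>y. Gint s g d x y \<partial>\<nu>)"
  proof (rule integral_tendsto_m)
    have "\<bar>Gint (sn n) (gs n) (ds n) (xs n) y\<bar> \<le> 2 * C * K\<^sup>2 * m y" for n y
      by (rule Gint_bound[OF L(1) K(2)[OF s(1,2)] K(1)])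
    then show "norm (Gint (sn n) (gs n) (ds n) (xs n) y) \<le> 2 * C * K\<^sup>2 * m y" for n y
      by (simp only: real_norm_def)
    show "(\<lambda>n. Gint (sn n) (gs n) (ds n) (xs n) y) \<longlonglongrightarrow> Gint s g d x y" for y
      unfolding Gint_def by (intro tendsto_intros g0 g1 d)
  qed (rule Gint_measurable'[OF L(1) s(1)] Gint_measurable'[OF L(2) s(3)])+
  moreover have "(\<lambda>n. \<Sum>k. Gtr (sn n) (qs n) (xs n) k) \<longlonglongrightarrow> (\<Sum>k. Gtr s q x k)"
  proof (rule conjunct2[OF conjunct2[OF tannerys_theorem[where M = "\<lambda>k. C * K\<^sup>2 * ((norm (qp k))\<^sup>2 + (norm (qm k))\<^sup>2)"]]])
    show "(\<lambda>n. Gtr (sn n) (qs n) (xs n) k) \<longlonglongrightarrow> Gtr s q x k" for k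
      unfolding Gtr_def by (intro tendsto_intros q)
    show "\<forall>\<^sub>F (k, n) in sequentially \<times>\<^sub>F sequentially. norm (Gtr (sn n) (qs n) (xs n) k) \<le> C * K\<^sup>2 * ((norm (qp k))\<^sup>2 + (norm (qm k))\<^sup>2)"
      by (intro always_eventually) (use Gtr_bound[OF L(1) K(2)[OF s(1,2)] K(1)] in auto)
    show "summable (\<lambda>k. C * K\<^sup>2 * ((norm (qp k))\<^sup>2 + (norm (qm k))\<^sup>2))" by (rule summable_mult[OF q_summable])
  qed simp
  ultimately show ?thesis
    unfolding G_def by (intro tendsto_intros d) auto
qed

lemma G_continuous:
  assumes L: "line_C2 C g d q" and s: "s \<ge> 0"
  shows "continuous_on UNIV (G s g d q)"
  unfolding continuous_on_sequentially o_def
proof (intro allI ballI impI)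
  fix xs and x :: 'a assume "(\<forall>n. xs n \<in> UNIV) \<and> xs \<longlonglongrightarrow> x"
  then have xs: "xs \<longlonglongrightarrow> x" by simp
  note D = line_C2D[OF L]
  show "(\<lambda>n. G s g d q (xs n)) \<longlonglongrightarrow> G s g d q x"
  proof (rule G_tendsto[OF L L s order_refl s])
    show "(\<lambda>n. g (xs n)) \<longlonglongrightarrow> g x" using continuous_on_tendsto_compose[OF D(6) xs] by simp
    have "(\<lambda>n. xs n + T s y) \<longlonglongrightarrow> x + T s y" for y by (intro tendsto_intros xs)
    from continuous_on_tendsto_compose[OF D(6) this]
    show "(\<lambda>n. g (xs n + T s y)) \<longlonglongrightarrow> g (x + T s y)" for y by simp
    show "(\<lambda>n. d (xs n) (T s y)) \<longlonglongrightarrow> d x (T s y)" "(\<lambda>n. q (xs n) (T s y)) \<longlonglongrightarrow> q x (T s y)" for y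
      using continuous_on_tendsto_compose[OF D(7) xs] continuous_on_tendsto_compose[OF D(8) xs] by auto
  qed
qed

lemma G_add:
  assumes "line_C2 C g d q" "line_C2 C' g2 d2 q2" and s: "s \<ge> 0"
  shows "G s (\<lambda>x. g x + g2 x) (\<lambda>x h. d x h + d2 x h) (\<lambda>x h. q x h + q2 x h) x = G s g d q x + G s g2 d2 q2 x"
proof -
  have "Gint s (\<lambda>x. g x + g2 x) (\<lambda>x h. d x h + d2 x h) x y = Gint s g d x y + Gint s g2 d2 x y" for y
    by (simp add: Gint_def algebra_simps)
  moreover have "Gtr s (\<lambda>x h. q x h + q2 x h) x k = Gtr s q x k + Gtr s q2 x k" for k
    by (simp add: Gtr_def)
  ultimately show ?thesis
    using Gint_integrable[OF assms(1) s, of x] Gint_integrable[OF assms(2) s, of x]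
      Gtr_summable[OF assms(1) s, of x] Gtr_summable[OF assms(2) s, of x]
    by (simp add: G_def suminf_add[symmetric])
qed

lemma G_cmult:
  assumes "line_C2 C g d q" and s: "s \<ge> 0"
  shows "G s (\<lambda>x. b * g x) (\<lambda>x h. b * d x h) (\<lambda>x h. b * q x h) x = b * G s g d q x"
proof -
  have "Gint s (\<lambda>x. b * g x) (\<lambda>x h. b * d x h) x y = b * Gint s g d x y" for y
    by (simp add: Gint_def algebra_simps)
  moreover have "Gtr s (\<lambda>x h. b * q x h) x k = b * Gtr s q x k" for k
    by (simp add: Gtr_def right_diff_distrib)
  ultimately show ?thesis
    using suminf_mult[OF Gtr_summable[OF assms(1) s, of x], of b]
    by (simp add: G_def algebra_simps)
qed

text \<open>Adjointness moves \<open>T s\<close> from jumps, diffusion and shift to the frequency,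
  so the operator multiplies the character of frequency \<open>k\<close> by minus the exponent at
  \<open>T' s k\<close>.\<close>

lemma G_cos:
  assumes s: "s \<ge> 0"
  shows "G s (\<lambda>x. cos (k \<bullet> x + c)) (\<lambda>x h. - sin (k \<bullet> x + c) * (k \<bullet> h)) (\<lambda>x h. - cos (k \<bullet> x + c) * (k \<bullet> h)\<^sup>2) x
    = Re (cis (k \<bullet> x + c) * - \<psi> (T' s k))"
proof -
  define \<theta> where "\<theta> = k \<bullet> x + c"
  define \<kappa> where "\<kappa> = T' s k"
  have kT: "k \<bullet> T s y = \<kappa> \<bullet> y" for y
    using T_adjoint[OF s, of y k] by (simp add: \<kappa>_def inner_commute)
  have "Gint s (\<lambda>x. cos (k \<bullet> x + c)) (\<lambda>x h. - sin (k \<bullet> x + c) * (k \<bullet> h)) x y = Re (cis \<theta> * levy_int \<kappa> y)" for y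
  proof -
    have "k \<bullet> (x + T s y) + c = \<theta> + \<kappa> \<bullet> y" by (simp add: \<theta>_def inner_add_right kT)
    then have e: "cos (k \<bullet> (x + T s y) + c) = cos \<theta> * cos (\<kappa> \<bullet> y) - sin \<theta> * sin (\<kappa> \<bullet> y)"
      by (simp only: cos_add)
    show ?thesis
      unfolding Gint_def levy_int_def kT e \<theta>_def[symmetric]
      by (simp add: cis_conv_exp[symmetric] algebra_simps)
  qed
  then have 1: "(\<integral>y. Gint s (\<lambda>x. cos (k \<bullet> x + c)) (\<lambda>x h. - sin (k \<bullet> x + c) * (k \<bullet> h)) x y \<partial>\<nu>)
      = Re (cis \<theta> * (\<integral>y. levy_int \<kappa> y \<partial>\<nu>))"
    using levy_int_integrable[of \<kappa>] by (simp del: times_complex.sel add: integral_Re[symmetric])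
  have "Gtr s (\<lambda>x h. - cos (k \<bullet> x + c) * (k \<bullet> h)\<^sup>2) x j = - cos \<theta> * ((qp j \<bullet> \<kappa>)\<^sup>2 - (qm j \<bullet> \<kappa>)\<^sup>2)" for j
    by (simp add: Gtr_def kT \<theta>_def inner_commute right_diff_distrib)
  then have 2: "(\<Sum>j. Gtr s (\<lambda>x h. - cos (k \<bullet> x + c) * (k \<bullet> h)\<^sup>2) x j) = - cos \<theta> * (Q \<kappa> \<bullet> \<kappa>)"
    using sums_unique[OF sums_mult[OF Q_quadratic, of "- cos \<theta>" \<kappa>]] by simp
  show ?thesis
    unfolding G_def 1 2 \<psi>_eq kT \<kappa>_def[symmetric] \<theta>_def[symmetric]
    by (simp add: inner_commute algebra_simps)
qed

end

subsection \<open>A bounded smooth function measuring distance to \<open>0\<close>\<close>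

definition kap :: "'a::real_inner \<Rightarrow> real" where "kap y = 1 - inverse (1 + y \<bullet> y)"

lemma kap_eq: "kap y = (norm y)\<^sup>2 / (1 + (norm y)\<^sup>2)"
proof -
  have "1 + (norm y)\<^sup>2 \<noteq> 0" using zero_le_power2[of "norm y"] by linarith
  then show ?thesis by (simp add: kap_def power2_norm_eq_inner[symmetric] field_simps)
qed

lemma kap_0: "kap 0 = 0" and kap_nonneg: "0 \<le> kap y" and kap_le_1: "kap y \<le> 1"
proof -
  have p: "0 < 1 + (norm y)\<^sup>2" by (simp add: add_pos_nonneg)
  show "kap 0 = 0" by (simp add: kap_def)
  show "0 \<le> kap y" by (simp add: kap_eq)
  show "kap y \<le> 1" using p by (simp add: kap_eq)
qed

text \<open>10 = 2 + 8 from the two Hessian terms. With r = 1 / (1 + |y|^2), the inequalities r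
  \<le> 1 and r |y|^2 \<le> 1 absorb the growth of the term that is quadratic in
  \<open>y\<close>.\<close>

lemma C2b_kap: "C2b 10 kap (\<lambda>y. (2 * (inverse (1 + y \<bullet> y))\<^sup>2) *\<^sub>R y)
   (\<lambda>y h. (2 * (inverse (1 + y \<bullet> y))\<^sup>2) *\<^sub>R h - (8 * (inverse (1 + y \<bullet> y)) ^ 3 * (y \<bullet> h)) *\<^sub>R (y :: 'a::real_inner))"
  unfolding C2b_def
proof (intro conjI allI)
  fix y h k :: 'a
  define r where "r = inverse (1 + y \<bullet> y)"
  have p: "0 < 1 + y \<bullet> y" "1 + y \<bullet> y \<noteq> 0" by (simp_all add: add_pos_nonneg add_nonneg_eq_0_iff)
  have r: "0 < r" "r \<le> 1" using p(1) by (auto simp: r_def inverse_le_1_iff)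
  have rn: "r * (norm y * norm y) \<le> 1"
    using p by (simp add: r_def power2_norm_eq_inner[symmetric] power2_eq_square divide_simps)
  have ry: "r * norm y \<le> 1"
  proof (cases "norm y \<le> 1")
    case True then show ?thesis using r by (simp add: mult_le_one)
  next
    case False
    then have "r * (norm y * 1) \<le> r * (norm y * norm y)" using r by (intro mult_left_mono) auto
    then show ?thesis using rn by simp
  qed
  have rr: "r\<^sup>2 \<le> 1" "r ^ 3 \<le> r" using r by (simp_all add: power_le_one power_le_one_iff power_decreasing[of 1 3 r, simplified])
  show "\<bar>kap y\<bar> \<le> 10" using kap_nonneg[of y] kap_le_1[of y] by simp
  have "r * (r * norm y) \<le> 1 * 1" using r ry by (intro mult_mono) auto
  then show "norm ((2 * (inverse (1 + y \<bullet> y))\<^sup>2) *\<^sub>R y) \<le> 10"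
    using r by (simp add: r_def[symmetric] power2_eq_square mult.assoc)
  have a: "norm ((2 * r\<^sup>2) *\<^sub>R h) \<le> 2 * norm h"
    using mult_right_mono[OF rr(1), of "norm h"] by simp
  have "norm ((8 * r ^ 3 * (y \<bullet> h)) *\<^sub>R y) = 8 * r ^ 3 * (\<bar>y \<bullet> h\<bar> * norm y)"
    using r by (simp add: abs_mult mult_ac)
  also have "\<dots> \<le> 8 * r * ((norm y * norm h) * norm y)"
    using r rr by (intro mult_mono Cauchy_Schwarz_ineq2) auto
  also have "\<dots> = 8 * (r * (norm y * norm y)) * norm h" by (simp add: mult_ac)
  also have "\<dots> \<le> 8 * 1 * norm h" using rn by (intro mult_right_mono mult_left_mono) auto
  finally show "norm ((2 * (inverse (1 + y \<bullet> y))\<^sup>2) *\<^sub>R h - (8 * (inverse (1 + y \<bullet> y)) ^ 3 * (y \<bullet> h)) *\<^sub>R y) \<le> 10 * norm h"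
    using a norm_triangle_ineq4[of "(2 * r\<^sup>2) *\<^sub>R h" "(8 * r ^ 3 * (y \<bullet> h)) *\<^sub>R y"] unfolding r_def[symmetric] by linarith
  have d1: "((\<lambda>y. inverse (1 + y \<bullet> y)) has_derivative (\<lambda>h. - (2 * r\<^sup>2 * (y \<bullet> h)))) (at y)"
  proof -
    have "((\<lambda>y. 1 + y \<bullet> y) has_derivative (\<lambda>h. 2 * (y \<bullet> h))) (at y)"
      by (rule has_derivative_eq_rhs[OF has_derivative_add[OF has_derivative_const
            has_derivative_inner[OF has_derivative_ident has_derivative_ident]]]) (auto simp: inner_commute)
    from Deriv.has_derivative_inverse[OF p(2) this] show ?thesis
      by (rule has_derivative_eq_rhs) (auto simp: r_def power2_eq_square)
  qed
  show "(kap has_derivative (\<lambda>h. (2 * (inverse (1 + y \<bullet> y))\<^sup>2) *\<^sub>R y \<bullet> h)) (at y)"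
    unfolding kap_def[abs_def] r_def[symmetric]
    by (rule has_derivative_eq_rhs[OF has_derivative_diff[OF has_derivative_const d1]]) auto
  have d2: "((\<lambda>y. 2 * (inverse (1 + y \<bullet> y))\<^sup>2) has_derivative (\<lambda>h. - (8 * r ^ 3 * (y \<bullet> h)))) (at y)"
    by (rule has_derivative_eq_rhs[OF has_derivative_mult_right[OF has_derivative_power[OF d1]]])
      (auto simp: r_def[symmetric] power2_eq_square power3_eq_cube)
  show "((\<lambda>y. (2 * (inverse (1 + y \<bullet> y))\<^sup>2) *\<^sub>R y) has_derivative
      (\<lambda>h. (2 * (inverse (1 + y \<bullet> y))\<^sup>2) *\<^sub>R h - (8 * (inverse (1 + y \<bullet> y)) ^ 3 * (y \<bullet> h)) *\<^sub>R y)) (at y)"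
    unfolding r_def[symmetric]
    by (rule has_derivative_eq_rhs[OF has_derivative_scaleR[OF d2 has_derivative_ident]]) (auto simp: r_def[symmetric])
  show "((2 * (inverse (1 + y \<bullet> y))\<^sup>2) *\<^sub>R h - (8 * (inverse (1 + y \<bullet> y)) ^ 3 * (y \<bullet> h)) *\<^sub>R y) \<bullet> k
      = ((2 * (inverse (1 + y \<bullet> y))\<^sup>2) *\<^sub>R k - (8 * (inverse (1 + y \<bullet> y)) ^ 3 * (y \<bullet> k)) *\<^sub>R y) \<bullet> h"
    by (simp add: inner_diff_left inner_commute[of h k])
next
  fix h :: 'a
  have "1 + y \<bullet> y \<noteq> 0" for y :: 'a by (simp add: add_nonneg_eq_0_iff)
  then show "continuous_on UNIV (\<lambda>y. (2 * (inverse (1 + y \<bullet> y))\<^sup>2) *\<^sub>R h - (8 * (inverse (1 + y \<bullet> y)) ^ 3 * (y \<bullet> h)) *\<^sub>R y)"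
    by (intro continuous_intros) auto
qed

lemma kap_mono_norm:
  assumes "norm v \<le> K * norm x" "K \<ge> 1"
  shows "kap v \<le> K\<^sup>2 * kap x"
proof -
  define n where "n = (norm x)\<^sup>2"
  define k where "k = (norm v)\<^sup>2"
  have n: "n \<ge> 0" "k \<ge> 0" by (simp_all add: n_def k_def)
  have K: "1 \<le> K\<^sup>2" using assms(2) by simp
  have kn: "k \<le> K\<^sup>2 * n"
    using power_mono[OF assms(1) norm_ge_zero, of 2] by (simp add: n_def k_def power_mult_distrib)
  have "k * (1 + n) \<le> K\<^sup>2 * n * (1 + k)"
  proof -
    have "k * n \<le> K\<^sup>2 * n * k" using mult_right_mono[OF K, of "n * k"] n by (simp add: mult_ac)
    then show ?thesis using kn by (simp add: algebra_simps)
  qed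
  then show ?thesis
    using n unfolding kap_eq n_def[symmetric] k_def[symmetric] by (simp add: divide_simps add_nonneg_eq_0_iff)
qed

text \<open>t / (1 + t) is increasing, so |x + y|^2 \<le> 2 |x|^2 + 2 |y|^2 may be inserted. The
  factor 2 is the price for a bounded substitute of the squared distance.\<close>

lemma kap_add: "kap (x + y) \<le> 2 * kap x + 2 * kap y"
proof -
  define u where "u = (norm x)\<^sup>2"
  define v where "v = (norm y)\<^sup>2"
  define w where "w = (norm (x + y))\<^sup>2"
  have nn: "u \<ge> 0" "v \<ge> 0" "w \<ge> 0" by (simp_all add: u_def v_def w_def)
  have "norm (x + y) \<le> norm x + norm y" by (rule norm_triangle_ineq)
  then have "w \<le> (norm x + norm y)\<^sup>2" unfolding w_def by (intro power_mono) auto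
  also have "\<dots> \<le> 2 * u + 2 * v"
    using sum_squares_bound[of "norm x" "norm y"] by (simp add: u_def v_def power2_sum)
  finally have w: "w \<le> 2 * u + 2 * v" .
  have frac: "t / (1 + t) = 1 - inverse (1 + t)" if "t \<ge> 0" for t :: real
    using that by (simp add: field_simps)
  have "w / (1 + w) \<le> (2 * u + 2 * v) / (1 + (2 * u + 2 * v))"
    using frac[of w] frac[of "2 * u + 2 * v"] le_imp_inverse_le[of "1 + w" "1 + (2 * u + 2 * v)"] w nn by simp
  also have "\<dots> = 2 * u / (1 + (2 * u + 2 * v)) + 2 * v / (1 + (2 * u + 2 * v))" by (simp add: add_divide_distrib)
  also have "\<dots> \<le> 2 * u / (1 + u) + 2 * v / (1 + v)"
    using nn by (intro add_mono divide_left_mono) (auto intro!: mult_pos_pos add_pos_nonneg)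
  finally show ?thesis unfolding kap_eq u_def v_def w_def by simp
qed

lemma kap_tendsto_0D:
  assumes "(\<lambda>n. kap (y n)) \<longlonglongrightarrow> 0"
  shows "y \<longlonglongrightarrow> 0"
proof -
  have p: "1 + (norm y)\<^sup>2 \<noteq> 0" for y :: 'a using zero_le_power2[of "norm y"] by linarith
  have "(\<lambda>n. kap (y n) / (1 - kap (y n))) \<longlonglongrightarrow> 0 / (1 - 0)"
    by (intro tendsto_intros assms) simp
  moreover have "kap y / (1 - kap y) = (norm y)\<^sup>2" for y :: 'a
  proof -
    have "1 - kap y = 1 / (1 + (norm y)\<^sup>2)" using p[of y] by (simp add: kap_eq field_simps)
    then show ?thesis using p[of y] by (simp add: kap_eq)
  qed
  ultimately have "(\<lambda>n. (norm (y n))\<^sup>2) \<longlonglongrightarrow> 0" by simp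
  from tendsto_real_sqrt[OF this] show ?thesis by (simp add: tendsto_norm_zero_iff)
qed

lemma kap_tendsto_0I:
  assumes "y \<longlonglongrightarrow> 0"
  shows "(\<lambda>n. kap (y n)) \<longlonglongrightarrow> 0"
  using continuous_on_tendsto_compose[OF C2bD(10)[OF C2b_kap] assms] by (simp add: kap_0)

text \<open>Leads from almost sure convergence along subsequences, which is what convergence in
  probability offers, back to full sequences of expectations.\<close>

lemma tendsto_subsequence_criterion:
  fixes x :: "nat \<Rightarrow> 'b::topological_space"
  assumes "\<And>r :: nat \<Rightarrow> nat. strict_mono r \<Longrightarrow> \<exists>r' :: nat \<Rightarrow> nat. strict_mono r' \<and> (\<lambda>n. x (r (r' n))) \<longlonglongrightarrow> l"
  shows "x \<longlonglongrightarrow> l"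
proof (rule topological_tendstoI, rule ccontr)
  fix S assume S: "open S" "l \<in> S" and "\<not> (\<forall>\<^sub>F n in sequentially. x n \<in> S)"
  then obtain r :: "nat \<Rightarrow> nat" where r: "strict_mono r" "\<And>n. x (r n) \<notin> S"
    using not_eventually_sequentiallyD by blast
  obtain r' where "(\<lambda>n. x (r (r' n))) \<longlonglongrightarrow> l" using assms[OF r(1)] by blast
  from topological_tendstoD[OF this S] r(2) show False by simp
qed

lemma (in prob_space) expectation_norm_le:
  fixes f :: "'a \<Rightarrow> 'b::{banach, second_countable_topology}"
  assumes f: "f \<in> borel_measurable M" and b: "\<And>\<omega>. norm (f \<omega>) \<le> B"
  shows "norm (\<integral>\<omega>. f \<omega> \<partial>M) \<le> B"
proof -
  have i: "integrable M f" by (rule integrable_const_bound[where B = B]) (use f b in auto)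
  have "norm (\<integral>\<omega>. f \<omega> \<partial>M) \<le> (\<integral>\<omega>. norm (f \<omega>) \<partial>M)" by (rule integral_norm_bound)
  also have "\<dots> \<le> (\<integral>\<omega>. B \<partial>M)" by (rule integral_mono) (use i b in auto)
  finally show ?thesis by (simp add: prob_space)
qed

context ou_setting
begin

subsection \<open>Dynkin's formula for the law of \<open>Y\<close>\<close>

lemma char_Y_derivative:
  assumes s: "s \<in> {0..h}"
  shows "((\<lambda>s. char_Y s k) has_vector_derivative - \<psi> (T' s k) * char_Y s k) (at s within {0..h})"
proof -
  have "((\<lambda>s. integral {0..s} (\<lambda>s. \<psi> (T' s k))) has_vector_derivative \<psi> (T' s k)) (at s within {0..h})"
    by (rule integral_has_vector_derivative[OF \<psi>_continuous_time s])
  from field_vector_diff_chain_within[OF has_vector_derivative_minus[OF this] has_field_derivative_at_within[OF DERIV_exp]]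
  show ?thesis by (simp add: char_Y_def[abs_def] o_def)
qed

lemma char_Y_continuous: "continuous_on {0..h} (\<lambda>s. char_Y s k)"
  using char_Y_derivative has_vector_derivative_continuous continuous_on_eq_continuous_within by blast

lemma C2b_borel: "C2b C g g' g'' \<Longrightarrow> g \<in> borel_measurable borel"
  by (rule borel_measurable_continuous_onI[OF C2bD(10)])

text \<open>For a cosine the integrand in \<open>s\<close> is the derivative of the real part of a
  multiple of \<open>char_Y s k\<close>, so the formula is the fundamental theorem of calculus. The
  rest is linearity and two nested dominated convergences, with the bound C L on [0, h].\<close>

lemma dynkin:
  fixes z :: 'a
  assumes h: "h \<ge> 0" and g: "C2b C g g' g''"
  defines "\<Phi> \<equiv> \<lambda>s. \<integral>\<omega>. G s g (\<lambda>x h. g' x \<bullet> h) (\<lambda>x h. g'' x h \<bullet> h) (z + Y s \<omega>) \<partial>M"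
  shows "(\<lambda>s. indicator {0..h} s * \<Phi> s) \<in> borel_measurable borel"
    and "(\<integral>\<omega>. g (z + Y h \<omega>) \<partial>M) - g z = (\<integral>s. indicator {0..h} s * \<Phi> s \<partial>lborel)"
proof -
  define E where "E g d q s = (\<integral>\<omega>. G s g d q (z + Y s \<omega>) \<partial>M)" for g d q s
  define F where "F g d q s = indicator {0..h} s * E g d q s" for g d q s
  obtain L where L: "L \<ge> 0" "\<And>C g d q s x. line_C2 C g d q \<Longrightarrow> 0 \<le> s \<Longrightarrow> s \<le> h \<Longrightarrow> \<bar>G s g d q x\<bar> \<le> C * L"
    using G_bound[OF h] by metis
  have G_meas: "(\<lambda>\<omega>. G s g d q (z + Y s \<omega>)) \<in> borel_measurable M" if "line_C2 C g d q" "s \<ge> 0" for C g d q s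
  proof -
    have [measurable]: "G s g d q \<in> borel_measurable borel"
      by (rule borel_measurable_continuous_onI[OF G_continuous[OF that]])
    have [measurable]: "Y s \<in> borel_measurable M" using that by simp
    show ?thesis by measurable
  qed
  have G_int: "integrable M (\<lambda>\<omega>. G s g d q (z + Y s \<omega>))" if "line_C2 C g d q" "0 \<le> s" "s \<le> h" for C g d q s
    by (rule integrable_const_bound[where B = "C * L"]) (use G_meas[OF that(1,2)] L(2)[OF that] in auto)
  have E_bound: "\<bar>E g d q s\<bar> \<le> C * L" if "line_C2 C g d q" "0 \<le> s" "s \<le> h" for C g d q s
  proof -
    have "\<bar>E g d q s\<bar> \<le> (\<integral>\<omega>. \<bar>G s g d q (z + Y s \<omega>)\<bar> \<partial>M)" unfolding E_def by (rule integral_abs_bound)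
    also have "\<dots> \<le> (\<integral>\<omega>. C * L \<partial>M)"
      by (rule integral_mono) (use G_int[OF that] L(2)[OF that] in auto)
    finally show ?thesis by (simp add: prob_space)
  qed
  have F_bound: "\<bar>F g d q s\<bar> \<le> C * L * indicator {0..h} s" if "line_C2 C g d q" for C g d q s
    using E_bound[OF that, of s] by (auto simp: F_def indicator_def)
  have int_ind: "integrable lborel (\<lambda>s. c * indicator {0..h} s :: real)" for c
    by (intro integrable_mult_right integrable_real_indicator) (auto simp: h)
  have F_int: "integrable lborel (F g d q)" if "line_C2 C g d q" "F g d q \<in> borel_measurable borel" for C g d q
    by (rule Bochner_Integration.integrable_bound[OF int_ind[of "C * L"]])
      (use that F_bound[OF that(1)] in \<open>auto intro: order_trans[OF _ abs_ge_self]\<close>)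
  have gm: "(\<lambda>\<omega>. g (z + Y h \<omega>)) \<in> borel_measurable M" "integrable M (\<lambda>\<omega>. g (z + Y h \<omega>))"
    if "line_C2 C g d q" for C d q and g :: "'a \<Rightarrow> real"
  proof -
    have [measurable]: "g \<in> borel_measurable borel" by (rule borel_measurable_continuous_onI[OF line_C2D(6)[OF that]])
    have [measurable]: "Y h \<in> borel_measurable M" using h by simp
    show "(\<lambda>\<omega>. g (z + Y h \<omega>)) \<in> borel_measurable M" by measurable
    then show "integrable M (\<lambda>\<omega>. g (z + Y h \<omega>))"
      by (rule integrable_const_bound[where B = C, rotated]) (use line_C2D(1)[OF that] in auto)
  qed
  \<comment> \<open>Measurability in time is carried along with the identity: the limit in
    \<open>s\<close> needs it, and for general \<open>g\<close> it is obtained only by passing to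
    limits.\<close>
  interpret bp_class "\<lambda>g d q. F g d q \<in> borel_measurable borel \<and>
      (\<integral>\<omega>. g (z + Y h \<omega>) \<partial>M) - g z = integral\<^sup>L lborel (F g d q)"
  proof
    fix k :: 'a and c
    let ?g = "\<lambda>x. cos (k \<bullet> x + c)" and ?d = "\<lambda>x h. - sin (k \<bullet> x + c) * (k \<bullet> h)"
    let ?q = "\<lambda>x h. - cos (k \<bullet> x + c) * (k \<bullet> h)\<^sup>2"
    \<comment> \<open>Phase of the starting point: the cosine at \<open>z + y\<close> is the real
      part of \<open>w\<close> times the character at \<open>y\<close>.\<close>
    define w where "w = cis (k \<bullet> z + c)"
    have cs: "cis (k \<bullet> (z + y) + c) = w * iexp (k \<bullet> y)" for y
      by (simp add: w_def cis_conv_exp[symmetric] cis_mult inner_add_right algebra_simps)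
    have ii: "integrable M (\<lambda>\<omega>. iexp (k \<bullet> Y s \<omega>))" if "s \<ge> 0" for s
    proof (rule integrable_const_bound[where B = 1])
      have [measurable]: "Y s \<in> borel_measurable M" using that by simp
      show "(\<lambda>\<omega>. iexp (k \<bullet> Y s \<omega>)) \<in> borel_measurable M" by measurable
    qed auto
    have E: "E ?g ?d ?q s = Re (w * (- \<psi> (T' s k) * char_Y s k))" if s: "s \<ge> 0" for s
    proof -
      have "E ?g ?d ?q s = (\<integral>\<omega>. Re (w * - \<psi> (T' s k) * iexp (k \<bullet> Y s \<omega>)) \<partial>M)"
        unfolding E_def G_cos[OF s] cs by (simp only: mult_ac)
      also have "\<dots> = Re (w * - \<psi> (T' s k) * (\<integral>\<omega>. iexp (k \<bullet> Y s \<omega>) \<partial>M))"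
        using ii[OF s] by (simp del: times_complex.sel add: integral_Re[symmetric])
      finally show ?thesis using Y_char[OF s] by (simp only: mult_ac)
    qed
    have cont: "continuous_on {0..h} (\<lambda>s. Re (w * (- \<psi> (T' s k) * char_Y s k)))"
      by (intro continuous_on_Re continuous_on_mult continuous_on_const continuous_on_minus \<psi>_continuous_time char_Y_continuous)
    have F: "F ?g ?d ?q = (\<lambda>s. indicator {0..h} s *\<^sub>R Re (w * (- \<psi> (T' s k) * char_Y s k)))"
    proof (rule ext)
      fix s show "F ?g ?d ?q s = indicator {0..h} s *\<^sub>R Re (w * (- \<psi> (T' s k) * char_Y s k))"
      proof (cases "s \<in> {0..h}")
        case True
        then have "s \<ge> 0" by simp
        then show ?thesis unfolding F_def real_scaleR_def by (simp only: E)
      qed (simp add: F_def)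
    qed
    have "((\<lambda>s. Re (w * char_Y s k)) has_vector_derivative Re (w * (- \<psi> (T' s k) * char_Y s k))) (at s within {0..h})"
      if "0 \<le> s" "s \<le> h" for s
      by (rule bounded_linear.has_vector_derivative[OF bounded_linear_Re
            bounded_linear.has_vector_derivative[OF bounded_linear_mult_right char_Y_derivative]]) (use that in auto)
    from integral_FTC_atLeastAtMost[OF h this cont]
    have I: "integral\<^sup>L lborel (F ?g ?d ?q) = Re (w * char_Y h k) - Re (w * char_Y 0 k)" unfolding F .
    have cw: "cos (k \<bullet> (z + y) + c) = Re (w * iexp (k \<bullet> y))" for y
      using arg_cong[OF cs[of y], of Re] by (simp del: times_complex.sel)
    have "(\<integral>\<omega>. ?g (z + Y h \<omega>) \<partial>M) = Re (w * (\<integral>\<omega>. iexp (k \<bullet> Y h \<omega>) \<partial>M))"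
      unfolding cw using ii[OF h] by (simp del: times_complex.sel add: integral_Re[symmetric])
    moreover have "Re (w * char_Y 0 k) = ?g z" by (simp add: char_Y_def w_def)
    moreover have "F ?g ?d ?q \<in> borel_measurable borel"
      unfolding F by (rule borel_measurable_continuous_on_indicator[OF _ cont]) simp
    ultimately show "F ?g ?d ?q \<in> borel_measurable borel \<and>
      (\<integral>\<omega>. ?g (z + Y h \<omega>) \<partial>M) - ?g z = integral\<^sup>L lborel (F ?g ?d ?q)"
      using I Y_char[OF h, of k] by simp
  next
    fix C C' g d q g2 d2 q2
    assume l: "line_C2 C g d q" "line_C2 C' g2 d2 q2"
      and 1: "F g d q \<in> borel_measurable borel \<and> (\<integral>\<omega>. g (z + Y h \<omega>) \<partial>M) - g z = integral\<^sup>L lborel (F g d q)"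
      and 2: "F g2 d2 q2 \<in> borel_measurable borel \<and> (\<integral>\<omega>. g2 (z + Y h \<omega>) \<partial>M) - g2 z = integral\<^sup>L lborel (F g2 d2 q2)"
    have F: "F (\<lambda>x. g x + g2 x) (\<lambda>x h. d x h + d2 x h) (\<lambda>x h. q x h + q2 x h) = (\<lambda>s. F g d q s + F g2 d2 q2 s)"
    proof (rule ext)
      fix s
      have "E (\<lambda>x. g x + g2 x) (\<lambda>x h. d x h + d2 x h) (\<lambda>x h. q x h + q2 x h) s = E g d q s + E g2 d2 q2 s"
        if s: "0 \<le> s" "s \<le> h"
        unfolding E_def G_add[OF l s(1)] by (rule Bochner_Integration.integral_add[OF G_int[OF l(1) s] G_int[OF l(2) s]])
      then show "F (\<lambda>x. g x + g2 x) (\<lambda>x h. d x h + d2 x h) (\<lambda>x h. q x h + q2 x h) s = F g d q s + F g2 d2 q2 s"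
        by (auto simp: F_def indicator_def)
    qed
    have "integral\<^sup>L lborel (\<lambda>s. F g d q s + F g2 d2 q2 s) = integral\<^sup>L lborel (F g d q) + integral\<^sup>L lborel (F g2 d2 q2)"
      by (rule Bochner_Integration.integral_add) (use F_int l 1 2 in blast)+
    then show "F (\<lambda>x. g x + g2 x) (\<lambda>x h. d x h + d2 x h) (\<lambda>x h. q x h + q2 x h) \<in> borel_measurable borel \<and>
      (\<integral>\<omega>. g (z + Y h \<omega>) + g2 (z + Y h \<omega>) \<partial>M) - (g z + g2 z) =
      integral\<^sup>L lborel (F (\<lambda>x. g x + g2 x) (\<lambda>x h. d x h + d2 x h) (\<lambda>x h. q x h + q2 x h))"
      unfolding F using 1 2 gm(2)[OF l(1)] gm(2)[OF l(2)] borel_measurable_add[OF conjunct1[OF 1] conjunct1[OF 2]]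
      by simp
  next
    fix C g d q and b :: real
    assume l: "line_C2 C g d q"
      and 1: "F g d q \<in> borel_measurable borel \<and> (\<integral>\<omega>. g (z + Y h \<omega>) \<partial>M) - g z = integral\<^sup>L lborel (F g d q)"
    have F: "F (\<lambda>x. b * g x) (\<lambda>x h. b * d x h) (\<lambda>x h. b * q x h) = (\<lambda>s. b * F g d q s)"
      by (rule ext) (auto simp: F_def E_def indicator_def G_cmult[OF l])
    show "F (\<lambda>x. b * g x) (\<lambda>x h. b * d x h) (\<lambda>x h. b * q x h) \<in> borel_measurable borel \<and>
      (\<integral>\<omega>. b * g (z + Y h \<omega>) \<partial>M) - b * g z = integral\<^sup>L lborel (F (\<lambda>x. b * g x) (\<lambda>x h. b * d x h) (\<lambda>x h. b * q x h))"
      unfolding F using 1 borel_measurable_times[OF borel_measurable_const conjunct1[OF 1], of b]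
      by (simp add: right_diff_distrib[symmetric])
  next
    fix C gs ds qs g d q
    assume l: "\<And>n. line_C2 C (gs n) (ds n) (qs n)" "line_C2 C g d q"
      and eq: "\<And>n. F (gs n) (ds n) (qs n) \<in> borel_measurable borel \<and>
        (\<integral>\<omega>. gs n (z + Y h \<omega>) \<partial>M) - gs n z = integral\<^sup>L lborel (F (gs n) (ds n) (qs n))"
      and lim: "\<And>x. (\<lambda>n. gs n x) \<longlonglongrightarrow> g x" "\<And>x h. (\<lambda>n. ds n x h) \<longlonglongrightarrow> d x h" "\<And>x h. (\<lambda>n. qs n x h) \<longlonglongrightarrow> q x h"
    have Fl: "(\<lambda>n. F (gs n) (ds n) (qs n) s) \<longlonglongrightarrow> F g d q s" for s
    proof (cases "s \<in> {0..h}")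
      case True
      then have s: "0 \<le> s" "s \<le> h" by auto
      have "(\<lambda>n. E (gs n) (ds n) (qs n) s) \<longlonglongrightarrow> E g d q s"
        unfolding E_def
      proof (rule integral_dominated_convergence[where w = "\<lambda>_. C * L"])
        show "AE \<omega> in M. (\<lambda>n. G s (gs n) (ds n) (qs n) (z + Y s \<omega>)) \<longlonglongrightarrow> G s g d q (z + Y s \<omega>)"
          by (intro AE_I2 G_tendsto[OF l s(1) s(2) s(1)] lim)
        show "AE \<omega> in M. norm (G s (gs n) (ds n) (qs n) (z + Y s \<omega>)) \<le> C * L" for n
          using L(2)[OF l(1) s] by (intro AE_I2) simp
      qed (use G_meas[OF l(1) s(1)] G_meas[OF l(2) s(1)] in auto)
      then show ?thesis using True by (simp add: F_def)
    qed (simp add: F_def)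
    have Fm: "F g d q \<in> borel_measurable borel"
      by (rule borel_measurable_LIMSEQ_real[OF Fl]) (use eq in blast)
    have "(\<lambda>n. integral\<^sup>L lborel (F (gs n) (ds n) (qs n))) \<longlonglongrightarrow> integral\<^sup>L lborel (F g d q)"
    proof (rule integral_dominated_convergence[where w = "\<lambda>s. C * L * indicator {0..h} s"])
      show "AE s in lborel. (\<lambda>n. F (gs n) (ds n) (qs n) s) \<longlonglongrightarrow> F g d q s" using Fl by simp
      show "AE s in lborel. norm (F (gs n) (ds n) (qs n) s) \<le> C * L * indicator {0..h} s" for n
        using F_bound[OF l(1)] by simp
    qed (use Fm eq int_ind in auto)
    moreover have "(\<lambda>n. (\<integral>\<omega>. gs n (z + Y h \<omega>) \<partial>M) - gs n z) \<longlonglongrightarrow> (\<integral>\<omega>. g (z + Y h \<omega>) \<partial>M) - g z"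
    proof (intro tendsto_diff lim)
      show "(\<lambda>n. \<integral>\<omega>. gs n (z + Y h \<omega>) \<partial>M) \<longlonglongrightarrow> (\<integral>\<omega>. g (z + Y h \<omega>) \<partial>M)"
        by (rule integral_dominated_convergence[where w = "\<lambda>_. C"])
          (use gm(1)[OF l(1)] gm(1)[OF l(2)] lim(1) line_C2D(1)[OF l(1)] in auto)
    qed
    ultimately show "F g d q \<in> borel_measurable borel \<and> (\<integral>\<omega>. g (z + Y h \<omega>) \<partial>M) - g z = integral\<^sup>L lborel (F g d q)"
      using Fm eq LIMSEQ_unique by fastforce
  qed
  note R = C2b_in_class[OF g]
  show "(\<lambda>s. indicator {0..h} s * \<Phi> s) \<in> borel_measurable borel"
    using conjunct1[OF R] unfolding F_def[abs_def] E_def \<Phi>_def .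
  show "(\<integral>\<omega>. g (z + Y h \<omega>) \<partial>M) - g z = (\<integral>s. indicator {0..h} s * \<Phi> s \<partial>lborel)"
    using conjunct2[OF R] unfolding F_def[abs_def] E_def \<Phi>_def .
qed

lemma dynkin_bound:
  assumes r: "r \<ge> 0"
  obtains L where "L \<ge> 0" "\<And>C g g' g'' h z. C2b C g g' g'' \<Longrightarrow> 0 \<le> h \<Longrightarrow> h \<le> r \<Longrightarrow>
    \<bar>(\<integral>\<omega>. g (z + Y h \<omega>) \<partial>M) - g z\<bar> \<le> C * L * h"
proof -
  obtain L where L: "L \<ge> 0" "\<And>C g d q s x. line_C2 C g d q \<Longrightarrow> 0 \<le> s \<Longrightarrow> s \<le> r \<Longrightarrow> \<bar>G s g d q x\<bar> \<le> C * L"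
    using G_bound[OF r] by metis
  show thesis
  proof (rule that[of "2 * L"])
    show "0 \<le> 2 * L" using L(1) by simp
    fix C and g :: "'a \<Rightarrow> real" and g' g'' h z
    assume g: "C2b C g g' g''" and h: "0 \<le> h" "h \<le> r"
    let ?\<Phi> = "\<lambda>s. \<integral>\<omega>. G s g (\<lambda>x h. g' x \<bullet> h) (\<lambda>x h. g'' x h \<bullet> h) (z + Y s \<omega>) \<partial>M"
    note l = C2b_imp_line_C2[OF g]
    have b: "\<bar>?\<Phi> s\<bar> \<le> 2 * C * L" if s: "0 \<le> s" "s \<le> h" for s
    proof -
      have [measurable]: "G s g (\<lambda>x h. g' x \<bullet> h) (\<lambda>x h. g'' x h \<bullet> h) \<in> borel_measurable borel" "Y s \<in> borel_measurable M"
        using borel_measurable_continuous_onI[OF G_continuous[OF l s(1)]] s by auto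
      have "norm (?\<Phi> s) \<le> 2 * C * L"
        by (rule expectation_norm_le) (use L(2)[OF l s(1)] s h in auto)
      then show ?thesis by simp
    qed
    have i: "integrable lborel (\<lambda>s. 2 * C * L * indicator {0..h} s)"
      by (intro integrable_mult_right integrable_real_indicator) (auto simp: h)
    have i2: "integrable lborel (\<lambda>s. indicator {0..h} s * ?\<Phi> s)"
      by (rule Bochner_Integration.integrable_bound[OF i])
        (use dynkin(1)[OF h(1) g] b in \<open>auto simp: indicator_def intro: order_trans[OF _ abs_ge_self]\<close>)
    have "\<bar>\<integral>s. indicator {0..h} s * ?\<Phi> s \<partial>lborel\<bar> \<le> (\<integral>s. \<bar>indicator {0..h} s * ?\<Phi> s\<bar> \<partial>lborel)"
      by (rule integral_abs_bound)
    also have "\<dots> \<le> (\<integral>s. 2 * C * L * indicator {0..h} s \<partial>lborel)"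
      by (rule integral_mono) (use i i2 b in \<open>auto simp: indicator_def\<close>)
    finally have "\<bar>\<integral>s. indicator {0..h} s * ?\<Phi> s \<partial>lborel\<bar> \<le> (\<integral>s. 2 * C * L * indicator {0..h} s \<partial>lborel)" .
    then show "\<bar>(\<integral>\<omega>. g (z + Y h \<omega>) \<partial>M) - g z\<bar> \<le> C * (2 * L) * h"
      unfolding dynkin(2)[OF h(1) g] using h by (simp add: mult_ac)
  qed
qed

subsection \<open>Continuity of \<open>Y\<close> in probability and the Markov property\<close>

text \<open>Second marginal of the pair law, read off from a function of the second
  component.\<close>

lemma shifted_law:
  assumes s: "0 \<le> s" "s \<le> t" and g: "C2b C g g' g''"
  shows "(\<integral>\<omega>. g (Y t \<omega> - T (t - s) (Y s \<omega>)) \<partial>M) = (\<integral>\<omega>. g (Y (t - s) \<omega>) \<partial>M)"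
proof -
  have "bounded_linear (\<lambda>y :: 'a. (0 :: 'a, y))"
    by (intro bounded_linear_Pair bounded_linear_zero bounded_linear_ident)
  from C2b_affine[OF g bounded_linear_snd this, of 1 0]
  have "C2b C (\<lambda>x :: 'a \<times> 'a. g (0 + snd x)) (\<lambda>x. (0, g' (0 + snd x))) (\<lambda>x h. (0, g'' (0 + snd x) (snd h)))"
    by (auto simp: inner_prod_def norm_snd_le)
  from increment_law_pair[OF s this] show ?thesis by (simp add: prob_space)
qed

lemma kap_integrable:
  assumes "X \<in> borel_measurable M"
  shows "integrable M (\<lambda>\<omega>. kap (X \<omega> :: 'a))"
proof (rule integrable_const_bound[where B = 1])
  show "(\<lambda>\<omega>. kap (X \<omega>)) \<in> borel_measurable M"
    by (rule measurable_compose[OF assms C2b_borel[OF C2b_kap]])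
qed (simp add: kap_nonneg kap_le_1)

text \<open>Dynkin's formula started at 0, where \<open>kap\<close> vanishes; 10 is the constant of
  \<open>C2b_kap\<close>.\<close>

lemma kap_Y_small:
  obtains L where "L \<ge> 0" "\<And>h. 0 \<le> h \<Longrightarrow> h \<le> 1 \<Longrightarrow> (\<integral>\<omega>. kap (Y h \<omega>) \<partial>M) \<le> L * h"
proof -
  obtain L where L: "L \<ge> 0" "\<And>C g g' g'' h z. C2b C g g' g'' \<Longrightarrow> 0 \<le> h \<Longrightarrow> h \<le> 1 \<Longrightarrow>
    \<bar>(\<integral>\<omega>. g (z + Y h \<omega>) \<partial>M) - g z\<bar> \<le> C * L * h"
    using dynkin_bound[of 1] by auto
  show thesis
  proof (rule that[of "10 * L"])
    show "0 \<le> 10 * L" using L(1) by simp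
    fix h :: real assume "0 \<le> h" "h \<le> 1"
    from L(2)[OF C2b_kap this, of 0] show "(\<integral>\<omega>. kap (Y h \<omega>) \<partial>M) \<le> 10 * L * h" by (simp add: kap_0)
  qed
qed

lemma kap_uminus: "kap (- y) = kap y"
  by (simp add: kap_def)

lemma kap_add_expectation:
  assumes [measurable]: "X \<in> borel_measurable M" "V \<in> borel_measurable M"
  shows "(\<integral>\<omega>. kap (X \<omega> + V \<omega> :: 'a) \<partial>M) \<le> 2 * (\<integral>\<omega>. kap (X \<omega>) \<partial>M) + 2 * (\<integral>\<omega>. kap (V \<omega>) \<partial>M)"
proof -
  have i: "integrable M (\<lambda>\<omega>. kap (X \<omega>))" "integrable M (\<lambda>\<omega>. kap (V \<omega>))" "integrable M (\<lambda>\<omega>. kap (X \<omega> + V \<omega>))"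
    by (intro kap_integrable; measurable)+
  have "(\<integral>\<omega>. kap (X \<omega> + V \<omega>) \<partial>M) \<le> (\<integral>\<omega>. 2 * kap (X \<omega>) + 2 * kap (V \<omega>) \<partial>M)"
    by (rule integral_mono) (use i kap_add in auto)
  then show ?thesis using i by simp
qed

text \<open>
  For \<open>t < s\<close> the idea is that \<open>Y s - T t (Y (s - t))\<close> has the same law as \<open>Y t\<close>, so that the variable
  \<open>T (s - t) (Y t) - Y t\<close> may be replaced by one that involves \<open>Y s\<close> and the small \<open>Y (s - t)\<close> only.
\<close>

lemma Y_difference_bound:
  assumes s: "s \<ge> 0"
  obtains K where "K \<ge> 0" "\<And>t. 0 \<le> t \<Longrightarrow> \<bar>t - s\<bar> \<le> 1 \<Longrightarrow>
    (\<integral>\<omega>. kap (Y t \<omega> - Y s \<omega>) \<partial>M) \<le> 4 * (\<integral>\<omega>. kap (T \<bar>t - s\<bar> (Y s \<omega>) - Y s \<omega>) \<partial>M) + K * \<bar>t - s\<bar>"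
proof -
  obtain L where L: "L \<ge> 0" "\<And>h. 0 \<le> h \<Longrightarrow> h \<le> 1 \<Longrightarrow> (\<integral>\<omega>. kap (Y h \<omega>) \<partial>M) \<le> L * h"
    using kap_Y_small by metis
  obtain K where K: "K \<ge> 1" "\<And>t x. 0 \<le> t \<Longrightarrow> t \<le> s + 1 \<Longrightarrow> norm (T t x) \<le> K * norm x"
    "\<And>t x. 0 \<le> t \<Longrightarrow> t \<le> s + 1 \<Longrightarrow> norm (T' t x) \<le> K * norm x"
    using bounds_on[of "s + 1"] by metis
  \<comment> \<open>(2 K K)^2 comes from \<open>kap_mono_norm\<close> for the operator (T h - 1) T
    t, which enlarges norms by at most 2 K K.\<close>
  define c where "c = (2 * K * K)\<^sup>2"
  have c: "c \<ge> 1" using K(1) mult_mono[of 1 "2 * K" 1 K] unfolding c_def by (intro one_le_power) auto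
  have E0: "0 \<le> (\<integral>\<omega>. kap (X \<omega> :: 'a) \<partial>M)" for X by (intro Bochner_Integration.integral_nonneg kap_nonneg)
  show thesis
  proof (rule that[of "(2 + 4 * c) * L"])
    show "0 \<le> (2 + 4 * c) * L" using c L(1) by simp
    fix t :: real assume t: "0 \<le> t" "\<bar>t - s\<bar> \<le> 1"
    define h where "h = \<bar>t - s\<bar>"
    have h: "0 \<le> h" "h \<le> 1" "h \<le> s + 1" using t s by (auto simp: h_def)
    have [measurable]: "Y t \<in> borel_measurable M" "Y s \<in> borel_measurable M" "Y h \<in> borel_measurable M"
      "T h \<in> borel_measurable borel" using t s h by auto
    have Lc: "2 * (L * h) \<le> (2 + 4 * c) * L * h"
      using c L(1) h by (auto simp: distrib_right intro!: mult_nonneg_nonneg)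
    show "(\<integral>\<omega>. kap (Y t \<omega> - Y s \<omega>) \<partial>M) \<le> 4 * (\<integral>\<omega>. kap (T \<bar>t - s\<bar> (Y s \<omega>) - Y s \<omega>) \<partial>M) + (2 + 4 * c) * L * \<bar>t - s\<bar>"
      unfolding h_def[symmetric]
    proof (cases "s \<le> t")
      case True
      then have ht: "t - s = h" by (simp add: h_def)
      have "(\<integral>\<omega>. kap (Y t \<omega> - Y s \<omega>) \<partial>M) = (\<integral>\<omega>. kap ((Y t \<omega> - T h (Y s \<omega>)) + (T h (Y s \<omega>) - Y s \<omega>)) \<partial>M)" by simp
      also have "\<dots> \<le> 2 * (\<integral>\<omega>. kap (Y t \<omega> - T h (Y s \<omega>)) \<partial>M) + 2 * (\<integral>\<omega>. kap (T h (Y s \<omega>) - Y s \<omega>) \<partial>M)"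
        by (rule kap_add_expectation) measurable
      also have "(\<integral>\<omega>. kap (Y t \<omega> - T h (Y s \<omega>)) \<partial>M) \<le> L * h"
        using shifted_law[OF s True C2b_kap] L(2)[OF h(1,2)] unfolding ht by simp
      finally show "(\<integral>\<omega>. kap (Y t \<omega> - Y s \<omega>) \<partial>M) \<le> 4 * (\<integral>\<omega>. kap (T h (Y s \<omega>) - Y s \<omega>) \<partial>M) + (2 + 4 * c) * L * h"
        using Lc E0[of "\<lambda>\<omega>. T h (Y s \<omega>) - Y s \<omega>"] by linarith
    next
      case False
      then have hs: "s - t = h" "h \<le> s" "s - h = t" "t \<le> s" using t by (auto simp: h_def)
      have [measurable]: "T t \<in> borel_measurable borel" using t by simp
      \<comment> \<open>\<open>?R\<close> is distributed like \<open>Y t\<close>. Estimating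
        \<open>T h (Y t) - Y t\<close> itself is no use, since T h - 1 is small only strongly and
        \<open>Y t\<close> moves with \<open>t\<close>; in \<open>?R\<close> the fixed
        \<open>Y s\<close> takes its place, up to a term that is small through
        \<open>Y h\<close>.\<close>
      let ?R = "\<lambda>\<omega>. Y s \<omega> - T t (Y h \<omega>)"
      have bl: "bounded_linear (\<lambda>y. T h y - y)" "bounded_linear (\<lambda>y. T' h y - y)"
        by (intro bounded_linear_sub T.T_linear T'.T_linear bounded_linear_ident h)+
      have nn: "norm (T h y - y) \<le> 2 * K * norm y" "norm (T' h y - y) \<le> 2 * K * norm y" for y
        using norm_triangle_ineq4[of "T h y" y] norm_triangle_ineq4[of "T' h y" y] K(2)[OF h(1,3), of y] K(3)[OF h(1,3), of y]
          mult_right_mono[OF K(1), of "norm y"] by auto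
      have "C2b ((2 * K)\<^sup>2 * 10) (\<lambda>y. kap (0 + (T h y - y))) (\<lambda>y. (\<lambda>y. T' h y - y) ((\<lambda>y. (2 * (inverse (1 + y \<bullet> y))\<^sup>2) *\<^sub>R y) (0 + (T h y - y))))
        (\<lambda>x v. (\<lambda>y. T' h y - y) ((\<lambda>y h. (2 * (inverse (1 + y \<bullet> y))\<^sup>2) *\<^sub>R h - (8 * (inverse (1 + y \<bullet> y)) ^ 3 * (y \<bullet> h)) *\<^sub>R y) (0 + (T h x - x)) (T h v - v)))"
        by (rule C2b_affine[OF C2b_kap bl _ nn]) (use K(1) T_adjoint[OF h(1)] in \<open>auto simp: inner_diff_left inner_diff_right\<close>)
      from shifted_law[OF h(1) hs(2) this]
      have eq: "(\<integral>\<omega>. kap (T h (?R \<omega>) - ?R \<omega>) \<partial>M) = (\<integral>\<omega>. kap (T h (Y t \<omega>) - Y t \<omega>) \<partial>M)"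
        unfolding hs by simp
      have split: "T h (?R \<omega>) - ?R \<omega> = (T h (Y s \<omega>) - Y s \<omega>) + - (T h (T t (Y h \<omega>)) - T t (Y h \<omega>))" for \<omega>
        by (simp add: T.T_lin h algebra_simps)
      have "(\<integral>\<omega>. kap (T h (Y t \<omega>) - Y t \<omega>) \<partial>M) \<le> 2 * (\<integral>\<omega>. kap (T h (Y s \<omega>) - Y s \<omega>) \<partial>M)
          + 2 * (\<integral>\<omega>. kap (- (T h (T t (Y h \<omega>)) - T t (Y h \<omega>))) \<partial>M)"
        unfolding eq[symmetric] split by (rule kap_add_expectation) measurable
      also have "(\<integral>\<omega>. kap (- (T h (T t (Y h \<omega>)) - T t (Y h \<omega>))) \<partial>M) \<le> (\<integral>\<omega>. c * kap (Y h \<omega>) \<partial>M)"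
      proof (rule integral_mono)
        fix \<omega>
        have "norm (T h (T t (Y h \<omega>)) - T t (Y h \<omega>)) \<le> 2 * K * (K * norm (Y h \<omega>))"
          using nn(1)[of "T t (Y h \<omega>)"] K(2)[OF t(1), of "Y h \<omega>"] hs(4) K(1)
          by (smt (verit, best) mult_left_mono)
        then have "kap (T h (T t (Y h \<omega>)) - T t (Y h \<omega>)) \<le> c * kap (Y h \<omega>)"
          unfolding c_def by (intro kap_mono_norm) (use K(1) mult_mono[of 1 "2 * K" 1 K] in \<open>auto simp: mult.assoc\<close>)
        then show "kap (- (T h (T t (Y h \<omega>)) - T t (Y h \<omega>))) \<le> c * kap (Y h \<omega>)" by (simp only: kap_uminus)
      qed (intro integrable_mult_right kap_integrable; measurable)+
      also have "(\<integral>\<omega>. c * kap (Y h \<omega>) \<partial>M) \<le> c * (L * h)"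
        using L(2)[OF h(1,2)] c by simp
      finally have 1: "(\<integral>\<omega>. kap (T h (Y t \<omega>) - Y t \<omega>) \<partial>M) \<le> 2 * (\<integral>\<omega>. kap (T h (Y s \<omega>) - Y s \<omega>) \<partial>M) + 2 * (c * (L * h))" by simp
      have "(\<integral>\<omega>. kap (Y t \<omega> - Y s \<omega>) \<partial>M) = (\<integral>\<omega>. kap ((Y s \<omega> - T h (Y t \<omega>)) + (T h (Y t \<omega>) - Y t \<omega>)) \<partial>M)"
        using kap_uminus[of "Y t _ - Y s _"] by simp
      also have "\<dots> \<le> 2 * (\<integral>\<omega>. kap (Y s \<omega> - T h (Y t \<omega>)) \<partial>M) + 2 * (\<integral>\<omega>. kap (T h (Y t \<omega>) - Y t \<omega>) \<partial>M)"
        by (rule kap_add_expectation) measurable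
      also have "(\<integral>\<omega>. kap (Y s \<omega> - T h (Y t \<omega>)) \<partial>M) \<le> L * h"
        using shifted_law[OF t(1) hs(4) C2b_kap] L(2)[OF h(1,2)] unfolding hs by simp
      finally show "(\<integral>\<omega>. kap (Y t \<omega> - Y s \<omega>) \<partial>M) \<le> 4 * (\<integral>\<omega>. kap (T h (Y s \<omega>) - Y s \<omega>) \<partial>M) + (2 + 4 * c) * L * h"
        using 1 by (simp add: algebra_simps)
    qed
  qed
qed

lemma Y_continuous_in_probability:
  assumes s: "\<And>n. s n \<ge> 0" "s \<longlonglongrightarrow> t"
  shows "(\<lambda>n. \<integral>\<omega>. kap (Y (s n) \<omega> - Y t \<omega>) \<partial>M) \<longlonglongrightarrow> 0"
proof -
  have t: "t \<ge> 0" using s by (simp add: LIMSEQ_le_const)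
  have [measurable]: "Y t \<in> borel_measurable M" using t by simp
  obtain K where K: "K \<ge> 0" "\<And>u. 0 \<le> u \<Longrightarrow> \<bar>u - t\<bar> \<le> 1 \<Longrightarrow>
    (\<integral>\<omega>. kap (Y u \<omega> - Y t \<omega>) \<partial>M) \<le> 4 * (\<integral>\<omega>. kap (T \<bar>u - t\<bar> (Y t \<omega>) - Y t \<omega>) \<partial>M) + K * \<bar>u - t\<bar>"
    by (rule Y_difference_bound[OF t]) (rule that)
  have "(\<lambda>n. \<bar>s n - t\<bar>) \<longlonglongrightarrow> \<bar>t - t\<bar>" by (intro tendsto_intros s)
  then have h: "(\<lambda>n. \<bar>s n - t\<bar>) \<longlonglongrightarrow> 0" by simp
  have "(\<lambda>n. \<integral>\<omega>. kap (T \<bar>s n - t\<bar> (Y t \<omega>) - Y t \<omega>) \<partial>M) \<longlonglongrightarrow> (\<integral>\<omega>. 0 \<partial>M)"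
  proof (rule integral_dominated_convergence[where w = "\<lambda>_. 1"])
    have m: "(\<lambda>\<omega>. T \<bar>s n - t\<bar> (Y t \<omega>) - Y t \<omega>) \<in> borel_measurable M" for n
    proof -
      have [measurable]: "T \<bar>s n - t\<bar> \<in> borel_measurable borel" by simp
      show ?thesis by measurable
    qed
    show "(\<lambda>\<omega>. kap (T \<bar>s n - t\<bar> (Y t \<omega>) - Y t \<omega>)) \<in> borel_measurable M" for n
      using kap_integrable[OF m] by simp
    show "AE \<omega> in M. (\<lambda>n. kap (T \<bar>s n - t\<bar> (Y t \<omega>) - Y t \<omega>)) \<longlonglongrightarrow> 0"
    proof (intro AE_I2 kap_tendsto_0I)
      fix \<omega>
      have "(\<lambda>n. T \<bar>s n - t\<bar> (Y t \<omega>)) \<longlonglongrightarrow> T 0 (Y t \<omega>)"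
        by (rule T.T_tendsto[OF _ h tendsto_const]) simp
      then show "(\<lambda>n. T \<bar>s n - t\<bar> (Y t \<omega>) - Y t \<omega>) \<longlonglongrightarrow> 0" 
        unfolding T.T_0 by (rule LIM_zero)
    qed
  qed (simp_all add: kap_nonneg kap_le_1)
  then have "(\<lambda>n. 4 * (\<integral>\<omega>. kap (T \<bar>s n - t\<bar> (Y t \<omega>) - Y t \<omega>) \<partial>M) + K * \<bar>s n - t\<bar>) \<longlonglongrightarrow> 4 * (\<integral>\<omega>. 0 \<partial>M) + K * 0"
    by (intro tendsto_intros h)
  then have lim: "(\<lambda>n. 4 * (\<integral>\<omega>. kap (T \<bar>s n - t\<bar> (Y t \<omega>) - Y t \<omega>) \<partial>M) + K * \<bar>s n - t\<bar>) \<longlonglongrightarrow> 0" by simp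
  have ev: "\<forall>\<^sub>F n in sequentially. \<bar>s n - t\<bar> < 1" using h by (rule order_tendstoD) simp
  show ?thesis
  proof (rule tendsto_sandwich[OF _ _ tendsto_const lim])
    show "\<forall>\<^sub>F n in sequentially. 0 \<le> (\<integral>\<omega>. kap (Y (s n) \<omega> - Y t \<omega>) \<partial>M)"
      by (intro always_eventually allI Bochner_Integration.integral_nonneg kap_nonneg)
    show "\<forall>\<^sub>F n in sequentially. (\<integral>\<omega>. kap (Y (s n) \<omega> - Y t \<omega>) \<partial>M)
        \<le> 4 * (\<integral>\<omega>. kap (T \<bar>s n - t\<bar> (Y t \<omega>) - Y t \<omega>) \<partial>M) + K * \<bar>s n - t\<bar>"
      using ev by eventually_elim (use K(2)[OF s(1)] in auto)
  qed
qed

lemma Y_subsequence: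
  assumes s: "\<And>n. s n \<ge> 0" "s \<longlonglongrightarrow> t"
  obtains r where "strict_mono r" "AE \<omega> in M. (\<lambda>n. Y (s (r n)) \<omega>) \<longlonglongrightarrow> Y t \<omega>"
proof -
  have t: "t \<ge> 0" using s by (simp add: LIMSEQ_le_const)
  have m: "(\<lambda>\<omega>. Y (s n) \<omega> - Y t \<omega>) \<in> borel_measurable M" for n
    using Y_measurable[OF s(1)[of n]] Y_measurable[OF t] by (rule borel_measurable_diff)
  have "(\<lambda>n. \<integral>\<omega>. norm (kap (Y (s n) \<omega> - Y t \<omega>)) \<partial>M) \<longlonglongrightarrow> 0"
    using Y_continuous_in_probability[OF s] by (simp add: kap_nonneg)
  from tendsto_L1_AE_subseq[OF kap_integrable[OF m] this]
  obtain r where r: "strict_mono r" "AE \<omega> in M. (\<lambda>n. kap (Y (s (r n)) \<omega> - Y t \<omega>)) \<longlonglongrightarrow> 0" by blast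
  have "AE \<omega> in M. (\<lambda>n. Y (s (r n)) \<omega>) \<longlonglongrightarrow> Y t \<omega>"
    using r(2) by eventually_elim (rule LIM_zero_cancel, rule kap_tendsto_0D)
  with r(1) show thesis by (rule that)
qed

text \<open>Continuity of \<open>Y\<close> in probability gives pathwise convergence along a further
  subsequence of every subsequence. The hypothesis \<open>lim\<close> has that form, and the bound
  \<open>C\<close> allows dominated convergence.\<close>

lemma expectation_tendsto:
  fixes \<Phi> :: "nat \<Rightarrow> 'w \<Rightarrow> 'b::{banach, second_countable_topology}"
  assumes s: "\<And>n. s n \<ge> 0" "s \<longlonglongrightarrow> t"
    and meas: "\<And>n. \<Phi> n \<in> borel_measurable M" "\<Phi>' \<in> borel_measurable M"
    and bound: "\<And>n \<omega>. norm (\<Phi> n \<omega>) \<le> C"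
    and lim: "\<And>\<omega> r. strict_mono r \<Longrightarrow> (\<lambda>n. Y (s (r n)) \<omega>) \<longlonglongrightarrow> Y t \<omega> \<Longrightarrow> (\<lambda>n. \<Phi> (r n) \<omega>) \<longlonglongrightarrow> \<Phi>' \<omega>"
  shows "(\<lambda>n. \<integral>\<omega>. \<Phi> n \<omega> \<partial>M) \<longlonglongrightarrow> (\<integral>\<omega>. \<Phi>' \<omega> \<partial>M)"
proof (rule tendsto_subsequence_criterion)
  fix r :: "nat \<Rightarrow> nat" assume r: "strict_mono r"
  have "(s \<circ> r) \<longlonglongrightarrow> t" by (rule LIMSEQ_subseq_LIMSEQ[OF s(2) r])
  then obtain r' where r': "strict_mono r'" "AE \<omega> in M. (\<lambda>n. Y ((s \<circ> r) (r' n)) \<omega>) \<longlonglongrightarrow> Y t \<omega>"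
    using Y_subsequence[of "s \<circ> r" t] s(1) by auto
  have rr: "strict_mono (\<lambda>n. r (r' n))" using strict_mono_compose[OF r r'(1)] by (simp add: o_def)
  have "(\<lambda>n. \<integral>\<omega>. \<Phi> (r (r' n)) \<omega> \<partial>M) \<longlonglongrightarrow> (\<integral>\<omega>. \<Phi>' \<omega> \<partial>M)"
  proof (rule integral_dominated_convergence[where w = "\<lambda>_. C"])
    show "AE \<omega> in M. (\<lambda>n. \<Phi> (r (r' n)) \<omega>) \<longlonglongrightarrow> \<Phi>' \<omega>"
      using r'(2) by eventually_elim (use lim[OF rr] in simp)
  qed (use meas bound in auto)
  with r'(1) show "\<exists>r'. strict_mono r' \<and> (\<lambda>n. \<integral>\<omega>. \<Phi> (r (r' n)) \<omega> \<partial>M) \<longlonglongrightarrow> (\<integral>\<omega>. \<Phi>' \<omega> \<partial>M)" by blast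
qed

text \<open>The position at time s + h is \<open>T h\<close> of the position at \<open>s\<close>
  plus the increment \<open>Y (s + h) - T h (Y s)\<close>. The pair law is applied to
  \<open>g\<close> composed with the map \<open>B\<close> on the product space, whose adjoint is
  \<open>B'\<close>.\<close>

lemma markov_property:
  assumes s: "s \<ge> 0" "h \<ge> 0" and g: "C2b C g g' g''"
  shows "(\<integral>\<omega>. g (T (s + h) x + Y (s + h) \<omega>) \<partial>M) = (\<integral>\<omega>. (\<integral>\<omega>'. g (T h (T s x + Y s \<omega>) + Y h \<omega>') \<partial>M) \<partial>M)"
proof -
  obtain K where K: "K \<ge> 1" "\<And>t x. 0 \<le> t \<Longrightarrow> t \<le> h \<Longrightarrow> norm (T t x) \<le> K * norm x"
    "\<And>t x. 0 \<le> t \<Longrightarrow> t \<le> h \<Longrightarrow> norm (T' t x) \<le> K * norm x"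
    using bounds_on[of h] by metis
  define B where "B z = T h (fst z) + snd z" for z :: "'a \<times> 'a"
  define B' where "B' z = (T' h z, z)" for z
  have "C2b ((2 * K)\<^sup>2 * C) (\<lambda>z. g (T (s + h) x + B z)) (\<lambda>z. B' (g' (T (s + h) x + B z)))
     (\<lambda>z v. B' (g'' (T (s + h) x + B z) (B v)))"
  proof (rule C2b_affine[OF g])
    show "bounded_linear B" unfolding B_def[abs_def]
      by (intro bounded_linear_add bounded_linear_compose[OF T.T_linear[OF s(2)]] bounded_linear_fst bounded_linear_snd)
    show "bounded_linear B'" unfolding B'_def[abs_def]
      by (intro bounded_linear_Pair T'.T_linear[OF s(2)] bounded_linear_ident)
    show "B z \<bullet> y = z \<bullet> B' y" for z y
      using T_adjoint[OF s(2)] by (simp add: B_def B'_def inner_prod_def inner_add_left)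
    show "norm (B z) \<le> 2 * K * norm z" for z
    proof -
      have "norm (B z) \<le> norm (T h (fst z)) + norm (snd z)" unfolding B_def by (rule norm_triangle_ineq)
      also have "\<dots> \<le> K * norm (fst z) + norm (snd z)" using K(2)[OF s(2) order_refl] by simp
      also have "\<dots> \<le> K * norm z + K * norm z"
        using K(1) norm_fst_le[of "fst z" "snd z"] norm_snd_le[of "snd z" "fst z"] mult_right_mono[OF K(1), of "norm (snd z)"]
        by (intro add_mono mult_left_mono) (auto intro: order_trans[OF _ mult_left_mono])
      finally show ?thesis by simp
    qed
    show "norm (B' y) \<le> 2 * K * norm y" for y
      using norm_Pair_le[of "T' h y" y] K(3)[OF s(2) order_refl, of y] mult_right_mono[OF K(1), of "norm y"]
      by (simp add: B'_def)
    show "1 \<le> 2 * K" using K(1) by simp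
  qed
  from increment_law_pair[OF s(1) _ this, of "s + h"]
  have "(\<integral>\<omega>. g (T (s + h) x + B (Y s \<omega>, Y (s + h) \<omega> - T h (Y s \<omega>))) \<partial>M)
      = (\<integral>\<omega>. (\<integral>\<omega>'. g (T (s + h) x + B (Y s \<omega>, Y h \<omega>')) \<partial>M) \<partial>M)"
    using s by simp
  moreover have "T (s + h) x = T h (T s x)" using T.T_add[OF s(2,1), of x] by (simp add: add.commute)
  ultimately show ?thesis
    using s by (simp add: B_def T.T_lin add.assoc)
qed

end

subsection \<open>Differentiation under the expectation\<close>

context prob_space
begin

lemma integrable_bounded_continuous:
  fixes \<phi> :: "'b::{real_normed_vector, second_countable_topology} \<Rightarrow> 'c::{banach, second_countable_topology}"
  assumes "continuous_on UNIV \<phi>" "\<And>x. norm (\<phi> x) \<le> C" and [measurable]: "X \<in> borel_measurable M"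
  shows "integrable M (\<lambda>\<omega>. \<phi> (z + X \<omega>))"
proof (rule integrable_const_bound[where B = C])
  have [measurable]: "\<phi> \<in> borel_measurable borel" by (rule borel_measurable_continuous_onI[OF assms(1)])
  show "(\<lambda>\<omega>. \<phi> (z + X \<omega>)) \<in> borel_measurable M" by measurable
qed (use assms(2) in auto)

text \<open>The Taylor remainder divided by the increment tends to 0 for each outcome and is at most
  2 C by the Lipschitz bound, so dominated convergence along sequences gives a Frechet
  derivative.\<close>

lemma expectation_has_derivative:
  fixes \<phi> :: "'b::{real_normed_vector, second_countable_topology} \<Rightarrow> 'c::{banach, second_countable_topology}"
  assumes d: "\<And>x. (\<phi> has_derivative \<phi>' x) (at x)" and b: "\<And>x. norm (\<phi> x) \<le> C" "\<And>x h. norm (\<phi>' x h) \<le> C * norm h"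
    and c: "\<And>h. continuous_on UNIV (\<lambda>x. \<phi>' x h)" and X: "X \<in> borel_measurable M"
  shows "((\<lambda>z. \<integral>\<omega>. \<phi> (z + X \<omega>) \<partial>M) has_derivative (\<lambda>h. \<integral>\<omega>. \<phi>' (z + X \<omega>) h \<partial>M)) (at z)"
  unfolding has_derivative_at
proof (intro conjI)
  have lin: "linear (\<phi>' x)" for x using d has_derivative_linear by blast
  have cp: "continuous_on UNIV \<phi>"
    by (auto intro!: continuous_at_imp_continuous_on has_derivative_continuous[OF d])
  note i0 = integrable_bounded_continuous[OF cp b(1) X]
  note i1 = integrable_bounded_continuous[OF c b(2) X]
  show "bounded_linear (\<lambda>h. \<integral>\<omega>. \<phi>' (z + X \<omega>) h \<partial>M)"
  proof (rule bounded_linear_intro[where K = C])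
    fix h k and r :: real
    show "(\<integral>\<omega>. \<phi>' (z + X \<omega>) (h + k) \<partial>M) = (\<integral>\<omega>. \<phi>' (z + X \<omega>) h \<partial>M) + (\<integral>\<omega>. \<phi>' (z + X \<omega>) k \<partial>M)"
      by (simp add: linear_add[OF lin] i1)
    show "(\<integral>\<omega>. \<phi>' (z + X \<omega>) (r *\<^sub>R h) \<partial>M) = r *\<^sub>R (\<integral>\<omega>. \<phi>' (z + X \<omega>) h \<partial>M)"
      by (simp add: linear_scale[OF lin])
    show "norm (\<integral>\<omega>. \<phi>' (z + X \<omega>) h \<partial>M) \<le> norm h * C"
      by (rule expectation_norm_le) (use i1[of z h] b(2) in \<open>auto simp: mult.commute\<close>)
  qed
  have lip: "norm (\<phi> (x + h) - \<phi> x) \<le> C * norm h" for x h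
  proof -
    have "norm (\<phi> (x + h) - \<phi> x) \<le> C * norm (x + h - x)"
    proof (rule differentiable_bound[of UNIV \<phi> \<phi>'])
      show "onorm (\<phi>' y) \<le> C" for y by (rule onorm_bound) (rule order_trans[OF norm_ge_zero b(1)], rule b(2))
    qed (use d in auto)
    then show ?thesis by simp
  qed
  show "(\<lambda>h. norm ((\<integral>\<omega>. \<phi> (z + h + X \<omega>) \<partial>M) - (\<integral>\<omega>. \<phi> (z + X \<omega>) \<partial>M) - (\<integral>\<omega>. \<phi>' (z + X \<omega>) h \<partial>M)) / norm h) \<midarrow>0\<rightarrow> 0"
    unfolding tendsto_at_iff_sequentially o_def
  proof (intro allI impI)
    fix hs :: "nat \<Rightarrow> 'b" assume hs: "\<forall>n. hs n \<in> UNIV - {0}" "hs \<longlonglongrightarrow> 0"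
    define R where "R n \<omega> = norm (\<phi> (z + hs n + X \<omega>) - \<phi> (z + X \<omega>) - \<phi>' (z + X \<omega>) (hs n)) / norm (hs n)" for n \<omega>
    have Rb: "norm (R n \<omega>) \<le> 2 * C" for n \<omega>
    proof -
      have "norm (\<phi> (z + hs n + X \<omega>) - \<phi> (z + X \<omega>) - \<phi>' (z + X \<omega>) (hs n)) \<le> C * norm (hs n) + C * norm (hs n)"
      proof -
        have e: "z + hs n + X \<omega> = z + X \<omega> + hs n" by simp
        show ?thesis
          unfolding e using lip[of "z + X \<omega>" "hs n"] b(2)[of "z + X \<omega>" "hs n"]
            norm_triangle_ineq4[of "\<phi> (z + X \<omega> + hs n) - \<phi> (z + X \<omega>)" "\<phi>' (z + X \<omega>) (hs n)"] by simp
      qed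
      then show ?thesis using hs(1) by (simp add: R_def divide_le_eq)
    qed
    have im: "integrable M (\<lambda>\<omega>. \<phi> (z + hs n + X \<omega>) - \<phi> (z + X \<omega>) - \<phi>' (z + X \<omega>) (hs n))" for n
      by (intro Bochner_Integration.integrable_diff i0 i1)
    have Rm: "R n \<in> borel_measurable M" for n
      unfolding R_def[abs_def] using borel_measurable_integrable[OF im[of n]] by measurable
    have "(\<lambda>n. \<integral>\<omega>. R n \<omega> \<partial>M) \<longlonglongrightarrow> (\<integral>\<omega>. 0 \<partial>M)"
    proof (rule integral_dominated_convergence[where w = "\<lambda>_. 2 * C"])
      have fl: "filterlim hs (at 0) sequentially" using hs by (simp add: filterlim_at)
      show "AE \<omega> in M. (\<lambda>n. R n \<omega>) \<longlonglongrightarrow> 0"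
      proof (intro AE_I2)
        fix \<omega>
        have "(\<lambda>h. norm (\<phi> (z + X \<omega> + h) - \<phi> (z + X \<omega>) - \<phi>' (z + X \<omega>) h) / norm h) \<midarrow>0\<rightarrow> 0"
          using d[of "z + X \<omega>"] by (simp add: has_derivative_at)
        from filterlim_compose[OF this fl] show "(\<lambda>n. R n \<omega>) \<longlonglongrightarrow> 0"
          by (simp add: R_def add_ac)
      qed
    qed (use Rm Rb in auto)
    then have lim: "(\<lambda>n. \<integral>\<omega>. R n \<omega> \<partial>M) \<longlonglongrightarrow> 0" by simp
    show "(\<lambda>n. norm ((\<integral>\<omega>. \<phi> (z + hs n + X \<omega>) \<partial>M) - (\<integral>\<omega>. \<phi> (z + X \<omega>) \<partial>M) - (\<integral>\<omega>. \<phi>' (z + X \<omega>) (hs n) \<partial>M)) / norm (hs n)) \<longlonglongrightarrow> 0"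
    proof (rule tendsto_sandwich[OF _ _ tendsto_const lim])
      have "norm ((\<integral>\<omega>. \<phi> (z + hs n + X \<omega>) \<partial>M) - (\<integral>\<omega>. \<phi> (z + X \<omega>) \<partial>M) - (\<integral>\<omega>. \<phi>' (z + X \<omega>) (hs n) \<partial>M)) / norm (hs n) \<le> (\<integral>\<omega>. R n \<omega> \<partial>M)" for n
      proof -
        have "(\<integral>\<omega>. \<phi> (z + hs n + X \<omega>) \<partial>M) - (\<integral>\<omega>. \<phi> (z + X \<omega>) \<partial>M) - (\<integral>\<omega>. \<phi>' (z + X \<omega>) (hs n) \<partial>M)
          = (\<integral>\<omega>. \<phi> (z + hs n + X \<omega>) - \<phi> (z + X \<omega>) - \<phi>' (z + X \<omega>) (hs n) \<partial>M)"
          by (simp add: i0 i1)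
        then show ?thesis
          unfolding R_def using integral_norm_bound[of M "\<lambda>\<omega>. \<phi> (z + hs n + X \<omega>) - \<phi> (z + X \<omega>) - \<phi>' (z + X \<omega>) (hs n)"]
          by (simp add: divide_right_mono)
      qed
      then show "\<forall>\<^sub>F n in sequentially. norm ((\<integral>\<omega>. \<phi> (z + hs n + X \<omega>) \<partial>M) - (\<integral>\<omega>. \<phi> (z + X \<omega>) \<partial>M) - (\<integral>\<omega>. \<phi>' (z + X \<omega>) (hs n) \<partial>M)) / norm (hs n) \<le> (\<integral>\<omega>. R n \<omega> \<partial>M)"
        by (intro always_eventually allI)
    qed simp
  qed
qed

lemma expectation_C2b:
  fixes g :: "'b::{real_inner, banach, second_countable_topology} \<Rightarrow> real"
  assumes g: "C2b C g g' g''" and X: "X \<in> borel_measurable M"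
  shows "C2b C (\<lambda>z. \<integral>\<omega>. g (z + X \<omega>) \<partial>M) (\<lambda>z. \<integral>\<omega>. g' (z + X \<omega>) \<partial>M) (\<lambda>z h. \<integral>\<omega>. g'' (z + X \<omega>) h \<partial>M)"
  unfolding C2b_def
proof (intro conjI allI)
  note D = C2bD[OF g]
  note i0 = integrable_bounded_continuous[OF D(10) _ X, of C]
  note i1 = integrable_bounded_continuous[OF D(11) D(2) X]
  note i2 = integrable_bounded_continuous[OF D(7) D(3) X]
  fix z h k
  show "\<bar>\<integral>\<omega>. g (z + X \<omega>) \<partial>M\<bar> \<le> C"
    using expectation_norm_le[of "\<lambda>\<omega>. g (z + X \<omega>)" C] i0[of z] D(1) by auto
  show "norm (\<integral>\<omega>. g' (z + X \<omega>) \<partial>M) \<le> C"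
    by (rule expectation_norm_le) (use i1 D(2) in auto)
  show "norm (\<integral>\<omega>. g'' (z + X \<omega>) h \<partial>M) \<le> C * norm h"
    by (rule expectation_norm_le) (use i2 D(3) in auto)
  have gh: "norm (g' x \<bullet> h) \<le> C * norm h" for x h
    using Cauchy_Schwarz_ineq2[of "g' x" h] mult_right_mono[OF D(2)[of x], of "norm h"] by simp
  have gC: "norm (g x) \<le> C" for x using D(1)[of x] by simp
  have gc: "continuous_on UNIV (\<lambda>x. g' x \<bullet> h)" for h
    by (intro continuous_on_inner D(11) continuous_on_const)
  from expectation_has_derivative[OF D(4) gC gh gc X]
  have "((\<lambda>z. \<integral>\<omega>. g (z + X \<omega>) \<partial>M) has_derivative (\<lambda>h. \<integral>\<omega>. g' (z + X \<omega>) \<bullet> h \<partial>M)) (at z)" .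
  then show "((\<lambda>z. \<integral>\<omega>. g (z + X \<omega>) \<partial>M) has_derivative (\<lambda>h. (\<integral>\<omega>. g' (z + X \<omega>) \<partial>M) \<bullet> h)) (at z)"
    using i1 by simp
  show "((\<lambda>z. \<integral>\<omega>. g' (z + X \<omega>) \<partial>M) has_derivative (\<lambda>h. \<integral>\<omega>. g'' (z + X \<omega>) h \<partial>M)) (at z)"
    by (rule expectation_has_derivative[OF D(5) D(2) D(3) D(7) X])
  show "(\<integral>\<omega>. g'' (z + X \<omega>) h \<partial>M) \<bullet> k = (\<integral>\<omega>. g'' (z + X \<omega>) k \<partial>M) \<bullet> h"
  proof -
    have "(\<integral>\<omega>. g'' (z + X \<omega>) h \<partial>M) \<bullet> k = (\<integral>\<omega>. g'' (z + X \<omega>) h \<bullet> k \<partial>M)"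
      by (rule integral_inner_left[symmetric, OF i2])
    also have "\<dots> = (\<integral>\<omega>. g'' (z + X \<omega>) k \<bullet> h \<partial>M)"
      by (rule Bochner_Integration.integral_cong[OF refl D(6)])
    also have "\<dots> = (\<integral>\<omega>. g'' (z + X \<omega>) k \<partial>M) \<bullet> h"
      by (rule integral_inner_left[OF i2])
    finally show ?thesis .
  qed
next
  note D = C2bD[OF g]
  fix h :: 'b
  show "continuous_on UNIV (\<lambda>z. \<integral>\<omega>. g'' (z + X \<omega>) h \<partial>M)"
    unfolding continuous_on_sequentially o_def
  proof (intro allI ballI impI)
    fix zs and z :: 'b assume "(\<forall>n. zs n \<in> UNIV) \<and> zs \<longlonglongrightarrow> z"
    then have zs: "zs \<longlonglongrightarrow> z" by simp
    show "(\<lambda>n. \<integral>\<omega>. g'' (zs n + X \<omega>) h \<partial>M) \<longlonglongrightarrow> (\<integral>\<omega>. g'' (z + X \<omega>) h \<partial>M)"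
    proof (rule integral_dominated_convergence[where w = "\<lambda>_. C * norm h"])
      show "AE \<omega> in M. (\<lambda>n. g'' (zs n + X \<omega>) h) \<longlonglongrightarrow> g'' (z + X \<omega>) h"
      proof (intro AE_I2)
        fix \<omega>
        have "(\<lambda>n. zs n + X \<omega>) \<longlonglongrightarrow> z + X \<omega>" by (intro tendsto_intros zs)
        from continuous_on_tendsto_compose[OF D(7) this] show "(\<lambda>n. g'' (zs n + X \<omega>) h) \<longlonglongrightarrow> g'' (z + X \<omega>) h" by simp
      qed
    qed (use integrable_bounded_continuous[OF D(7) D(3) X] D(3) in auto)
  qed
qed

text \<open>Jensen's inequality for each basis vector, summed under the integral. \<open>N\<close>
  is any measurable majorant: later a constant, or a norm of differences whose measurability comes
  from continuity.\<close>

lemma hs_norm_expectation: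
  fixes H :: "'a \<Rightarrow> 'b::{real_inner, banach, second_countable_topology} \<Rightarrow> 'b"
  assumes H: "\<And>\<omega>. hilbert_schmidt (H \<omega>)" "\<And>h. (\<lambda>\<omega>. H \<omega> h) \<in> borel_measurable M"
    and N: "\<And>\<omega>. hs_norm (H \<omega>) \<le> N \<omega>" "N \<in> borel_measurable M" "\<And>\<omega>. N \<omega> \<le> c"
    and bl: "bounded_linear (\<lambda>h. \<integral>\<omega>. H \<omega> h \<partial>M)"
  shows "hilbert_schmidt (\<lambda>h. \<integral>\<omega>. H \<omega> h \<partial>M)"
    and "hs_norm (\<lambda>h. \<integral>\<omega>. H \<omega> h \<partial>M) \<le> sqrt (\<integral>\<omega>. (N \<omega>)\<^sup>2 \<partial>M)"
proof -
  have N0: "0 \<le> N \<omega>" for \<omega> using N(1)[of \<omega>] hs_norm_nonneg[of "H \<omega>"] by linarith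
  have N2: "integrable M (\<lambda>\<omega>. (N \<omega>)\<^sup>2)"
    by (rule integrable_const_bound[where B = "c\<^sup>2"]) (use N N0 in \<open>auto intro!: power_mono\<close>)
  have Hb: "norm (H \<omega> h) \<le> c * norm h" for \<omega> h
    using norm_le_hs_norm[OF H(1)[of \<omega>], of h] mult_right_mono[OF order_trans[OF N(1,3)], of "norm h" \<omega>] by simp
  have i1: "integrable M (\<lambda>\<omega>. norm (H \<omega> h))" for h
    by (rule integrable_const_bound[where B = "c * norm h"]) (use H(2)[of h] Hb in auto)
  have i2: "integrable M (\<lambda>\<omega>. (norm (H \<omega> h))\<^sup>2)" for h
    by (rule integrable_const_bound[where B = "(c * norm h)\<^sup>2"]) (use H(2)[of h] Hb in \<open>auto intro!: power_mono\<close>)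
  have jensen: "(norm (\<integral>\<omega>. H \<omega> h \<partial>M))\<^sup>2 \<le> (\<integral>\<omega>. (norm (H \<omega> h))\<^sup>2 \<partial>M)" for h
  proof -
    have "norm (\<integral>\<omega>. H \<omega> h \<partial>M) \<le> (\<integral>\<omega>. norm (H \<omega> h) \<partial>M)" by (rule integral_norm_bound)
    then have "(norm (\<integral>\<omega>. H \<omega> h \<partial>M))\<^sup>2 \<le> (\<integral>\<omega>. norm (H \<omega> h) \<partial>M)\<^sup>2" by (intro power_mono) auto
    also have "\<dots> \<le> (\<integral>\<omega>. (norm (H \<omega> h))\<^sup>2 \<partial>M)"
      using variance_eq[OF i1 i2, of h] variance_positive[of "\<lambda>\<omega>. norm (H \<omega> h)"] by simp
    finally show ?thesis .
  qed
  have le: "(\<Sum>e\<in>F. (norm (\<integral>\<omega>. H \<omega> e \<partial>M))\<^sup>2) \<le> (sqrt (\<integral>\<omega>. (N \<omega>)\<^sup>2 \<partial>M))\<^sup>2"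
    if F: "finite F" "F \<subseteq> hilbert_basis" for F
  proof -
    have "(\<Sum>e\<in>F. (norm (\<integral>\<omega>. H \<omega> e \<partial>M))\<^sup>2) \<le> (\<Sum>e\<in>F. \<integral>\<omega>. (norm (H \<omega> e))\<^sup>2 \<partial>M)"
      by (intro sum_mono jensen)
    also have "\<dots> = (\<integral>\<omega>. (\<Sum>e\<in>F. (norm (H \<omega> e))\<^sup>2) \<partial>M)" using i2 by simp
    also have "\<dots> \<le> (\<integral>\<omega>. (N \<omega>)\<^sup>2 \<partial>M)"
    proof (rule integral_mono[OF _ N2])
      show "integrable M (\<lambda>\<omega>. \<Sum>e\<in>F. (norm (H \<omega> e))\<^sup>2)" using i2 by simp
      fix \<omega>
      have "(\<Sum>e\<in>F. (norm (H \<omega> e))\<^sup>2) \<le> (hs_norm (H \<omega>))\<^sup>2" by (rule hs_norm_finite_sum[OF H(1) F])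
      also have "\<dots> \<le> (N \<omega>)\<^sup>2" by (intro power_mono N hs_norm_nonneg)
      finally show "(\<Sum>e\<in>F. (norm (H \<omega> e))\<^sup>2) \<le> (N \<omega>)\<^sup>2" .
    qed
    finally show ?thesis by simp
  qed
  show "hilbert_schmidt (\<lambda>h. \<integral>\<omega>. H \<omega> h \<partial>M)" "hs_norm (\<lambda>h. \<integral>\<omega>. H \<omega> h \<partial>M) \<le> sqrt (\<integral>\<omega>. (N \<omega>)\<^sup>2 \<partial>M)"
    by (rule hilbert_schmidtI[OF bl _ le]; simp)+
qed

end

text \<open>The Hilbert-Schmidt norm does not change under adjoints, so multiplication by
  \<open>S\<close> on the right is multiplication of the adjoint by \<open>S'\<close> on the
  left.\<close>

lemma hs_compose_right:
  fixes L L' S S' :: "'a::{real_inner, banach} \<Rightarrow> 'a"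
  assumes L: "hilbert_schmidt L" "bounded_linear L'" "\<And>x y. L x \<bullet> y = x \<bullet> L' y"
    and S: "bounded_linear S" "bounded_linear S'" "\<And>x y. S x \<bullet> y = x \<bullet> S' y" "\<And>y. norm (S' y) \<le> c * norm y" "0 \<le> c"
  shows "hilbert_schmidt (\<lambda>h. L (S h))" "hs_norm (\<lambda>h. L (S h)) \<le> c * hs_norm L"
proof -
  note L' = hs_norm_adjoint[OF L]
  note SL = hs_norm_compose_left[OF L'(1) S(2,4,5)]
  have bl: "bounded_linear (\<lambda>h. L (S h))"
    using L(1) bounded_linear_compose[OF _ S(1), of L] by (simp add: hilbert_schmidt_def)
  have adj: "S' (L' x) \<bullet> y = x \<bullet> L (S y)" for x y
    using L(3)[of "S y" x] S(3)[of y "L' x"] by (simp add: inner_commute)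
  note R = hs_norm_adjoint[OF SL(1) bl adj]
  show "hilbert_schmidt (\<lambda>h. L (S h))" by (rule R(1))
  have "hs_norm (\<lambda>h. L (S h)) \<le> c * hs_norm L'" using R(2) SL(2) by linarith
  also have "\<dots> \<le> c * hs_norm L" by (intro mult_left_mono L' S)
  finally show "hs_norm (\<lambda>h. L (S h)) \<le> c * hs_norm L" .
qed

text \<open>The triangle inequality in both arguments. Formulated on pairs, it makes the norm of the
  difference of Hessians at two random points measurable.\<close>

lemma hs_difference_continuous:
  fixes F :: "'b::metric_space \<Rightarrow> 'a::{real_inner, banach} \<Rightarrow> 'a"
  assumes c: "hs_continuous_on UNIV F" and hs: "\<And>p. hilbert_schmidt (F p)"
  shows "continuous_on UNIV (\<lambda>p. hs_norm (\<lambda>h. F (fst p) h - F (snd p) h))"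
  unfolding continuous_on_sequentially o_def
proof (intro allI ballI impI)
  fix ps and p :: "'b \<times> 'b" assume "(\<forall>n. ps n \<in> UNIV) \<and> ps \<longlonglongrightarrow> p"
  then have ps: "(\<lambda>n. fst (ps n)) \<longlonglongrightarrow> fst p" "(\<lambda>n. snd (ps n)) \<longlonglongrightarrow> snd p"
    by (auto intro: tendsto_fst tendsto_snd)
  let ?d = "\<lambda>x y. hs_norm (\<lambda>h. F x h - F y h)"
  have hd: "hilbert_schmidt (\<lambda>h. F x h - F y h)" for x y by (rule hs_norm_diff(1)[OF hs hs])
  have tri: "?d x z \<le> ?d x y + ?d y z" for x y z
    using hs_norm_add(2)[OF hd[of x y] hd[of y z]] by simp
  have sym: "?d x y = ?d y x" for x y
    by (simp add: hs_norm_def norm_minus_commute)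
  have "(\<lambda>n. ?d (fst (ps n)) (fst p) + ?d (snd (ps n)) (snd p)) \<longlonglongrightarrow> 0 + 0"
    by (intro tendsto_add hs_continuous_tendsto[OF c] ps) auto
  then have "(\<lambda>n. ?d (fst (ps n)) (fst p) + ?d (snd (ps n)) (snd p)) \<longlonglongrightarrow> 0" by simp
  moreover have "norm (?d (fst (ps n)) (snd (ps n)) - ?d (fst p) (snd p)) \<le> ?d (fst (ps n)) (fst p) + ?d (snd (ps n)) (snd p)" for n
    using tri[of "fst (ps n)" "snd (ps n)" "fst p"] tri[of "fst p" "snd (ps n)" "snd p"]
      tri[of "fst p" "snd p" "fst (ps n)"] tri[of "fst (ps n)" "snd p" "snd (ps n)"]
      sym[of "fst (ps n)" "fst p"] sym[of "snd (ps n)" "snd p"] unfolding real_norm_def abs_le_iff by linarith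
  ultimately have "(\<lambda>n. ?d (fst (ps n)) (snd (ps n)) - ?d (fst p) (snd p)) \<longlonglongrightarrow> 0"
    by (rule Lim_null_comparison[OF always_eventually[OF allI], rotated])
  then show "(\<lambda>n. ?d (fst (ps n)) (snd (ps n))) \<longlonglongrightarrow> ?d (fst p) (snd p)" by (rule LIM_zero_cancel)
qed

text \<open>Telescoping into S' (K - K0) S, (S' - S0') K0 S and S0' K0 (S - S0). Strong convergence
  of \<open>S'\<close> suffices for the middle term since \<open>K0\<close> is Hilbert-Schmidt; K0
  (S - S0) is the adjoint of (S' - S0') K0, so the last term follows from the same limit.\<close>

lemma hs_tendsto_sandwich:
  fixes K S S' :: "nat \<Rightarrow> 'a::{real_inner, banach} \<Rightarrow> 'a" and K0 S0 S0' :: "'a \<Rightarrow> 'a"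
  assumes T: "\<And>n. bounded_linear (S n)" "bounded_linear S0" "\<And>n. bounded_linear (S' n)" "bounded_linear S0'"
    and adj: "\<And>n x y. S n x \<bullet> y = x \<bullet> S' n y" "\<And>x y. S0 x \<bullet> y = x \<bullet> S0' y"
    and bound: "\<And>n x. norm (S n x) \<le> c * norm x" "\<And>x. norm (S0 x) \<le> c * norm x"
      "\<And>n x. norm (S' n x) \<le> c * norm x" "\<And>x. norm (S0' x) \<le> c * norm x" and c: "0 \<le> c"
    and lim: "\<And>x. (\<lambda>n. S' n x) \<longlonglongrightarrow> S0' x"
    and K: "\<And>n. hilbert_schmidt (K n)" "hilbert_schmidt K0" "\<And>n x y. K n x \<bullet> y = x \<bullet> K n y" "\<And>x y. K0 x \<bullet> y = x \<bullet> K0 y"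
    and Kl: "(\<lambda>n. hs_norm (\<lambda>h. K n h - K0 h)) \<longlonglongrightarrow> 0"
  shows "(\<lambda>n. hs_norm (\<lambda>h. S' n (K n (S n h)) - S0' (K0 (S0 h)))) \<longlonglongrightarrow> 0"
proof -
  define Dn where "Dn n h = K n h - K0 h" for n h
  define E where "E n h = S' n (K0 h) - S0' (K0 h)" for n h
  define F where "F n h = K0 (S n h) - K0 (S0 h)" for n h
  have blK: "bounded_linear (K n)" "bounded_linear K0" for n using K by (auto simp: hilbert_schmidt_def)
  have Dh: "hilbert_schmidt (Dn n)" for n unfolding Dn_def[abs_def] by (rule hs_norm_diff(1)[OF K(1,2)])
  have Da: "Dn n x \<bullet> y = x \<bullet> Dn n y" for n x y by (simp add: Dn_def inner_diff_left inner_diff_right K)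
  have Db: "bounded_linear (Dn n)" for n using Dh by (simp add: hilbert_schmidt_def)
  have DS: "hilbert_schmidt (\<lambda>h. Dn n (S n h))" "hs_norm (\<lambda>h. Dn n (S n h)) \<le> c * hs_norm (Dn n)" for n
    by (rule hs_compose_right[OF Dh[of n] Db[of n] Da[of n] T(1)[of n] T(3)[of n] adj(1)[of n] bound(3)[of n] c])+
  have SDS: "hilbert_schmidt (\<lambda>h. S' n (Dn n (S n h)))" "hs_norm (\<lambda>h. S' n (Dn n (S n h))) \<le> c * hs_norm (\<lambda>h. Dn n (S n h))" for n
    by (rule hs_norm_compose_left[OF DS(1)[of n] T(3)[of n] bound(3)[of n] c])+
  have SK: "hilbert_schmidt (\<lambda>h. S' n (K0 h))" "hilbert_schmidt (\<lambda>h. S0' (K0 h))" for n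
    by (rule hs_norm_compose_left(1)[OF K(2) T(3)[of n] bound(3)[of n] c] hs_norm_compose_left(1)[OF K(2) T(4) bound(4) c])+
  have Eh: "hilbert_schmidt (E n)" for n unfolding E_def[abs_def] by (rule hs_norm_diff(1)[OF SK])
  have Fb: "bounded_linear (F n)" for n
    unfolding F_def[abs_def]
    by (intro bounded_linear_sub bounded_linear_compose[OF blK(2) T(1)] bounded_linear_compose[OF blK(2) T(2)])
  have EF: "E n x \<bullet> y = x \<bullet> F n y" for n x y
  proof -
    have "S' n u \<bullet> y = u \<bullet> S n y" "S0' u \<bullet> y = u \<bullet> S0 y" for u
      using adj(1)[of n y u] adj(2)[of y u] by (simp_all add: inner_commute)
    then show ?thesis by (simp add: E_def F_def inner_diff_left inner_diff_right K)
  qed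
  have F_hs: "hilbert_schmidt (F n)" "hs_norm (F n) \<le> hs_norm (E n)" for n
    by (rule hs_norm_adjoint[OF Eh[of n] Fb[of n] EF[of n]])+
  have ES: "hilbert_schmidt (\<lambda>h. E n (S n h))" "hs_norm (\<lambda>h. E n (S n h)) \<le> c * hs_norm (E n)" for n
    by (rule hs_compose_right[OF Eh[of n] Fb[of n] EF[of n] T(1)[of n] T(3)[of n] adj(1)[of n] bound(3)[of n] c])+
  have SF: "hilbert_schmidt (\<lambda>h. S0' (F n h))" "hs_norm (\<lambda>h. S0' (F n h)) \<le> c * hs_norm (F n)" for n
    by (rule hs_norm_compose_left[OF F_hs(1)[of n] T(4) bound(4) c])+
  have E_lim: "(\<lambda>n. hs_norm (E n)) \<longlonglongrightarrow> 0"
  proof -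
    have "(\<lambda>n. hs_norm (\<lambda>h. (\<lambda>x. S' n x - S0' x) (K0 h))) \<longlonglongrightarrow> 0"
    proof (rule hs_norm_strong_limit[OF K(2), where c = "c + c"])
      show "bounded_linear (\<lambda>x. S' n x - S0' x)" for n by (intro bounded_linear_sub T)
      show "norm (S' n x - S0' x) \<le> (c + c) * norm x" for n x
        using norm_triangle_ineq4[of "S' n x" "S0' x"] bound(3)[of n x] bound(4)[of x] by (simp add: distrib_right)
      show "(\<lambda>n. S' n x - S0' x) \<longlonglongrightarrow> 0" for x using LIM_zero[OF lim] .
    qed
    then show ?thesis by (simp add: E_def[abs_def])
  qed
  have lin: "S' n (u + v) = S' n u + S' n v" "S' n (u - v) = S' n u - S' n v" "S0' (u - v) = S0' u - S0' v" for n u v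
    using T by (simp_all add: bounded_linear.linear linear_add linear_diff)
  have dec: "S' n (K n (S n h)) - S0' (K0 (S0 h)) = (S' n (Dn n (S n h)) + E n (S n h)) + S0' (F n h)" for n h
    by (simp add: Dn_def E_def F_def lin)
  have le: "hs_norm (\<lambda>h. S' n (K n (S n h)) - S0' (K0 (S0 h)))
      \<le> c * (c * hs_norm (Dn n)) + c * hs_norm (E n) + c * hs_norm (E n)" for n
  proof -
    have 1: "hs_norm (\<lambda>h. S' n (Dn n (S n h)) + E n (S n h)) \<le> c * (c * hs_norm (Dn n)) + c * hs_norm (E n)"
      by (intro order_trans[OF hs_norm_add(2)[OF SDS(1) ES(1)]] add_mono order_trans[OF SDS(2)] mult_left_mono DS(2) ES(2) c)
    have 2: "hs_norm (\<lambda>h. S0' (F n h)) \<le> c * hs_norm (E n)"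
      by (intro order_trans[OF SF(2)] mult_left_mono F_hs(2) c)
    show ?thesis
      unfolding dec using hs_norm_add(2)[OF hs_norm_add(1)[OF SDS(1) ES(1)] SF(1), of n n n] 1 2 by linarith
  qed
  have "(\<lambda>n. c * (c * hs_norm (Dn n)) + c * hs_norm (E n) + c * hs_norm (E n)) \<longlonglongrightarrow> c * (c * 0) + c * 0 + c * 0"
    by (intro tendsto_intros E_lim) (use Kl in \<open>simp add: Dn_def[abs_def]\<close>)
  then have lim0: "(\<lambda>n. c * (c * hs_norm (Dn n)) + c * hs_norm (E n) + c * hs_norm (E n)) \<longlonglongrightarrow> 0" by simp
  show ?thesis
    by (rule tendsto_sandwich[OF _ _ tendsto_const lim0])
      (use le hs_norm_nonneg in \<open>auto intro!: always_eventually\<close>)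
qed

locale ou_function = ou_setting +
  fixes f :: "'a \<Rightarrow> real"
  assumes f: "f \<in> CA2 D A"
begin

subsection \<open>Spatial regularity of the Ornstein--Uhlenbeck semigroup\<close>

abbreviation "Af \<equiv> \<lambda>x. adj_op D A (grad f x)"

lemma f_Cb2: "f \<in> Cb2" and f_adj: "grad f x \<in> adj_dom D A" and Af_continuous: "continuous_on UNIV Af"
  using f by (auto simp: CA2_def)

definition C where "C = (SOME C. \<forall>x. \<bar>f x\<bar> \<le> C \<and> norm (grad f x) \<le> C \<and> hs_norm (hess f x) \<le> C \<and> norm (Af x) \<le> C)"

lemma C: "\<bar>f x\<bar> \<le> C" "norm (grad f x) \<le> C" "hs_norm (hess f x) \<le> C" "norm (Af x) \<le> C" "0 \<le> C"
proof -
  obtain c where c: "\<And>x. \<bar>f x\<bar> \<le> c" "\<And>x. norm (grad f x) \<le> c" "\<And>x. hs_norm (hess f x) \<le> c"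
    by (rule Cb2_bound[OF f_Cb2]) (rule that)
  have "bounded (range Af)" using f by (simp add: CA2_def)
  then obtain c' where c': "\<And>x. norm (Af x) \<le> c'" by (auto simp: bounded_iff)
  have "\<forall>x. \<bar>f x\<bar> \<le> max c c' \<and> norm (grad f x) \<le> max c c' \<and> hs_norm (hess f x) \<le> max c c' \<and> norm (Af x) \<le> max c c'"
    using c c' by (simp add: le_max_iff_disj)
  then have *: "\<forall>x. \<bar>f x\<bar> \<le> C \<and> norm (grad f x) \<le> C \<and> hs_norm (hess f x) \<le> C \<and> norm (Af x) \<le> C"
    unfolding C_def by (rule someI)
  then show "\<bar>f x\<bar> \<le> C" "norm (grad f x) \<le> C" "hs_norm (hess f x) \<le> C" "norm (Af x) \<le> C" by auto
  show "0 \<le> C" using * abs_ge_zero order_trans by blast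
qed

lemma f_C2b: "C2b C f (grad f) (hess f)"
  by (rule Cb2_imp_C2b[OF f_Cb2]) (use C in auto)

abbreviation "u \<equiv> \<lambda>t x. OU_semigroup M T Y t f x"

text \<open>\<open>Kf\<close> is the expected Hessian before transport. \<open>du\<close>,
  \<open>Au\<close> and \<open>hu\<close> are the candidates for the gradient of \<open>u t\<close>,
  the adjoint of \<open>A\<close> applied to it, and the Hessian, found by differentiating under the
  expectation and transporting with the adjoint semigroup.\<close>

definition Kf :: "real \<Rightarrow> 'a \<Rightarrow> 'a \<Rightarrow> 'a" where "Kf t x h = (\<integral>\<omega>. hess f (T t x + Y t \<omega>) h \<partial>M)"
definition du :: "real \<Rightarrow> 'a \<Rightarrow> 'a" where "du t x = T' t (\<integral>\<omega>. grad f (T t x + Y t \<omega>) \<partial>M)"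
definition Au :: "real \<Rightarrow> 'a \<Rightarrow> 'a" where "Au t x = T' t (\<integral>\<omega>. Af (T t x + Y t \<omega>) \<partial>M)"
definition hu :: "real \<Rightarrow> 'a \<Rightarrow> 'a \<Rightarrow> 'a" where "hu t x h = T' t (Kf t x (T t h))"

lemma u_eq: "u t x = (\<integral>\<omega>. f (T t x + Y t \<omega>) \<partial>M)"
  by (simp add: OU_semigroup_def)

lemma u_C2b:
  assumes t: "t \<ge> 0" and K: "K \<ge> 1" "\<And>x. norm (T t x) \<le> K * norm x"
  shows "C2b (K\<^sup>2 * C) (u t) (du t) (hu t)"
proof -
  have m: "Y t \<in> borel_measurable M" using t by simp
  from C2b_affine[OF expectation_C2b[OF f_C2b m] T.T_linear[OF t] T'.T_linear[OF t] T_adjoint[OF t] K(2) T'_bound[OF t K(2)] K(1), of 0]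
  show ?thesis
    by (simp add: u_eq[abs_def] du_def[abs_def] hu_def[abs_def] Kf_def[abs_def])
qed

lemma u_C2b_ex: "t \<ge> 0 \<Longrightarrow> \<exists>C. C2b C (u t) (du t) (hu t)"
  using T.T_bounded[of t] u_C2b order_refl by metis

lemma grad_u: "t \<ge> 0 \<Longrightarrow> grad (u t) = du t"
  using u_C2b_ex[of t] C2bD(4) by (auto intro!: ext grad_eqI)

lemma hess_u: "t \<ge> 0 \<Longrightarrow> hess (u t) = hu t"
  using u_C2b_ex[of t] C2bD(5) by (auto simp: hess_def[abs_def] grad_u intro!: ext fun_cong[OF frechet_derivative_at[symmetric]])

lemma expectation_integrable:
  fixes \<phi> :: "'a \<Rightarrow> 'c::{banach, second_countable_topology}"
  assumes "t \<ge> 0" "continuous_on UNIV \<phi>" "\<And>x. norm (\<phi> x) \<le> c"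
  shows "integrable M (\<lambda>\<omega>. \<phi> (T t x + Y t \<omega>))"
  by (rule integrable_bounded_continuous[OF assms(2,3)]) (use assms(1) in simp)

text \<open>The adjoint of \<open>A\<close> passes through the expectation because its defining
  identity is tested against single vectors of \<open>D\<close>; then \<open>T'\<close> commutes
  with its generator.\<close>

lemma adj_u:
  assumes t: "t \<ge> 0"
  shows "du t x \<in> adj_dom D A" "adj_op D A (du t x) = Au t x"
proof -
  note i1 = expectation_integrable[OF t Cb2D(7)[OF f_Cb2] C(2)]
  note i2 = expectation_integrable[OF t Af_continuous C(4)]
  have "A y \<bullet> (\<integral>\<omega>. grad f (T t x + Y t \<omega>) \<partial>M) = y \<bullet> (\<integral>\<omega>. Af (T t x + Y t \<omega>) \<partial>M)" if "y \<in> D" for y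
  proof -
    have "A y \<bullet> (\<integral>\<omega>. grad f (T t x + Y t \<omega>) \<partial>M) = (\<integral>\<omega>. A y \<bullet> grad f (T t x + Y t \<omega>) \<partial>M)"
      by (rule integral_inner_right[symmetric, OF i1])
    also have "\<dots> = (\<integral>\<omega>. y \<bullet> Af (T t x + Y t \<omega>) \<partial>M)"
      by (rule Bochner_Integration.integral_cong[OF refl adj_op_eq[OF f_adj that]])
    also have "\<dots> = y \<bullet> (\<integral>\<omega>. Af (T t x + Y t \<omega>) \<partial>M)" by (rule integral_inner_right[OF i2])
    finally show ?thesis .
  qed
  note e = adj_op_eqI[OF this]
  show "du t x \<in> adj_dom D A" "adj_op D A (du t x) = Au t x"
    using T'.T_commute[OF e(1) t] by (simp_all add: du_def Au_def e(2))
qed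

lemma Kf_symmetric: "t \<ge> 0 \<Longrightarrow> Kf t x h \<bullet> k = h \<bullet> Kf t x k"
  using C2bD(6)[OF expectation_C2b[OF f_C2b], of "Y t" "T t x" h k] by (simp add: Kf_def inner_commute)

lemma Kf_linear: "t \<ge> 0 \<Longrightarrow> bounded_linear (Kf t x)"
  using C2bD(9)[OF expectation_C2b[OF f_C2b], of "Y t" "T t x"] by (simp add: Kf_def[abs_def])

lemma hess_measurable: "t \<ge> 0 \<Longrightarrow> (\<lambda>\<omega>. hess f (T t x + Y t \<omega>) h) \<in> borel_measurable M"
  using expectation_integrable[OF _ C2bD(7,3)[OF f_C2b]] by (rule borel_measurable_integrable)

lemma Kf_hs:
  assumes t: "t \<ge> 0"
  shows "hilbert_schmidt (Kf t x)" "hs_norm (Kf t x) \<le> C"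
proof -
  have bl: "bounded_linear (\<lambda>h. \<integral>\<omega>. hess f (T t x + Y t \<omega>) h \<partial>M)"
    using Kf_linear[OF t] by (simp add: Kf_def[abs_def])
  note H = hs_norm_expectation[OF Cb2D(3)[OF f_Cb2] hess_measurable[OF t] C(3) borel_measurable_const order_refl bl]
  show "hilbert_schmidt (Kf t x)" "hs_norm (Kf t x) \<le> C"
    using H C(5) by (simp_all add: Kf_def[abs_def] prob_space)
qed

lemma time_bound:
  fixes s :: "nat \<Rightarrow> real"
  assumes s: "\<And>n. s n \<ge> 0" "s \<longlonglongrightarrow> t"
  obtains r where "\<And>n. s n \<le> r" "t \<le> r" "0 \<le> t" "0 \<le> r"
proof -
  have t: "t \<ge> 0" using s by (simp add: LIMSEQ_le_const)
  have "bounded (range s)" using s(2) convergent_imp_bounded by blast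
  then obtain r where "\<And>n. \<bar>s n\<bar> \<le> r" by (auto simp: bounded_iff)
  then have "s n \<le> max r t" for n by (metis abs_le_D1 le_max_iff_disj)
  then show thesis using that[of "max r t"] t by simp
qed

lemma expectation_path_tendsto:
  fixes \<phi> :: "'a \<Rightarrow> 'c::{banach, second_countable_topology}"
  assumes s: "\<And>n. s n \<ge> 0" "s \<longlonglongrightarrow> t" and x: "xs \<longlonglongrightarrow> x"
    and \<phi>: "continuous_on UNIV \<phi>" "\<And>x. norm (\<phi> x) \<le> c"
  shows "(\<lambda>n. \<integral>\<omega>. \<phi> (T (s n) (xs n) + Y (s n) \<omega>) \<partial>M) \<longlonglongrightarrow> (\<integral>\<omega>. \<phi> (T t x + Y t \<omega>) \<partial>M)"
proof (rule expectation_tendsto[OF s])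
  have t: "t \<ge> 0" using s by (simp add: LIMSEQ_le_const)
  show "(\<lambda>\<omega>. \<phi> (T (s n) (xs n) + Y (s n) \<omega>)) \<in> borel_measurable M" for n
    using expectation_integrable[OF s(1) \<phi>] by (rule borel_measurable_integrable)
  show "(\<lambda>\<omega>. \<phi> (T t x + Y t \<omega>)) \<in> borel_measurable M"
    using expectation_integrable[OF t \<phi>] by (rule borel_measurable_integrable)
  show "norm (\<phi> (T (s n) (xs n) + Y (s n) \<omega>)) \<le> c" for n \<omega> by (rule \<phi>)
  fix \<omega> and r :: "nat \<Rightarrow> nat" assume r: "strict_mono r" and Y: "(\<lambda>n. Y (s (r n)) \<omega>) \<longlonglongrightarrow> Y t \<omega>"
  have "(\<lambda>n. T (s n) (xs n)) \<longlonglongrightarrow> T t x" by (rule T.T_tendsto[OF s x])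
  from LIMSEQ_subseq_LIMSEQ[OF this r] have "(\<lambda>n. T (s (r n)) (xs (r n))) \<longlonglongrightarrow> T t x" by (simp add: o_def)
  from continuous_on_tendsto_compose[OF \<phi>(1) tendsto_add[OF this Y]]
  show "(\<lambda>n. \<phi> (T (s (r n)) (xs (r n)) + Y (s (r n)) \<omega>)) \<longlonglongrightarrow> \<phi> (T t x + Y t \<omega>)" by simp
qed

lemma u_tendsto:
  assumes s: "\<And>n. s n \<ge> 0" "s \<longlonglongrightarrow> t" and x: "xs \<longlonglongrightarrow> x"
  shows "(\<lambda>n. u (s n) (xs n)) \<longlonglongrightarrow> u t x" "(\<lambda>n. du (s n) (xs n)) \<longlonglongrightarrow> du t x"
    "(\<lambda>n. Au (s n) (xs n)) \<longlonglongrightarrow> Au t x"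
    "(\<lambda>n. hs_norm (\<lambda>h. hu (s n) (xs n) h - hu t x h)) \<longlonglongrightarrow> 0"
proof -
  show "(\<lambda>n. u (s n) (xs n)) \<longlonglongrightarrow> u t x"
    unfolding u_eq by (rule expectation_path_tendsto[OF s x Cb2D(6)[OF f_Cb2], of C]) (use C in auto)
  show "(\<lambda>n. du (s n) (xs n)) \<longlonglongrightarrow> du t x"
    unfolding du_def by (rule T'.T_tendsto[OF s expectation_path_tendsto[OF s x Cb2D(7)[OF f_Cb2] C(2)]])
  show "(\<lambda>n. Au (s n) (xs n)) \<longlonglongrightarrow> Au t x"
    unfolding Au_def by (rule T'.T_tendsto[OF s expectation_path_tendsto[OF s x Af_continuous C(4)]])
  obtain r where r: "\<And>n. s n \<le> r" "t \<le> r" "0 \<le> t" "0 \<le> r"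
    by (rule time_bound[OF s]) (rule that)
  obtain \<kappa> where \<kappa>: "\<kappa> \<ge> 1" "\<And>t x. 0 \<le> t \<Longrightarrow> t \<le> r \<Longrightarrow> norm (T t x) \<le> \<kappa> * norm x"
    "\<And>t x. 0 \<le> t \<Longrightarrow> t \<le> r \<Longrightarrow> norm (T' t x) \<le> \<kappa> * norm x"
    by (rule bounds_on[of r]) (rule that)
  \<comment> \<open>Distance of the Hessians at the two random points. Its mean square tends to 0
    and, by \<open>hs_norm_expectation\<close>, dominates the squared distance of the expected
    Hessians.\<close>
  define N where "N n \<omega> = hs_norm (\<lambda>h. hess f (T (s n) (xs n) + Y (s n) \<omega>) h - hess f (T t x + Y t \<omega>) h)" for n \<omega>
  note hs = Cb2D(3)[OF f_Cb2]
  have N0: "0 \<le> N n \<omega>" for n \<omega> unfolding N_def by (rule hs_norm_nonneg)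
  have Nc: "N n \<omega> \<le> 2 * C" for n \<omega>
    unfolding N_def using order_trans[OF hs_norm_diff(2)[OF hs hs] add_mono[OF C(3) C(3)]] by simp
  have Nm [measurable]: "N n \<in> borel_measurable M" for n
  proof -
    have [measurable]: "(\<lambda>p. hs_norm (\<lambda>h. hess f (fst p) h - hess f (snd p) h)) \<in> borel_measurable borel"
      by (rule borel_measurable_continuous_onI[OF hs_difference_continuous[OF Cb2D(4)[OF f_Cb2] hs]])
    have [measurable]: "Y (s n) \<in> borel_measurable M" "Y t \<in> borel_measurable M" using s r by auto
    have "(\<lambda>\<omega>. (\<lambda>p. hs_norm (\<lambda>h. hess f (fst p) h - hess f (snd p) h)) (T (s n) (xs n) + Y (s n) \<omega>, T t x + Y t \<omega>)) \<in> borel_measurable M"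
      by measurable
    then show ?thesis by (simp add: N_def[abs_def])
  qed
  have "(\<lambda>n. \<integral>\<omega>. (N n \<omega>)\<^sup>2 \<partial>M) \<longlonglongrightarrow> (\<integral>\<omega>. 0 \<partial>M)"
  proof (rule expectation_tendsto[OF s, where C = "(2 * C)\<^sup>2"])
    show "norm ((N n \<omega>)\<^sup>2) \<le> (2 * C)\<^sup>2" for n \<omega> using power_mono[OF Nc N0, of n \<omega> 2] by simp
    fix \<omega> and r :: "nat \<Rightarrow> nat" assume r: "strict_mono r" and Y: "(\<lambda>n. Y (s (r n)) \<omega>) \<longlonglongrightarrow> Y t \<omega>"
    have "(\<lambda>n. T (s n) (xs n)) \<longlonglongrightarrow> T t x" by (rule T.T_tendsto[OF s x])
    from LIMSEQ_subseq_LIMSEQ[OF this r] have "(\<lambda>n. T (s (r n)) (xs (r n))) \<longlonglongrightarrow> T t x" by (simp add: o_def)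
    from hs_continuous_tendsto[OF Cb2D(4)[OF f_Cb2] UNIV_I UNIV_I tendsto_add[OF this Y]]
    have "(\<lambda>n. N (r n) \<omega>) \<longlonglongrightarrow> 0" by (simp add: N_def)
    from tendsto_power[OF this, of 2] show "(\<lambda>n. (N (r n) \<omega>)\<^sup>2) \<longlonglongrightarrow> 0" by simp
  qed measurable
  then have "(\<lambda>n. sqrt (\<integral>\<omega>. (N n \<omega>)\<^sup>2 \<partial>M)) \<longlonglongrightarrow> sqrt 0" by (intro tendsto_real_sqrt) simp
  then have sq: "(\<lambda>n. sqrt (\<integral>\<omega>. (N n \<omega>)\<^sup>2 \<partial>M)) \<longlonglongrightarrow> 0" by simp
  have Kl: "(\<lambda>n. hs_norm (\<lambda>h. Kf (s n) (xs n) h - Kf t x h)) \<longlonglongrightarrow> 0"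
  proof (rule tendsto_sandwich[OF _ _ tendsto_const sq])
    have "hs_norm (\<lambda>h. Kf (s n) (xs n) h - Kf t x h) \<le> sqrt (\<integral>\<omega>. (N n \<omega>)\<^sup>2 \<partial>M)" for n
    proof -
      have eq: "Kf (s n) (xs n) h - Kf t x h = (\<integral>\<omega>. hess f (T (s n) (xs n) + Y (s n) \<omega>) h - hess f (T t x + Y t \<omega>) h \<partial>M)" for h
        unfolding Kf_def
        by (rule Bochner_Integration.integral_diff[symmetric]; rule expectation_integrable[OF _ C2bD(7,3)[OF f_C2b]]; use s r in simp)
      have bl: "bounded_linear (\<lambda>h. Kf (s n) (xs n) h - Kf t x h)"
        by (intro bounded_linear_sub Kf_linear s r)
      show ?thesis
        using hs_norm_expectation(2)[of "\<lambda>\<omega> h. hess f (T (s n) (xs n) + Y (s n) \<omega>) h - hess f (T t x + Y t \<omega>) h" "N n" "2 * C"]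
          hs_norm_diff(1)[OF hs hs] borel_measurable_diff[OF hess_measurable[OF s(1)] hess_measurable[OF r(3)]] Nc Nm bl
        unfolding eq N_def by auto
    qed
    then show "\<forall>\<^sub>F n in sequentially. hs_norm (\<lambda>h. Kf (s n) (xs n) h - Kf t x h) \<le> sqrt (\<integral>\<omega>. (N n \<omega>)\<^sup>2 \<partial>M)"
      by (intro always_eventually allI)
  qed (intro always_eventually allI hs_norm_nonneg)
  show "(\<lambda>n. hs_norm (\<lambda>h. hu (s n) (xs n) h - hu t x h)) \<longlonglongrightarrow> 0"
    unfolding hu_def
    by (rule hs_tendsto_sandwich[where c = \<kappa>, OF T.T_linear[OF s(1)] T.T_linear[OF r(3)] T'.T_linear[OF s(1)] T'.T_linear[OF r(3)]
          T_adjoint[OF s(1)] T_adjoint[OF r(3)] \<kappa>(2)[OF s(1) r(1)] \<kappa>(2)[OF r(3,2)] \<kappa>(3)[OF s(1) r(1)] \<kappa>(3)[OF r(3,2)] _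
          T'.T_tendsto[OF s tendsto_const] Kf_hs(1)[OF s(1)] Kf_hs(1)[OF r(3)] Kf_symmetric[OF s(1)] Kf_symmetric[OF r(3)] Kl])
      (use \<kappa>(1) in simp)
qed

lemma hu_hs:
  assumes t: "t \<ge> 0" and K: "K \<ge> 1" "\<And>x. norm (T t x) \<le> K * norm x"
  shows "hilbert_schmidt (hu t x)" "hs_norm (hu t x) \<le> K\<^sup>2 * C"
proof -
  have K0: "0 \<le> K" using K by simp
  have bl: "bounded_linear (Kf t x)" using Kf_linear[OF t] .
  note R = hs_compose_right[OF Kf_hs(1)[OF t] bl Kf_symmetric[OF t] T.T_linear[OF t] T'.T_linear[OF t] T_adjoint[OF t] T'_bound[OF t K(2)] K0]
  note L = hs_norm_compose_left[OF R(1) T'.T_linear[OF t] T'_bound[OF t K(2)] K0]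
  show "hilbert_schmidt (hu t x)" using L(1) by (simp add: hu_def[abs_def])
  have "hs_norm (hu t x) \<le> K * (K * C)"
    unfolding hu_def[abs_def]
    by (intro order_trans[OF L(2)] mult_left_mono order_trans[OF R(2)] Kf_hs(2)[OF t] K0)
  then show "hs_norm (hu t x) \<le> K\<^sup>2 * C" by (simp add: power2_eq_square mult.assoc)
qed

lemma u_bounds:
  assumes t: "t \<ge> 0" and K: "K \<ge> 1" "\<And>x. norm (T t x) \<le> K * norm x"
  shows "\<bar>u t x\<bar> \<le> C" "norm (du t x) \<le> K * C" "norm (Au t x) \<le> K * C"
proof -
  have K0: "0 \<le> K" using K by simp
  have "norm (u t x) \<le> C" unfolding u_eq
    by (rule expectation_norm_le[OF borel_measurable_integrable[OF expectation_integrable[OF t Cb2D(6)[OF f_Cb2]]]])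
      (use C in auto)
  then show "\<bar>u t x\<bar> \<le> C" by simp
  show "norm (du t x) \<le> K * C" unfolding du_def
    by (intro order_trans[OF T'_bound[OF t K(2)]] mult_left_mono K0
        expectation_norm_le[OF borel_measurable_integrable[OF expectation_integrable[OF t Cb2D(7)[OF f_Cb2] C(2)]] C(2)])
  show "norm (Au t x) \<le> K * C" unfolding Au_def
    by (intro order_trans[OF T'_bound[OF t K(2)]] mult_left_mono K0
        expectation_norm_le[OF borel_measurable_integrable[OF expectation_integrable[OF t Af_continuous C(4)]] C(4)])
qed

lemma u_in_CA2:
  assumes t: "t \<ge> 0"
  shows "u t \<in> CA2 D A"
proof -
  obtain K where K: "K \<ge> 1" "\<And>s x. 0 \<le> s \<Longrightarrow> s \<le> t \<Longrightarrow> norm (T s x) \<le> K * norm x"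
    using T.T_bounded[of t] by metis
  note Kt = K(2)[OF t order_refl]
  note c = u_C2b[OF t K(1) Kt]
  note D = C2bD[OF c]
  have seq: "continuous_on UNIV (Au t)" "hs_continuous_on UNIV (hu t)"
  proof -
    show "continuous_on UNIV (Au t)"
      unfolding continuous_on_sequentially o_def using t by (auto intro!: u_tendsto(3))
    show "hs_continuous_on UNIV (hu t)"
      by (rule hs_continuousI) (rule u_tendsto(4)[OF t tendsto_const])
  qed
  note b = u_bounds[OF t K(1) Kt]
  have b4: "norm (hs_norm (hu t x)) \<le> K\<^sup>2 * C" for x
    using hu_hs(2)[OF t K(1) Kt, of x] hs_norm_nonneg[of "hu t x"] by simp
  have "bounded (range (u t))" unfolding bounded_iff by (rule exI[of _ C]) (use b(1) in auto)
  moreover have "bounded (range (du t))" unfolding bounded_iff by (rule exI[of _ "K * C"]) (use b(2) in auto)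
  moreover have "bounded (range (Au t))" unfolding bounded_iff by (rule exI[of _ "K * C"]) (use b(3) in auto)
  moreover have "bounded (range (\<lambda>x. hs_norm (hu t x)))" unfolding bounded_iff by (rule exI[of _ "K\<^sup>2 * C"]) (use b4 in auto)
  moreover have "\<exists>g. GDERIV (u t) x :> g" for x
    using D(4)[of x] by (auto simp: gderiv_def inner_commute)
  moreover have "du t differentiable (at x)" for x using D(5)[of x] by (auto simp: differentiable_def)
  ultimately show ?thesis
    unfolding CA2_def Cb2_def
    using adj_u[OF t] D(10,11) seq hu_hs(1)[OF t K(1) Kt] by (simp add: grad_u[OF t] hess_u[OF t])
qed

end

section \<open>Measurable averages and one-sided derivatives on the line\<close>

lemma average_attained:
  fixes f :: "real \<Rightarrow> real"
  assumes h: "h > 0" and m: "(\<lambda>s. indicator {0..h} s * f s) \<in> borel_measurable borel"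
  shows "\<exists>s\<in>{0..h}. \<bar>(\<integral>s. indicator {0..h} s * f s \<partial>lborel) / h - l\<bar> \<le> 2 * \<bar>f s - l\<bar>"
proof (rule ccontr)
  \<comment> \<open>If the deviation of \<open>f\<close> were below e/2 on the whole interval, that
    of its average would be at most e/2, while it equals \<open>e\<close>. The factor 2 gives room
    to argue this way for an \<open>f\<close> that is merely measurable.\<close>
  define e where "e = \<bar>(\<integral>s. indicator {0..h} s * f s \<partial>lborel) / h - l\<bar>"
  assume "\<not> ?thesis"
  then have neg: "2 * \<bar>f s - l\<bar> < e" if "0 \<le> s" "s \<le> h" for s
    using that by (auto simp: e_def not_le)
  have i0: "integrable lborel (\<lambda>s. c * indicator {0..h} s)" for c :: real
    by (intro integrable_mult_right integrable_real_indicator) (use h in auto)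
  have i: "integrable lborel (\<lambda>s. indicator {0..h} s * f s)"
  proof (rule Bochner_Integration.integrable_bound[OF i0[of "\<bar>l\<bar> + e"]])
    have "\<bar>f s\<bar> \<le> \<bar>l\<bar> + e" if "0 \<le> s" "s \<le> h" for s 
    proof -
      have "x \<le> y + e" if "2 * d < e" "0 \<le> d" "x - y \<le> d" for x y d :: real using that by linarith
      from this[OF neg[OF that] abs_ge_zero abs_triangle_ineq2] show ?thesis .
    qed
    then show "AE s in lborel. norm (indicator {0..h} s * f s) \<le> norm ((\<bar>l\<bar> + e) * indicator {0..h} s)"
      by (auto simp: indicator_def intro: order_trans[OF _ abs_ge_self])
  qed (use m in simp)
  have "(\<integral>s. indicator {0..h} s * f s \<partial>lborel) - l * h = (\<integral>s. indicator {0..h} s * f s - l * indicator {0..h} s \<partial>lborel)"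
    using i i0[of l] h by simp
  also have "\<bar>\<dots>\<bar> \<le> (\<integral>s. \<bar>indicator {0..h} s * f s - l * indicator {0..h} s\<bar> \<partial>lborel)"
    by (rule integral_abs_bound)
  also have "\<dots> \<le> (\<integral>s. e / 2 * indicator {0..h} s \<partial>lborel)"
  proof (rule integral_mono)
    fix s
    show "\<bar>indicator {0..h} s * f s - l * indicator {0..h} s\<bar> \<le> e / 2 * indicator {0..h} s"
      using neg[of s] by (cases "s \<in> {0..h}") auto
  qed (use i i0 in auto)
  also have "\<dots> = e / 2 * h" using h by simp
  finally have "\<bar>(\<integral>s. indicator {0..h} s * f s \<partial>lborel) - l * h\<bar> / h \<le> e / 2"
    using h by (simp add: divide_le_eq)
  moreover have "\<bar>(\<integral>s. indicator {0..h} s * f s \<partial>lborel) - l * h\<bar> / h = e"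
    using h by (simp add: e_def diff_divide_distrib[symmetric] abs_divide[symmetric] field_simps)
  moreover have "0 \<le> 2 * \<bar>f 0 - l\<bar>" by simp
  then have "0 < e" using neg[of 0] h by (meson le_less_trans less_imp_le order_refl)
  ultimately show False by simp
qed

text \<open>For each slope eps > 0 the deviation from the value at \<open>a\<close> stays below the
  line of that slope: at the last time up to which this holds, a small right quotient would continue
  it. Quotients are taken along sequences, the form in which the small-time limits arrive.\<close>

lemma zero_right_derivative_constant:
  fixes \<phi> :: "real \<Rightarrow> real"
  assumes ab: "a \<le> b" and c: "continuous_on {a..b} \<phi>"
    and d: "\<And>s h. a \<le> s \<Longrightarrow> s < b \<Longrightarrow> (\<And>n. 0 < h n) \<Longrightarrow> (\<And>n. s + h n \<le> b) \<Longrightarrow> h \<longlonglongrightarrow> 0 \<Longrightarrow>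
      (\<lambda>n. (\<phi> (s + h n) - \<phi> s) / h n) \<longlonglongrightarrow> 0"
  shows "\<phi> b = \<phi> a"
proof -
  have "\<bar>\<phi> b - \<phi> a\<bar> \<le> \<epsilon> * (b - a)" if \<epsilon>: "\<epsilon> > 0" for \<epsilon>
  proof -
    define P where "P t \<longleftrightarrow> \<bar>\<phi> t - \<phi> a\<bar> \<le> \<epsilon> * (t - a)" for t
    define S where "S = {t \<in> {a..b}. \<forall>s\<in>{a..t}. P s}"
    define t where "t = Sup S"
    have S: "a \<in> S" "bdd_above S" "S \<noteq> {}"
      using ab by (auto simp: S_def P_def intro!: bdd_aboveI[of _ b])
    have t: "a \<le> t" "t \<le> b"
      using cSup_upper[OF S(1,2)] cSup_least[OF S(3), of b] by (auto simp: t_def S_def)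
    have below: "P s" if sat: "a \<le> s" "s < t" for s
    proof -
      obtain t' where "t' \<in> S" "s < t'" using less_cSupD[OF S(3)] sat(2) by (auto simp: t_def)
      then show ?thesis using sat by (auto simp: S_def)
    qed
    have Pt: "P t"
    proof (cases "t = a")
      case False
      define s where "s n = t - (t - a) / real (Suc n)" for n
      have pos: "0 < t - a" using False t by simp
      have "(\<lambda>n. t - (t - a) / real (Suc n)) \<longlonglongrightarrow> t" by real_asymp
      then have s: "s \<longlonglongrightarrow> t" by (simp add: s_def[abs_def])
      have sr: "a \<le> s n" "s n < t" for n
      proof -
        have "(t - a) / real (Suc n) \<le> t - a" "0 < (t - a) / real (Suc n)"
          using pos by (auto simp: divide_le_eq mult_left_mono[of 1 "real (Suc n)" "t - a", simplified])
        then show "a \<le> s n" "s n < t" by (auto simp: s_def)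
      qed
      have "(\<lambda>n. \<phi> (s n)) \<longlonglongrightarrow> \<phi> t"
        by (rule continuous_on_tendsto_compose[OF c s]) (use t sr in \<open>auto intro!: always_eventually intro: less_imp_le order_trans[OF less_imp_le]\<close>)
      then have "(\<lambda>n. \<bar>\<phi> (s n) - \<phi> a\<bar>) \<longlonglongrightarrow> \<bar>\<phi> t - \<phi> a\<bar>" by (intro tendsto_intros)
      moreover have "(\<lambda>n. \<epsilon> * (s n - a)) \<longlonglongrightarrow> \<epsilon> * (t - a)" by (intro tendsto_intros s)
      ultimately show ?thesis
        unfolding P_def by (rule LIMSEQ_le) (use below[OF sr] in \<open>auto simp: P_def\<close>)
    qed (simp add: P_def)
    have "t = b"
    proof (rule ccontr)
      assume "t \<noteq> b"
      then have tb: "t < b" using t by simp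
      \<comment> \<open>Beyond the supremum \<open>t\<close> violations must occur at arbitrarily
        small steps; they contradict the vanishing right quotient.\<close>
      have "\<exists>h. 0 < h \<and> h \<le> (b - t) / real (Suc n) \<and> \<bar>\<phi> (t + h) - \<phi> t\<bar> > \<epsilon> * h" for n
      proof (rule ccontr)
        assume neg: "\<not> ?thesis"
        define \<delta> where "\<delta> = (b - t) / real (Suc n)"
        have \<delta>: "0 < \<delta>" "\<delta> \<le> b - t" using tb
          by (auto simp: \<delta>_def divide_le_eq mult_left_mono[of 1 "real (Suc n)" "b - t", simplified])
        have step: "P (t + h)" if "0 < h" "h \<le> \<delta>" for h
        proof -
          have "\<bar>\<phi> (t + h) - \<phi> t\<bar> \<le> \<epsilon> * h" using neg that by (auto simp: \<delta>_def not_less)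
          moreover have "\<epsilon> * (t + h - a) = \<epsilon> * (t - a) + \<epsilon> * h" by (simp add: algebra_simps)
          ultimately show ?thesis using Pt unfolding P_def by linarith
        qed
        have "P s" if s: "a \<le> s" "s \<le> t + \<delta>" for s
        proof (cases "s \<le> t")
          case True
          then show ?thesis using below[OF s(1)] Pt by (cases "s = t") auto
        next
          case False
          then show ?thesis using step[of "s - t"] s by simp
        qed
        then have "t + \<delta> \<in> S" using \<delta> t by (auto simp: S_def)
        from cSup_upper[OF this S(2)] show False using \<delta> by (simp add: t_def)
      qed
      then obtain h where h: "\<And>n. 0 < h n" "\<And>n. h n \<le> (b - t) / real (Suc n)" "\<And>n. \<bar>\<phi> (t + h n) - \<phi> t\<bar> > \<epsilon> * h n"
        by metis
      have "(\<lambda>n. (b - t) / real (Suc n)) \<longlonglongrightarrow> 0" by real_asymp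
      then have h0: "h \<longlonglongrightarrow> 0"
        by (rule tendsto_sandwich[OF _ _ tendsto_const, rotated 2]) (use h in \<open>auto intro!: always_eventually less_imp_le simp del: of_nat_Suc\<close>)
      have "t + h n \<le> b" for n
      proof -
        have "(b - t) / real (Suc n) \<le> b - t"
          using tb by (auto simp: divide_le_eq mult_left_mono[of 1 "real (Suc n)" "b - t", simplified])
        then show ?thesis using h(2)[of n] by linarith
      qed
      from d[OF t(1) tb h(1) this h0] have "(\<lambda>n. \<bar>(\<phi> (t + h n) - \<phi> t) / h n\<bar>) \<longlonglongrightarrow> \<bar>0\<bar>" by (rule tendsto_rabs)
      moreover have "\<epsilon> \<le> \<bar>(\<phi> (t + h n) - \<phi> t) / h n\<bar>" for n
        using h(1)[of n] h(3)[of n] by (simp add: le_divide_eq)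
      ultimately have "\<epsilon> \<le> \<bar>0\<bar>" by (intro LIMSEQ_le_const) auto
      then show False using \<epsilon> by simp
    qed
    then show ?thesis using Pt by (simp add: P_def)
  qed
  note le = this
  show ?thesis
  proof (rule ccontr)
    assume ne: "\<phi> b \<noteq> \<phi> a"
    then have "b - a > 0" using ab by (cases "a = b") auto
    moreover define e where "e = \<bar>\<phi> b - \<phi> a\<bar>"
    moreover define d where "d = b - a"
    ultimately have e: "e / (2 * (b - a)) * (b - a) = e / 2" "0 < e / (2 * (b - a))" "0 < e"
      using ne unfolding d_def[symmetric] by auto
    have "e \<le> e / 2" using le[OF e(2)] unfolding e(1) by (simp only: e_def)
    with e(3) show False by simp
  qed
qed

lemma continuous_on_pair_tendsto:
  assumes "continuous_on (S \<times> UNIV) (\<lambda>(t, x). F t x)" "\<And>n. s n \<in> S" "t \<in> S" "s \<longlonglongrightarrow> t" "xs \<longlonglongrightarrow> x"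
  shows "(\<lambda>n. F (s n) (xs n)) \<longlonglongrightarrow> F t x"
  using continuous_on_tendsto_compose[OF assms(1) tendsto_Pair[OF assms(4,5)]] assms(2,3) by simp

lemma continuous_on_pairI:
  fixes F :: "'a::metric_space \<Rightarrow> 'b::metric_space \<Rightarrow> 'c::topological_space"
  assumes "\<And>s t xs x. (\<And>n. s n \<in> S) \<Longrightarrow> t \<in> S \<Longrightarrow> s \<longlonglongrightarrow> t \<Longrightarrow> xs \<longlonglongrightarrow> x \<Longrightarrow> (\<lambda>n. F (s n) (xs n)) \<longlonglongrightarrow> F t x"
  shows "continuous_on (S \<times> UNIV) (\<lambda>(t, x). F t x)"
  unfolding continuous_on_sequentially o_def
proof (intro allI ballI impI)
  fix ps and p :: "'a \<times> 'b" assume p: "p \<in> S \<times> UNIV" "(\<forall>n. ps n \<in> S \<times> UNIV) \<and> ps \<longlonglongrightarrow> p"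
  have "fst (ps n) \<in> S" for n using p(2) by (metis mem_Times_iff)
  moreover have "(\<lambda>n. fst (ps n)) \<longlonglongrightarrow> fst p" "(\<lambda>n. snd (ps n)) \<longlonglongrightarrow> snd p"
    using p(2) by (auto intro: tendsto_fst tendsto_snd)
  ultimately have "(\<lambda>n. F (fst (ps n)) (snd (ps n))) \<longlonglongrightarrow> F (fst p) (snd p)"
    using p(1) by (intro assms) auto
  then show "(\<lambda>n. case ps n of (t, x) \<Rightarrow> F t x) \<longlonglongrightarrow> (case p of (t, x) \<Rightarrow> F t x)"
    by (simp add: case_prod_beta)
qed

context ou_setting
begin

subsection \<open>Small-time asymptotics\<close>

text \<open>The average of the Dynkin integrand over [0, h n] is compared with its value at a time
  \<open>s n\<close> of the interval; these times tend to 0 and \<open>G_tendsto\<close> applies.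
  The hypotheses \<open>lim\<close> allow subsequences, since \<open>Y\<close> converges pathwise
  only along such.\<close>

lemma generator_limit:
  fixes gs :: "nat \<Rightarrow> 'a \<Rightarrow> real"
  assumes h: "\<And>n. 0 < h n" "h \<longlonglongrightarrow> 0"
    and gs: "\<And>n. C2b C (gs n) (gs' n) (gs'' n)" and g: "C2b C g g' g''"
    and lim: "\<And>r xs x. strict_mono r \<Longrightarrow> xs \<longlonglongrightarrow> x \<Longrightarrow> (\<lambda>n. gs (r n) (xs n)) \<longlonglongrightarrow> g x"
      "\<And>r xs x. strict_mono r \<Longrightarrow> xs \<longlonglongrightarrow> x \<Longrightarrow> (\<lambda>n. gs' (r n) (xs n)) \<longlonglongrightarrow> g' x"
      "\<And>r xs x k. strict_mono r \<Longrightarrow> xs \<longlonglongrightarrow> x \<Longrightarrow> (\<lambda>n. gs'' (r n) (xs n) k) \<longlonglongrightarrow> g'' x k"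
    and z: "zs \<longlonglongrightarrow> z"
  shows "(\<lambda>n. ((\<integral>\<omega>. gs n (zs n + Y (h n) \<omega>) \<partial>M) - gs n (zs n)) / h n)
    \<longlonglongrightarrow> G 0 g (\<lambda>x h. g' x \<bullet> h) (\<lambda>x h. g'' x h \<bullet> h) z"
proof -
  define Gn where "Gn n s = G s (gs n) (\<lambda>x h. gs' n x \<bullet> h) (\<lambda>x h. gs'' n x h \<bullet> h)" for n s
  define G0 where "G0 = G 0 g (\<lambda>x h. g' x \<bullet> h) (\<lambda>x h. g'' x h \<bullet> h)"
  define \<Phi> where "\<Phi> n s = (\<integral>\<omega>. Gn n s (zs n + Y s \<omega>) \<partial>M)" for n s
  note l = C2b_imp_line_C2[OF gs] C2b_imp_line_C2[OF g]
  have av: "((\<integral>\<omega>. gs n (zs n + Y (h n) \<omega>) \<partial>M) - gs n (zs n)) / h n = (\<integral>s. indicator {0..h n} s * \<Phi> n s \<partial>lborel) / h n" for n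
    unfolding dynkin(2)[OF less_imp_le[OF h(1)] gs] \<Phi>_def Gn_def ..
  have "\<exists>s\<in>{0..h n}. \<bar>(\<integral>s. indicator {0..h n} s * \<Phi> n s \<partial>lborel) / h n - G0 z\<bar> \<le> 2 * \<bar>\<Phi> n s - G0 z\<bar>" for n
    by (rule average_attained[OF h(1)]) (use dynkin(1)[OF less_imp_le[OF h(1)] gs] in \<open>simp add: \<Phi>_def Gn_def\<close>)
  then obtain s where s: "\<And>n. s n \<in> {0..h n}"
    "\<And>n. \<bar>(\<integral>s. indicator {0..h n} s * \<Phi> n s \<partial>lborel) / h n - G0 z\<bar> \<le> 2 * \<bar>\<Phi> n (s n) - G0 z\<bar>"
    by metis
  have s0: "0 \<le> s n" for n using s(1)[of n] by simp
  have slim: "s \<longlonglongrightarrow> 0"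
    by (rule tendsto_sandwich[OF _ _ tendsto_const h(2)]) (use s(1) in \<open>auto intro!: always_eventually\<close>)
  have "bounded (range s)" using slim convergent_imp_bounded by blast
  then obtain r where r: "\<And>n. s n \<le> r" unfolding bounded_iff by (auto dest: abs_le_D1)
  have r0: "0 \<le> r" using s0[of 0] r[of 0] by linarith
  obtain L where L: "L \<ge> 0" "\<And>C g d q s x. line_C2 C g d q \<Longrightarrow> 0 \<le> s \<Longrightarrow> s \<le> r \<Longrightarrow> \<bar>G s g d q x\<bar> \<le> C * L"
    by (rule G_bound[OF r0]) (rule that)
  have "(\<lambda>n. \<integral>\<omega>. Gn n (s n) (zs n + Y (s n) \<omega>) \<partial>M) \<longlonglongrightarrow> (\<integral>\<omega>. G0 (z + Y 0 \<omega>) \<partial>M)"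
  proof (rule expectation_tendsto[OF s0 slim, where C = "2 * C * L"])
    show "(\<lambda>\<omega>. Gn n (s n) (zs n + Y (s n) \<omega>)) \<in> borel_measurable M" for n
    proof -
      have [measurable]: "Gn n (s n) \<in> borel_measurable borel" "Y (s n) \<in> borel_measurable M"
        unfolding Gn_def using borel_measurable_continuous_onI[OF G_continuous[OF l(1) s0]] s0 by auto
      show ?thesis by measurable
    qed
    have [measurable]: "G0 \<in> borel_measurable borel" "Y 0 \<in> borel_measurable M"
      unfolding G0_def using borel_measurable_continuous_onI[OF G_continuous[OF l(2) order_refl]] by auto
    show "(\<lambda>\<omega>. G0 (z + Y 0 \<omega>)) \<in> borel_measurable M" by measurable
    show "norm (Gn n (s n) (zs n + Y (s n) \<omega>)) \<le> 2 * C * L" for n \<omega>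
      unfolding Gn_def using L(2)[OF l(1) s0 r] by simp
    fix \<omega> and \<rho> :: "nat \<Rightarrow> nat" assume \<rho>: "strict_mono \<rho>" and Y: "(\<lambda>n. Y (s (\<rho> n)) \<omega>) \<longlonglongrightarrow> Y 0 \<omega>"
    have zr: "(\<lambda>n. zs (\<rho> n)) \<longlonglongrightarrow> z" using LIMSEQ_subseq_LIMSEQ[OF z \<rho>] by (simp add: o_def)
    have sr: "(\<lambda>n. s (\<rho> n)) \<longlonglongrightarrow> 0" using LIMSEQ_subseq_LIMSEQ[OF slim \<rho>] by (simp add: o_def)
    have x: "(\<lambda>n. zs (\<rho> n) + Y (s (\<rho> n)) \<omega>) \<longlonglongrightarrow> z + Y 0 \<omega>" by (rule tendsto_add[OF zr Y])
    have Tl: "(\<lambda>n. T (s (\<rho> n)) y) \<longlonglongrightarrow> T 0 y" for y by (rule T.T_tendsto[OF s0 sr tendsto_const])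
    show "(\<lambda>n. Gn (\<rho> n) (s (\<rho> n)) (zs (\<rho> n) + Y (s (\<rho> n)) \<omega>)) \<longlonglongrightarrow> G0 (z + Y 0 \<omega>)"
      unfolding Gn_def G0_def
    proof (rule G_tendsto[OF l s0 r order_refl])
      show "(\<lambda>n. gs (\<rho> n) (zs (\<rho> n) + Y (s (\<rho> n)) \<omega>)) \<longlonglongrightarrow> g (z + Y 0 \<omega>)" by (rule lim(1)[OF \<rho> x])
      fix y
      show "(\<lambda>n. gs (\<rho> n) (zs (\<rho> n) + Y (s (\<rho> n)) \<omega> + T (s (\<rho> n)) y)) \<longlonglongrightarrow> g (z + Y 0 \<omega> + T 0 y)"
        by (rule lim(1)[OF \<rho> tendsto_add[OF x Tl]])
      show "(\<lambda>n. gs' (\<rho> n) (zs (\<rho> n) + Y (s (\<rho> n)) \<omega>) \<bullet> T (s (\<rho> n)) y) \<longlonglongrightarrow> g' (z + Y 0 \<omega>) \<bullet> T 0 y"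
        by (intro tendsto_inner lim(2)[OF \<rho> x] Tl)
      let ?x = "\<lambda>n. zs (\<rho> n) + Y (s (\<rho> n)) \<omega>"
      have "(\<lambda>n. gs'' (\<rho> n) (?x n) (T (s (\<rho> n)) y - T 0 y)) \<longlonglongrightarrow> 0"
      proof (rule Lim_null_comparison)
        show "\<forall>\<^sub>F n in sequentially. norm (gs'' (\<rho> n) (?x n) (T (s (\<rho> n)) y - T 0 y)) \<le> C * norm (T (s (\<rho> n)) y - T 0 y)"
          by (intro always_eventually allI C2bD(3)[OF gs])
        show "(\<lambda>n. C * norm (T (s (\<rho> n)) y - T 0 y)) \<longlonglongrightarrow> 0"
          by (intro tendsto_mult_right_zero tendsto_norm_zero LIM_zero Tl)
      qed
      from tendsto_add[OF this lim(3)[OF \<rho> x, of "T 0 y"]]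
      have "(\<lambda>n. gs'' (\<rho> n) (?x n) (T (s (\<rho> n)) y)) \<longlonglongrightarrow> g'' (z + Y 0 \<omega>) (T 0 y)"
        using C2bD(9)[OF gs] by (simp add: bounded_linear.linear linear_diff)
      then show "(\<lambda>n. gs'' (\<rho> n) (?x n) (T (s (\<rho> n)) y) \<bullet> T (s (\<rho> n)) y) \<longlonglongrightarrow> g'' (z + Y 0 \<omega>) (T 0 y) \<bullet> T 0 y"
        by (rule tendsto_inner[OF _ Tl])
    qed
  qed
  moreover have "(\<integral>\<omega>. G0 (z + Y 0 \<omega>) \<partial>M) = (\<integral>\<omega>. G0 z \<partial>M)"
  proof (rule integral_cong_AE)
    have [measurable]: "G0 \<in> borel_measurable borel" "Y 0 \<in> borel_measurable M"
      unfolding G0_def using borel_measurable_continuous_onI[OF G_continuous[OF l(2) order_refl]] by auto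
    show "(\<lambda>\<omega>. G0 (z + Y 0 \<omega>)) \<in> borel_measurable M" by measurable
    show "AE \<omega> in M. G0 (z + Y 0 \<omega>) = G0 z" using Y_0 by eventually_elim simp
  qed simp
  ultimately have "(\<lambda>n. \<Phi> n (s n)) \<longlonglongrightarrow> G0 z" by (simp add: \<Phi>_def prob_space)
  then have lim0: "(\<lambda>n. 2 * \<bar>\<Phi> n (s n) - G0 z\<bar>) \<longlonglongrightarrow> 0"
    by (intro tendsto_mult_right_zero tendsto_rabs_zero LIM_zero)
  have "(\<lambda>n. (\<integral>s. indicator {0..h n} s * \<Phi> n s \<partial>lborel) / h n - G0 z) \<longlonglongrightarrow> 0"
    by (rule Lim_null_comparison[OF _ lim0]) (use s(2) in \<open>auto intro!: always_eventually\<close>)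
  then show ?thesis unfolding av G0_def[symmetric] by (rule LIM_zero_cancel)
qed

subsection \<open>The chain rule along the semigroup\<close>

text \<open>Along the curve from r to (\<open>\<tau> - r\<close>, \<open>T r z\<close>) the
  derivative of \<open>v\<close> is -w plus the pairing of \<open>dv\<close> with
  \<open>A (T r z)\<close>; the adjoint identity makes this -\<open>\<Gamma>\<close>. The orbit is
  differentiable for \<open>z\<close> in \<open>D\<close>, and the integrated formula extends to all
  \<open>z\<close> because both sides are continuous in it.\<close>

lemma flow_integral:
  assumes h: "0 \<le> h" "h \<le> \<tau>"
    and v: "\<And>t x. t \<in> {0..\<tau>} \<Longrightarrow> (v t has_derivative (\<lambda>k. dv t x \<bullet> k)) (at x)"
    and dom: "\<And>t x. t \<in> {0..\<tau>} \<Longrightarrow> dv t x \<in> adj_dom D A"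
    and dv: "continuous_on ({0..\<tau>} \<times> UNIV) (\<lambda>(t, x). dv t x)"
    and w: "\<And>t x. t \<in> {0..\<tau>} \<Longrightarrow> ((\<lambda>s. v s x) has_real_derivative w t x) (at t within {0..\<tau>})"
    and \<Gamma>: "\<And>t x. t \<in> {0..\<tau>} \<Longrightarrow> \<Gamma> t x = w t x - x \<bullet> adj_op D A (dv t x)"
    and \<Gamma>_cont: "continuous_on ({0..\<tau>} \<times> UNIV) (\<lambda>(t, x). \<Gamma> t x)"
    and \<Gamma>_bound: "\<And>t x. t \<in> {0..\<tau>} \<Longrightarrow> \<bar>\<Gamma> t x\<bar> \<le> c * (1 + norm x)" and c: "0 \<le> c"
  shows "((\<lambda>r. - \<Gamma> (\<tau> - r) (T r z)) has_integral v (\<tau> - h) (T h z) - v \<tau> z) {0..h}"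
proof -
  have core: "((\<lambda>r. - \<Gamma> (\<tau> - r) (T r z)) has_integral v (\<tau> - h) (T h z) - v \<tau> z) {0..h}" if z: "z \<in> D" for z
  proof -
    have "((\<lambda>r. - \<Gamma> (\<tau> - r) (T r z)) has_integral v (\<tau> - h) (T h z) - v (\<tau> - 0) (T 0 z)) {0..h}"
    proof (rule fundamental_theorem_of_calculus[OF h(1)])
      fix r assume r: "r \<in> {0..h}"
      have r0: "0 \<le> r" using r by simp
      have \<tau>r: "\<tau> - r \<in> {0..\<tau>}" using r h by simp
      \<comment> \<open>Joint differentiability follows from the time derivative and a jointly
        continuous spatial derivative; under the Riesz isomorphism the latter is the continuity of
        \<open>dv\<close>.\<close>
      have "((\<lambda>(t, y). v t y) has_derivative (\<lambda>(s, k). s * w (\<tau> - r) (T r z) + blinfun_inner_right (dv (\<tau> - r) (T r z)) k))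
          (at (\<tau> - r, T r z) within {0..\<tau>} \<times> UNIV)"
      proof (rule has_derivative_partialsI)
        show "((\<lambda>t. v t (T r z)) has_derivative (\<lambda>s. s * w (\<tau> - r) (T r z))) (at (\<tau> - r) within {0..\<tau>})"
          using w[OF \<tau>r, of "T r z"] by (simp add: has_field_derivative_def mult.commute[of _ "w _ _"])
        show "((\<lambda>y. v t y) has_derivative blinfun_apply (blinfun_inner_right (dv t y))) (at y within UNIV)"
          if "t \<in> {0..\<tau>}" for t y using v[OF that, of y] by simp
        have "continuous_on ({0..\<tau>} \<times> UNIV) (\<lambda>(t, x). blinfun_inner_right (dv t x))"
          using bounded_linear.continuous_on[OF bounded_linear_blinfun_inner_right dv] by (simp add: case_prod_beta')
        then show "continuous (at (\<tau> - r, T r z) within {0..\<tau>} \<times> UNIV) (\<lambda>(t, x). blinfun_inner_right (dv t x))"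
          unfolding continuous_on_eq_continuous_within by (rule bspec) (use \<tau>r in simp)
      qed auto
      then have dp: "((\<lambda>(t, y). v t y) has_derivative (\<lambda>(s, k). s * w (\<tau> - r) (T r z) + dv (\<tau> - r) (T r z) \<bullet> k))
          (at (\<tau> - r, T r z) within {0..\<tau>} \<times> UNIV)" by simp
      have c1: "((\<lambda>r. T r z) has_derivative (\<lambda>k. k *\<^sub>R T r (A z))) (at r within {0..h})"
        using has_vector_derivative_within_subset[OF T.T_derivative[OF z r0], of "{0..h}"]
        by (auto simp: has_vector_derivative_def)
      have c2: "((\<lambda>r. \<tau> - r) has_derivative (\<lambda>k. - k)) (at r within {0..h})"
        by (auto intro!: derivative_eq_intros)
      have sub: "(\<lambda>r. (\<tau> - r, T r z)) ` {0..h} \<subseteq> {0..\<tau>} \<times> UNIV" using h by auto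
      have "((\<lambda>r. (case (\<tau> - r, T r z) of (t, y) \<Rightarrow> v t y)) has_derivative
          (\<lambda>k. case (- k, k *\<^sub>R T r (A z)) of (s, k) \<Rightarrow> s * w (\<tau> - r) (T r z) + dv (\<tau> - r) (T r z) \<bullet> k)) (at r within {0..h})"
        by (rule has_derivative_in_compose[OF has_derivative_Pair[OF c2 c1] has_derivative_subset[OF dp sub]])
      moreover have "dv (\<tau> - r) (T r z) \<bullet> T r (A z) = T r z \<bullet> adj_op D A (dv (\<tau> - r) (T r z))"
        using adj_op_eq[OF dom[OF \<tau>r], of "T r z" "T r z"] T.T_commute[OF z r0] by (simp add: inner_commute)
      then have "(\<lambda>k. case (- k, k *\<^sub>R T r (A z)) of (s, k) \<Rightarrow> s * w (\<tau> - r) (T r z) + dv (\<tau> - r) (T r z) \<bullet> k)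
          = (\<lambda>k. k *\<^sub>R - \<Gamma> (\<tau> - r) (T r z))"
        by (auto simp: \<Gamma>[OF \<tau>r] algebra_simps)
      ultimately show "((\<lambda>r. v (\<tau> - r) (T r z)) has_vector_derivative - \<Gamma> (\<tau> - r) (T r z)) (at r within {0..h})"
        unfolding has_vector_derivative_def by simp
    qed
    then show ?thesis by (simp add: T.T_0)
  qed
  obtain zs where zs: "\<And>n. zs n \<in> D" "zs \<longlonglongrightarrow> z" by (rule T.D_dense[of z]) (rule that)
  have "bounded (range zs)" using zs(2) convergent_imp_bounded by blast
  then obtain b where b: "\<And>n. norm (zs n) \<le> b" by (auto simp: bounded_iff)
  obtain K where K: "K \<ge> 1" "\<And>t x. 0 \<le> t \<Longrightarrow> t \<le> h \<Longrightarrow> norm (T t x) \<le> K * norm x"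
    by (rule T.T_bounded[of h]) (rule that)
  have in\<tau>: "0 \<in> {0..\<tau>}" "\<tau> \<in> {0..\<tau>}" "\<tau> - h \<in> {0..\<tau>}" using h by auto
  have vc: "continuous_on UNIV (v t)" if "t \<in> {0..\<tau>}" for t
    by (auto intro!: continuous_at_imp_continuous_on has_derivative_continuous[OF v[OF that]])
  show ?thesis
  \<comment> \<open>Linear growth of \<open>\<Gamma>\<close> gives a constant bound, as the
    approximating points and their orbits stay in a bounded set.\<close>
  proof (rule has_integral_dominated_convergence[OF core[OF zs(1)], where h = "\<lambda>_. c * (1 + K * b)"])
    show "(\<lambda>_. c * (1 + K * b)) integrable_on {0..h}" by (rule integrable_const_ivl)
    show "\<forall>r\<in>{0..h}. norm (- \<Gamma> (\<tau> - r) (T r (zs n))) \<le> c * (1 + K * b)" for n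
    proof
      fix r assume r: "r \<in> {0..h}"
      have "norm (T r (zs n)) \<le> K * b"
        using K(2)[of r "zs n"] r mult_left_mono[OF b[of n], of K] K(1) by (auto intro: order_trans)
      then have "c * (1 + norm (T r (zs n))) \<le> c * (1 + K * b)" using c by (intro mult_left_mono) auto
      then show "norm (- \<Gamma> (\<tau> - r) (T r (zs n))) \<le> c * (1 + K * b)"
        using \<Gamma>_bound[of "\<tau> - r" "T r (zs n)"] r h by simp
    qed
    show "\<forall>r\<in>{0..h}. (\<lambda>n. - \<Gamma> (\<tau> - r) (T r (zs n))) \<longlonglongrightarrow> - \<Gamma> (\<tau> - r) (T r z)"
    proof
      fix r assume r: "r \<in> {0..h}"
      have "(\<lambda>n. \<Gamma> (\<tau> - r) (T r (zs n))) \<longlonglongrightarrow> \<Gamma> (\<tau> - r) (T r z)"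
        by (rule continuous_on_pair_tendsto[OF \<Gamma>_cont])
          (use r h in \<open>auto intro!: bounded_linear.tendsto[OF T.T_linear] zs\<close>)
      then show "(\<lambda>n. - \<Gamma> (\<tau> - r) (T r (zs n))) \<longlonglongrightarrow> - \<Gamma> (\<tau> - r) (T r z)" by (rule tendsto_minus)
    qed
    have "(\<lambda>n. T h (zs n)) \<longlonglongrightarrow> T h z" by (rule bounded_linear.tendsto[OF T.T_linear[OF h(1)] zs(2)])
    from continuous_on_tendsto_compose[OF vc[OF in\<tau>(3)] this] continuous_on_tendsto_compose[OF vc[OF in\<tau>(2)] zs(2)]
    show "(\<lambda>n. v (\<tau> - h) (T h (zs n)) - v \<tau> (zs n)) \<longlonglongrightarrow> v (\<tau> - h) (T h z) - v \<tau> z"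
      by (intro tendsto_diff) auto
  qed
qed

end

lemma integral_quotient:
  fixes k :: "real \<Rightarrow> real"
  assumes k: "continuous_on {0..\<tau>} k" and F: "\<And>h. 0 \<le> h \<Longrightarrow> h \<le> \<tau> \<Longrightarrow> (k has_integral F h) {0..h}"
    and h: "\<And>n. 0 < h n" "\<And>n. h n \<le> \<tau>" "h \<longlonglongrightarrow> 0"
  shows "(\<lambda>n. F (h n) / h n) \<longlonglongrightarrow> k 0"
proof -
  have "((\<lambda>u. integral {0..u} k) has_vector_derivative k 0) (at 0 within {0..\<tau>})"
    by (rule integral_has_vector_derivative[OF k]) (use less_imp_le[OF order.strict_trans2[OF h(1,2)]] in simp)
  then have q: "((\<lambda>y. (integral {0..y} k - integral {0..0} k) /\<^sub>R (y - 0)) \<longlongrightarrow> k 0) (at 0 within {0..\<tau>})"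
    by (rule has_vector_derivative_quotient)
  have "filterlim h (at 0 within {0..\<tau>}) sequentially"
    unfolding filterlim_at using h less_imp_le[OF h(1)] less_imp_neq[OF h(1), symmetric] by auto
  from filterlim_compose[OF q this] have "(\<lambda>n. integral {0..h n} k / h n) \<longlonglongrightarrow> k 0"
    by (simp add: divide_inverse mult.commute)
  moreover have "integral {0..h n} k = F (h n)" for n
    using F[OF less_imp_le[OF h(1)] h(2)] by (rule integral_unique)
  ultimately show ?thesis by simp
qed

text \<open>Subtract the primitive \<open>J\<close> of \<open>\<rho>\<close>: the difference has
  zero right derivative, hence is constant, and the derivative within the interval is inherited from
  \<open>J\<close>.\<close>

lemma continuous_right_derivative:
  fixes \<phi> \<rho> :: "real \<Rightarrow> real"
  assumes c: "continuous_on {0..b} \<phi>" "continuous_on {0..b} \<rho>"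
    and d: "\<And>s h. 0 \<le> s \<Longrightarrow> s < b \<Longrightarrow> (\<And>n. 0 < h n) \<Longrightarrow> (\<And>n. s + h n \<le> b) \<Longrightarrow> h \<longlonglongrightarrow> 0 \<Longrightarrow>
      (\<lambda>n. (\<phi> (s + h n) - \<phi> s) / h n) \<longlonglongrightarrow> \<rho> s"
    and t: "t \<in> {0..b}"
  shows "(\<phi> has_real_derivative \<rho> t) (at t within {0..b})"
proof -
  define J where "J t = integral {0..t} \<rho>" for t
  have J: "(J has_real_derivative \<rho> s) (at s within {0..b})" if "s \<in> {0..b}" for s
    unfolding J_def by (rule integral_has_real_derivative[OF c(2) that])
  have Jc: "continuous_on {0..b} J"
    by (rule DERIV_continuous_on) (rule J)
  have eq: "\<phi> r = \<phi> 0 + J r" if r: "r \<in> {0..b}" for r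
  proof -
    have "(\<lambda>s. \<phi> s - J s) r = (\<lambda>s. \<phi> s - J s) 0"
    proof (rule zero_right_derivative_constant[where \<phi> = "\<lambda>s. \<phi> s - J s"])
      show "0 \<le> r" using r by simp
      show "continuous_on {0..r} (\<lambda>s. \<phi> s - J s)"
        by (rule continuous_on_subset[of "{0..b}"]) (use r in \<open>auto intro!: continuous_intros c Jc\<close>)
      fix s and h :: "nat \<Rightarrow> real" assume s: "0 \<le> s" "s < r" and h: "\<And>n. 0 < h n" "\<And>n. s + h n \<le> r" "h \<longlonglongrightarrow> 0"
      have hb: "s < b" "\<And>n. s + h n \<le> b" using s(2) h(2) r order_trans by auto
      have "((\<lambda>y. (J y - J s) / (y - s)) \<longlongrightarrow> \<rho> s) (at s within {0..b})"
        using J[of s] s hb by (simp add: has_field_derivative_iff)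
      moreover have "filterlim (\<lambda>n. s + h n) (at s within {0..b}) sequentially"
      proof -
        have "(\<lambda>n. s + h n) \<longlonglongrightarrow> s + 0" by (intro tendsto_intros h)
        moreover have "0 \<le> s + h n" "h n \<noteq> 0" for n using s(1) h(1)[of n] by auto
        ultimately show ?thesis unfolding filterlim_at using hb by auto
      qed
      ultimately have "(\<lambda>n. (J (s + h n) - J s) / (s + h n - s)) \<longlonglongrightarrow> \<rho> s" by (rule filterlim_compose)
      from tendsto_diff[OF d[OF s(1) hb(1) h(1) hb(2) h(3)] this]
      show "(\<lambda>n. (\<phi> (s + h n) - J (s + h n) - (\<phi> s - J s)) / h n) \<longlonglongrightarrow> 0"
        by (simp add: diff_divide_distrib add_divide_distrib algebra_simps)
    qed
    then show ?thesis by (simp add: J_def)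
  qed
  have "((\<lambda>r. \<phi> 0 + J r) has_real_derivative \<rho> t) (at t within {0..b})"
    using DERIV_add[OF DERIV_const J[OF t], of "\<phi> 0"] by simp
  then show ?thesis
    unfolding has_field_derivative_def by (rule has_derivative_transform[OF t eq, rotated])
qed

section \<open>Space-time regular functions and difference quotients along the process\<close>

context ou_setting
begin

text \<open>What the flow and the small-time limits ask of a space-time function, with no equation
  imposed: \<open>u\<close>, a locally bounded solution and a time-independent function in
  \<open>CA2\<close> all qualify. Continuity of the Hessian is asked in each direction only.\<close>

definition regular :: "real \<Rightarrow> real \<Rightarrow> (real \<Rightarrow> 'a \<Rightarrow> real) \<Rightarrow> bool" where
  "regular \<tau> C v \<longleftrightarrow>
     (\<forall>t\<in>{0..\<tau>}. C2b C (v t) (grad (v t)) (hess (v t)) \<and>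
        (\<forall>x. grad (v t) x \<in> adj_dom D A \<and> norm (adj_op D A (grad (v t) x)) \<le> C)) \<and>
     continuous_on ({0..\<tau>} \<times> UNIV) (\<lambda>(t, x). v t x) \<and>
     continuous_on ({0..\<tau>} \<times> UNIV) (\<lambda>(t, x). grad (v t) x) \<and>
     continuous_on ({0..\<tau>} \<times> UNIV) (\<lambda>(t, x). adj_op D A (grad (v t) x)) \<and>
     (\<forall>k. continuous_on ({0..\<tau>} \<times> UNIV) (\<lambda>(t, x). hess (v t) x k))"

lemma regularD:
  assumes "regular \<tau> C v"
  shows "t \<in> {0..\<tau>} \<Longrightarrow> C2b C (v t) (grad (v t)) (hess (v t))"
    "t \<in> {0..\<tau>} \<Longrightarrow> grad (v t) x \<in> adj_dom D A" "t \<in> {0..\<tau>} \<Longrightarrow> norm (adj_op D A (grad (v t) x)) \<le> C"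
    "continuous_on ({0..\<tau>} \<times> UNIV) (\<lambda>(t, x). v t x)"
    "continuous_on ({0..\<tau>} \<times> UNIV) (\<lambda>(t, x). grad (v t) x)"
    "continuous_on ({0..\<tau>} \<times> UNIV) (\<lambda>(t, x). adj_op D A (grad (v t) x))"
    "continuous_on ({0..\<tau>} \<times> UNIV) (\<lambda>(t, x). hess (v t) x k)"
  using assms by (auto simp: regular_def)

lemma regular_mono:
  assumes r: "regular \<tau> C v" and le: "\<sigma> \<le> \<tau>"
  shows "regular \<sigma> C v"
proof -
  have sub: "{0..\<sigma>} \<times> UNIV \<subseteq> {0..\<tau>} \<times> (UNIV :: 'a set)" using le by auto
  have "\<forall>t\<in>{0..\<sigma>}. C2b C (v t) (grad (v t)) (hess (v t)) \<and>
        (\<forall>x. grad (v t) x \<in> adj_dom D A \<and> norm (adj_op D A (grad (v t) x)) \<le> C)"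
    using regularD(1-3)[OF r] le by simp
  then show ?thesis
    unfolding regular_def using regularD(4-7)[OF r] by (auto intro!: continuous_on_subset[OF _ sub])
qed

lemma regularI:
  assumes bounded: "bounded ((\<lambda>(t, x). v t x) ` ({0..} \<times> UNIV))"
    and cont: "continuous_on ({0..} \<times> UNIV) (\<lambda>(t, x). v t x)"
      "continuous_on ({0..} \<times> UNIV) (\<lambda>(t, x). grad (v t) x)"
      "continuous_on ({0..} \<times> UNIV) (\<lambda>(t, x). adj_op D A (grad (v t) x))"
      "hs_continuous_on ({0..} \<times> UNIV) (\<lambda>(t, x). hess (v t) x)"
    and CA2: "\<And>t. t \<ge> 0 \<Longrightarrow> v t \<in> CA2 D A" and db: "derivs_bounded D A {0..\<tau>} v"
  obtains C where "regular \<tau> C v"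
proof -
  obtain c0 where c0: "\<And>t x. 0 \<le> t \<Longrightarrow> \<bar>v t x\<bar> \<le> c0"
    using bounded by (auto simp: bounded_iff)
  have "\<exists>c. \<forall>t\<in>{0..\<tau>}. \<forall>x. norm (grad (v t) x) \<le> c"
    using db by (auto simp: derivs_bounded_def bounded_iff)
  then obtain c1 where "\<forall>t\<in>{0..\<tau>}. \<forall>x. norm (grad (v t) x) \<le> c1" ..
  then have c1: "norm (grad (v t) x) \<le> c1" if "0 \<le> t" "t \<le> \<tau>" for t x using that by simp
  have "\<exists>c. \<forall>t\<in>{0..\<tau>}. \<forall>x. norm (adj_op D A (grad (v t) x)) \<le> c"
    using db by (auto simp: derivs_bounded_def bounded_iff)
  then obtain c2 where "\<forall>t\<in>{0..\<tau>}. \<forall>x. norm (adj_op D A (grad (v t) x)) \<le> c2" ..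
  then have c2: "norm (adj_op D A (grad (v t) x)) \<le> c2" if "0 \<le> t" "t \<le> \<tau>" for t x using that by simp
  have "\<exists>c. \<forall>t\<in>{0..\<tau>}. \<forall>x. \<bar>hs_norm (hess (v t) x)\<bar> \<le> c"
    using db by (auto simp: derivs_bounded_def bounded_iff)
  then obtain c3 where "\<forall>t\<in>{0..\<tau>}. \<forall>x. \<bar>hs_norm (hess (v t) x)\<bar> \<le> c3" ..
  then have c3': "\<bar>hs_norm (hess (v t) x)\<bar> \<le> c3" if "0 \<le> t" "t \<le> \<tau>" for t x using that by simp
  have c3: "hs_norm (hess (v t) x) \<le> c3" if "0 \<le> t" "t \<le> \<tau>" for t x
    by (rule abs_le_D1[OF c3'[OF that]])
  define C where "C = max (max c0 c1) (max c2 c3)"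
  have C: "c0 \<le> C" "c1 \<le> C" "c2 \<le> C" "c3 \<le> C" by (auto simp: C_def)
  have Cb2: "v t \<in> Cb2" and dom: "grad (v t) x \<in> adj_dom D A" if "t \<ge> 0" for t x
    using CA2[OF that] by (auto simp: CA2_def)
  have sub: "{0..\<tau>} \<times> UNIV \<subseteq> {0..} \<times> (UNIV :: 'a set)" by auto
  have hs: "continuous_on ({0..} \<times> UNIV) (\<lambda>p. (case p of (t, x) \<Rightarrow> hess (v t) x) k)" for k
    by (rule hs_continuous_strong[OF cont(4)]) (use Cb2D(3)[OF Cb2] in auto)
  show thesis
  proof (rule that[of C])
    show "regular \<tau> C v"
      unfolding regular_def
    proof (intro conjI ballI allI)
      fix t x assume t: "t \<in> {0..\<tau>}"
      then have t0: "0 \<le> t" "t \<le> \<tau>" by auto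
      show "C2b C (v t) (grad (v t)) (hess (v t))"
        by (rule Cb2_imp_C2b[OF Cb2[OF t0(1)]])
          (rule order_trans[OF c0[OF t0(1)] C(1)] order_trans[OF c1[OF t0] C(2)] order_trans[OF c3[OF t0] C(4)])+
      show "grad (v t) x \<in> adj_dom D A" by (rule dom[OF t0(1)])
      show "norm (adj_op D A (grad (v t) x)) \<le> C" by (rule order_trans[OF c2[OF t0] C(3)])
    next
      fix k
      show "continuous_on ({0..\<tau>} \<times> UNIV) (\<lambda>(t, x). hess (v t) x k)"
        using continuous_on_subset[OF hs[of k] sub] by (simp add: case_prod_beta')
    qed (rule continuous_on_subset[OF cont(1) sub] continuous_on_subset[OF cont(2) sub] continuous_on_subset[OF cont(3) sub])+
  qed
qed

text \<open>A fixed \<open>g\<close> viewed as constant in time, so that the flow formula yields the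
  drift term in the derivative of the semigroup at 0.\<close>

lemma regular_const:
  assumes g: "g \<in> CA2 D A"
  obtains C where "regular \<tau> C (\<lambda>_. g)"
proof -
  have fst: "continuous_on ({0..} \<times> UNIV) (\<lambda>(t :: real, x :: 'a). F x)" if "continuous_on UNIV F" for F :: "'a \<Rightarrow> 'c::topological_space"
    using continuous_on_compose2[OF that continuous_on_snd[OF continuous_on_id], of "{0..} \<times> UNIV"] by (simp add: case_prod_beta')
  have Cb2: "g \<in> Cb2" using g by (simp add: CA2_def)
  have b: "bounded (range g)" "bounded (range (grad g))" "bounded (range (\<lambda>x. adj_op D A (grad g x)))"
     "bounded (range (\<lambda>x. hs_norm (hess g x)))" and c: "continuous_on UNIV (\<lambda>x. adj_op D A (grad g x))"
    using g by (auto simp: CA2_def Cb2_def)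
  show thesis
  proof (rule regularI[of "\<lambda>_. g"])
    show "bounded ((\<lambda>(t, x). g x) ` ({0..} \<times> UNIV))" by (rule bounded_subset[OF b(1)]) auto
    show "continuous_on ({0..} \<times> UNIV) (\<lambda>(t :: real, x). g x)" "continuous_on ({0..} \<times> UNIV) (\<lambda>(t :: real, x). grad g x)"
      "continuous_on ({0..} \<times> UNIV) (\<lambda>(t :: real, x). adj_op D A (grad g x))"
      by (rule fst Cb2D(6)[OF Cb2] Cb2D(7)[OF Cb2] c)+
    show "hs_continuous_on ({0..} \<times> UNIV) (\<lambda>(t :: real, x). hess g x)"
    proof (rule hs_continuousI)
      fix p and ps :: "nat \<Rightarrow> real \<times> 'a" assume "ps \<longlonglongrightarrow> p"
      from hs_continuous_tendsto[OF Cb2D(4)[OF Cb2] UNIV_I UNIV_I tendsto_snd[OF this]]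
      show "(\<lambda>n. hs_norm (\<lambda>h. (case ps n of (t, x) \<Rightarrow> hess g x) h - (case p of (t, x) \<Rightarrow> hess g x) h)) \<longlonglongrightarrow> 0"
        by (simp add: case_prod_beta)
    qed
    show "derivs_bounded D A {0..\<tau>} (\<lambda>_. g)"
      unfolding derivs_bounded_def
      by (intro conjI; rule bounded_subset[OF b(2)] bounded_subset[OF b(3)] bounded_subset[OF b(4)]; force)
  qed (use g that in auto)
qed

text \<open>\<open>L0\<close> without the pairing of \<open>x\<close> with the adjoint of
  \<open>A\<close> on the gradient, see \<open>L0_eq\<close>. This part is bounded when the
  derivatives are; the flow accounts for the other.\<close>

definition gen :: "('a \<Rightarrow> real) \<Rightarrow> 'a \<Rightarrow> real" where
  "gen g x = G 0 g (\<lambda>x h. grad g x \<bullet> h) (\<lambda>x h. hess g x h \<bullet> h) x"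

lemma L0_eq:
  assumes g: "C2b C g (grad g) (hess g)"
  shows "L0 D A Q a \<nu> g x = x \<bullet> adj_op D A (grad g x) + gen g x"
proof -
  note D = C2bD[OF g]
  have s: "hess g x y \<bullet> k = y \<bullet> hess g x k" for y k using D(6)[of x y k] by (simp add: inner_commute)
  have "op_trace (\<lambda>h. Q (hess g x h)) = (\<Sum>k. hess g x (qp k) \<bullet> qp k - hess g x (qm k) \<bullet> qm k)"
    by (rule op_trace_Q[OF s bounded_linear.linear[OF D(9)] D(3)])
  then show ?thesis
    by (simp add: L0_def gen_def G_def Gint_def Gtr_def T.T_0 inner_commute)
qed

lemma gen_bound:
  obtains L where "L \<ge> 0" "\<And>C g x. C2b C g (grad g) (hess g) \<Longrightarrow> \<bar>gen g x\<bar> \<le> C * L"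
proof -
  obtain L where L: "L \<ge> 0" "\<And>C g d q s x. line_C2 C g d q \<Longrightarrow> 0 \<le> s \<Longrightarrow> s \<le> 0 \<Longrightarrow> \<bar>G s g d q x\<bar> \<le> C * L"
    by (rule G_bound[OF order_refl]) (rule that)
  have "\<bar>gen g x\<bar> \<le> C * (2 * L)" if "C2b C g (grad g) (hess g)" for C g x
    using L(2)[OF C2b_imp_line_C2[OF that] order_refl order_refl, of x] by (simp add: gen_def mult.assoc mult.left_commute)
  with L(1) show thesis by (intro that[of "2 * L"]) auto
qed

lemma regular_gen_continuous:
  assumes r: "regular \<tau> C v"
  shows "continuous_on ({0..\<tau>} \<times> UNIV) (\<lambda>(t, x). gen (v t) x)"
proof (rule continuous_on_pairI)
  note R = regularD[OF r]
  fix s t and xs :: "nat \<Rightarrow> 'a" and x assume s: "\<And>n. s n \<in> {0..\<tau>}" "t \<in> {0..\<tau>}" "s \<longlonglongrightarrow> t" and x: "xs \<longlonglongrightarrow> x"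
  show "(\<lambda>n. gen (v (s n)) (xs n)) \<longlonglongrightarrow> gen (v t) x"
    unfolding gen_def
  proof (rule G_tendsto[OF C2b_imp_line_C2[OF R(1)[OF s(1)]] C2b_imp_line_C2[OF R(1)[OF s(2)]]])
    show "(\<lambda>n. v (s n) (xs n)) \<longlonglongrightarrow> v t x" by (rule continuous_on_pair_tendsto[OF R(4) s x])
    fix y
    show "(\<lambda>n. v (s n) (xs n + T 0 y)) \<longlonglongrightarrow> v t (x + T 0 y)"
      by (rule continuous_on_pair_tendsto[OF R(4) s tendsto_add[OF x tendsto_const]])
    show "(\<lambda>n. grad (v (s n)) (xs n) \<bullet> T 0 y) \<longlonglongrightarrow> grad (v t) x \<bullet> T 0 y"
      by (intro tendsto_inner tendsto_const continuous_on_pair_tendsto[OF R(5) s x])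
    show "(\<lambda>n. hess (v (s n)) (xs n) (T 0 y) \<bullet> T 0 y) \<longlonglongrightarrow> hess (v t) x (T 0 y) \<bullet> T 0 y"
      by (intro tendsto_inner tendsto_const continuous_on_pair_tendsto[OF R(7) s x])
  qed auto
qed

lemma regular_small_time:
  assumes r: "regular \<tau> C v" and h: "\<And>n. 0 < h n" "\<And>n. h n \<le> \<tau>" "h \<longlonglongrightarrow> 0"
  shows "(\<lambda>n. ((\<integral>\<omega>. v (\<tau> - h n) (T (h n) z + Y (h n) \<omega>) \<partial>M) - v (\<tau> - h n) (T (h n) z)) / h n) \<longlonglongrightarrow> gen (v \<tau>) z"
proof -
  note R = regularD[OF r]
  have \<tau>: "\<tau> \<in> {0..\<tau>}" using less_imp_le[OF order.strict_trans2[OF h(1,2)]] by simp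
  have \<tau>h: "\<tau> - h n \<in> {0..\<tau>}" for n using h(1,2)[of n] by simp
  have lim: "(\<lambda>n. \<tau> - h (r n)) \<longlonglongrightarrow> \<tau>" if "strict_mono r" for r
    using tendsto_diff[OF tendsto_const LIMSEQ_subseq_LIMSEQ[OF h(3) that], of \<tau>] by (simp add: o_def)
  have z: "(\<lambda>n. T (h n) z) \<longlonglongrightarrow> T 0 z" by (rule T.T_tendsto[OF less_imp_le[OF h(1)] h(3) tendsto_const])
  show ?thesis
    unfolding gen_def
  proof (rule generator_limit[OF h(1,3) R(1)[OF \<tau>h] R(1)[OF \<tau>]])
    fix r and xs :: "nat \<Rightarrow> 'a" and x k assume r: "strict_mono (r :: nat \<Rightarrow> nat)" and x: "xs \<longlonglongrightarrow> x"
    show "(\<lambda>n. v (\<tau> - h (r n)) (xs n)) \<longlonglongrightarrow> v \<tau> x" by (rule continuous_on_pair_tendsto[OF R(4) \<tau>h \<tau> lim[OF r] x])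
    show "(\<lambda>n. grad (v (\<tau> - h (r n))) (xs n)) \<longlonglongrightarrow> grad (v \<tau>) x" by (rule continuous_on_pair_tendsto[OF R(5) \<tau>h \<tau> lim[OF r] x])
    show "(\<lambda>n. hess (v (\<tau> - h (r n))) (xs n) k) \<longlonglongrightarrow> hess (v \<tau>) x k" by (rule continuous_on_pair_tendsto[OF R(7) \<tau>h \<tau> lim[OF r] x])
  qed (use z in \<open>simp add: T.T_0\<close>)
qed

lemma regular_flow:
  assumes r: "regular \<tau> C v"
    and w: "\<And>t x. t \<in> {0..\<tau>} \<Longrightarrow> ((\<lambda>s. v s x) has_real_derivative w t x) (at t within {0..\<tau>})"
    and \<Gamma>: "\<And>t x. t \<in> {0..\<tau>} \<Longrightarrow> \<Gamma> t x = w t x - x \<bullet> adj_op D A (grad (v t) x)"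
    and \<Gamma>_cont: "continuous_on ({0..\<tau>} \<times> UNIV) (\<lambda>(t, x). \<Gamma> t x)"
    and \<Gamma>_bound: "\<And>t x. t \<in> {0..\<tau>} \<Longrightarrow> \<bar>\<Gamma> t x\<bar> \<le> c * (1 + norm x)" and c: "0 \<le> c"
  shows "0 \<le> h \<Longrightarrow> h \<le> \<tau> \<Longrightarrow> ((\<lambda>r. - \<Gamma> (\<tau> - r) (T r z)) has_integral v (\<tau> - h) (T h z) - v \<tau> z) {0..h}"
    and "(\<And>n. 0 < hs n) \<Longrightarrow> (\<And>n. hs n \<le> \<tau>) \<Longrightarrow> hs \<longlonglongrightarrow> 0 \<Longrightarrow>
      (\<lambda>n. (v (\<tau> - hs n) (T (hs n) z) - v \<tau> z) / hs n) \<longlonglongrightarrow> - \<Gamma> \<tau> z"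
proof -
  note R = regularD[OF r]
  show i: "((\<lambda>r. - \<Gamma> (\<tau> - r) (T r z)) has_integral v (\<tau> - h) (T h z) - v \<tau> z) {0..h}" if "0 \<le> h" "h \<le> \<tau>" for h
    by (rule flow_integral[OF that C2bD(4)[OF R(1)] R(2,5) w \<Gamma> \<Gamma>_cont \<Gamma>_bound c])
  assume hs: "\<And>n. 0 < hs n" "\<And>n. hs n \<le> \<tau>" "hs \<longlonglongrightarrow> 0"
  have "continuous_on {0..\<tau>} (\<lambda>r. - \<Gamma> (\<tau> - r) (T r z))"
    unfolding continuous_on_sequentially o_def
  proof (intro allI ballI impI tendsto_minus)
    fix s t assume t: "t \<in> {0..\<tau>}" and s: "(\<forall>n. s n \<in> {0..\<tau>}) \<and> s \<longlonglongrightarrow> t"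
    then have s': "\<And>n. 0 \<le> s n" "\<And>n. \<tau> - s n \<in> {0..\<tau>}" "\<tau> - t \<in> {0..\<tau>}" "s \<longlonglongrightarrow> t" by auto
    show "(\<lambda>n. \<Gamma> (\<tau> - s n) (T (s n) z)) \<longlonglongrightarrow> \<Gamma> (\<tau> - t) (T t z)"
      by (rule continuous_on_pair_tendsto[OF \<Gamma>_cont s'(2,3) tendsto_diff[OF tendsto_const s'(4)] T.T_tendsto[OF s'(1,4) tendsto_const]])
  qed
  from integral_quotient[OF this i hs] show "(\<lambda>n. (v (\<tau> - hs n) (T (hs n) z) - v \<tau> z) / hs n) \<longlonglongrightarrow> - \<Gamma> \<tau> z"
    by (simp add: T.T_0)
qed

text \<open>The increment splits into the noise started at \<open>T h z\<close>, with limit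
  \<open>gen g z\<close>, and the flow from \<open>z\<close> to \<open>T h z\<close>, with limit the
  drift term.\<close>

lemma semigroup_quotient:
  assumes g: "g \<in> CA2 D A" and h: "\<And>n. 0 < h n" "\<And>n. h n \<le> \<tau>" "h \<longlonglongrightarrow> 0"
  shows "(\<lambda>n. ((\<integral>\<omega>. g (T (h n) z + Y (h n) \<omega>) \<partial>M) - g z) / h n) \<longlonglongrightarrow> L0 D A Q a \<nu> g z"
proof -
  obtain C where r: "regular \<tau> C (\<lambda>_. g)" by (rule regular_const[OF g]) (rule that)
  note R = regularD[OF r]
  have \<tau>: "\<tau> \<in> {0..\<tau>}" using less_imp_le[OF order.strict_trans2[OF h(1,2)]] by simp
  note c2 = R(1)[OF \<tau>]
  have "(\<lambda>n. (g (T (h n) z) - g z) / h n) \<longlonglongrightarrow> - (- (z \<bullet> adj_op D A (grad g z)))"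
  \<comment> \<open>For a time-independent function \<open>w\<close> is 0, so
    \<open>\<Gamma>\<close> is the drift term with opposite sign, of linear growth in
    \<open>x\<close>.\<close>
  proof (rule regular_flow(2)[OF r, of "\<lambda>_ _. 0" "\<lambda>_ x. - (x \<bullet> adj_op D A (grad g x))" C])
    show "continuous_on ({0..\<tau>} \<times> UNIV) (\<lambda>(t, x). - (x \<bullet> adj_op D A (grad g x)))"
      using R(6) by (auto simp: case_prod_beta' intro!: continuous_intros)
    show "\<bar>- (x \<bullet> adj_op D A (grad g x))\<bar> \<le> C * (1 + norm x)" for x
    proof -
      have "\<bar>x \<bullet> adj_op D A (grad g x)\<bar> \<le> norm x * C"
        by (rule order_trans[OF Cauchy_Schwarz_ineq2 mult_left_mono[OF R(3)[OF \<tau>]]]) simp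
      then show ?thesis using C2bD(8)[OF c2] by (simp add: algebra_simps)
    qed
  qed (use h C2bD(8)[OF c2] in auto)
  from tendsto_add[OF regular_small_time[OF r h, of z] this] show ?thesis
    by (simp add: L0_eq[OF c2] add_divide_distrib[symmetric] add.commute)
qed

text \<open>By the equation the flow contributes -\<open>gen\<close>, its unbounded drift having
  cancelled, and the noise contributes +\<open>gen\<close>. The second claim is uniform in
  \<open>z\<close>, to dominate the quotients under the law of the process.\<close>

lemma backward_quotient:
  assumes r: "regular \<tau> C v"
    and pde: "\<And>t x. t \<in> {0..\<tau>} \<Longrightarrow> ((\<lambda>s. v s x) has_real_derivative L0 D A Q a \<nu> (v t) x) (at t within {0..\<tau>})"
  shows "(\<And>n. 0 < h n) \<Longrightarrow> (\<And>n. h n \<le> \<tau>) \<Longrightarrow> h \<longlonglongrightarrow> 0 \<Longrightarrow>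
      (\<lambda>n. ((\<integral>\<omega>. v (\<tau> - h n) (T (h n) z + Y (h n) \<omega>) \<partial>M) - v \<tau> z) / h n) \<longlonglongrightarrow> 0"
    and "\<exists>L\<ge>0. \<forall>h z. 0 < h \<longrightarrow> h \<le> \<tau> \<longrightarrow>
      \<bar>((\<integral>\<omega>. v (\<tau> - h) (T h z + Y h \<omega>) \<partial>M) - v \<tau> z) / h\<bar> \<le> L"
proof -
  note R = regularD[OF r]
  obtain L where L: "L \<ge> 0" "\<And>C g x. C2b C g (grad g) (hess g) \<Longrightarrow> \<bar>gen g x\<bar> \<le> C * L"
    by (rule gen_bound) (rule that)
  \<comment> \<open>The absolute value keeps \<open>c\<close> nonnegative also for an empty time
    interval, where \<open>regular\<close> says nothing about the sign of \<open>C\<close>.\<close>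
  define c where "c = \<bar>C\<bar> * L"
  have c: "0 \<le> c" using L(1) by (simp add: c_def)
  have gb: "\<bar>gen (v t) x\<bar> \<le> c" if "t \<in> {0..\<tau>}" for t x
    using L(2)[OF R(1)[OF that], of x] mult_right_mono[OF abs_ge_self[of C] L(1)] by (simp add: c_def)
  have gb': "\<bar>gen (v t) x\<bar> \<le> c * (1 + norm x)" if "t \<in> {0..\<tau>}" for t x
    unfolding distrib_left using gb[OF that, of x] mult_nonneg_nonneg[OF c norm_ge_zero[of x]] by linarith
  have \<Gamma>: "gen (v t) x = L0 D A Q a \<nu> (v t) x - x \<bullet> adj_op D A (grad (v t) x)" if "t \<in> {0..\<tau>}" for t x
    by (simp add: L0_eq[OF R(1)[OF that]])
  have F1: "((\<lambda>r. - gen (v (\<tau> - r)) (T r z)) has_integral v (\<tau> - h) (T h z) - v \<tau> z) {0..h}" if "0 \<le> h" "h \<le> \<tau>" for h z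
    by (rule regular_flow(1)[OF r pde \<Gamma> regular_gen_continuous[OF r] gb' c that])
  {
    assume h: "\<And>n. 0 < h n" "\<And>n. h n \<le> \<tau>" "h \<longlonglongrightarrow> 0"
    have "(\<lambda>n. (v (\<tau> - h n) (T (h n) z) - v \<tau> z) / h n) \<longlonglongrightarrow> - gen (v \<tau>) z"
      by (rule regular_flow(2)[OF r pde \<Gamma> regular_gen_continuous[OF r] gb' c h])
    from tendsto_add[OF regular_small_time[OF r h, of z] this]
    show "(\<lambda>n. ((\<integral>\<omega>. v (\<tau> - h n) (T (h n) z + Y (h n) \<omega>) \<partial>M) - v \<tau> z) / h n) \<longlonglongrightarrow> 0"
      by (simp add: add_divide_distrib[symmetric])
  }
  obtain L' where L': "L' \<ge> 0" "\<And>C g g' g'' h z. C2b C g g' g'' \<Longrightarrow> 0 \<le> h \<Longrightarrow> h \<le> \<bar>\<tau>\<bar> \<Longrightarrow>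
    \<bar>(\<integral>\<omega>. g (z + Y h \<omega>) \<partial>M) - g z\<bar> \<le> C * L' * h"
    by (rule dynkin_bound[OF abs_ge_zero[of \<tau>]]) (rule that)
  show "\<exists>L\<ge>0. \<forall>h z. 0 < h \<longrightarrow> h \<le> \<tau> \<longrightarrow> \<bar>((\<integral>\<omega>. v (\<tau> - h) (T h z + Y h \<omega>) \<partial>M) - v \<tau> z) / h\<bar> \<le> L"
  proof (intro exI[of _ "\<bar>C\<bar> * L' + c"] conjI allI impI)
    show "0 \<le> \<bar>C\<bar> * L' + c" using L'(1) c by simp
    fix h z assume h: "0 < h" "h \<le> \<tau>"
    have 1: "\<bar>v (\<tau> - h) (T h z) - v \<tau> z\<bar> \<le> c * h"
      using has_integral_bound_real[OF c finite.emptyI F1[OF less_imp_le[OF h(1)] h(2)]] gb h by auto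
    have "\<bar>(\<integral>\<omega>. v (\<tau> - h) (T h z + Y h \<omega>) \<partial>M) - v (\<tau> - h) (T h z)\<bar> \<le> C * L' * h"
      by (rule L'(2)[OF R(1)]) (use h in auto)
    also have "\<dots> \<le> \<bar>C\<bar> * L' * h" using L'(1) h by (intro mult_right_mono) auto
    finally have "\<bar>(\<integral>\<omega>. v (\<tau> - h) (T h z + Y h \<omega>) \<partial>M) - v \<tau> z\<bar> \<le> \<bar>C\<bar> * L' * h + c * h" using 1 by linarith
    then show "\<bar>((\<integral>\<omega>. v (\<tau> - h) (T h z + Y h \<omega>) \<partial>M) - v \<tau> z) / h\<bar> \<le> \<bar>C\<bar> * L' + c"
      using h by (simp add: divide_le_eq distrib_right)
  qed
qed

end

context ou_function
begin

subsection \<open>Existence\<close>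

lemma u_bounded: "t \<ge> 0 \<Longrightarrow> \<bar>u t x\<bar> \<le> C"
  using T.T_bounded[of t] u_bounds(1) order_refl by metis

lemma u_space:
  shows "bounded ((\<lambda>(t, x). u t x) ` ({0..} \<times> UNIV))"
    and "continuous_on ({0..} \<times> UNIV) (\<lambda>(t, x). u t x)"
    and "continuous_on ({0..} \<times> UNIV) (\<lambda>(t, x). grad (u t) x)"
    and "continuous_on ({0..} \<times> UNIV) (\<lambda>(t, x). adj_op D A (grad (u t) x))"
    and "hs_continuous_on ({0..} \<times> UNIV) (\<lambda>(t, x). hess (u t) x)"
proof -
  show "bounded ((\<lambda>(t, x). u t x) ` ({0..} \<times> UNIV))"
    unfolding bounded_iff by (rule exI[of _ C]) (use u_bounded in auto)
  have 1: "(\<lambda>n. u (s n) (xs n)) \<longlonglongrightarrow> u t x" "(\<lambda>n. grad (u (s n)) (xs n)) \<longlonglongrightarrow> grad (u t) x"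
    "(\<lambda>n. adj_op D A (grad (u (s n)) (xs n))) \<longlonglongrightarrow> adj_op D A (grad (u t) x)"
    "(\<lambda>n. hs_norm (\<lambda>h. hess (u (s n)) (xs n) h - hess (u t) x h)) \<longlonglongrightarrow> 0"
    if s: "\<And>n. s n \<in> {0..}" "t \<in> {0..}" "s \<longlonglongrightarrow> t" "xs \<longlonglongrightarrow> x" for s t xs x
  proof -
    have s0: "\<And>n. s n \<ge> 0" "t \<ge> 0" using s by auto
    note L = u_tendsto[OF s0(1) s(3,4)]
    show "(\<lambda>n. u (s n) (xs n)) \<longlonglongrightarrow> u t x" by (rule L(1))
    show "(\<lambda>n. grad (u (s n)) (xs n)) \<longlonglongrightarrow> grad (u t) x"
      unfolding grad_u[OF s0(1)] grad_u[OF s0(2)] by (rule L(2))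
    show "(\<lambda>n. adj_op D A (grad (u (s n)) (xs n))) \<longlonglongrightarrow> adj_op D A (grad (u t) x)"
      unfolding grad_u[OF s0(1)] grad_u[OF s0(2)] adj_u(2)[OF s0(1)] adj_u(2)[OF s0(2)] by (rule L(3))
    show "(\<lambda>n. hs_norm (\<lambda>h. hess (u (s n)) (xs n) h - hess (u t) x h)) \<longlonglongrightarrow> 0"
      unfolding hess_u[OF s0(1)] hess_u[OF s0(2)] by (rule L(4))
  qed
  show "continuous_on ({0..} \<times> UNIV) (\<lambda>(t, x). u t x)" by (rule continuous_on_pairI) (rule 1)
  show "continuous_on ({0..} \<times> UNIV) (\<lambda>(t, x). grad (u t) x)" by (rule continuous_on_pairI) (rule 1)
  show "continuous_on ({0..} \<times> UNIV) (\<lambda>(t, x). adj_op D A (grad (u t) x))" by (rule continuous_on_pairI) (rule 1)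
  show "hs_continuous_on ({0..} \<times> UNIV) (\<lambda>(t, x). hess (u t) x)"
  proof (rule hs_continuousI)
    fix p and ps :: "nat \<Rightarrow> real \<times> 'a"
    assume p: "p \<in> {0..} \<times> UNIV" "\<And>n. ps n \<in> {0..} \<times> UNIV" "ps \<longlonglongrightarrow> p"
    have "fst (ps n) \<in> {0..}" for n using p(2)[of n] by (simp add: mem_Times_iff)
    moreover have "fst p \<in> {0..}" using p(1) by (simp add: mem_Times_iff)
    ultimately show "(\<lambda>n. hs_norm (\<lambda>h. (case ps n of (t, x) \<Rightarrow> hess (u t) x) h - (case p of (t, x) \<Rightarrow> hess (u t) x) h)) \<longlonglongrightarrow> 0"
      unfolding case_prod_beta by (rule 1(4)[OF _ _ tendsto_fst[OF p(3)] tendsto_snd[OF p(3)]])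
  qed
qed

lemma u_derivs_bounded:
  assumes J: "\<And>t. t \<in> J \<Longrightarrow> 0 \<le> t" and K: "K \<ge> 1" "\<And>t x. t \<in> J \<Longrightarrow> norm (T t x) \<le> K * norm x"
  shows "derivs_bounded D A J u"
  unfolding derivs_bounded_def bounded_iff
proof (intro conjI)
  show "\<exists>a. \<forall>x\<in>(\<lambda>(t, x). grad (u t) x) ` (J \<times> UNIV). norm x \<le> a"
    by (rule exI[of _ "K * C"]) (use u_bounds(2)[OF J K(1) K(2)] grad_u J in auto)
  show "\<exists>a. \<forall>x\<in>(\<lambda>(t, x). adj_op D A (grad (u t) x)) ` (J \<times> UNIV). norm x \<le> a"
    by (rule exI[of _ "K * C"]) (use u_bounds(3)[OF J K(1) K(2)] grad_u adj_u(2) J in auto)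
  show "\<exists>a. \<forall>x\<in>(\<lambda>(t, x). hs_norm (hess (u t) x)) ` (J \<times> UNIV). norm x \<le> a"
    by (rule exI[of _ "K\<^sup>2 * C"]) (use hu_hs(2)[OF J K(1) K(2)] J in \<open>auto simp: hs_norm_nonneg hess_u\<close>)
qed

lemma u_derivs_bounded_Icc: "derivs_bounded D A {0..r} u"
proof -
  obtain K where K: "K \<ge> 1" "\<And>t x. 0 \<le> t \<Longrightarrow> t \<le> r \<Longrightarrow> norm (T t x) \<le> K * norm x"
    by (rule T.T_bounded[of r]) (rule that)
  show ?thesis by (rule u_derivs_bounded[OF _ K(1)]) (use K(2) in auto)
qed

lemma u_regular:
  obtains c where "regular b c u"
  by (rule regularI[OF u_space u_in_CA2 u_derivs_bounded_Icc, of b]) (assumption, rule that)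

lemma u_0: "u 0 x = f x"
proof -
  have "(\<integral>\<omega>. f (T 0 x + Y 0 \<omega>) \<partial>M) = (\<integral>\<omega>. f x \<partial>M)"
  proof (rule integral_cong_AE)
    show "(\<lambda>\<omega>. f (T 0 x + Y 0 \<omega>)) \<in> borel_measurable M"
      by (rule borel_measurable_integrable[OF expectation_integrable[OF order_refl Cb2D(6)[OF f_Cb2], of C]]) (use C(1) in simp)
    show "AE \<omega> in M. f (T 0 x + Y 0 \<omega>) = f x" using Y_0 by eventually_elim (simp add: T.T_0)
  qed simp
  then show ?thesis by (simp add: u_eq prob_space)
qed

lemma u_semigroup:
  assumes "h \<ge> 0" "t \<ge> 0"
  shows "u (t + h) x = (\<integral>\<omega>. u t (T h x + Y h \<omega>) \<partial>M)"
  using markov_property[OF assms f_C2b, of x] by (simp add: u_eq add.commute)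

lemma L0_u_continuous_Icc: "continuous_on {0..b} (\<lambda>t. L0 D A Q a \<nu> (u t) x)"
proof -
  obtain c where r: "regular b c u" by (rule u_regular[of b]) (rule that)
  have pair: "continuous_on {0..b} (\<lambda>t. (t, x))" "(\<lambda>t. (t, x)) ` {0..b} \<subseteq> {0..b} \<times> UNIV"
    by (auto intro!: continuous_intros)
  have "continuous_on {0..b} (\<lambda>t. x \<bullet> adj_op D A (grad (u t) x) + gen (u t) x)"
    using continuous_on_compose2[OF regularD(6)[OF r] pair] continuous_on_compose2[OF regular_gen_continuous[OF r] pair]
    by (auto intro!: continuous_intros)
  then show ?thesis
    by (rule continuous_on_eq) (simp add: L0_eq[OF regularD(1)[OF r]])
qed

lemma L0_u_continuous: "continuous_on {0..} (\<lambda>t. L0 D A Q a \<nu> (u t) x)"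
  unfolding continuous_on_sequentially o_def
proof (intro allI ballI impI)
  fix s :: "nat \<Rightarrow> real" and t assume "(\<forall>n. s n \<in> {0..}) \<and> s \<longlonglongrightarrow> t"
  then have s: "\<And>n. s n \<ge> 0" "s \<longlonglongrightarrow> t" by auto
  obtain r where r: "\<And>n. s n \<le> r" "t \<le> r" "0 \<le> t" "0 \<le> r" by (rule time_bound[OF s]) (rule that)
  show "(\<lambda>n. L0 D A Q a \<nu> (u (s n)) x) \<longlonglongrightarrow> L0 D A Q a \<nu> (u t) x"
    by (rule continuous_on_tendsto_compose[OF L0_u_continuous_Icc[of r x] s(2)]) (use r s in auto)
qed

lemma u_derivative:
  assumes t: "t \<ge> 0"
  shows "((\<lambda>s. u s x) has_real_derivative L0 D A Q a \<nu> (u t) x) (at t within {0..})"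
proof -
  \<comment> \<open>With \<open>b\<close> beyond \<open>t\<close>, differentiability at
    \<open>t\<close> within {0..b} and within {0..} coincide.\<close>
  define b where "b = t + 1"
  have "((\<lambda>s. u s x) has_real_derivative L0 D A Q a \<nu> (u t) x) (at t within {0..b})"
  proof (rule continuous_right_derivative[where \<rho> = "\<lambda>t. L0 D A Q a \<nu> (u t) x"])
    have pair: "continuous_on {0..b} (\<lambda>t. (t, x))" "(\<lambda>t. (t, x)) ` {0..b} \<subseteq> {0..} \<times> UNIV"
      by (auto intro!: continuous_intros)
    show "continuous_on {0..b} (\<lambda>s. u s x)"
      using continuous_on_compose2[OF u_space(2) pair] by simp
    show "continuous_on {0..b} (\<lambda>t. L0 D A Q a \<nu> (u t) x)" by (rule L0_u_continuous_Icc)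
    fix s and h :: "nat \<Rightarrow> real"
    assume s: "0 \<le> s" "s < b" and h: "\<And>n. 0 < h n" "\<And>n. s + h n \<le> b" "h \<longlonglongrightarrow> 0"
    have hb: "h n \<le> b" for n using h(2)[of n] s(1) by simp
    from semigroup_quotient[OF u_in_CA2[OF s(1)] h(1) hb h(3), of x]
    show "(\<lambda>n. (u (s + h n) x - u s x) / h n) \<longlonglongrightarrow> L0 D A Q a \<nu> (u s) x"
      using u_semigroup[OF less_imp_le[OF h(1)] s(1)] by simp
  qed (use t in \<open>simp add: b_def\<close>)
  moreover have "at t within {0..b} = at t within {0..}"
    by (rule at_within_nhd[of t "{..<b}"]) (auto simp: b_def)
  ultimately show ?thesis by simp
qed

lemma u_classical_solution: "classical_solution D A Q a \<nu> f u"
  unfolding classical_solution_def Let_def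
proof (intro conjI allI)
  show "\<exists>u'. continuous_on {0..} u' \<and> (\<forall>t\<ge>0. ((\<lambda>s. u s x) has_real_derivative u' t) (at t within {0..}) \<and>
      u' t = L0 D A Q a \<nu> (u t) x)" for x
    by (rule exI[of _ "\<lambda>t. L0 D A Q a \<nu> (u t) x"]) (intro conjI allI impI L0_u_continuous u_derivative refl)
qed (rule u_space u_0 | (intro impI, rule u_in_CA2, assumption))+

subsection \<open>Uniqueness\<close>

lemma solution_unique:
  assumes v: "loc_bounded_classical_solution D A Q a \<nu> f v" and t: "t \<ge> 0"
  shows "v t x = u t x"
proof -
  have cs: "classical_solution D A Q a \<nu> f v" and db: "derivs_bounded D A {0..t} v"
    using v t by (auto simp: loc_bounded_classical_solution_def)
  note cs' = cs[unfolded classical_solution_def Let_def]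
  have v0: "v 0 x = f x" for x using cs' by blast
  have der: "((\<lambda>s. v s x) has_real_derivative L0 D A Q a \<nu> (v r) x) (at r within {0..})" if "r \<ge> 0" for r x
  proof -
    obtain v' where "\<forall>t\<ge>0. ((\<lambda>s. v s x) has_real_derivative v' t) (at t within {0..}) \<and> v' t = L0 D A Q a \<nu> (v t) x"
      using cs' by metis
    then show ?thesis using that by auto
  qed
  obtain c where r: "regular t c v"
    by (rule regularI[OF _ _ _ _ _ _ db]) (use cs' that in auto)
  note R = regularD[OF r]
  have vc: "continuous_on UNIV (v s)" and vb: "\<And>y. norm (v s y) \<le> c" if "s \<in> {0..t}" for s
    using C2bD(1,10)[OF R(1)[OF that]] by auto
  define w where "w s = (\<integral>\<omega>. v (t - s) (T s x + Y s \<omega>) \<partial>M)" for s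
  have "w t = w 0"
  proof (rule zero_right_derivative_constant[OF t])
    show "continuous_on {0..t} w"
      unfolding continuous_on_sequentially o_def
    proof (intro allI ballI impI)
      fix s and s' :: real assume s': "s' \<in> {0..t}" and s: "(\<forall>n. s n \<in> {0..t}) \<and> s \<longlonglongrightarrow> s'"
      have s0: "\<And>n. 0 \<le> s n" "\<And>n. t - s n \<in> {0..t}" "0 \<le> s'" "t - s' \<in> {0..t}" and sl: "s \<longlonglongrightarrow> s'" using s s' by auto
      show "(\<lambda>n. w (s n)) \<longlonglongrightarrow> w s'"
        unfolding w_def
      proof (rule expectation_tendsto[OF s0(1) sl])
        show "(\<lambda>\<omega>. v (t - s n) (T (s n) x + Y (s n) \<omega>)) \<in> borel_measurable M" for n
          by (rule borel_measurable_integrable[OF expectation_integrable[OF s0(1) vc[OF s0(2)] vb[OF s0(2)]]])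
        show "(\<lambda>\<omega>. v (t - s') (T s' x + Y s' \<omega>)) \<in> borel_measurable M"
          by (rule borel_measurable_integrable[OF expectation_integrable[OF s0(3) vc[OF s0(4)] vb[OF s0(4)]]])
        show "norm (v (t - s n) (T (s n) x + Y (s n) \<omega>)) \<le> c" for n \<omega> by (rule vb[OF s0(2)])
        fix \<omega> and \<rho> :: "nat \<Rightarrow> nat" assume \<rho>: "strict_mono \<rho>" and Y: "(\<lambda>n. Y (s (\<rho> n)) \<omega>) \<longlonglongrightarrow> Y s' \<omega>"
        have sr: "(\<lambda>n. s (\<rho> n)) \<longlonglongrightarrow> s'" using LIMSEQ_subseq_LIMSEQ[OF sl \<rho>] by (simp add: o_def)
        show "(\<lambda>n. v (t - s (\<rho> n)) (T (s (\<rho> n)) x + Y (s (\<rho> n)) \<omega>)) \<longlonglongrightarrow> v (t - s') (T s' x + Y s' \<omega>)"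
          by (rule continuous_on_pair_tendsto[OF R(4) s0(2,4) tendsto_diff[OF tendsto_const sr]
                tendsto_add[OF T.T_tendsto[OF s0(1) sr tendsto_const] Y]])
      qed
    qed
    fix s and h :: "nat \<Rightarrow> real"
    assume s: "0 \<le> s" "s < t" and h: "\<And>n. 0 < h n" "\<And>n. s + h n \<le> t" "h \<longlonglongrightarrow> 0"
    define \<tau> where "\<tau> = t - s"
    have \<tau>: "\<tau> \<le> t" "0 \<le> \<tau>" "\<tau> \<in> {0..t}" and h\<tau>: "h n \<le> \<tau>" and th: "\<tau> - h n \<in> {0..t}" for n
      using s h(1)[of n] h(2)[of n] by (auto simp: \<tau>_def)
    have pde: "((\<lambda>s. v s x) has_real_derivative L0 D A Q a \<nu> (v r) x) (at r within {0..\<tau>})" if "r \<in> {0..\<tau>}" for r x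
      by (rule DERIV_subset[OF der]) (use that in auto)
    have B1: "(\<lambda>n. ((\<integral>\<omega>. v (\<tau> - h n) (T (h n) z + Y (h n) \<omega>) \<partial>M) - v \<tau> z) / h n) \<longlonglongrightarrow> 0" for z
      by (rule backward_quotient(1)[OF regular_mono[OF r \<tau>(1)] pde h(1) h\<tau> h(3)])
    have B2: "\<exists>L\<ge>0. \<forall>h z. 0 < h \<longrightarrow> h \<le> \<tau> \<longrightarrow> \<bar>((\<integral>\<omega>. v (\<tau> - h) (T h z + Y h \<omega>) \<partial>M) - v \<tau> z) / h\<bar> \<le> L"
      by (rule backward_quotient(2)[OF regular_mono[OF r \<tau>(1)] pde])
    define X where "X \<omega> = T s x + Y s \<omega>" for \<omega>
    \<comment> \<open>By the Markov property the difference quotient of \<open>w\<close> at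
      \<open>s\<close> is the expectation of this conditional quotient, started from the position
      \<open>X\<close> at time \<open>s\<close>.\<close>
    define \<Phi> where "\<Phi> n \<omega> = ((\<integral>\<omega>'. v (\<tau> - h n) (T (h n) (X \<omega>) + Y (h n) \<omega>') \<partial>M) - v \<tau> (X \<omega>)) / h n" for n \<omega>
    have X [measurable]: "X \<in> borel_measurable M"
      unfolding X_def using Y_measurable[OF s(1)] by measurable
    have [measurable]: "v \<tau> \<in> borel_measurable borel" by (rule borel_measurable_continuous_onI[OF vc[OF \<tau>(3)]])
    have [measurable]: "(\<lambda>z. \<integral>\<omega>'. v (\<tau> - h n) (T (h n) z + Y (h n) \<omega>') \<partial>M) \<in> borel_measurable borel" for n
    proof -
      have "C2b c (\<lambda>z. \<integral>\<omega>'. v (\<tau> - h n) (z + Y (h n) \<omega>') \<partial>M) (\<lambda>z. \<integral>\<omega>'. grad (v (\<tau> - h n)) (z + Y (h n) \<omega>') \<partial>M)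
          (\<lambda>z k. \<integral>\<omega>'. hess (v (\<tau> - h n)) (z + Y (h n) \<omega>') k \<partial>M)"
        by (rule expectation_C2b[OF R(1)[OF th] Y_measurable[OF less_imp_le[OF h(1)]]])
      from borel_measurable_continuous_onI[OF C2bD(10)[OF this]] T_measurable[OF less_imp_le[OF h(1)]]
      show ?thesis by (rule measurable_compose[rotated])
    qed
    have \<Phi>m [measurable]: "\<Phi> n \<in> borel_measurable M" for n
      unfolding \<Phi>_def[abs_def] by measurable
    \<comment> \<open>Uniform in the starting point, so it dominates although \<open>X\<close> may
      be unbounded.\<close>
    obtain L where L: "\<And>h z. 0 < h \<Longrightarrow> h \<le> \<tau> \<Longrightarrow> \<bar>((\<integral>\<omega>. v (\<tau> - h) (T h z + Y h \<omega>) \<partial>M) - v \<tau> z) / h\<bar> \<le> L"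
      using B2 by auto
    have lim: "(\<lambda>n. \<integral>\<omega>. \<Phi> n \<omega> \<partial>M) \<longlonglongrightarrow> (\<integral>\<omega>. 0 \<partial>M)"
    proof (rule integral_dominated_convergence[where w = "\<lambda>_. L"])
      show "AE \<omega> in M. (\<lambda>n. \<Phi> n \<omega>) \<longlonglongrightarrow> 0"
        unfolding \<Phi>_def by (intro AE_I2 B1)
      show "AE \<omega> in M. norm (\<Phi> n \<omega>) \<le> L" for n
        unfolding \<Phi>_def real_norm_def by (intro AE_I2 L[OF h(1) h\<tau>])
    qed auto
    have "(\<integral>\<omega>. \<Phi> n \<omega> \<partial>M) = (w (s + h n) - w s) / h n" for n
    proof -
      have e: "t - (s + h n) = \<tau> - h n" "t - s = \<tau>" by (auto simp: \<tau>_def)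
      have i1: "integrable M (\<lambda>\<omega>. v \<tau> (X \<omega>))"
        by (rule integrable_const_bound[where B = c]) (use vb[OF \<tau>(3)] in auto)
      have i2: "integrable M (\<lambda>\<omega>. \<integral>\<omega>'. v (\<tau> - h n) (T (h n) (X \<omega>) + Y (h n) \<omega>') \<partial>M)"
      proof (rule integrable_const_bound[where B = c])
        show "AE \<omega> in M. norm (\<integral>\<omega>'. v (\<tau> - h n) (T (h n) (X \<omega>) + Y (h n) \<omega>') \<partial>M) \<le> c"
          by (intro AE_I2 expectation_norm_le vb[OF th]
              borel_measurable_integrable[OF expectation_integrable[OF less_imp_le[OF h(1)] vc[OF th] vb[OF th]]])
      qed measurable
      show ?thesis
        unfolding w_def e \<Phi>_def
        using markov_property[OF s(1) less_imp_le[OF h(1)[of n]] R(1)[OF th[of n]], of x] i1 i2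
        by (simp add: X_def)
    qed
    with lim show "(\<lambda>n. (w (s + h n) - w s) / h n) \<longlonglongrightarrow> 0" by simp
  qed
  moreover have "w t = u t x" by (simp add: w_def u_eq v0)
  moreover have "w 0 = v t x"
  proof -
    have t': "t \<in> {0..t}" using t by simp
    have "w 0 = (\<integral>\<omega>. v t x \<partial>M)"
      unfolding w_def diff_zero
    proof (rule integral_cong_AE)
      show "(\<lambda>\<omega>. v t (T 0 x + Y 0 \<omega>)) \<in> borel_measurable M"
        by (rule borel_measurable_integrable[OF expectation_integrable[OF order_refl vc[OF t'] vb[OF t']]])
      show "AE \<omega> in M. v t (T 0 x + Y 0 \<omega>) = v t x" using Y_0 by eventually_elim (simp add: T.T_0)
    qed simp
    then show ?thesis by (simp add: prob_space)
  qed
  ultimately show ?thesis by simp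
qed

lemma unique_loc_bounded: "unique_solution (loc_bounded_classical_solution D A Q a \<nu> f) u"
  using u_classical_solution u_derivs_bounded_Icc solution_unique
  by (simp add: unique_solution_def loc_bounded_classical_solution_def)

text \<open>A bound on \<open>T\<close> uniform in time makes the derivative bounds of
  \<open>u\<close> global; uniqueness is inherited from the larger class of locally bounded
  solutions.\<close>

lemma unique_bounded:
  assumes b: "\<And>t x. t \<ge> 0 \<Longrightarrow> norm (T t x) \<le> K * norm x"
  shows "unique_solution (bounded_classical_solution D A Q a \<nu> f) u"
proof -
  \<comment> \<open>The derivative bounds for \<open>u\<close> are stated for a constant at least
    1.\<close>
  have "norm (T t x) \<le> max 1 K * norm x" if "t \<ge> 0" for t x
    by (rule order_trans[OF b[OF that]]) (intro mult_right_mono, auto)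
  then have "derivs_bounded D A {0..} u"
    by (intro u_derivs_bounded[where K = "max 1 K"]) auto
  then show ?thesis
    using u_classical_solution solution_unique[OF bounded_imp_loc_bounded_classical_solution]
    by (simp add: unique_solution_def bounded_classical_solution_def)
qed

end

theorem theorem5p5:
  fixes Q A :: "'a::{real_inner, banach, second_countable_topology} \<Rightarrow> 'a"
    and a :: 'a
    and \<nu> :: "'a measure"
    and M :: "'w measure"
    and Z Y :: "real \<Rightarrow> 'w \<Rightarrow> 'a"
    and D :: "'a set"
    and T T' :: "real \<Rightarrow> 'a \<Rightarrow> 'a"
    and f :: "'a \<Rightarrow> real"
  assumes Q_trace_class: "trace_class Q"
    and Q_symmetric: "\<And>x y. Q x \<bullet> y = x \<bullet> Q y"
    and Q_nonneg: "\<And>x. 0 \<le> Q x \<bullet> x"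
    and \<nu>_borel: "sets \<nu> = sets borel"
    and \<nu>_sigma_finite: "sigma_finite_measure \<nu>"
    and \<nu>_zero: "emeasure \<nu> {0} = 0"
    and \<nu>_integrable: "(\<integral>\<^sup>+ y. ennreal (min 1 ((norm y)\<^sup>2)) \<partial>\<nu>) < \<infinity>"
    and Z_levy: "levy_process M Z"
    and Z_char: "\<And>t h. t \<ge> 0 \<Longrightarrow>
      (\<integral>\<omega>. exp (\<i> * complex_of_real (Z t \<omega> \<bullet> h)) \<partial>M) = exp (- complex_of_real t * levy_exponent Q a \<nu> h)"
    and A_generates: "generates D A T"
    and A_adjoint_generates: "generates (adj_dom D A) (adj_op D A) T'"
    and Y_conv: "\<And>t. t \<ge> 0 \<Longrightarrow> is_stochastic_convolution M T Z t (Y t)"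
    and f: "f \<in> CA2 D A"
  shows "unique_solution (loc_bounded_classical_solution D A Q a \<nu> f)
      (\<lambda>t x. OU_semigroup M T Y t f x) \<and>
    ((\<exists>C. \<forall>t\<ge>0. \<forall>x. norm (T t x) \<le> C * norm x) \<longrightarrow>
      unique_solution (bounded_classical_solution D A Q a \<nu> f)
        (\<lambda>t x. OU_semigroup M T Y t f x))"
proof -
  interpret ou_function Q A a \<nu> M Z Y D T T' f
    by unfold_locales (fact assms)+
  show ?thesis using unique_loc_bounded unique_bounded by blast
qed

end
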